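(* Assume that there are real constants $\sigma^2>0$ and $\rho$ with $|\rho|<\sigma^2$ such that, for all $n\ge p-1$: (i) for every $k\in\mathbb{G}_{n+1}$, $\varepsilon_k\in L^2$, $\mathbb{E}[\varepsilon_k\mid\mathcal{F}_n]=0$ and $\mathbb{E}[\varepsilon_k^2\mid\mathcal{F}_n]=\sigma^2$ a.s.; (ii) for all different $k,l\in\mathbb{G}_{n+1}$, if $[k/2]=[l/2]$ then $\mathbb{E}[\varepsilon_k\varepsilon_l\mid\mathcal{F}_n]=\rho$ a.s., and otherwise $\varepsilon_k$ and $\varepsilon_l$ are conditionally independent given $\mathcal{F}_n$. Assume also that (iii) $\varepsilon_k\in L^4$ for all $k\in\mathbb{G}_{n+1}$, $n\ge p-1$, and $\sup_{n\ge p-1}\sup_{k\in\mathbb{G}_{n+1}}\mathbb{E}[\varepsilon_k^4\mid\mathcal{F}_n]<\infty$ a.s. Then $$M_n^t\Sigma_{n-1}^{-1}M_n=\mathcal{O}(n)\quad\text{a.s.}$$ and $$\lim_{n\to\infty}\frac1n\sum_{k=p}^nM_k^t\Sigma_{k-1}^{-1}M_k=2(p+1)\sigma^2\quad\text{a.s.}$$ Moreover, assume in addition that (iv) there are $\tau^4>0$ and $\nu^2<\tau^4$ such that for all $n\ge p-1$, $\mathbb{E}[\varepsilon_k^4\mid\mathcal{F}_n]=\tau^4$ a.s. for all $k\in\mathbb{G}_{n+1}$, and $\mathbb{E}[\varepsilon_k^2\varepsilon_l^2\mid\mathcal{F}_n]=\nu^2$ a.s. for all different $k,l\in\mathbb{G}_{n+1}$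 with $[k/2]=[l/2]$; and (v) $\varepsilon_k\in L^8$ for all $k\in\mathbb{G}_{n+1}$, $n\ge p-1$, and $\sup_{n\ge p-1}\sup_{k\in\mathbb{G}_{n+1}}\mathbb{E}[\varepsilon_k^8\mid\mathcal{F}_n]<\infty$ a.s. Then, as $n\to\infty$, one has the convergence in distribution $$\frac{1}{\sqrt{|\mathbb{T}_{n-1}|}}M_n\longrightarrow\mathcal{N}(0,\Gamma\otimes L).$$
   Context: Fix an integer $p\ge1$. For $n\ge0$ let $\mathbb{G}_n=\{2^n,\dots,2^{n+1}-1\}$, $\mathbb{T}_n=\bigcup_{k=0}^n\mathbb{G}_k$, and for an integer $q\geq 0$ let $\mathbb{T}_{n,q}=\{k\in\mathbb{T}_n:k\ge2^q\}$; $|E|$ denotes cardinality, so $|\mathbb{G}_n|=2^n$, $|\mathbb{T}_n|=2^{n+1}-1$. $[x]$ is the integer part of $x$. The asymmetric BAR($p$) process consists of real random variables $(X_n)_{n\ge1}$ and $(\varepsilon_n)_{n\ge2^p}$ such that for all $n\ge2^{p-1}$ $$X_{2n}=a_0+\sum_{k=1}^pa_kX_{[n/2^{k-1}]}+\varepsilon_{2n},\qquad X_{2n+1}=b_0+\sum_{k=1}^pb_kX_{[n/2^{k-1}]}+\varepsilon_{2n+1},$$ with real parameters $a_0,\dots,a_p,b_0,\dots,b_p$. The initial states satisfy $\mathbb{E}[X_k^8]<\infty$ for $1\le k\le2^p-1$. For $n\ge2^{p-1}$, $\mathbb{X}_n=(X_n,X_{[n/2]},\dots,X_{[n/2^{p-1}]})^t\in\mathbb{R}^p$.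 $A$ (resp. $B$) is the $p\times p$ companion matrix with first row $(a_1,\dots,a_p)$ (resp. $(b_1,\dots,b_p)$), ones on the subdiagonal and zeros elsewhere. It is assumed that $\beta=\max\{\|A\|,\|B\|\}<1$, where $\|A\|=\sup\{\|Au\|:u\in\mathbb{R}^p,\|u\|=1\}$ is the operator norm induced by a norm on $\mathbb{R}^p$. $\mathcal{F}_n=\sigma\{X_k:k\in\mathbb{T}_n\}$. $Y_n=(1,\mathbb{X}_n^t)^t\in\mathbb{R}^{p+1}$ and, for $n\ge p-1$, $S_n=\sum_{k\in\mathbb{T}_{n,p-1}}Y_kY_k^t$, with the convention that when $S_n$ is not invertible it is replaced by $S_n+I_{p+1}$. $\Sigma_n=I_2\otimes S_n$ ($\otimes$ is the Kronecker product). For $n\ge p$, $$M_n=\sum_{k\in\mathbb{T}_{n-1,p-1}}\big(\varepsilon_{2k},\ \varepsilon_{2k}\mathbb{X}_k^t,\ \varepsilon_{2k+1},\ \varepsilon_{2k+1}\mathbb{X}_k^t\big)^t\in\mathbb{R}^{2(p+1)}.$$ $\Gamma=\begin{pmatrix}\sigma^2&\rho\\ \rho&\sigma^2\end{pmatrix}$ and $L=\begin{pmatrix}1&\lambda^t\\ \lambda&\ell\end{pmatrix}$, where, with $e_1=(1,0,\dots,0)^t\in\mathbb{R}^p$, $\overline a=(a_0+b_0)/2$, $\overline{a^2}=(a_0^2+b_0^2)/2$, $\overline A=(A+B)/2$, one sets $\lambda=\overline a(I_p-\overline A)^{-1}e_1$ and $\ell$ is the unique solution of $\ell=T+\frac12(A\ell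 A^t+B\ell B^t)$ with $$T=(\sigma^2+\overline{a^2})e_1e_1^t+\tfrac12\big(a_0(A\lambda e_1^t+e_1\lambda^tA^t)+b_0(B\lambda e_1^t+e_1\lambda^tB^t)\big).$$
   Formalization: In (ii), conditional independence of non-sisters is taken mutually: given F_n, the sister pairs (ε_{2j}, ε_{2j+1}), j in G_n, are mutually independent. With independence of only two variables at a time the limits can fail (e.g. p=1, zero coefficients, pairwise independent random signs). *)

theory Defs
  imports "HOL-Probability.Probability" "HOL-Library.Landau_Symbols"
begin

section \<open>The binary tree\<close>

definition Gen :: "nat \<Rightarrow> nat set" where
  "Gen n = {2 ^ n..<2 ^ (n + 1)}"

definition Tree :: "nat \<Rightarrow> nat set" where
  "Tree n = (\<Union>k\<le>n. Gen k)"

definition Tree_from :: "nat \<Rightarrow> nat \<Rightarrow> nat set" where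
  "Tree_from n q = {k \<in> Tree n. 2 ^ q \<le> k}"

section \<open>Linear algebra\<close>

text \<open>
  The integer p is the cardinality of a finite linearly ordered index type \<^typ>\<open>'n\<close>, whose
  elements are numbered 1, ..., p in increasing order.  The space of dimension p + 1 is indexed by
  \<^typ>\<open>'n option\<close>, where \<^term>\<open>None\<close> is the first coordinate, and the one of
  dimension 2 (p + 1) by \<^typ>\<open>2 \<times> 'n option\<close>: the first component selects the block
  (\<^term>\<open>1 :: 2\<close> the first, \<^term>\<open>2 :: 2\<close> the second), the second one the coordinate in it.
\<close>

definition pos :: "'n::{finite,linorder} \<Rightarrow> nat" where
  "pos i = card {..i}"

definition e1 :: "real ^ 'n::{finite,linorder}" where
  "e1 = (\<chi> i. if pos i = 1 then 1 else 0)"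

definition outer :: "real ^ 'm \<Rightarrow> real ^ 'n \<Rightarrow> real ^ 'n ^ 'm" where
  "outer u v = (\<chi> i j. u $ i * v $ j)"

definition kron :: "real ^ 'b ^ 'a \<Rightarrow> real ^ 'd ^ 'c \<Rightarrow> real ^ ('b \<times> 'd) ^ ('a \<times> 'c)" where
  "kron A B = (\<chi> i j. A $ fst i $ fst j * B $ snd i $ snd j)"

definition companion :: "(nat \<Rightarrow> real) \<Rightarrow> real ^ ('n::{finite,linorder}) ^ ('n::{finite,linorder})" where
  "companion c = (\<chi> i j. if pos i = 1 then c (pos j) else if pos i = pos j + 1 then 1 else 0)"

definition is_norm :: "('v::real_vector \<Rightarrow> real) \<Rightarrow> bool" where
  "is_norm N \<longleftrightarrow>
     (\<forall>u. 0 \<le> N u) \<and> (\<forall>u. N u = 0 \<longleftrightarrow> u = 0) \<and>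
     (\<forall>c u. N (c *\<^sub>R u) = \<bar>c\<bar> * N u) \<and> (\<forall>u v. N (u + v) \<le> N u + N v)"

definition op_norm :: "(real ^ 'n \<Rightarrow> real) \<Rightarrow> real ^ 'n ^ 'n \<Rightarrow> real" where
  "op_norm N A = (SUP u\<in>{u. N u = 1}. N (A *v u))"

section \<open>Probability\<close>

text \<open>Mutual conditional independence of the family of random variables Z, with values in N,
  given the sub-sigma-algebra F.\<close>

definition cond_indep_vars ::
  "'w measure \<Rightarrow> 'w measure \<Rightarrow> 'c measure \<Rightarrow> ('i \<Rightarrow> 'w \<Rightarrow> 'c) \<Rightarrow> 'i set \<Rightarrow> bool" where
  "cond_indep_vars P F N Z I \<longleftrightarrow>
     (\<forall>J B. J \<subseteq> I \<and> finite J \<and> (\<forall>j\<in>J. B j \<in> sets N) \<longrightarrow>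
        (AE \<omega> in P. real_cond_exp P F (\<lambda>\<omega>. \<Prod>j\<in>J. indicator (B j) (Z j \<omega>)) \<omega> =
           (\<Prod>j\<in>J. real_cond_exp P F (\<lambda>\<omega>. indicator (B j) (Z j \<omega>)) \<omega>)))"

text \<open>The (possibly degenerate) normal law with mean m and covariance matrix Q, given by its
  characteristic function.\<close>

definition multivariate_normal ::
  "real ^ 'd \<Rightarrow> real ^ 'd ^ 'd \<Rightarrow> (real ^ 'd) measure \<Rightarrow> bool" where
  "multivariate_normal m Q \<mu> \<longleftrightarrow>
     prob_space \<mu> \<and> sets \<mu> = sets borel \<and>
     (\<forall>u. (LINT x|\<mu>. exp (\<i> * complex_of_real (u \<bullet> x))) =
        exp (\<i> * complex_of_real (u \<bullet> m) - complex_of_real (u \<bullet> (Q *v u)) / 2))"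

definition converges_in_distribution ::
  "'w measure \<Rightarrow> (nat \<Rightarrow> 'w \<Rightarrow> 'v::euclidean_space) \<Rightarrow> 'v measure \<Rightarrow> bool" where
  "converges_in_distribution P Z \<mu> \<longleftrightarrow>
     (\<forall>f :: 'v \<Rightarrow> real. continuous_on UNIV f \<and> bounded (range f) \<longrightarrow>
        (\<lambda>n. LINT \<omega>|P. f (Z n \<omega>)) \<longlonglongrightarrow> (LINT x|\<mu>. f x))"

section \<open>The asymmetric bifurcating autoregressive process\<close>

definition tree_filtration :: "'w measure \<Rightarrow> (nat \<Rightarrow> 'w \<Rightarrow> real) \<Rightarrow> nat \<Rightarrow> 'w measure" where
  "tree_filtration P X n =
     sigma (space P) (\<Union>k\<in>Tree n. {X k -` B \<inter> space P |B. B \<in> sets borel})"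

definition state_vec :: "(nat \<Rightarrow> 'w \<Rightarrow> real) \<Rightarrow> nat \<Rightarrow> 'w \<Rightarrow> real ^ 'n::{finite,linorder}" where
  "state_vec X k \<omega> = (\<chi> i. X (k div 2 ^ (pos i - 1)) \<omega>)"

definition Y_vec :: "(nat \<Rightarrow> 'w \<Rightarrow> real) \<Rightarrow> nat \<Rightarrow> 'w \<Rightarrow> real ^ ('n::{finite,linorder}) option" where
  "Y_vec X k \<omega> = (\<chi> i. case i of None \<Rightarrow> 1 | Some j \<Rightarrow> state_vec X k \<omega> $ j)"

definition S_mat ::
  "(nat \<Rightarrow> 'w \<Rightarrow> real) \<Rightarrow> nat \<Rightarrow> 'w \<Rightarrow> real ^ ('n::{finite,linorder}) option ^ 'n option" where
  "S_mat X n \<omega> =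
     (let S = \<Sum>k\<in>Tree_from n (CARD('n) - 1). outer (Y_vec X k \<omega>) (Y_vec X k \<omega>)
      in if invertible S then S else S + mat 1)"

definition Sigma_mat ::
  "(nat \<Rightarrow> 'w \<Rightarrow> real) \<Rightarrow> nat \<Rightarrow> 'w \<Rightarrow>
     real ^ (2 \<times> ('n::{finite,linorder}) option) ^ (2 \<times> 'n option)" where
  "Sigma_mat X n \<omega> = kron (mat 1) (S_mat X n \<omega>)"

definition M_vec ::
  "(nat \<Rightarrow> 'w \<Rightarrow> real) \<Rightarrow> (nat \<Rightarrow> 'w \<Rightarrow> real) \<Rightarrow> nat \<Rightarrow> 'w \<Rightarrow>
     real ^ (2 \<times> ('n::{finite,linorder}) option)" where
  "M_vec X \<epsilon> n \<omega> =
     (\<Sum>k\<in>Tree_from (n - 1) (CARD('n) - 1).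
        \<chi> i. vector [\<epsilon> (2 * k) \<omega>, \<epsilon> (2 * k + 1) \<omega>] $ fst i * Y_vec X k \<omega> $ snd i)"

section \<open>The limiting covariance matrix\<close>

definition Gamma_mat :: "real \<Rightarrow> real \<Rightarrow> real ^ 2 ^ 2" where
  "Gamma_mat \<sigma>2 \<rho> = vector [vector [\<sigma>2, \<rho>], vector [\<rho>, \<sigma>2]]"

definition lambda_vec ::
  "(nat \<Rightarrow> real) \<Rightarrow> (nat \<Rightarrow> real) \<Rightarrow> real ^ 'n::{finite,linorder}" where
  "lambda_vec a b =
     ((a 0 + b 0) / 2) *\<^sub>R
       (matrix_inv (mat 1 - (1/2) *\<^sub>R (companion a + companion b)) *v e1)"

definition T_mat ::
  "(nat \<Rightarrow> real) \<Rightarrow> (nat \<Rightarrow> real) \<Rightarrow> real \<Rightarrow> real ^ ('n::{finite,linorder}) ^ ('n::{finite,linorder})" where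
  "T_mat a b \<sigma>2 =
     (let A = companion a; B = companion b; l = lambda_vec a b in
       (\<sigma>2 + ((a 0)\<^sup>2 + (b 0)\<^sup>2) / 2) *\<^sub>R outer e1 e1
       + (1/2) *\<^sub>R (a 0 *\<^sub>R (outer (A *v l) e1 + outer e1 (A *v l))
                  + b 0 *\<^sub>R (outer (B *v l) e1 + outer e1 (B *v l))))"

definition ell_mat ::
  "(nat \<Rightarrow> real) \<Rightarrow> (nat \<Rightarrow> real) \<Rightarrow> real \<Rightarrow> real ^ ('n::{finite,linorder}) ^ ('n::{finite,linorder})" where
  "ell_mat a b \<sigma>2 =
     (THE l. l = T_mat a b \<sigma>2 +
        (1/2) *\<^sub>R (companion a ** l ** transpose (companion a)
                  + companion b ** l ** transpose (companion b)))"

definition L_mat ::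
  "(nat \<Rightarrow> real) \<Rightarrow> (nat \<Rightarrow> real) \<Rightarrow> real \<Rightarrow>
     real ^ ('n::{finite,linorder}) option ^ 'n option" where
  "L_mat a b \<sigma>2 =
     (\<chi> i j. case (i, j) of
        (None, None) \<Rightarrow> 1
      | (None, Some j') \<Rightarrow> lambda_vec a b $ j'
      | (Some i', None) \<Rightarrow> lambda_vec a b $ i'
      | (Some i', Some j') \<Rightarrow> ell_mat a b \<sigma>2 $ i' $ j')"

section \<open>Hypotheses on the noise\<close>

definition noise_mean_var ::
  "nat \<Rightarrow> 'w measure \<Rightarrow> (nat \<Rightarrow> 'w \<Rightarrow> real) \<Rightarrow> (nat \<Rightarrow> 'w \<Rightarrow> real) \<Rightarrow> real \<Rightarrow> bool" where
  "noise_mean_var p P X \<epsilon> \<sigma>2 \<longleftrightarrow>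
     (\<forall>n\<ge>p - 1. \<forall>k\<in>Gen (n + 1).
        integrable P (\<lambda>\<omega>. \<epsilon> k \<omega> ^ 2) \<and>
        (AE \<omega> in P. real_cond_exp P (tree_filtration P X n) (\<epsilon> k) \<omega> = 0) \<and>
        (AE \<omega> in P. real_cond_exp P (tree_filtration P X n) (\<lambda>\<omega>. \<epsilon> k \<omega> ^ 2) \<omega> = \<sigma>2))"

text \<open>
  Conditional independence between noise variables with different mothers is required in the mutual
  sense: given the past, the sister pairs of one generation are independent of each other.
  Independence of only two variables at a time is not sufficient for a central limit theorem.  Take
  p = 1 and all coefficients and the initial state 0, so that the process is the noise.  In each
  generation, independently, multiply the absolute values of independent standard normal variables
  by the two-by-two independent signs r\<open>\<^sub>0\<close> * (product of r\<open>\<^sub>i\<close> for i in I), where I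
  ranges over the subsets of {1, ..., n} and the r\<open>\<^sub>i\<close> are independent random signs.  The
  signs of a generation add up to 0 with probability tending to 1, and the limiting variance of the
  normalized sums is 1 - 2/pi, although every single variable has variance 1.
\<close>

definition noise_covariance ::
  "nat \<Rightarrow> 'w measure \<Rightarrow> (nat \<Rightarrow> 'w \<Rightarrow> real) \<Rightarrow> (nat \<Rightarrow> 'w \<Rightarrow> real) \<Rightarrow> real \<Rightarrow> bool" where
  "noise_covariance p P X \<epsilon> \<rho> \<longleftrightarrow>
     (\<forall>n\<ge>p - 1.
        (\<forall>k\<in>Gen (n + 1). \<forall>l\<in>Gen (n + 1). k \<noteq> l \<and> k div 2 = l div 2 \<longrightarrow>
           (AE \<omega> in P. real_cond_exp P (tree_filtration P X n) (\<lambda>\<omega>. \<epsilon> k \<omega> * \<epsilon> l \<omega>) \<omega> = \<rho>)) \<and>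
        cond_indep_vars P (tree_filtration P X n) borel
          (\<lambda>j \<omega>. (\<epsilon> (2 * j) \<omega>, \<epsilon> (2 * j + 1) \<omega>)) (Gen n))"

definition noise_moment_bounded ::
  "nat \<Rightarrow> 'w measure \<Rightarrow> (nat \<Rightarrow> 'w \<Rightarrow> real) \<Rightarrow> (nat \<Rightarrow> 'w \<Rightarrow> real) \<Rightarrow> nat \<Rightarrow> bool" where
  "noise_moment_bounded p P X \<epsilon> r \<longleftrightarrow>
     (\<forall>n\<ge>p - 1. \<forall>k\<in>Gen (n + 1). integrable P (\<lambda>\<omega>. \<epsilon> k \<omega> ^ r)) \<and>
     (AE \<omega> in P. (SUP n\<in>{p - 1..}. SUP k\<in>Gen (n + 1).
        ereal (real_cond_exp P (tree_filtration P X n) (\<lambda>\<omega>. \<epsilon> k \<omega> ^ r) \<omega>)) < \<infinity>)"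

definition noise_fourth_moments ::
  "nat \<Rightarrow> 'w measure \<Rightarrow> (nat \<Rightarrow> 'w \<Rightarrow> real) \<Rightarrow> (nat \<Rightarrow> 'w \<Rightarrow> real) \<Rightarrow> real \<Rightarrow> real \<Rightarrow> bool" where
  "noise_fourth_moments p P X \<epsilon> \<tau>4 \<nu>2 \<longleftrightarrow>
     (\<forall>n\<ge>p - 1.
        (\<forall>k\<in>Gen (n + 1).
           AE \<omega> in P. real_cond_exp P (tree_filtration P X n) (\<lambda>\<omega>. \<epsilon> k \<omega> ^ 4) \<omega> = \<tau>4) \<and>
        (\<forall>k\<in>Gen (n + 1). \<forall>l\<in>Gen (n + 1). k \<noteq> l \<and> k div 2 = l div 2 \<longrightarrow>
           (AE \<omega> in P.
              real_cond_exp P (tree_filtration P X n) (\<lambda>\<omega>. \<epsilon> k \<omega> ^ 2 * \<epsilon> l \<omega> ^ 2) \<omega> = \<nu>2)))"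

end

theory Submission
  imports Defs
begin

text \<open>
  The vertices of the tree are taken one at a time.  Since the sister pairs of a generation are
  conditionally independent given the earlier generations, the noise is a martingale difference
  sequence, with the prescribed conditional covariances, for the filtration in which vertex k knows
  all X j with j < 2 k.  Strong laws for orthogonal variables and the contraction of the companion
  matrices show that S n / 2 ^ (n + 1) tends to L, which is positive definite because its quadratic
  form q satisfies q u = \<sigma>2 * t ^ 2 + (q (u A) + q (u B)) / 2, where t is the coefficient of e1 in u
  and u A, u B are the pull-backs of u to the mother, which shift the coordinates.

  For a scalar martingale m whose weights in generation n are known at the beginning of it, let z n
  be 2 ^ (-n) times the difference of the square of m and its compensator at time 2 ^ n.  Then
  z (n + 1) = (z n + D n) / 2 with orthogonal D n that are bounded in L2, so the averages of z tend
  to 0.  By polarization the averages of both diagonal blocks of M n (M n)^T / 2 ^ n tend to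
  \<sigma>2 L; contraction with the inverse of S (n - 1) / 2 ^ n, which tends to the inverse of L, gives
  the trace 2 (p + 1) \<sigma>2, and the bound O(n) is a consequence of the convergence of the averages.

  The central limit theorem follows by computing characteristic functions along the martingale, with
  the increments stopped when the accumulated conditional variance becomes too large.
\<close>

section \<open>Real sequences\<close>

text \<open>Hypothesis (iii) bounds the conditional fourth moments only by a random constant, so the
  centred squares of the noise need not be bounded in L2. Both laws that use them are therefore
  first proved with predictable cut-offs at a fixed level; almost every point is unaffected by some
  integer level, and there are countably many levels. In the quadratic law the cut-off also bounds
  the sum of the squared weights of a generation. It has to be decided at the beginning of the
  generation, where all weights of the generation are compared with a single value of the
  martingale. Only averages over n can be treated: the terms \<open>D n\<close> are bounded in L2
  but need not become small, so z n itself need not converge. Under (iv) the conditional fourth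
  moments are constants, which bounds the fourth moments of the states uniformly over the vertices.
  (v) puts the states into L8, so that state times noise lies in L4, as the remainder estimate of
  the central limit theorem requires. Characteristic functions then give convergence in distribution
  because the normalized M n have bounded second moments, which keeps their mass in large
  balls.\<close>

lemma contraction_recursion_LIMSEQ_0:
  fixes x r :: "nat \<Rightarrow> real"
  assumes g: "0 \<le> g" "g < 1" and x0: "\<And>n. 0 \<le> x n"
    and rec: "eventually (\<lambda>n. x (Suc n) \<le> g * x n + r n) sequentially"
    and r: "r \<longlonglongrightarrow> 0"
  shows "x \<longlonglongrightarrow> 0"
proof (rule LIMSEQ_I)
  fix e :: real assume e: "0 < e"
  \<comment> \<open>\<open>e / 2\<close> is the fixed point of t \<mapsto> g * t + d: once
    \<open>r\<close> stays below \<open>d\<close>, the recursion reproduces a bound with constant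
    part \<open>e / 2\<close>.\<close>
  define d where "d = e / 2 * (1 - g)"
  have d: "0 < d" using e g by (simp add: d_def)
  obtain K1 where K1: "\<And>n. n \<ge> K1 \<Longrightarrow> x (Suc n) \<le> g * x n + r n"
    using rec by (auto simp: eventually_sequentially)
  obtain K2 where K2: "\<And>n. n \<ge> K2 \<Longrightarrow> norm (r n - 0) < d"
    using LIMSEQ_D[OF r d] by auto
  define K where "K = max K1 K2"
  have step: "x (K + m) \<le> g ^ m * x K + e / 2" for m
  proof (induction m)
    case 0 then show ?case using e by simp
  next
    case (Suc m)
    have "x (K + Suc m) \<le> g * x (K + m) + r (K + m)" using K1[of "K + m"] by (simp add: K_def)
    also have "\<dots> \<le> g * (g ^ m * x K + e / 2) + d"
      using mult_left_mono[OF Suc g(1)] K2[of "K + m"] by (intro add_mono) (auto simp: K_def abs_less_iff intro: less_imp_le)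
    also have "\<dots> = g ^ Suc m * x K + e / 2" by (simp add: d_def field_simps)
    finally show ?case .
  qed
  have "(\<lambda>m. g ^ m * x K) \<longlonglongrightarrow> 0 * x K" using g by (intro tendsto_intros LIMSEQ_power_zero) auto
  from LIMSEQ_D[OF this, of "e/2"] e obtain m0 where m0: "\<And>m. m \<ge> m0 \<Longrightarrow> g ^ m * x K < e / 2"
    by fastforce
  show "\<exists>no. \<forall>n\<ge>no. norm (x n - 0) < e"
  proof (intro exI allI impI)
    fix n assume n: "K + m0 \<le> n"
    then have "x n \<le> g ^ (n - K) * x K + e / 2" using step[of "n - K"] by simp
    moreover have "g ^ (n - K) * x K < e / 2" using n by (intro m0) simp
    ultimately show "norm (x n - 0) < e" using x0[of n] by simp
  qed
qed

lemma cesaro_null: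
  fixes x :: "nat \<Rightarrow> real"
  assumes "x \<longlonglongrightarrow> 0"
  shows "(\<lambda>n. (\<Sum>k<n. x k) / real n) \<longlonglongrightarrow> 0"
proof -
  have "(\<lambda>n. norm ((\<Sum>k<n. x k) / real n)) \<longlonglongrightarrow> 0"
  proof (rule LIMSEQ_I)
    fix e :: real assume e: "0 < e"
    obtain K where K: "\<And>n. n \<ge> K \<Longrightarrow> \<bar>x n\<bar> < e / 2" using LIMSEQ_D[OF assms, of "e/2"] e by auto
    define C where "C = (\<Sum>k<K. \<bar>x k\<bar>)"
    obtain N :: nat where N: "2 * C / e < N" using reals_Archimedean2 by blast
    show "\<exists>no. \<forall>n\<ge>no. norm (norm ((\<Sum>k<n. x k) / real n) - 0) < e"
    proof (intro exI allI impI)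
      fix n assume n: "max (Suc K) N \<le> n"
      have "\<bar>\<Sum>k<n. x k\<bar> \<le> (\<Sum>k<n. \<bar>x k\<bar>)" by simp
      also have "\<dots> = C + (\<Sum>k=K..<n. \<bar>x k\<bar>)"
        unfolding C_def using n by (subst sum.atLeastLessThan_concat[of 0 K n, unfolded atLeast0LessThan, symmetric]) auto
      also have "(\<Sum>k=K..<n. \<bar>x k\<bar>) \<le> (\<Sum>k=K..<n. e / 2)" by (intro sum_mono) (use K in \<open>force intro: less_imp_le\<close>)
      also have "\<dots> \<le> real n * (e / 2)" using e by (simp add: mult_right_mono)
      also have "C < real n * (e / 2)"
        using N n e by (simp add: field_simps) (smt (verit) mult_left_mono of_nat_le_iff)
      finally have "\<bar>\<Sum>k<n. x k\<bar> < real n * e" by (simp add: field_simps)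
      then show "norm (norm ((\<Sum>k<n. x k) / real n) - 0) < e"
        using n by (simp add: field_simps)
    qed
  qed
  then show ?thesis by (rule tendsto_norm_zero_cancel)
qed

text \<open>\<open>Q\<close> need not converge: writing \<open>R k\<close> as R0 + (R k - R0), the
  second part is small for large k against the absolute values of \<open>Q\<close>, whose averages
  are bounded. Later \<open>R\<close> is an entry of an inverse matrix and \<open>Q\<close> a
  normalized product of two components of M n.\<close>

lemma cesaro_weighted:
  fixes R Q :: "nat \<Rightarrow> real"
  assumes R: "R \<longlonglongrightarrow> R0"
    and Q: "(\<lambda>n. (\<Sum>k<n. Q k) / real n) \<longlonglongrightarrow> Q0"
    and B: "\<And>n. (\<Sum>k<n. \<bar>Q k\<bar>) \<le> C * real n"
  shows "(\<lambda>n. (\<Sum>k<n. R k * Q k) / real n) \<longlonglongrightarrow> R0 * Q0"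
proof -
  have C: "0 \<le> C" using B[of 1] abs_ge_zero[of "Q 0"] by (simp add: lessThan_Suc del: abs_ge_zero)
  have "(\<lambda>n. (\<Sum>k<n. (R k - R0) * Q k) / real n) \<longlonglongrightarrow> 0"
  proof (rule LIMSEQ_I)
    fix e :: real assume e: "0 < e"
    \<comment> \<open>\<open>C + 1\<close> keeps the denominator positive for \<open>C = 0\<close>
      and still gives \<open>d * C \<le> e / 2\<close>.\<close>
    define d where "d = e / (2 * (C + 1))"
    have d: "0 < d" using e C by (simp add: d_def)
    obtain K where K: "\<And>n. n \<ge> K \<Longrightarrow> \<bar>R n - R0\<bar> < d" using LIMSEQ_D[OF R d] by auto
    define D where "D = (\<Sum>k<K. \<bar>(R k - R0) * Q k\<bar>)"
    obtain N :: nat where N: "2 * D / e < N" using reals_Archimedean2 by blast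
    show "\<exists>no. \<forall>n\<ge>no. norm ((\<Sum>k<n. (R k - R0) * Q k) / real n - 0) < e"
    proof (intro exI allI impI)
      fix n assume n: "max (Suc K) N \<le> n"
      have "\<bar>\<Sum>k<n. (R k - R0) * Q k\<bar> \<le> (\<Sum>k<n. \<bar>(R k - R0) * Q k\<bar>)" by simp
      also have "\<dots> = D + (\<Sum>k=K..<n. \<bar>(R k - R0) * Q k\<bar>)"
        unfolding D_def using n by (subst sum.atLeastLessThan_concat[of 0 K n, unfolded atLeast0LessThan, symmetric]) auto
      also have "(\<Sum>k=K..<n. \<bar>(R k - R0) * Q k\<bar>) \<le> (\<Sum>k=K..<n. d * \<bar>Q k\<bar>)"
        unfolding abs_mult by (intro sum_mono mult_right_mono) (use K in \<open>force intro: less_imp_le\<close>)+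
      also have "\<dots> \<le> (\<Sum>k<n. d * \<bar>Q k\<bar>)" using d by (intro sum_mono2) auto
      also have "\<dots> \<le> d * (C * real n)" using B[of n] d by (simp add: sum_distrib_left[symmetric])
      also have "\<dots> \<le> real n * (e / 2)"
      proof -
        have "d * C \<le> e / 2" using C e by (simp add: d_def field_simps)
        from mult_right_mono[OF this, of "real n"] show ?thesis by (simp add: algebra_simps)
      qed
      also have "D < real n * (e / 2)"
        using N n e by (simp add: field_simps) (smt (verit) mult_left_mono of_nat_le_iff)
      finally have "\<bar>\<Sum>k<n. (R k - R0) * Q k\<bar> < real n * e" by (simp add: field_simps)
      then show "norm ((\<Sum>k<n. (R k - R0) * Q k) / real n - 0) < e"
        using n by (simp add: field_simps)
    qed
  qed
  from tendsto_add[OF this tendsto_mult[OF tendsto_const[of R0] Q]]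
  show ?thesis by (simp add: left_diff_distrib sum_subtractf sum_distrib_left diff_divide_distrib)
qed

text \<open>Summing the recursion shows that the absolute average of \<open>z\<close> at n + 1 is at
  most half of the one at n plus a null sequence, so the averages contract to 0 although
  \<open>z\<close> itself need not converge.\<close>

lemma two_scale_cesaro:
  fixes z D :: "nat \<Rightarrow> real"
  assumes rec: "\<And>n. z (Suc n) = z n / 2 + D n / 2"
    and D: "(\<lambda>n. (\<Sum>k<n. D k) / real n) \<longlonglongrightarrow> 0"
  shows "(\<lambda>n. (\<Sum>k<n. z k) / real n) \<longlonglongrightarrow> 0"
proof -
  define a where "a n = \<bar>(\<Sum>k<n. z k) / real n\<bar>" for n
  have S: "(\<Sum>k<Suc n. z k) = z 0 + (\<Sum>k<n. z k) / 2 + (\<Sum>k<n. D k) / 2" for n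
    unfolding sum.lessThan_Suc_shift by (simp add: rec sum.distrib sum_divide_distrib)
  have "a \<longlonglongrightarrow> 0"
  proof (rule contraction_recursion_LIMSEQ_0[where g = "1/2"])
    show "(\<lambda>n. \<bar>z 0\<bar> / real n + \<bar>(\<Sum>k<n. D k) / real n\<bar>) \<longlonglongrightarrow> 0"
      using tendsto_add[OF lim_const_over_n[of "\<bar>z 0\<bar>"] tendsto_rabs_zero[OF D]] by simp
    show "\<forall>\<^sub>F n in sequentially. a (Suc n) \<le> 1/2 * a n + (\<bar>z 0\<bar> / real n + \<bar>(\<Sum>k<n. D k) / real n\<bar>)"
      using eventually_gt_at_top[of 0]
    proof eventually_elim
      case (elim n)
      have "a (Suc n) \<le> \<bar>\<Sum>k<Suc n. z k\<bar> / real n"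
        unfolding a_def using elim by (simp add: divide_left_mono)
      also have "\<dots> \<le> (\<bar>z 0\<bar> + \<bar>\<Sum>k<n. z k\<bar> / 2 + \<bar>\<Sum>k<n. D k\<bar>) / real n"
        unfolding S using elim by (intro divide_right_mono) auto
      also have "\<dots> = 1/2 * a n + (\<bar>z 0\<bar> / real n + \<bar>(\<Sum>k<n. D k) / real n\<bar>)"
        by (simp add: a_def add_divide_distrib)
      finally show ?case .
    qed
  qed (auto simp: a_def)
  then show ?thesis unfolding a_def by (rule tendsto_rabs_zero_cancel)
qed

lemma power4_eq: "(x::real) ^ 4 = (x\<^sup>2)\<^sup>2"
  by (simp add: power_mult[symmetric])

text \<open>The argument is a convex combination of \<open>u\<close> and
  \<open>w / (1 - \<beta>)\<close>, and an even power is convex on the whole line. The coefficient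
  \<open>\<beta>\<close> in front of \<open>u ^ r\<close> is what makes moments contract from mother
  to child.\<close>

lemma convex_power_bound:
  fixes \<beta> u w :: real
  assumes b: "0 \<le> \<beta>" "\<beta> < 1" and e: "even r" "r > 0"
  shows "(\<beta> * u + w) ^ r \<le> \<beta> * u ^ r + (1 - \<beta>) * (w / (1 - \<beta>)) ^ r"
proof -
  have "convex_on UNIV (\<lambda>x::real. x ^ r)" using e by (intro convex_power_even) auto
  from convex_onD[OF this, of "1 - \<beta>" u "w / (1 - \<beta>)"] b show ?thesis
    by (simp add: add.commute)
qed

section \<open>Fourth moments\<close>

definition L4 :: "'a measure \<Rightarrow> ('a \<Rightarrow> real) \<Rightarrow> bool" where
  "L4 M f \<longleftrightarrow> f \<in> borel_measurable M \<and> integrable M (\<lambda>x. f x ^ 4)"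

lemma L4_measurable [measurable_dest]: "L4 M f \<Longrightarrow> f \<in> borel_measurable M"
  by (simp add: L4_def)

lemma power4_add_le: "(x + y) ^ 4 \<le> 8 * (x ^ 4 + (y::real) ^ 4)"
proof -
  have "(x + y)\<^sup>2 \<le> 2 * (x\<^sup>2 + y\<^sup>2)" 
    using zero_le_power2[of "x - y"] by (simp add: power2_eq_square algebra_simps)
  then have "((x + y)\<^sup>2)\<^sup>2 \<le> (2 * (x\<^sup>2 + y\<^sup>2))\<^sup>2" by (intro power_mono) auto
  also have "\<dots> = 4 * (x\<^sup>2 + y\<^sup>2)\<^sup>2" by (simp only: power_mult_distrib) simp
  also have "(x\<^sup>2 + y\<^sup>2)\<^sup>2 \<le> 2 * ((x\<^sup>2)\<^sup>2 + (y\<^sup>2)\<^sup>2)"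
    using zero_le_power2[of "x\<^sup>2 - y\<^sup>2"] by (simp add: power2_eq_square algebra_simps)
  finally show ?thesis unfolding power4_eq by simp
qed

lemma L4_add: "L4 M f \<Longrightarrow> L4 M g \<Longrightarrow> L4 M (\<lambda>x. f x + g x)"
proof -
  assume f: "L4 M f" and g: "L4 M g"
  note f[THEN L4_measurable, measurable] g[THEN L4_measurable, measurable]
  have "integrable M (\<lambda>x. 8 * (f x ^ 4 + g x ^ 4))" using f g by (simp add: L4_def)
  then have "integrable M (\<lambda>x. (f x + g x) ^ 4)"
    by (rule Bochner_Integration.integrable_bound) (auto intro!: order_trans[OF power4_add_le] AE_I2)
  then show "L4 M (\<lambda>x. f x + g x)" by (simp add: L4_def)
qed

lemma L4_bounded_mult:
  assumes f: "L4 M f" and c[measurable]: "c \<in> borel_measurable M" and b: "\<And>x. \<bar>c x\<bar> \<le> C"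
  shows "L4 M (\<lambda>x. c x * f x)"
proof -
  note f[THEN L4_measurable, measurable]
  have "integrable M (\<lambda>x. (c x * f x) ^ 4)"
  proof (rule Bochner_Integration.integrable_bound[where f = "\<lambda>x. C ^ 4 * f x ^ 4"])
    show "AE x in M. norm ((c x * f x) ^ 4) \<le> norm (C ^ 4 * f x ^ 4)"
    proof (intro AE_I2)
      fix x
      have "\<bar>c x\<bar> ^ 4 \<le> C ^ 4" by (intro power_mono b) auto
      then show "norm ((c x * f x) ^ 4) \<le> norm (C ^ 4 * f x ^ 4)"
        by (simp add: power_mult_distrib abs_mult mult_right_mono)
    qed
  qed (use f in \<open>auto simp: L4_def\<close>)
  then show ?thesis by (simp add: L4_def)
qed

lemma L4_cmult: "L4 M f \<Longrightarrow> L4 M (\<lambda>x. c * f x)"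
  by (rule L4_bounded_mult[where C = "\<bar>c\<bar>"]) auto

lemma L4_zero [simp]: "L4 M (\<lambda>x. 0)" by (simp add: L4_def)

lemma L4_sum: "(\<And>i. i \<in> I \<Longrightarrow> L4 M (f i)) \<Longrightarrow> L4 M (\<lambda>x. \<Sum>i\<in>I. f i x)"
  by (induction I rule: infinite_finite_induct) (auto intro: L4_add)

lemma (in prob_space) L4_const [simp]: "L4 M (\<lambda>x. c)" by (simp add: L4_def)

lemma mult4_le:
  fixes a b c d :: real
  shows "\<bar>a * b * c * d\<bar> \<le> a ^ 4 + b ^ 4 + c ^ 4 + d ^ 4"
proof -
  have m: "\<bar>x * y\<bar> \<le> (x\<^sup>2 + y\<^sup>2) / 2" for x y :: real
    using zero_le_power2[of "\<bar>x\<bar> - \<bar>y\<bar>"] by (simp add: power2_eq_square abs_mult algebra_simps)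
  have avg: "((x + y) / 2 + (z + w) / 2) / 2 = (x + y + z + w) / 4" for x y z w :: real
    by (simp add: field_simps)
  have s: "((x + y) / 2)\<^sup>2 \<le> (x\<^sup>2 + y\<^sup>2) / 2" for x y :: real
    using zero_le_power2[of "x - y"] by (simp add: power2_eq_square algebra_simps)
  have "\<bar>a * b * c * d\<bar> = \<bar>(a * b) * (c * d)\<bar>" by (simp add: mult.assoc)
  also have "\<dots> \<le> (\<bar>a * b\<bar>\<^sup>2 + \<bar>c * d\<bar>\<^sup>2) / 2" using m[of "a * b" "c * d"] by simp
  also have "\<dots> \<le> (((a\<^sup>2 + b\<^sup>2) / 2)\<^sup>2 + ((c\<^sup>2 + d\<^sup>2) / 2)\<^sup>2) / 2"
    by (intro divide_right_mono add_mono power_mono m) auto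
  also have "\<dots> \<le> (((a\<^sup>2)\<^sup>2 + (b\<^sup>2)\<^sup>2) / 2 + ((c\<^sup>2)\<^sup>2 + (d\<^sup>2)\<^sup>2) / 2) / 2"
    by (intro divide_right_mono add_mono s) auto
  also have "\<dots> = (a ^ 4 + b ^ 4 + c ^ 4 + d ^ 4) / 4" unfolding power4_eq by (rule avg)
  also have "\<dots> \<le> a ^ 4 + b ^ 4 + c ^ 4 + d ^ 4" by simp
  finally show ?thesis .
qed

lemma L4_mult4_integrable:
  assumes "L4 M a" "L4 M b" "L4 M c" "L4 M d"
  shows "integrable M (\<lambda>x. a x * b x * c x * d x :: real)"
proof -
  note assms[THEN L4_measurable, measurable]
  have int: "integrable M (\<lambda>x. a x ^ 4 + b x ^ 4 + c x ^ 4 + d x ^ 4)"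
    using assms by (auto simp: L4_def)
  have bd: "AE x in M. norm (a x * b x * c x * d x) \<le> norm (a x ^ 4 + b x ^ 4 + c x ^ 4 + d x ^ 4)"
    using mult4_le[of "a _" "b _" "c _" "d _"] by (intro AE_I2) simp
  show ?thesis by (rule Bochner_Integration.integrable_bound[OF int _ bd]) measurable
qed

context prob_space
begin

lemma L4_mult_integrable: "L4 M a \<Longrightarrow> L4 M b \<Longrightarrow> integrable M (\<lambda>x. a x * b x)"
  using L4_mult4_integrable[of M a b "\<lambda>_. 1" "\<lambda>_. 1"] by simp

lemma L4_integrable: "L4 M a \<Longrightarrow> integrable M a"
  using L4_mult_integrable[of a "\<lambda>_. 1"] by simp

lemma L4_square_integrable: "L4 M a \<Longrightarrow> integrable M (\<lambda>x. (a x)\<^sup>2)"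
  using L4_mult_integrable[of a a] by (simp add: power2_eq_square)

lemma L4_mult_square_integrable: "L4 M a \<Longrightarrow> L4 M b \<Longrightarrow> integrable M (\<lambda>x. (a x * b x)\<^sup>2)"
  using L4_mult4_integrable[of M a a b b] by (simp add: power2_eq_square ac_simps)

end

section \<open>A strong law for orthogonal random variables\<close>

text \<open>By Tonelli the series of the \<open>f n\<close> has finite expectation, so it converges
  almost everywhere and its terms tend to 0. Applied to squares, it turns summable second moments
  into almost sure convergence.\<close>

lemma summable_expectation_AE_LIMSEQ_0:
  fixes f :: "nat \<Rightarrow> 'a \<Rightarrow> real"
  assumes int: "\<And>n. integrable M (f n)" and pos: "\<And>n x. 0 \<le> f n x"
    and s: "summable (\<lambda>n. integral\<^sup>L M (f n))"
  shows "AE x in M. (\<lambda>n. f n x) \<longlonglongrightarrow> 0"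
proof -
  have [measurable]: "f n \<in> borel_measurable M" for n using int by auto
  have "(\<integral>\<^sup>+x. (\<Sum>n. ennreal (f n x)) \<partial>M) = (\<Sum>n. \<integral>\<^sup>+x. ennreal (f n x) \<partial>M)"
    by (rule nn_integral_suminf) auto
  also have "\<dots> = (\<Sum>n. ennreal (integral\<^sup>L M (f n)))"
    using int pos by (simp add: nn_integral_eq_integral)
  also have "\<dots> < \<infinity>"
    using s by (simp add: suminf_ennreal2 pos Bochner_Integration.integral_nonneg less_top[symmetric])
  finally have "AE x in M. (\<Sum>n. ennreal (f n x)) \<noteq> \<infinity>"
    by (intro nn_integral_PInf_AE) auto
  then show ?thesis
  proof eventually_elim
    case (elim x)
    then have "summable (\<lambda>n. f n x)"
      using pos by (intro summable_suminf_not_top) auto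
    then show ?case by (rule summable_LIMSEQ_zero)
  qed
qed

context prob_space
begin

lemma expectation_orthogonal_sum_square:
  fixes \<xi> :: "nat \<Rightarrow> 'a \<Rightarrow> real"
  assumes int: "\<And>j k. integrable M (\<lambda>\<omega>. \<xi> j \<omega> * \<xi> k \<omega>)"
    and orth: "\<And>j k. j < k \<Longrightarrow> expectation (\<lambda>\<omega>. \<xi> j \<omega> * \<xi> k \<omega>) = 0"
    and fin: "finite I"
  shows "expectation (\<lambda>\<omega>. (\<Sum>k\<in>I. \<xi> k \<omega>)\<^sup>2) = (\<Sum>k\<in>I. expectation (\<lambda>\<omega>. (\<xi> k \<omega>)\<^sup>2))"
proof -
  have orth': "expectation (\<lambda>\<omega>. \<xi> j \<omega> * \<xi> k \<omega>) = (if j = k then expectation (\<lambda>\<omega>. (\<xi> k \<omega>)\<^sup>2) else 0)" for j k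
    using orth[of j k] orth[of k j] by (cases j k rule: linorder_cases) (auto simp: mult.commute power2_eq_square)
  have "expectation (\<lambda>\<omega>. (\<Sum>k\<in>I. \<xi> k \<omega>)\<^sup>2) = (\<Sum>j\<in>I. \<Sum>k\<in>I. expectation (\<lambda>\<omega>. \<xi> j \<omega> * \<xi> k \<omega>))"
    by (simp add: power2_eq_square sum_product int)
  also have "\<dots> = (\<Sum>k\<in>I. expectation (\<lambda>\<omega>. (\<xi> k \<omega>)\<^sup>2))"
    using fin by (simp add: orth')
  finally show ?thesis .
qed

text \<open>Along n^2 the normalized sums have second moments of order 1 / n^2, which are summable.
  Between two consecutive squares lie only 2 n + 1 terms, so even the sum of their absolute values,
  divided by n^2, has summable second moments.\<close>

theorem orthogonal_strong_law:
  fixes \<xi> :: "nat \<Rightarrow> 'a \<Rightarrow> real"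
  assumes meas[measurable]: "\<And>k. \<xi> k \<in> borel_measurable M"
    and sq: "\<And>k. integrable M (\<lambda>\<omega>. (\<xi> k \<omega>)\<^sup>2)"
    and orth: "\<And>j k. j < k \<Longrightarrow> expectation (\<lambda>\<omega>. \<xi> j \<omega> * \<xi> k \<omega>) = 0"
    and bound: "\<And>k. expectation (\<lambda>\<omega>. (\<xi> k \<omega>)\<^sup>2) \<le> C"
  shows "AE \<omega> in M. (\<lambda>n. (\<Sum>k<n. \<xi> k \<omega>) / real n) \<longlonglongrightarrow> 0"
proof -
  have int: "integrable M (\<lambda>\<omega>. \<xi> j \<omega> * \<xi> k \<omega>)" for j k
  proof (rule Bochner_Integration.integrable_bound[where f = "\<lambda>\<omega>. (\<xi> j \<omega>)\<^sup>2 + (\<xi> k \<omega>)\<^sup>2"])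
    show "AE \<omega> in M. norm (\<xi> j \<omega> * \<xi> k \<omega>) \<le> norm ((\<xi> j \<omega>)\<^sup>2 + (\<xi> k \<omega>)\<^sup>2)"
    proof (intro AE_I2)
      fix \<omega>
      have "2 * (\<bar>\<xi> j \<omega>\<bar> * \<bar>\<xi> k \<omega>\<bar>) \<le> (\<xi> j \<omega>)\<^sup>2 + (\<xi> k \<omega>)\<^sup>2"
        using sum_squares_bound[of "\<bar>\<xi> j \<omega>\<bar>" "\<bar>\<xi> k \<omega>\<bar>"] by simp
      moreover have "0 \<le> \<bar>\<xi> j \<omega>\<bar> * \<bar>\<xi> k \<omega>\<bar>" by (rule mult_nonneg_nonneg) auto
      ultimately show "norm (\<xi> j \<omega> * \<xi> k \<omega>) \<le> norm ((\<xi> j \<omega>)\<^sup>2 + (\<xi> k \<omega>)\<^sup>2)"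
        unfolding real_norm_def abs_mult by linarith
    qed
  qed (use sq in auto)
  have C: "0 \<le> C" using bound[of 0] by (rule order_trans[rotated]) (simp add: Bochner_Integration.integral_nonneg)
  define T where "T n \<omega> = (\<Sum>k<n\<^sup>2. \<xi> k \<omega>) / real (n\<^sup>2)" for n \<omega>
  define U where "U n \<omega> = (\<Sum>k=n\<^sup>2..<(Suc n)\<^sup>2. \<bar>\<xi> k \<omega>\<bar>) / real (n\<^sup>2)" for n \<omega>
  have sumsq: "summable (\<lambda>n. C' / (real n)\<^sup>2)" for C'
    using inverse_power_summable[of 2, where 'a = real] summable_mult[of _ C'] by (simp add: divide_inverse)
  have "AE \<omega> in M. (\<lambda>n. (T n \<omega>)\<^sup>2) \<longlonglongrightarrow> 0"
  proof (rule summable_expectation_AE_LIMSEQ_0)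
    show "integrable M (\<lambda>\<omega>. (T n \<omega>)\<^sup>2)" for n
      unfolding T_def power_divide power2_eq_square[of "\<Sum>k<_. _ k"] sum_product
      using int by (intro integrable_divide Bochner_Integration.integrable_sum)
    have "norm (expectation (\<lambda>\<omega>. (T n \<omega>)\<^sup>2)) \<le> C / (real n)\<^sup>2" for n
    proof -
      have "expectation (\<lambda>\<omega>. (T n \<omega>)\<^sup>2) = (\<Sum>k<n\<^sup>2. expectation (\<lambda>\<omega>. (\<xi> k \<omega>)\<^sup>2)) / (real (n\<^sup>2))\<^sup>2"
        using expectation_orthogonal_sum_square[OF int orth, where I = "{..<n\<^sup>2}"]
        by (simp add: T_def power_divide)
      also have "\<dots> \<le> (real (n\<^sup>2) * C) / (real (n\<^sup>2))\<^sup>2"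
        using sum_bounded_above[of "{..<n\<^sup>2}", OF bound] by (intro divide_right_mono) auto
      also have "\<dots> = C / (real n)\<^sup>2" by (cases "n = 0") (auto simp: power2_eq_square)
      finally show ?thesis by (simp add: Bochner_Integration.integral_nonneg)
    qed
    then show "summable (\<lambda>n. expectation (\<lambda>\<omega>. (T n \<omega>)\<^sup>2))"
      by (intro summable_comparison_test'[OF sumsq[of C], of 0])
  qed auto
  moreover have "AE \<omega> in M. (\<lambda>n. (U n \<omega>)\<^sup>2) \<longlonglongrightarrow> 0"
  proof (rule summable_expectation_AE_LIMSEQ_0)
    have *: "(\<lambda>\<omega>. (U n \<omega>)\<^sup>2) = (\<lambda>\<omega>. (\<Sum>j=n\<^sup>2..<(Suc n)\<^sup>2. \<Sum>k=n\<^sup>2..<(Suc n)\<^sup>2. \<bar>\<xi> j \<omega> * \<xi> k \<omega>\<bar>) / (real (n\<^sup>2))\<^sup>2)" for n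
      unfolding U_def power_divide power2_eq_square[of "\<Sum>k=_..<_. _ k"] by (simp add: sum_product abs_mult)
    show "integrable M (\<lambda>\<omega>. (U n \<omega>)\<^sup>2)" for n
      unfolding * using int by (intro integrable_divide Bochner_Integration.integrable_sum integrable_abs)
    have "norm (expectation (\<lambda>\<omega>. (U n \<omega>)\<^sup>2)) \<le> 9 * C / (real n)\<^sup>2" for n
    proof (cases "n = 0")
      case True then show ?thesis by (simp add: U_def)
    next
      case False
      let ?I = "{n\<^sup>2..<(Suc n)\<^sup>2}"
      have card: "real (card ?I) = 2 * real n + 1" by (simp add: power2_eq_square)
      \<comment> \<open>Cauchy-Schwarz over the 2 n + 1 indices of the block. Together with 2 n + 1
        \<le> 3 n this is the origin of the constant 9.\<close>
      have "(U n \<omega>)\<^sup>2 \<le> (2 * real n + 1) * (\<Sum>k\<in>?I. (\<xi> k \<omega>)\<^sup>2) / (real (n\<^sup>2))\<^sup>2" for \<omega>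
        using sum_squared_le_sum_of_squares[of "\<lambda>k. \<bar>\<xi> k \<omega>\<bar>" ?I] card
        by (simp add: U_def power_divide divide_right_mono mult.commute)
      then have "expectation (\<lambda>\<omega>. (U n \<omega>)\<^sup>2) \<le> expectation (\<lambda>\<omega>. (2 * real n + 1) * (\<Sum>k\<in>?I. (\<xi> k \<omega>)\<^sup>2) / (real (n\<^sup>2))\<^sup>2)"
        by (intro integral_mono) (use sq \<open>integrable M (\<lambda>\<omega>. (U n \<omega>)\<^sup>2)\<close> in auto)
      also have "\<dots> = (2 * real n + 1) * (\<Sum>k\<in>?I. expectation (\<lambda>\<omega>. (\<xi> k \<omega>)\<^sup>2)) / (real (n\<^sup>2))\<^sup>2"
        using sq by simp
      also have "\<dots> \<le> (2 * real n + 1) * ((2 * real n + 1) * C) / (real (n\<^sup>2))\<^sup>2"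
        using sum_bounded_above[of ?I, OF bound] card by (intro divide_right_mono mult_left_mono) auto
      also have "\<dots> \<le> (3 * real n * (3 * real n * C)) / (real (n\<^sup>2))\<^sup>2"
        using False C by (intro divide_right_mono mult_mono mult_right_mono) auto
      also have "\<dots> = 9 * C / (real n)\<^sup>2" using False by (simp add: power2_eq_square)
      finally show ?thesis by (simp add: Bochner_Integration.integral_nonneg)
    qed
    then show "summable (\<lambda>n. expectation (\<lambda>\<omega>. (U n \<omega>)\<^sup>2))"
      by (intro summable_comparison_test'[OF sumsq[of "9 * C"], of 0])
  qed auto
  ultimately show ?thesis
  proof eventually_elim
    case (elim \<omega>)
    have T: "(\<lambda>n. \<bar>T n \<omega>\<bar>) \<longlonglongrightarrow> 0" and U: "(\<lambda>n. \<bar>U n \<omega>\<bar>) \<longlonglongrightarrow> 0"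
      using elim tendsto_real_sqrt[OF elim(1)] tendsto_real_sqrt[OF elim(2)] by auto
    have fs: "filterlim floor_sqrt at_top sequentially"
      unfolding filterlim_at_top eventually_sequentially
      by (auto simp: le_floor_sqrt_iff)
    have lim: "(\<lambda>n. \<bar>T (floor_sqrt n) \<omega>\<bar> + \<bar>U (floor_sqrt n) \<omega>\<bar>) \<longlonglongrightarrow> 0 + 0"
      by (intro tendsto_add filterlim_compose[OF T fs] filterlim_compose[OF U fs])
    have "\<forall>\<^sub>F m in sequentially. norm ((\<Sum>k<m. \<xi> k \<omega>) / real m) \<le> \<bar>T (floor_sqrt m) \<omega>\<bar> + \<bar>U (floor_sqrt m) \<omega>\<bar>"
      using eventually_gt_at_top[of 0]
    proof eventually_elim
      case (elim m)
      define n where "n = floor_sqrt m"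
      have n: "n\<^sup>2 \<le> m" "m < (Suc n)\<^sup>2" "0 < n" using elim
        by (auto simp: n_def Suc_floor_sqrt_power2_gt)
      have "\<bar>\<Sum>k<m. \<xi> k \<omega>\<bar> = \<bar>(\<Sum>k<n\<^sup>2. \<xi> k \<omega>) + (\<Sum>k=n\<^sup>2..<m. \<xi> k \<omega>)\<bar>"
        using n(1) by (subst sum.atLeastLessThan_concat[of 0 "n\<^sup>2" m, unfolded atLeast0LessThan, symmetric]) auto
      also have "\<dots> \<le> \<bar>\<Sum>k<n\<^sup>2. \<xi> k \<omega>\<bar> + (\<Sum>k=n\<^sup>2..<m. \<bar>\<xi> k \<omega>\<bar>)"
        by (intro order_trans[OF abs_triangle_ineq] add_mono sum_abs) auto
      also have "(\<Sum>k=n\<^sup>2..<m. \<bar>\<xi> k \<omega>\<bar>) \<le> (\<Sum>k=n\<^sup>2..<(Suc n)\<^sup>2. \<bar>\<xi> k \<omega>\<bar>)"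
        using n by (intro sum_mono2) auto
      finally have "\<bar>\<Sum>k<m. \<xi> k \<omega>\<bar> / real m \<le> (\<bar>\<Sum>k<n\<^sup>2. \<xi> k \<omega>\<bar> + (\<Sum>k=n\<^sup>2..<(Suc n)\<^sup>2. \<bar>\<xi> k \<omega>\<bar>)) / real (n\<^sup>2)"
        using n by (intro frac_le) (auto intro!: add_nonneg_nonneg sum_nonneg simp del: of_nat_power)
      also have "\<dots> \<le> \<bar>T n \<omega>\<bar> + \<bar>U n \<omega>\<bar>" by (simp add: T_def U_def add_divide_distrib)
      finally show ?case by (simp add: n_def)
    qed
    then show ?case using lim by (intro Lim_null_comparison[OF _ lim[simplified]])
  qed
qed

end

section \<open>Martingale differences\<close>

lemma square_integrable_mult:
  fixes f g :: "'a \<Rightarrow> real"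
  assumes [measurable]: "f \<in> borel_measurable M" "g \<in> borel_measurable M"
    and "integrable M (\<lambda>x. (f x)\<^sup>2)" "integrable M (\<lambda>x. (g x)\<^sup>2)"
  shows "integrable M (\<lambda>x. f x * g x)"
proof (rule Bochner_Integration.integrable_bound[where f = "\<lambda>x. (f x)\<^sup>2 + (g x)\<^sup>2"])
  show "AE x in M. norm (f x * g x) \<le> norm ((f x)\<^sup>2 + (g x)\<^sup>2)"
  proof (intro AE_I2)
    fix x
    have "2 * (\<bar>f x\<bar> * \<bar>g x\<bar>) \<le> (f x)\<^sup>2 + (g x)\<^sup>2"
      using sum_squares_bound[of "\<bar>f x\<bar>" "\<bar>g x\<bar>"] by simp
    moreover have "0 \<le> \<bar>f x\<bar> * \<bar>g x\<bar>" by (rule mult_nonneg_nonneg) auto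
    ultimately show "norm (f x * g x) \<le> norm ((f x)\<^sup>2 + (g x)\<^sup>2)"
      unfolding real_norm_def abs_mult by linarith
  qed
qed (use assms in auto)

locale filtered_prob_space = prob_space M for M :: "'a measure" +
  fixes G :: "nat \<Rightarrow> 'a measure"
  assumes subalgebra_G: "\<And>k. subalgebra M (G k)"
    and sets_G_mono: "\<And>j k. j \<le> k \<Longrightarrow> sets (G j) \<subseteq> sets (G k)"
begin

lemma space_G: "space (G k) = space M"
  using subalgebra_G[of k] by (simp add: subalgebra_def)

lemma sigma_finite_subalgebra_G: "sigma_finite_subalgebra M (G k)"
proof -
  interpret finite_measure_subalgebra M "G k" by standard (rule subalgebra_G)
  show ?thesis by standard
qed

lemma measurable_G_mono: "f \<in> measurable (G j) N \<Longrightarrow> j \<le> k \<Longrightarrow> f \<in> measurable (G k) N"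
  using sets_G_mono[of j k] space_G by (auto simp: measurable_def)

lemma measurable_G_M: "f \<in> measurable (G j) N \<Longrightarrow> f \<in> measurable M N"
  by (rule measurable_from_subalg[OF subalgebra_G])

text \<open>\<open>h\<close> may be any function that agrees almost everywhere with the conditional
  expectation, so constants and chosen versions can be inserted directly. The second part supplies
  the integrability that comparisons with \<open>h\<close> require.\<close>

lemma expectation_mult_cond_exp:
  assumes "f \<in> borel_measurable (G k)" "g \<in> borel_measurable M" "integrable M (\<lambda>\<omega>. f \<omega> * g \<omega>)"
    and "AE \<omega> in M. real_cond_exp M (G k) g \<omega> = h \<omega>" and [measurable]: "h \<in> borel_measurable M"
  shows "expectation (\<lambda>\<omega>. f \<omega> * g \<omega>) = expectation (\<lambda>\<omega>. f \<omega> * h \<omega>)"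
    and "integrable M (\<lambda>\<omega>. f \<omega> * h \<omega>)"
proof -
  interpret S: sigma_finite_subalgebra M "G k" by (rule sigma_finite_subalgebra_G)
  have [measurable]: "f \<in> borel_measurable M" using assms(1) by (rule measurable_G_M)
  note E = S.real_cond_exp_intg[OF assms(3,1,2)]
  have ae: "AE \<omega> in M. f \<omega> * real_cond_exp M (G k) g \<omega> = f \<omega> * h \<omega>"
    using assms(4) by eventually_elim simp
  show "expectation (\<lambda>\<omega>. f \<omega> * g \<omega>) = expectation (\<lambda>\<omega>. f \<omega> * h \<omega>)"
    unfolding E(2)[symmetric] by (rule integral_cong_AE) (use ae in auto)
  show "integrable M (\<lambda>\<omega>. f \<omega> * h \<omega>)"
    by (rule Bochner_Integration.integrable_cong_AE[THEN iffD1, OF _ _ ae E(1)]) auto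
qed

end

lemma Gen_iff_floor_log: "k \<in> Gen n \<longleftrightarrow> 0 < k \<and> floor_log k = n"
proof
  assume "k \<in> Gen n"
  then have "2 ^ n \<le> k" "k < 2 ^ Suc n" by (auto simp: Gen_def)
  then show "0 < k \<and> floor_log k = n"
    by (metis floor_log_eqI gr0I le_zero_eq power_eq_0_iff zero_neq_numeral power_Suc)
next
  assume "0 < k \<and> floor_log k = n"
  then show "k \<in> Gen n" using floor_log_exp2_le[of k] floor_log_exp2_gt[of k] by (auto simp: Gen_def)
qed

section \<open>The quadratic strong law\<close>

text \<open>\<open>2 ^ floor_log k\<close> is the beginning of the generation of k. Weights and
  conditional fourth moments are known there, whereas \<open>e k\<close> is a martingale difference
  for the finer \<open>G k\<close>. The index 0 is not a vertex and gets weight 0.\<close>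

locale quadratic_law = filtered_prob_space +
  fixes e :: "nat \<Rightarrow> 'a \<Rightarrow> real" and s :: "nat \<Rightarrow> real" and \<kappa> c :: "nat \<Rightarrow> 'a \<Rightarrow> real" and \<sigma> :: real
  assumes e_L4: "\<And>k. L4 M (e k)"
    and e_adapted: "\<And>k. e k \<in> borel_measurable (G (Suc k))"
    and e_mean: "\<And>k. AE \<omega> in M. real_cond_exp M (G k) (e k) \<omega> = 0"
    and e_var: "\<And>k. AE \<omega> in M. real_cond_exp M (G k) (\<lambda>\<omega>. (e k \<omega>)\<^sup>2) \<omega> = s k"
    and s_nonneg: "\<And>k. 0 \<le> s k" and s_le: "\<And>k. s k \<le> \<sigma>"
    and e_fourth: "\<And>k. AE \<omega> in M. real_cond_exp M (G k) (\<lambda>\<omega>. (e k \<omega>) ^ 4) \<omega> = \<kappa> k \<omega>"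
    and \<kappa>_meas: "\<And>k. 0 < k \<Longrightarrow> \<kappa> k \<in> borel_measurable (G (2 ^ floor_log k))"
    and c_meas: "\<And>k. 0 < k \<Longrightarrow> c k \<in> borel_measurable (G (2 ^ floor_log k))"
    and c_0: "c 0 = (\<lambda>\<omega>. 0)"
begin

definition mart :: "nat \<Rightarrow> 'a \<Rightarrow> real" where
  "mart k \<omega> = (\<Sum>j<k. e j \<omega> * c j \<omega>)"

definition comp :: "nat \<Rightarrow> 'a \<Rightarrow> real" where
  "comp k \<omega> = (\<Sum>j<k. s j * (c j \<omega>)\<^sup>2)"

lemma c_meas_G: "c k \<in> borel_measurable (G k)"
proof (cases "k = 0")
  case False
  then show ?thesis using measurable_G_mono[OF c_meas floor_log_exp2_le] by simp
qed (simp add: c_0)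

lemma mart_meas: "mart k \<in> borel_measurable (G k)"
  unfolding mart_def
  by (intro borel_measurable_sum borel_measurable_times measurable_G_mono[OF e_adapted]
        measurable_G_mono[OF c_meas_G]) auto

end

text \<open>Deterministic forms of the two almost sure bounds, so that expectations can be taken.
  \<open>\<kappa>\<close> is bounded only where the weight is nonzero, which is what a cut-off of
  the weights can guarantee.\<close>

locale bounded_quadratic_law = quadratic_law +
  fixes C :: real
  assumes c_bound: "\<And>n \<omega>. (\<Sum>k\<in>Gen n. (c k \<omega>)\<^sup>2) \<le> C * 2 ^ n"
    and c_\<kappa>: "\<And>k \<omega>. c k \<omega> \<noteq> 0 \<Longrightarrow> \<kappa> k \<omega> \<le> C"
begin

lemma C_nonneg: "0 \<le> C"
  using order_trans[OF sum_nonneg c_bound[where n = 0]] by simp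

lemma \<sigma>_nonneg: "0 \<le> \<sigma>" using order_trans[OF s_nonneg s_le] .

lemma c_sq_le: "k \<in> Gen n \<Longrightarrow> (c k \<omega>)\<^sup>2 \<le> C * 2 ^ n"
  by (rule order_trans[OF member_le_sum c_bound[where n = n and \<omega> = \<omega>]]) (auto simp: Gen_def)

lemma c_bounded: "\<exists>B. \<forall>\<omega>. \<bar>c k \<omega>\<bar> \<le> B"
proof (cases "k = 0")
  case False
  then have "k \<in> Gen (floor_log k)" by (simp add: Gen_iff_floor_log)
  from c_sq_le[OF this] have "\<bar>c k \<omega>\<bar> \<le> sqrt (C * 2 ^ floor_log k)" for \<omega>
    by (metis real_sqrt_abs real_sqrt_le_mono)
  then show ?thesis by blast
qed (auto simp: c_0)

lemma c_meas_M [measurable]: "c k \<in> borel_measurable M" by (rule measurable_G_M[OF c_meas_G])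
lemma e_meas_M [measurable]: "e k \<in> borel_measurable M" by (rule measurable_G_M[OF e_adapted])
lemma mart_meas_M [measurable]: "mart k \<in> borel_measurable M" by (rule measurable_G_M[OF mart_meas])

lemma L4_c_mult: "L4 M f \<Longrightarrow> L4 M (\<lambda>\<omega>. c k \<omega> * f \<omega>)"
proof -
  assume f: "L4 M f"
  obtain B where "\<And>\<omega>. \<bar>c k \<omega>\<bar> \<le> B" using c_bounded[of k] by blast
  then show ?thesis by (intro L4_bounded_mult[OF f, where C = B]) auto
qed

lemma L4_c: "L4 M (c k)" using L4_c_mult[OF L4_const[of 1]] by simp

lemma L4_mart: "L4 M (mart k)"
  unfolding mart_def using L4_sum[of "{..<k}" M "\<lambda>j \<omega>. c j \<omega> * e j \<omega>"] L4_c_mult[OF e_L4]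
  by (simp add: mult.commute)

lemma var_identity:
  assumes f: "f \<in> borel_measurable (G k)" "L4 M f" and g: "g \<in> borel_measurable (G k)" "L4 M g"
  shows "expectation (\<lambda>\<omega>. (f \<omega> * g \<omega>) * (e k \<omega>)\<^sup>2) = s k * expectation (\<lambda>\<omega>. f \<omega> * g \<omega>)"
proof -
  have "expectation (\<lambda>\<omega>. (f \<omega> * g \<omega>) * (e k \<omega>)\<^sup>2) = expectation (\<lambda>\<omega>. (f \<omega> * g \<omega>) * s k)"
    by (rule expectation_mult_cond_exp(1)[OF _ _ _ e_var])
       (use f g L4_mult4_integrable[OF f(2) g(2) e_L4 e_L4, of k k] in
         \<open>auto simp: power2_eq_square mult.assoc intro: borel_measurable_times\<close>)
  then show ?thesis by (simp add: mult.commute)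
qed

lemma mart_weighted_second_moment_Suc:
  assumes f: "f \<in> borel_measurable (G k)" and B: "\<And>\<omega>. \<bar>f \<omega>\<bar> \<le> B"
  shows "expectation (\<lambda>\<omega>. (f \<omega> * mart (Suc k) \<omega>)\<^sup>2) =
    expectation (\<lambda>\<omega>. (f \<omega> * mart k \<omega>)\<^sup>2) + s k * expectation (\<lambda>\<omega>. (f \<omega> * c k \<omega>)\<^sup>2)"
proof -
  have [measurable]: "f \<in> borel_measurable M" by (rule measurable_G_M[OF f])
  have fm: "L4 M (\<lambda>\<omega>. f \<omega> * mart k \<omega>)" and fc: "L4 M (\<lambda>\<omega>. f \<omega> * c k \<omega>)"
    by (auto intro!: L4_bounded_mult[where C = B] B L4_mart L4_c)
  have fmG: "(\<lambda>\<omega>. f \<omega> * mart k \<omega>) \<in> borel_measurable (G k)" "(\<lambda>\<omega>. f \<omega> * c k \<omega>) \<in> borel_measurable (G k)"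
    using f mart_meas c_meas_G by (auto intro: borel_measurable_times)
  have cross: "expectation (\<lambda>\<omega>. ((f \<omega> * mart k \<omega>) * (f \<omega> * c k \<omega>)) * e k \<omega>) = 0"
  proof -
    have "expectation (\<lambda>\<omega>. ((f \<omega> * mart k \<omega>) * (f \<omega> * c k \<omega>)) * e k \<omega>) =
      expectation (\<lambda>\<omega>. ((f \<omega> * mart k \<omega>) * (f \<omega> * c k \<omega>)) * 0)"
      by (rule expectation_mult_cond_exp(1)[OF _ _ _ e_mean])
         (use fmG L4_mult4_integrable[OF fm fc e_L4 L4_const[of 1], of k] in \<open>auto intro: borel_measurable_times\<close>)
    then show ?thesis by simp
  qed
  have i1: "integrable M (\<lambda>\<omega>. (f \<omega> * mart k \<omega>)\<^sup>2)" by (rule L4_square_integrable[OF fm])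
  have i2: "integrable M (\<lambda>\<omega>. ((f \<omega> * mart k \<omega>) * (f \<omega> * c k \<omega>)) * e k \<omega>)"
    using L4_mult4_integrable[OF fm fc e_L4 L4_const[of 1], of k] by simp
  have i3: "integrable M (\<lambda>\<omega>. ((f \<omega> * c k \<omega>) * (f \<omega> * c k \<omega>)) * (e k \<omega>)\<^sup>2)"
    using L4_mult4_integrable[OF fc fc e_L4 e_L4, of k k] by (simp add: power2_eq_square mult.assoc)
  have "(f \<omega> * mart (Suc k) \<omega>)\<^sup>2 = (f \<omega> * mart k \<omega>)\<^sup>2 + 2 * (((f \<omega> * mart k \<omega>) * (f \<omega> * c k \<omega>)) * e k \<omega>) +
      ((f \<omega> * c k \<omega>) * (f \<omega> * c k \<omega>)) * (e k \<omega>)\<^sup>2" for \<omega>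
    by (simp add: mart_def power2_eq_square algebra_simps)
  then have "expectation (\<lambda>\<omega>. (f \<omega> * mart (Suc k) \<omega>)\<^sup>2) = expectation (\<lambda>\<omega>. (f \<omega> * mart k \<omega>)\<^sup>2) +
     2 * 0 + expectation (\<lambda>\<omega>. ((f \<omega> * c k \<omega>) * (f \<omega> * c k \<omega>)) * (e k \<omega>)\<^sup>2)"
    using i1 i2 i3 cross by simp
  then show ?thesis using var_identity[OF fmG(2) fc fmG(2) fc] by (simp add: power2_eq_square)
qed

text \<open>Since \<open>f\<close> is known at time \<open>j\<close>, it can be carried through all
  later increments. It is used with \<open>f\<close> the weight of a vertex k of generation n and
  \<open>j = 2 ^ n\<close>, to replace \<open>mart k\<close> by \<open>mart (2 ^ n)\<close>, which
  is common to the whole generation.\<close>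

lemma mart_weighted_second_moment:
  assumes f: "f \<in> borel_measurable (G j)" and B: "\<And>\<omega>. \<bar>f \<omega>\<bar> \<le> B" and jk: "j \<le> k"
  shows "expectation (\<lambda>\<omega>. (f \<omega> * mart k \<omega>)\<^sup>2) \<le>
    expectation (\<lambda>\<omega>. (f \<omega> * mart j \<omega>)\<^sup>2) + \<sigma> * expectation (\<lambda>\<omega>. (f \<omega>)\<^sup>2 * (\<Sum>i=j..<k. (c i \<omega>)\<^sup>2))"
  using jk
proof (induction rule: dec_induct)
  case base then show ?case by simp
next
  case (step k)
  have [measurable]: "f \<in> borel_measurable M" by (rule measurable_G_M[OF f])
  have "L4 M (\<lambda>\<omega>. f \<omega> * 1)" by (rule L4_bounded_mult[OF L4_const _ B]) measurable
  then have fL: "L4 M f" by simp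
  have fc: "integrable M (\<lambda>\<omega>. (f \<omega>)\<^sup>2 * (c i \<omega>)\<^sup>2)" for i
    using L4_mult_square_integrable[OF fL L4_c] by (simp add: power_mult_distrib)
  have "s k * expectation (\<lambda>\<omega>. (f \<omega> * c k \<omega>)\<^sup>2) \<le> \<sigma> * expectation (\<lambda>\<omega>. (f \<omega>)\<^sup>2 * (c k \<omega>)\<^sup>2)"
    unfolding power_mult_distrib by (rule mult_right_mono[OF s_le]) simp
  moreover have eq: "expectation (\<lambda>\<omega>. (f \<omega>)\<^sup>2 * (\<Sum>i=j..<Suc k. (c i \<omega>)\<^sup>2)) =
      expectation (\<lambda>\<omega>. (f \<omega>)\<^sup>2 * (\<Sum>i=j..<k. (c i \<omega>)\<^sup>2)) + expectation (\<lambda>\<omega>. (f \<omega>)\<^sup>2 * (c k \<omega>)\<^sup>2)"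
  proof -
    have i: "integrable M (\<lambda>\<omega>. (f \<omega>)\<^sup>2 * (\<Sum>i=j..<k. (c i \<omega>)\<^sup>2))"
      unfolding sum_distrib_left by (intro Bochner_Integration.integrable_sum fc)
    show ?thesis
      unfolding sum.atLeastLessThan_Suc[OF step.hyps(1)] distrib_left by (rule Bochner_Integration.integral_add[OF i fc])
  qed
  ultimately show ?case
    using step.IH mart_weighted_second_moment_Suc[OF measurable_G_mono[OF f step.hyps(1)] B]
    unfolding eq distrib_left by linarith
qed

lemma expectation_c_sq_sum_le: "expectation (\<lambda>\<omega>. \<Sum>k\<in>Gen n. (c k \<omega>)\<^sup>2) \<le> C * 2 ^ n"
proof -
  have "expectation (\<lambda>\<omega>. \<Sum>k\<in>Gen n. (c k \<omega>)\<^sup>2) \<le> expectation (\<lambda>\<omega>. C * 2 ^ n)"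
    using c_bound by (intro integral_mono) (auto intro: L4_square_integrable[OF L4_c])
  then show ?thesis by (simp add: prob_space)
qed

lemma mart_second_moment: "expectation (\<lambda>\<omega>. (mart (2 ^ n) \<omega>)\<^sup>2) \<le> \<sigma> * C * 2 ^ n"
proof (induction n)
  case 0
  then show ?case using C_nonneg \<sigma>_nonneg by (simp add: mart_def c_0)
next
  case (Suc n)
  have "expectation (\<lambda>\<omega>. (mart (2 ^ Suc n) \<omega>)\<^sup>2) \<le>
      expectation (\<lambda>\<omega>. (mart (2 ^ n) \<omega>)\<^sup>2) + \<sigma> * expectation (\<lambda>\<omega>. \<Sum>k\<in>Gen n. (c k \<omega>)\<^sup>2)"
    using mart_weighted_second_moment[of "\<lambda>_. 1" "2 ^ n" 1 "2 ^ Suc n"] by (simp add: Gen_def)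
  also have "\<dots> \<le> \<sigma> * C * 2 ^ n + \<sigma> * (C * 2 ^ n)"
    by (intro add_mono Suc mult_left_mono expectation_c_sq_sum_le \<sigma>_nonneg)
  also have "\<dots> = \<sigma> * C * 2 ^ Suc n" by simp
  finally show ?case .
qed

section \<open>Increments of the squared martingale minus its compensator\<close>

definition incr :: "nat \<Rightarrow> 'a \<Rightarrow> real" where
  "incr k \<omega> = 2 * (mart k \<omega> * c k \<omega>) * e k \<omega> + (c k \<omega>)\<^sup>2 * ((e k \<omega>)\<^sup>2 - s k)"

lemma incr_eq: "incr k \<omega> = ((mart (Suc k) \<omega>)\<^sup>2 - comp (Suc k) \<omega>) - ((mart k \<omega>)\<^sup>2 - comp k \<omega>)"
  by (simp add: incr_def mart_def comp_def power2_eq_square algebra_simps)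

lemma incr_meas: "incr k \<in> borel_measurable (G (Suc k))"
proof -
  have [measurable]: "mart k \<in> borel_measurable (G (Suc k))" "c k \<in> borel_measurable (G (Suc k))"
    "e k \<in> borel_measurable (G (Suc k))"
    using measurable_G_mono[OF mart_meas, of k "Suc k"] measurable_G_mono[OF c_meas_G, of k "Suc k"] e_adapted[of k]
    by auto
  show ?thesis unfolding incr_def by measurable
qed

lemma incr_meas_M [measurable]: "incr k \<in> borel_measurable M" by (rule measurable_G_M[OF incr_meas])

lemma incr_parts_square_integrable:
  "integrable M (\<lambda>\<omega>. (2 * (mart k \<omega> * c k \<omega>) * e k \<omega>)\<^sup>2)"
  "integrable M (\<lambda>\<omega>. ((c k \<omega>)\<^sup>2 * ((e k \<omega>)\<^sup>2 - s k))\<^sup>2)"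
  "integrable M (\<lambda>\<omega>. (c k \<omega>) ^ 4 * (e k \<omega>) ^ 4)"
proof -
  have ce: "L4 M (\<lambda>\<omega>. c k \<omega> * e k \<omega>)" by (rule L4_c_mult[OF e_L4])
  show "integrable M (\<lambda>\<omega>. (2 * (mart k \<omega> * c k \<omega>) * e k \<omega>)\<^sup>2)"
    using L4_mult_square_integrable[OF L4_cmult[OF L4_mart, of 2] ce] by (simp add: mult.assoc)
  have "integrable M (\<lambda>\<omega>. (c k \<omega> * e k \<omega>)^4 - 2 * s k * (c k \<omega> * c k \<omega> * (c k \<omega> * e k \<omega>) * (c k \<omega> * e k \<omega>)) + (s k)\<^sup>2 * (c k \<omega>) ^ 4)"
    using ce L4_c[of k] L4_mult4_integrable[OF L4_c L4_c ce ce, of k k]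
    by (intro Bochner_Integration.integrable_add Bochner_Integration.integrable_diff integrable_mult_right) (auto simp: L4_def)
  also have "(\<lambda>\<omega>. (c k \<omega> * e k \<omega>)^4 - 2 * s k * (c k \<omega> * c k \<omega> * (c k \<omega> * e k \<omega>) * (c k \<omega> * e k \<omega>)) + (s k)\<^sup>2 * (c k \<omega>) ^ 4) =
     (\<lambda>\<omega>. ((c k \<omega>)\<^sup>2 * ((e k \<omega>)\<^sup>2 - s k))\<^sup>2)"
    by (rule ext) (simp add: power2_eq_square power4_eq algebra_simps)
  finally show "integrable M (\<lambda>\<omega>. ((c k \<omega>)\<^sup>2 * ((e k \<omega>)\<^sup>2 - s k))\<^sup>2)" .
  show "integrable M (\<lambda>\<omega>. (c k \<omega>) ^ 4 * (e k \<omega>) ^ 4)"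
    using ce by (simp add: L4_def power_mult_distrib)
qed

lemma incr_square_integrable: "integrable M (\<lambda>\<omega>. (incr k \<omega>)\<^sup>2)"
proof -
  have "integrable M (\<lambda>\<omega>. (2 * (mart k \<omega> * c k \<omega>) * e k \<omega>)\<^sup>2 + ((c k \<omega>)\<^sup>2 * ((e k \<omega>)\<^sup>2 - s k))\<^sup>2 +
     2 * ((2 * (mart k \<omega> * c k \<omega>) * e k \<omega>) * ((c k \<omega>)\<^sup>2 * ((e k \<omega>)\<^sup>2 - s k))))"
    using incr_parts_square_integrable[of k]
    by (intro Bochner_Integration.integrable_add integrable_mult_right square_integrable_mult) auto
  then show ?thesis unfolding incr_def power2_sum by (simp only: mult.assoc)
qed

lemma incr_orthogonal:
  assumes f: "f \<in> borel_measurable (G k)" and f2: "integrable M (\<lambda>\<omega>. (f \<omega>)\<^sup>2)"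
  shows "expectation (\<lambda>\<omega>. f \<omega> * incr k \<omega>) = 0"
proof -
  have [measurable]: "f \<in> borel_measurable M" by (rule measurable_G_M[OF f])
  have i1: "integrable M (\<lambda>\<omega>. (f \<omega> * (2 * (mart k \<omega> * c k \<omega>))) * e k \<omega>)"
    using square_integrable_mult[OF _ _ f2 incr_parts_square_integrable(1)[of k]] by (simp add: mult.assoc)
  have i2: "integrable M (\<lambda>\<omega>. (f \<omega> * (c k \<omega>)\<^sup>2) * ((e k \<omega>)\<^sup>2 - s k))"
    using square_integrable_mult[OF _ _ f2 incr_parts_square_integrable(2)[of k]] by (simp add: mult.assoc)
  have m: "(\<lambda>\<omega>. f \<omega> * (2 * (mart k \<omega> * c k \<omega>))) \<in> borel_measurable (G k)"
      "(\<lambda>\<omega>. f \<omega> * (c k \<omega>)\<^sup>2) \<in> borel_measurable (G k)"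
    using f mart_meas[of k] c_meas_G[of k] by measurable
  interpret S: sigma_finite_subalgebra M "G k" by (rule sigma_finite_subalgebra_G)
  have "AE \<omega> in M. real_cond_exp M (G k) (\<lambda>\<omega>. (e k \<omega>)\<^sup>2 - s k) \<omega> = 0"
    using S.real_cond_exp_diff[OF L4_square_integrable[OF e_L4] integrable_const[of "s k"], of k] e_var[of k]
      S.real_cond_exp_F_meas[OF integrable_const[of "s k"] borel_measurable_const]
    by eventually_elim simp
  then have "expectation (\<lambda>\<omega>. (f \<omega> * (c k \<omega>)\<^sup>2) * ((e k \<omega>)\<^sup>2 - s k)) = expectation (\<lambda>\<omega>. (f \<omega> * (c k \<omega>)\<^sup>2) * 0)"
    by (intro expectation_mult_cond_exp(1)[OF m(2) _ i2]) auto
  moreover have "expectation (\<lambda>\<omega>. (f \<omega> * (2 * (mart k \<omega> * c k \<omega>))) * e k \<omega>) = expectation (\<lambda>\<omega>. (f \<omega> * (2 * (mart k \<omega> * c k \<omega>))) * 0)"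
    by (intro expectation_mult_cond_exp(1)[OF m(1) _ i1 e_mean]) auto
  moreover have "f \<omega> * incr k \<omega> = (f \<omega> * (2 * (mart k \<omega> * c k \<omega>))) * e k \<omega> + (f \<omega> * (c k \<omega>)\<^sup>2) * ((e k \<omega>)\<^sup>2 - s k)" for \<omega>
    by (simp add: incr_def distrib_left mult.assoc)
  ultimately show ?thesis using i1 i2 by simp
qed

text \<open>From (x + y)^2 \<le> 2 x^2 + 2 y^2. The cross part contributes 2 * 4 * \<sigma> through
  the conditional variance. The centred square contributes at most twice the fourth moment of
  \<open>c k * e k\<close>, because centring only lowers the second moment, and there
  \<open>\<kappa>\<close> is at most \<open>C\<close>.\<close>

lemma incr_second_moment:
  "expectation (\<lambda>\<omega>. (incr k \<omega>)\<^sup>2) \<le>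
     8 * \<sigma> * expectation (\<lambda>\<omega>. (c k \<omega> * mart k \<omega>)\<^sup>2) + 2 * C * expectation (\<lambda>\<omega>. (c k \<omega>) ^ 4)"
proof -
  let ?a = "\<lambda>\<omega>. 2 * (mart k \<omega> * c k \<omega>) * e k \<omega>" and ?b = "\<lambda>\<omega>. (c k \<omega>)\<^sup>2 * ((e k \<omega>)\<^sup>2 - s k)"
  have cm: "L4 M (\<lambda>\<omega>. c k \<omega> * mart k \<omega>)" by (rule L4_c_mult[OF L4_mart])
  have cmG: "(\<lambda>\<omega>. c k \<omega> * mart k \<omega>) \<in> borel_measurable (G k)" using c_meas_G mart_meas by measurable
  have "expectation (\<lambda>\<omega>. (incr k \<omega>)\<^sup>2) \<le> expectation (\<lambda>\<omega>. 2 * (?a \<omega>)\<^sup>2 + 2 * (?b \<omega>)\<^sup>2)"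
  proof (rule integral_mono)
    show "(incr k \<omega>)\<^sup>2 \<le> 2 * (?a \<omega>)\<^sup>2 + 2 * (?b \<omega>)\<^sup>2" for \<omega>
      using zero_le_power2[of "?a \<omega> - ?b \<omega>"] unfolding incr_def power2_sum power2_diff by linarith
  qed (use incr_square_integrable incr_parts_square_integrable in auto)
  also have "\<dots> = 2 * expectation (\<lambda>\<omega>. (?a \<omega>)\<^sup>2) + 2 * expectation (\<lambda>\<omega>. (?b \<omega>)\<^sup>2)"
    using incr_parts_square_integrable by simp
  also have "expectation (\<lambda>\<omega>. (?a \<omega>)\<^sup>2) = 4 * expectation (\<lambda>\<omega>. ((c k \<omega> * mart k \<omega>) * (c k \<omega> * mart k \<omega>)) * (e k \<omega>)\<^sup>2)"
    by (subst integral_mult_right_zero[symmetric]) (simp add: power2_eq_square ac_simps)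
  also have "\<dots> = 4 * (s k * expectation (\<lambda>\<omega>. (c k \<omega> * mart k \<omega>)\<^sup>2))"
    unfolding var_identity[OF cmG cm cmG cm] by (simp add: power2_eq_square)
  also have "\<dots> \<le> 4 * (\<sigma> * expectation (\<lambda>\<omega>. (c k \<omega> * mart k \<omega>)\<^sup>2))"
    by (intro mult_left_mono mult_right_mono s_le Bochner_Integration.integral_nonneg) auto
  also have "expectation (\<lambda>\<omega>. (?b \<omega>)\<^sup>2) \<le> expectation (\<lambda>\<omega>. (c k \<omega>) ^ 4 * (e k \<omega>) ^ 4)"
  proof -
    have c2: "integrable M (\<lambda>\<omega>. (c k \<omega>)^4)" using L4_c by (simp add: L4_def)
    have cc: "L4 M (\<lambda>\<omega>. c k \<omega> * c k \<omega>)" by (rule L4_c_mult[OF L4_c])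
    have cc': "(\<lambda>\<omega>. c k \<omega> * c k \<omega>) \<in> borel_measurable (G k)" using c_meas_G by measurable
    have i: "integrable M (\<lambda>\<omega>. ((c k \<omega> * c k \<omega>) * (c k \<omega> * c k \<omega>)) * (e k \<omega>)\<^sup>2)"
      using L4_mult4_integrable[OF cc cc e_L4 e_L4, of k k] by (simp add: power2_eq_square mult.assoc)
    have "(?b \<omega>)\<^sup>2 = (c k \<omega>) ^ 4 * (e k \<omega>) ^ 4 - 2 * s k * (((c k \<omega> * c k \<omega>) * (c k \<omega> * c k \<omega>)) * (e k \<omega>)\<^sup>2) + (s k)\<^sup>2 * (c k \<omega>) ^ 4" for \<omega>
      by (simp add: power2_eq_square power4_eq algebra_simps)
    then have "expectation (\<lambda>\<omega>. (?b \<omega>)\<^sup>2) = expectation (\<lambda>\<omega>. (c k \<omega>) ^ 4 * (e k \<omega>) ^ 4)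
       - 2 * s k * expectation (\<lambda>\<omega>. ((c k \<omega> * c k \<omega>) * (c k \<omega> * c k \<omega>)) * (e k \<omega>)\<^sup>2) + (s k)\<^sup>2 * expectation (\<lambda>\<omega>. (c k \<omega>) ^ 4)"
      using incr_parts_square_integrable(3)[of k] c2 i by simp
    also have "expectation (\<lambda>\<omega>. ((c k \<omega> * c k \<omega>) * (c k \<omega> * c k \<omega>)) * (e k \<omega>)\<^sup>2) = s k * expectation (\<lambda>\<omega>. (c k \<omega>) ^ 4)"
      unfolding var_identity[OF cc' cc cc' cc] by (simp add: power4_eq power2_eq_square)
    finally have "expectation (\<lambda>\<omega>. (?b \<omega>)\<^sup>2) = expectation (\<lambda>\<omega>. (c k \<omega>) ^ 4 * (e k \<omega>) ^ 4) - (s k)\<^sup>2 * expectation (\<lambda>\<omega>. (c k \<omega>) ^ 4)"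
      by (simp add: power2_eq_square)
    moreover have "0 \<le> (s k)\<^sup>2 * expectation (\<lambda>\<omega>. (c k \<omega>) ^ 4)" by simp
    ultimately show ?thesis by linarith
  qed
  also have "expectation (\<lambda>\<omega>. (c k \<omega>) ^ 4 * (e k \<omega>) ^ 4) \<le> C * expectation (\<lambda>\<omega>. (c k \<omega>) ^ 4)"
  proof (cases "k = 0")
    case False
    then have [measurable]: "\<kappa> k \<in> borel_measurable M" using measurable_G_M[OF \<kappa>_meas] by simp
    have c4: "(\<lambda>\<omega>. (c k \<omega>) ^ 4) \<in> borel_measurable (G k)" using c_meas_G[of k] by measurable
    note E = expectation_mult_cond_exp[OF c4 _ incr_parts_square_integrable(3) e_fourth]
    have "expectation (\<lambda>\<omega>. (c k \<omega>) ^ 4 * \<kappa> k \<omega>) \<le> expectation (\<lambda>\<omega>. C * (c k \<omega>) ^ 4)"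
    proof (rule integral_mono)
      \<comment> \<open>Where the weight vanishes no bound on \<open>\<kappa> k\<close> is
        available, but both sides are 0.\<close>
      show "(c k \<omega>) ^ 4 * \<kappa> k \<omega> \<le> C * (c k \<omega>) ^ 4" for \<omega>
        using c_\<kappa>[of k \<omega>] by (cases "c k \<omega> = 0") (auto simp: mult.commute[of C] intro!: mult_left_mono)
    qed (use E(2) L4_c[of k] in \<open>auto simp: L4_def\<close>)
    then show ?thesis using E(1) by simp
  qed (simp add: c_0)
  finally show ?thesis by simp
qed

text \<open>The order is the square of the size 2 ^ n of the generation. With \<open>mart k\<close>
  replaced by the common \<open>mart (2 ^ n)\<close>, the pointwise bound on the sum of the squared
  weights applies, and this sum and the second moment of the martingale each have order 2 ^ n. For
  the fourth powers, one squared weight is estimated by the bound on the whole sum.\<close>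

lemma incr_block_second_moment: "(\<Sum>k\<in>Gen n. expectation (\<lambda>\<omega>. (incr k \<omega>)\<^sup>2)) \<le> (16 * \<sigma>\<^sup>2 * C\<^sup>2 + 2 * C ^ 3) * 4 ^ n"
proof -
  have c2: "integrable M (\<lambda>\<omega>. (c k \<omega>)\<^sup>2)" for k by (rule L4_square_integrable[OF L4_c])
  have cm: "integrable M (\<lambda>\<omega>. (c k \<omega> * mart j \<omega>)\<^sup>2)" for k j by (rule L4_mult_square_integrable[OF L4_c L4_mart])
  have one: "(\<Sum>k\<in>Gen n. expectation (\<lambda>\<omega>. (c k \<omega> * mart k \<omega>)\<^sup>2)) \<le> 2 * \<sigma> * C\<^sup>2 * 4 ^ n"
  proof -
    have "expectation (\<lambda>\<omega>. (c k \<omega> * mart k \<omega>)\<^sup>2) \<le>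
        expectation (\<lambda>\<omega>. (c k \<omega> * mart (2 ^ n) \<omega>)\<^sup>2) + \<sigma> * (C * 2 ^ n * expectation (\<lambda>\<omega>. (c k \<omega>)\<^sup>2))" if k: "k \<in> Gen n" for k
    proof -
      obtain B where B: "\<And>\<omega>. \<bar>c k \<omega>\<bar> \<le> B" using c_bounded[of k] by blast
      have kG: "c k \<in> borel_measurable (G (2 ^ n))" using c_meas[of k] k by (simp add: Gen_iff_floor_log)
      have "expectation (\<lambda>\<omega>. (c k \<omega>)\<^sup>2 * (\<Sum>i=2^n..<k. (c i \<omega>)\<^sup>2)) \<le> expectation (\<lambda>\<omega>. C * 2 ^ n * (c k \<omega>)\<^sup>2)"
      proof (rule integral_mono)
        show "integrable M (\<lambda>\<omega>. (c k \<omega>)\<^sup>2 * (\<Sum>i=2^n..<k. (c i \<omega>)\<^sup>2))"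
          using L4_mult_square_integrable[OF L4_c[of k] L4_c]
          by (auto simp: sum_distrib_left power_mult_distrib)
        show "(c k \<omega>)\<^sup>2 * (\<Sum>i=2^n..<k. (c i \<omega>)\<^sup>2) \<le> C * 2 ^ n * (c k \<omega>)\<^sup>2" for \<omega>
        proof -
          have "(\<Sum>i=2^n..<k. (c i \<omega>)\<^sup>2) \<le> (\<Sum>i\<in>Gen n. (c i \<omega>)\<^sup>2)"
            using k by (intro sum_mono2) (auto simp: Gen_def)
          also note c_bound[where n = n and \<omega> = \<omega>]
          finally show ?thesis by (simp add: mult.commute[of "(c k \<omega>)\<^sup>2"] mult_right_mono)
        qed
      qed (use c2 in auto)
      from mult_left_mono[OF this \<sigma>_nonneg] mart_weighted_second_moment[OF kG B, of k] k
      show ?thesis by (simp add: Gen_def)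
    qed
    then have "(\<Sum>k\<in>Gen n. expectation (\<lambda>\<omega>. (c k \<omega> * mart k \<omega>)\<^sup>2)) \<le>
       (\<Sum>k\<in>Gen n. expectation (\<lambda>\<omega>. (c k \<omega> * mart (2 ^ n) \<omega>)\<^sup>2) + \<sigma> * (C * 2 ^ n * expectation (\<lambda>\<omega>. (c k \<omega>)\<^sup>2)))"
      by (intro sum_mono)
    also have "\<dots> = expectation (\<lambda>\<omega>. (\<Sum>k\<in>Gen n. (c k \<omega>)\<^sup>2) * (mart (2 ^ n) \<omega>)\<^sup>2) +
        \<sigma> * C * 2 ^ n * expectation (\<lambda>\<omega>. \<Sum>k\<in>Gen n. (c k \<omega>)\<^sup>2)"
      using cm c2 by (simp add: sum.distrib sum_distrib_left sum_distrib_right power_mult_distrib mult.assoc)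
    also have "expectation (\<lambda>\<omega>. (\<Sum>k\<in>Gen n. (c k \<omega>)\<^sup>2) * (mart (2 ^ n) \<omega>)\<^sup>2) \<le> expectation (\<lambda>\<omega>. C * 2 ^ n * (mart (2 ^ n) \<omega>)\<^sup>2)"
    proof (rule integral_mono)
      show "integrable M (\<lambda>\<omega>. (\<Sum>k\<in>Gen n. (c k \<omega>)\<^sup>2) * (mart (2 ^ n) \<omega>)\<^sup>2)"
        using cm by (simp add: sum_distrib_right power_mult_distrib)
    qed (use c_bound L4_square_integrable[OF L4_mart] in \<open>auto intro!: mult_right_mono\<close>)
    also have "\<dots> = C * 2 ^ n * expectation (\<lambda>\<omega>. (mart (2 ^ n) \<omega>)\<^sup>2)" by simp
    also have "\<dots> \<le> C * 2 ^ n * (\<sigma> * C * 2 ^ n)"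
      using C_nonneg by (intro mult_left_mono mart_second_moment) auto
    also have "\<sigma> * C * 2 ^ n * expectation (\<lambda>\<omega>. \<Sum>k\<in>Gen n. (c k \<omega>)\<^sup>2) \<le> \<sigma> * C * 2 ^ n * (C * 2 ^ n)"
      using C_nonneg \<sigma>_nonneg by (intro mult_left_mono expectation_c_sq_sum_le) auto
    also have "C * 2 ^ n * (\<sigma> * C * 2 ^ n) + \<sigma> * C * 2 ^ n * (C * 2 ^ n) = 2 * \<sigma> * C\<^sup>2 * (2 ^ n * 2 ^ n)"
      by (simp add: power2_eq_square)
    also have "(2::real) ^ n * 2 ^ n = 4 ^ n" by (simp add: power_mult_distrib[symmetric])
    finally show ?thesis by simp
  qed
  have two: "(\<Sum>k\<in>Gen n. expectation (\<lambda>\<omega>. (c k \<omega>) ^ 4)) \<le> C\<^sup>2 * 4 ^ n"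
  proof -
    have c4: "integrable M (\<lambda>\<omega>. (c k \<omega>) ^ 4)" for k using L4_c by (simp add: L4_def)
    have "(\<Sum>k\<in>Gen n. expectation (\<lambda>\<omega>. (c k \<omega>) ^ 4)) = expectation (\<lambda>\<omega>. \<Sum>k\<in>Gen n. (c k \<omega>) ^ 4)"
      using c4 by simp
    also have "\<dots> \<le> expectation (\<lambda>\<omega>. C\<^sup>2 * 4 ^ n)"
    proof (rule integral_mono)
      fix \<omega>
      have "(\<Sum>k\<in>Gen n. (c k \<omega>) ^ 4) \<le> (\<Sum>k\<in>Gen n. C * 2 ^ n * (c k \<omega>)\<^sup>2)"
      proof (intro sum_mono)
        fix k assume "k \<in> Gen n"
        from mult_right_mono[OF c_sq_le[OF this, of \<omega>], of "(c k \<omega>)\<^sup>2"]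
        show "(c k \<omega>) ^ 4 \<le> C * 2 ^ n * (c k \<omega>)\<^sup>2"
          unfolding power4_eq power2_eq_square[of "(c k \<omega>)\<^sup>2"] by simp
      qed
      also have "\<dots> \<le> C * 2 ^ n * (C * 2 ^ n)"
        unfolding sum_distrib_left[symmetric] using C_nonneg by (intro mult_left_mono c_bound) auto
      also have "\<dots> = C\<^sup>2 * (2 ^ n * 2 ^ n)" by (simp add: power2_eq_square)
      also have "(2::real) ^ n * 2 ^ n = 4 ^ n" by (simp add: power_mult_distrib[symmetric])
      finally show "(\<Sum>k\<in>Gen n. (c k \<omega>) ^ 4) \<le> C\<^sup>2 * 4 ^ n" .
    qed (use c4 in auto)
    finally show ?thesis by (simp add: prob_space)
  qed
  have "(\<Sum>k\<in>Gen n. expectation (\<lambda>\<omega>. (incr k \<omega>)\<^sup>2)) \<le>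
      (\<Sum>k\<in>Gen n. 8 * \<sigma> * expectation (\<lambda>\<omega>. (c k \<omega> * mart k \<omega>)\<^sup>2) + 2 * C * expectation (\<lambda>\<omega>. (c k \<omega>) ^ 4))"
    by (intro sum_mono incr_second_moment)
  also have "\<dots> = 8 * \<sigma> * (\<Sum>k\<in>Gen n. expectation (\<lambda>\<omega>. (c k \<omega> * mart k \<omega>)\<^sup>2)) +
      2 * C * (\<Sum>k\<in>Gen n. expectation (\<lambda>\<omega>. (c k \<omega>) ^ 4))"
    by (simp add: sum.distrib sum_distrib_left)
  also have "\<dots> \<le> 8 * \<sigma> * (2 * \<sigma> * C\<^sup>2 * 4 ^ n) + 2 * C * (C\<^sup>2 * 4 ^ n)"
    using one two C_nonneg \<sigma>_nonneg by (intro add_mono mult_left_mono) auto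
  also have "\<dots> = (16 * \<sigma>\<^sup>2 * C\<^sup>2 + 2 * C ^ 3) * 4 ^ n"
    by (simp add: power2_eq_square power3_eq_cube algebra_simps)
  finally show ?thesis .
qed

lemma bounded_quadratic_strong_law:
  "AE \<omega> in M. (\<lambda>N. (\<Sum>n<N. ((mart (2 ^ n) \<omega>)\<^sup>2 - comp (2 ^ n) \<omega>) / 2 ^ n) / real N) \<longlonglongrightarrow> 0"
proof -
  define D where "D n \<omega> = (\<Sum>k\<in>Gen n. incr k \<omega>) / 2 ^ n" for n \<omega>
  have int: "integrable M (\<lambda>\<omega>. incr j \<omega> * incr k \<omega>)" for j k
    by (intro square_integrable_mult incr_square_integrable) auto
  have orth: "expectation (\<lambda>\<omega>. incr j \<omega> * incr k \<omega>) = 0" if "j < k" for j k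
    using that by (intro incr_orthogonal measurable_G_mono[OF incr_meas] incr_square_integrable) auto
  have D_sq: "(D n \<omega>)\<^sup>2 = (\<Sum>k\<in>Gen n. incr k \<omega>)\<^sup>2 / 4 ^ n" for n \<omega>
    by (simp add: D_def power_divide power2_eq_square power_mult_distrib[symmetric])
  have "AE \<omega> in M. (\<lambda>N. (\<Sum>n<N. D n \<omega>) / real N) \<longlonglongrightarrow> 0"
  proof (rule orthogonal_strong_law)
    show "D n \<in> borel_measurable M" for n unfolding D_def by measurable
    show "integrable M (\<lambda>\<omega>. (D n \<omega>)\<^sup>2)" for n
      unfolding D_sq
      unfolding power2_eq_square sum_product
      by (intro integrable_divide Bochner_Integration.integrable_sum int)
    show "expectation (\<lambda>\<omega>. D i \<omega> * D n \<omega>) = 0" if "i < n" for i n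
    proof -
      have "expectation (\<lambda>\<omega>. incr j \<omega> * incr k \<omega>) = 0" if "j \<in> Gen i" "k \<in> Gen n" for j k
      proof (rule orth)
        have "j < 2 ^ Suc i" using that by (simp add: Gen_def)
        also have "\<dots> \<le> 2 ^ n" using \<open>i < n\<close> by (intro power_increasing) auto
        also have "\<dots> \<le> k" using that by (simp add: Gen_def)
        finally show "j < k" .
      qed
      then show ?thesis by (simp add: D_def sum_product int)
    qed
    show "expectation (\<lambda>\<omega>. (D n \<omega>)\<^sup>2) \<le> 16 * \<sigma>\<^sup>2 * C\<^sup>2 + 2 * C ^ 3" for n
    proof -
      have "expectation (\<lambda>\<omega>. (D n \<omega>)\<^sup>2) = (\<Sum>k\<in>Gen n. expectation (\<lambda>\<omega>. (incr k \<omega>)\<^sup>2)) / 4 ^ n"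
        unfolding D_sq by (simp add: expectation_orthogonal_sum_square[OF int orth] Gen_def)
      also have "\<dots> \<le> (16 * \<sigma>\<^sup>2 * C\<^sup>2 + 2 * C ^ 3) * 4 ^ n / 4 ^ n"
        by (intro divide_right_mono incr_block_second_moment) auto
      finally show ?thesis by simp
    qed
  qed
  then show ?thesis
  proof eventually_elim
    case (elim \<omega>)
    show ?case
    proof (rule two_scale_cesaro[OF _ elim])
      fix n
      have "(\<Sum>k\<in>Gen n. incr k \<omega>) = ((mart (2 ^ Suc n) \<omega>)\<^sup>2 - comp (2 ^ Suc n) \<omega>) - ((mart (2 ^ n) \<omega>)\<^sup>2 - comp (2 ^ n) \<omega>)"
        unfolding incr_eq Gen_def by (subst sum_Suc_diff') auto
      then show "((mart (2 ^ Suc n) \<omega>)\<^sup>2 - comp (2 ^ Suc n) \<omega>) / 2 ^ Suc n =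
          ((mart (2 ^ n) \<omega>)\<^sup>2 - comp (2 ^ n) \<omega>) / 2 ^ n / 2 + D n \<omega> / 2"
        by (simp add: D_def field_simps)
    qed
  qed
qed

end

text \<open>The weights are cut off at level C by two conditions known at the beginning of the
  generation, so the new weights are again admissible and satisfy the deterministic bounds. For
  almost every \<omega>, an integer level above both random bounds leaves all weights unchanged, and
  countably many levels cost only a null set.\<close>

theorem (in quadratic_law) quadratic_strong_law:
  assumes c_avg: "AE \<omega> in M. \<exists>C. \<forall>n. (\<Sum>k\<in>Gen n. (c k \<omega>)\<^sup>2) \<le> C * 2 ^ n"
    and \<kappa>_bdd: "AE \<omega> in M. \<exists>C. \<forall>k. \<kappa> k \<omega> \<le> C"
  shows "AE \<omega> in M. (\<lambda>N. (\<Sum>n<N. ((\<Sum>k<2 ^ n. e k \<omega> * c k \<omega>)\<^sup>2 - (\<Sum>k<2 ^ n. s k * (c k \<omega>)\<^sup>2)) / 2 ^ n) / real N) \<longlonglongrightarrow> 0"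
proof -
  define t where "t C k \<omega> = (if (\<Sum>j\<in>Gen (floor_log k). (c j \<omega>)\<^sup>2) \<le> C * 2 ^ floor_log k \<and> \<kappa> k \<omega> \<le> C then c k \<omega> else 0)"
    for C :: real and k \<omega>
  have law: "AE \<omega> in M. (\<lambda>N. (\<Sum>n<N. ((\<Sum>k<2 ^ n. e k \<omega> * t C k \<omega>)\<^sup>2 - (\<Sum>k<2 ^ n. s k * (t C k \<omega>)\<^sup>2)) / 2 ^ n) / real N) \<longlonglongrightarrow> 0"
    if C: "0 \<le> C" for C
  proof -
    interpret T: bounded_quadratic_law M G e s \<kappa> "t C" \<sigma> C
    proof unfold_locales
      show "t C k \<in> borel_measurable (G (2 ^ floor_log k))" if k: "0 < k" for k
      proof -
        have "c j \<in> borel_measurable (G (2 ^ floor_log k))" if "j \<in> Gen (floor_log k)" for j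
          using c_meas[of j] that by (simp add: Gen_iff_floor_log)
        then show ?thesis unfolding t_def using c_meas[OF k] \<kappa>_meas[OF k] by measurable
      qed
      show "t C 0 = (\<lambda>\<omega>. 0)" by (simp add: t_def c_0 fun_eq_iff)
      show "\<kappa> k \<omega> \<le> C" if "t C k \<omega> \<noteq> 0" for k \<omega> using that by (auto simp: t_def split: if_splits)
      show "(\<Sum>k\<in>Gen n. (t C k \<omega>)\<^sup>2) \<le> C * 2 ^ n" for n \<omega>
      proof (cases "(\<Sum>j\<in>Gen n. (c j \<omega>)\<^sup>2) \<le> C * 2 ^ n")
        case True
        have "(\<Sum>k\<in>Gen n. (t C k \<omega>)\<^sup>2) \<le> (\<Sum>k\<in>Gen n. (c k \<omega>)\<^sup>2)" by (intro sum_mono) (simp add: t_def)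
        then show ?thesis using True by linarith
      next
        case False
        then have "t C k \<omega> = 0" if "k \<in> Gen n" for k using that by (simp add: t_def Gen_iff_floor_log)
        then show ?thesis using C by simp
      qed
    qed (use e_L4 e_adapted e_mean e_var s_nonneg s_le e_fourth \<kappa>_meas in auto)
    show ?thesis using T.bounded_quadratic_strong_law unfolding T.mart_def T.comp_def .
  qed
  have "AE \<omega> in M. \<forall>m::nat. (\<lambda>N. (\<Sum>n<N. ((\<Sum>k<2 ^ n. e k \<omega> * t (real m) k \<omega>)\<^sup>2 - (\<Sum>k<2 ^ n. s k * (t (real m) k \<omega>)\<^sup>2)) / 2 ^ n) / real N) \<longlonglongrightarrow> 0"
    unfolding AE_all_countable using law by auto
  with c_avg \<kappa>_bdd show ?thesis
  proof eventually_elim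
    case (elim \<omega>)
    obtain C1 C2 where C1: "\<And>n. (\<Sum>k\<in>Gen n. (c k \<omega>)\<^sup>2) \<le> C1 * 2 ^ n" and C2: "\<And>k. \<kappa> k \<omega> \<le> C2"
      using elim(1,2) by blast
    obtain m :: nat where m: "max C1 C2 \<le> real m" using real_arch_simple by blast
    have "t (real m) k \<omega> = c k \<omega>" for k
    proof -
      have "C1 * 2 ^ floor_log k \<le> real m * 2 ^ floor_log k" using m by (intro mult_right_mono) auto
      then show ?thesis using order_trans[OF C1[of "floor_log k"]] order_trans[OF C2[of k], of "real m"] m
        by (simp add: t_def)
    qed
    then show ?case using elim(3)[rule_format, of m] by simp
  qed
qed

section \<open>A martingale central limit theorem\<close>

lemma exp_minus_approx:
  fixes x :: real assumes "0 \<le> x" shows "\<bar>(1 - x) - exp (- x)\<bar> \<le> x\<^sup>2"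
proof -
  have l: "1 - x \<le> exp (- x)" using exp_ge_add_one_self[of "- x"] by simp
  have "exp (- x) = 1 / exp x" by (simp add: exp_minus inverse_eq_divide)
  also have "\<dots> \<le> 1 / (1 + x)" using exp_ge_add_one_self[of x] assms by (intro divide_left_mono) auto
  also have "\<dots> \<le> 1 - x + x\<^sup>2"
  proof -
    have "1 \<le> (1 - x + x\<^sup>2) * (1 + x)" using assms by (simp add: power2_eq_square algebra_simps)
    then show ?thesis using assms by (simp add: divide_le_eq)
  qed
  finally show ?thesis using l by simp
qed

lemma cube_abs_le: "\<bar>x\<bar> ^ 3 \<le> 1 + (x::real) ^ 4"
proof (cases "\<bar>x\<bar> \<le> 1")
  case True
  then have "\<bar>x\<bar> ^ 3 \<le> 1" by (intro power_le_one) auto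
  moreover have "0 \<le> x ^ 4" by simp
  ultimately show ?thesis by linarith
next
  case False
  then have "\<bar>x\<bar> ^ 3 \<le> \<bar>x\<bar> ^ 4" by (intro power_increasing) auto
  then show ?thesis by simp
qed

text \<open>Conditional expectations are taken of real functions, so the complex factor is split
  into real and imaginary parts.\<close>

lemma (in filtered_prob_space) expectation_complex_mult_cond_exp:
  fixes g :: "'a \<Rightarrow> complex" and f h :: "'a \<Rightarrow> real"
  assumes g: "g \<in> borel_measurable (G k)" and B: "\<And>\<omega>. norm (g \<omega>) \<le> B"
    and f: "integrable M f"
    and c: "AE \<omega> in M. real_cond_exp M (G k) f \<omega> = h \<omega>" and h[measurable]: "h \<in> borel_measurable M"
  shows "expectation (\<lambda>\<omega>. g \<omega> * complex_of_real (f \<omega>)) = expectation (\<lambda>\<omega>. g \<omega> * complex_of_real (h \<omega>))"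
proof -
  have [measurable]: "g \<in> borel_measurable M" by (rule measurable_G_M[OF g])
  have [measurable]: "f \<in> borel_measurable M" using f by auto
  have iR: "integrable M (\<lambda>\<omega>. Re (g \<omega>) * f \<omega>)" "integrable M (\<lambda>\<omega>. Im (g \<omega>) * f \<omega>)"
  proof -
    have fB: "integrable M (\<lambda>\<omega>. B * f \<omega>)" using f by simp
    have le: "norm (Re (g \<omega>) * f \<omega>) \<le> norm (B * f \<omega>)" "norm (Im (g \<omega>) * f \<omega>) \<le> norm (B * f \<omega>)" for \<omega>
      using abs_Re_le_cmod[of "g \<omega>"] abs_Im_le_cmod[of "g \<omega>"] B[of \<omega>]
      by (auto simp: abs_mult intro!: mult_right_mono)
    show "integrable M (\<lambda>\<omega>. Re (g \<omega>) * f \<omega>)"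
      by (rule Bochner_Integration.integrable_bound[OF fB _ AE_I2[OF le(1)]]) measurable
    show "integrable M (\<lambda>\<omega>. Im (g \<omega>) * f \<omega>)"
      by (rule Bochner_Integration.integrable_bound[OF fB _ AE_I2[OF le(2)]]) measurable
  qed
  have mR: "(\<lambda>\<omega>. Re (g \<omega>)) \<in> borel_measurable (G k)" "(\<lambda>\<omega>. Im (g \<omega>)) \<in> borel_measurable (G k)"
    using g by auto
  note E1 = expectation_mult_cond_exp[OF mR(1) _ iR(1) c h] and E2 = expectation_mult_cond_exp[OF mR(2) _ iR(2) c h]
  have dec: "g \<omega> * complex_of_real t = complex_of_real (Re (g \<omega>) * t) + \<i> * complex_of_real (Im (g \<omega>) * t)" for \<omega> t
    by (simp add: complex_eq_iff)
  have exp_dec: "expectation (\<lambda>\<omega>. g \<omega> * complex_of_real (q \<omega>)) =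
     complex_of_real (expectation (\<lambda>\<omega>. Re (g \<omega>) * q \<omega>)) + \<i> * complex_of_real (expectation (\<lambda>\<omega>. Im (g \<omega>) * q \<omega>))"
    if "integrable M (\<lambda>\<omega>. Re (g \<omega>) * q \<omega>)" "integrable M (\<lambda>\<omega>. Im (g \<omega>) * q \<omega>)" for q
    unfolding dec Bochner_Integration.integral_add[OF integrable_of_real[OF that(1)] integrable_mult_right[OF integrable_of_real[OF that(2)]]]
      integral_mult_right_zero integral_complex_of_real ..
  show ?thesis
    unfolding exp_dec[OF iR] exp_dec[OF E1(2) E2(2), simplified] using E1(1) E2(1) by simp
qed

text \<open>One row of the limit theorem: the first \<open>m\<close> increments, normalized by
  \<open>sqrt r\<close>, with \<open>V\<close> the value near which their normalized conditional
  variance is expected. The theorem uses one instance for each n, in which only \<open>m\<close> and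
  \<open>r\<close> vary.\<close>

locale martingale_clt = filtered_prob_space +
  fixes \<xi> v :: "nat \<Rightarrow> 'a \<Rightarrow> real" and C V :: real and m :: nat and r :: real
  assumes \<xi>_meas: "\<And>k. \<xi> k \<in> borel_measurable (G (Suc k))"
    and v_meas: "\<And>k. v k \<in> borel_measurable (G k)"
    and v_nonneg: "\<And>k \<omega>. 0 \<le> v k \<omega>"
    and \<xi>_L4: "\<And>k. L4 M (\<xi> k)"
    and \<xi>_mean: "\<And>k. AE \<omega> in M. real_cond_exp M (G k) (\<xi> k) \<omega> = 0"
    and \<xi>_var: "\<And>k. AE \<omega> in M. real_cond_exp M (G k) (\<lambda>\<omega>. (\<xi> k \<omega>)\<^sup>2) \<omega> = v k \<omega>"
    and \<xi>_bound: "\<And>k. expectation (\<lambda>\<omega>. (\<xi> k \<omega>) ^ 4) \<le> C"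
    and v_sq: "\<And>k. integrable M (\<lambda>\<omega>. (v k \<omega>)\<^sup>2)" and v_bound: "\<And>k. expectation (\<lambda>\<omega>. (v k \<omega>)\<^sup>2) \<le> C"
    and V_nonneg: "0 \<le> V" and r_pos: "0 < r"
begin

text \<open>The increments are stopped before the accumulated conditional variance exceeds V + 1; this
  keeps the exponential compensator of the characteristic function bounded.\<close>

definition keep :: "nat \<Rightarrow> 'a \<Rightarrow> real" where
  "keep k \<omega> = (if (\<Sum>j\<le>k. v j \<omega>) / r \<le> V + 1 then 1 else 0)"

definition sv :: "nat \<Rightarrow> 'a \<Rightarrow> real" where "sv k \<omega> = keep k \<omega> * v k \<omega> / r"
definition sx :: "nat \<Rightarrow> 'a \<Rightarrow> real" where "sx k \<omega> = keep k \<omega> * \<xi> k \<omega> / sqrt r"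

text \<open>The characteristic exponential of the stopped sum divided by the Gaussian factor exp (-
  A / 2), where A is the accumulated stopped variance. Its expectation starts at 1 and is almost
  constant in \<open>k\<close>.\<close>

definition phase :: "nat \<Rightarrow> 'a \<Rightarrow> complex" where
  "phase k \<omega> = iexp (\<Sum>j<k. sx j \<omega>) * complex_of_real (exp ((\<Sum>j<k. sv j \<omega>) / 2))"

lemma keep_bounds: "0 \<le> keep k \<omega>" "keep k \<omega> \<le> 1" "\<bar>keep k \<omega>\<bar> \<le> 1" "keep k \<omega> * keep k \<omega> = keep k \<omega>" by (auto simp: keep_def)

lemma keep_meas: "keep k \<in> borel_measurable (G k)"
proof -
  have [measurable]: "v j \<in> borel_measurable (G k)" if "j \<le> k" for j
    using measurable_G_mono[OF v_meas that] .
  then have [measurable]: "(\<lambda>\<omega>. \<Sum>j\<le>k. v j \<omega>) \<in> borel_measurable (G k)" by (intro borel_measurable_sum) auto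
  show ?thesis unfolding keep_def by measurable
qed

lemma sv_meas: "sv k \<in> borel_measurable (G k)"
  unfolding sv_def using keep_meas[of k] v_meas[of k] by measurable

lemma sx_meas: "sx k \<in> borel_measurable (G (Suc k))"
  unfolding sx_def using measurable_G_mono[OF keep_meas, of k "Suc k"] \<xi>_meas[of k] by measurable

lemma v_meas_M [measurable]: "v k \<in> borel_measurable M" by (rule measurable_G_M[OF v_meas])
lemma keep_meas_M [measurable]: "keep k \<in> borel_measurable M" by (rule measurable_G_M[OF keep_meas])
lemma sv_meas_M [measurable]: "sv k \<in> borel_measurable M" by (rule measurable_G_M[OF sv_meas])
lemma \<xi>_meas_M [measurable]: "\<xi> k \<in> borel_measurable M" by (rule measurable_G_M[OF \<xi>_meas])
lemma sx_meas_M [measurable]: "sx k \<in> borel_measurable M" by (rule measurable_G_M[OF sx_meas])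

lemma sv_nonneg: "0 \<le> sv k \<omega>"
  using keep_bounds(1) v_nonneg r_pos by (auto simp: sv_def intro!: divide_nonneg_pos mult_nonneg_nonneg)

lemma sv_sum_le: "(\<Sum>j<k. sv j \<omega>) \<le> V + 1"
proof (induction k)
  case 0 then show ?case using V_nonneg by simp
next
  case (Suc k)
  show ?case
  proof (cases "(\<Sum>j\<le>k. v j \<omega>) / r \<le> V + 1")
    case True
    have "(\<Sum>j<Suc k. sv j \<omega>) \<le> (\<Sum>j\<le>k. v j \<omega> / r)"
      unfolding lessThan_Suc_atMost sv_def
      using r_pos v_nonneg keep_bounds by (intro sum_mono divide_right_mono mult_left_le_one_le) auto
    then show ?thesis using True by (simp add: sum_divide_distrib)
  next
    case False
    then have "sv k \<omega> = 0" by (simp add: sv_def keep_def)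
    then show ?thesis using Suc by simp
  qed
qed

definition bnd :: real where "bnd = exp ((V + 1) / 2)"

lemma phase_norm: "norm (phase k \<omega>) \<le> bnd"
  using sv_sum_le[of \<omega> k] by (simp add: phase_def norm_mult bnd_def)

text \<open>\<open>phase k\<close> advanced by the variance but not yet by the increment of step
  \<open>k\<close>; this is possible because \<open>sv k\<close> is known at time \<open>k\<close>.
  Both neighbouring phases are multiples of it: \<open>phase (Suc k)\<close> by
  \<open>iexp (sx k)\<close>, and \<open>phase k\<close> by the exponential of
  \<open>- (sv k / 2)\<close>.\<close>

definition pre :: "nat \<Rightarrow> 'a \<Rightarrow> complex" where
  "pre k \<omega> = iexp (\<Sum>j<k. sx j \<omega>) * complex_of_real (exp ((\<Sum>j<Suc k. sv j \<omega>) / 2))"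

lemma pre_norm: "norm (pre k \<omega>) \<le> bnd"
  using sv_sum_le[of \<omega> "Suc k"] by (simp add: pre_def norm_mult bnd_def del: sum.lessThan_Suc)

lemma phase_meas_M [measurable]: "phase k \<in> borel_measurable M"
  unfolding phase_def by measurable

lemma pre_meas: "pre k \<in> borel_measurable (G k)"
proof -
  have a: "(\<lambda>\<omega>. \<Sum>j<k. sx j \<omega>) \<in> borel_measurable (G k)"
    by (intro borel_measurable_sum measurable_G_mono[OF sx_meas]) auto
  have b: "(\<lambda>\<omega>. \<Sum>j<Suc k. sv j \<omega>) \<in> borel_measurable (G k)"
    by (intro borel_measurable_sum measurable_G_mono[OF sv_meas]) auto
  note [measurable] = a b
  show ?thesis unfolding pre_def by measurable
qed

lemma pre_meas_M [measurable]: "pre k \<in> borel_measurable M" by (rule measurable_G_M[OF pre_meas])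

lemma sx_cond: "expectation (\<lambda>\<omega>. pre k \<omega> * complex_of_real (sx k \<omega>)) = 0"
proof -
  define g where "g \<omega> = pre k \<omega> * complex_of_real (keep k \<omega> / sqrt r)" for \<omega>
  have gm: "g \<in> borel_measurable (G k)" unfolding g_def using pre_meas[of k] keep_meas[of k] by measurable
  have gb: "norm (g \<omega>) \<le> bnd * (1 / sqrt r)" for \<omega>
    unfolding g_def norm_mult using keep_bounds[of k \<omega>] r_pos
    by (intro mult_mono pre_norm) (auto simp: norm_divide bnd_def intro!: divide_right_mono)
  have "expectation (\<lambda>\<omega>. g \<omega> * complex_of_real (\<xi> k \<omega>)) = expectation (\<lambda>\<omega>. g \<omega> * complex_of_real 0)"
    by (rule expectation_complex_mult_cond_exp[OF gm gb L4_integrable[OF \<xi>_L4] \<xi>_mean]) simp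
  then show ?thesis by (simp add: g_def sx_def mult.assoc)
qed

lemma sx_sq_cond: "expectation (\<lambda>\<omega>. pre k \<omega> * complex_of_real ((sx k \<omega>)\<^sup>2)) = expectation (\<lambda>\<omega>. pre k \<omega> * complex_of_real (sv k \<omega>))"
proof -
  define g where "g \<omega> = pre k \<omega> * complex_of_real (keep k \<omega> / r)" for \<omega>
  have gm: "g \<in> borel_measurable (G k)" unfolding g_def using pre_meas[of k] keep_meas[of k] by measurable
  have gb: "norm (g \<omega>) \<le> bnd * (1 / r)" for \<omega>
    unfolding g_def norm_mult using keep_bounds[of k \<omega>] r_pos
    by (intro mult_mono pre_norm) (auto simp: norm_divide bnd_def intro!: divide_right_mono)
  have "expectation (\<lambda>\<omega>. g \<omega> * complex_of_real ((\<xi> k \<omega>)\<^sup>2)) = expectation (\<lambda>\<omega>. g \<omega> * complex_of_real (v k \<omega>))"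
    by (rule expectation_complex_mult_cond_exp[OF gm gb L4_square_integrable[OF \<xi>_L4] \<xi>_var]) simp
  moreover have "g \<omega> * complex_of_real ((\<xi> k \<omega>)\<^sup>2) = pre k \<omega> * complex_of_real ((sx k \<omega>)\<^sup>2)" for \<omega>
  proof -
    have "(sx k \<omega>)\<^sup>2 = keep k \<omega> / r * (\<xi> k \<omega>)\<^sup>2"
      using keep_bounds(4)[of k \<omega>] r_pos by (simp add: sx_def power_divide power_mult_distrib) (simp add: power2_eq_square)
    then show ?thesis by (simp add: g_def mult.assoc)
  qed
  moreover have "g \<omega> * complex_of_real (v k \<omega>) = pre k \<omega> * complex_of_real (sv k \<omega>)" for \<omega>
    by (simp add: g_def sv_def)
  ultimately show ?thesis by simp
qed

text \<open>The error of one step: the third-order remainder of the exponential of the increment, of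
  order r^(-3/2), plus the squared stopped variance, of order r^(-2). A number of steps of order r
  leaves a total of order r^(-1/2).\<close>

definition err :: real where "err = bnd * ((1 + C) / (r * sqrt r) + C / r\<^sup>2)"

lemma sx_L4: "L4 M (sx k)"
proof -
  have "L4 M (\<lambda>\<omega>. keep k \<omega> / sqrt r * \<xi> k \<omega>)"
    by (rule L4_bounded_mult[OF \<xi>_L4, where C = "1 / sqrt r"])
       (use keep_bounds r_pos in \<open>auto simp: abs_divide intro!: divide_right_mono\<close>)
  then show ?thesis by (simp add: sx_def[abs_def])
qed

lemma sx_cube: "expectation (\<lambda>\<omega>. \<bar>sx k \<omega>\<bar> ^ 3) \<le> (1 + C) / (r * sqrt r)" "integrable M (\<lambda>\<omega>. \<bar>sx k \<omega>\<bar> ^ 3)"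
proof -
  have i: "integrable M (\<lambda>\<omega>. (1 + (\<xi> k \<omega>) ^ 4) / (r * sqrt r))"
    using \<xi>_L4[of k] by (simp add: L4_def)
  have le: "\<bar>sx k \<omega>\<bar> ^ 3 \<le> (1 + (\<xi> k \<omega>) ^ 4) / (r * sqrt r)" for \<omega>
  proof -
    have "\<bar>sx k \<omega>\<bar> \<le> \<bar>\<xi> k \<omega>\<bar> / sqrt r"
      unfolding sx_def abs_divide abs_mult using keep_bounds[of k \<omega>] r_pos
      by (auto intro!: divide_right_mono mult_left_le_one_le)
    then have "\<bar>sx k \<omega>\<bar> ^ 3 \<le> (\<bar>\<xi> k \<omega>\<bar> / sqrt r) ^ 3" by (intro power_mono) auto
    also have "\<dots> = \<bar>\<xi> k \<omega>\<bar> ^ 3 / (r * sqrt r)"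
      using r_pos by (simp add: power_divide power3_eq_cube)
    also have "\<dots> \<le> (1 + (\<xi> k \<omega>) ^ 4) / (r * sqrt r)"
      using cube_abs_le r_pos by (intro divide_right_mono) auto
    finally show ?thesis .
  qed
  show i3: "integrable M (\<lambda>\<omega>. \<bar>sx k \<omega>\<bar> ^ 3)"
    by (rule Bochner_Integration.integrable_bound[OF i]) (use le r_pos in auto)
  have "expectation (\<lambda>\<omega>. \<bar>sx k \<omega>\<bar> ^ 3) \<le> expectation (\<lambda>\<omega>. (1 + (\<xi> k \<omega>) ^ 4) / (r * sqrt r))"
    by (rule integral_mono[OF i3 i le])
  also have "\<dots> = (1 + expectation (\<lambda>\<omega>. (\<xi> k \<omega>) ^ 4)) / (r * sqrt r)"
    using \<xi>_L4[of k] by (simp add: L4_def prob_space)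
  also have "\<dots> \<le> (1 + C) / (r * sqrt r)"
    using \<xi>_bound[of k] r_pos by (intro divide_right_mono) auto
  finally show "expectation (\<lambda>\<omega>. \<bar>sx k \<omega>\<bar> ^ 3) \<le> (1 + C) / (r * sqrt r)" .
qed

lemma sv_sq: "expectation (\<lambda>\<omega>. (sv k \<omega>)\<^sup>2) \<le> C / r\<^sup>2" "integrable M (\<lambda>\<omega>. (sv k \<omega>)\<^sup>2)"
proof -
  have i: "integrable M (\<lambda>\<omega>. (v k \<omega>)\<^sup>2 / r\<^sup>2)" using v_sq by simp
  have le: "(sv k \<omega>)\<^sup>2 \<le> (v k \<omega>)\<^sup>2 / r\<^sup>2" for \<omega>
  proof -
    have "sv k \<omega> \<le> v k \<omega> / r"
      unfolding sv_def using keep_bounds[of k \<omega>] r_pos v_nonneg by (intro divide_right_mono mult_left_le_one_le) auto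
    then have "(sv k \<omega>)\<^sup>2 \<le> (v k \<omega> / r)\<^sup>2" by (intro power_mono sv_nonneg)
    then show ?thesis by (simp add: power_divide)
  qed
  show i2: "integrable M (\<lambda>\<omega>. (sv k \<omega>)\<^sup>2)"
    by (rule Bochner_Integration.integrable_bound[OF i]) (use le in auto)
  have "expectation (\<lambda>\<omega>. (sv k \<omega>)\<^sup>2) \<le> expectation (\<lambda>\<omega>. (v k \<omega>)\<^sup>2 / r\<^sup>2)"
    by (rule integral_mono[OF i2 i le])
  also have "\<dots> = expectation (\<lambda>\<omega>. (v k \<omega>)\<^sup>2) / r\<^sup>2" by simp
  also have "\<dots> \<le> C / r\<^sup>2" using v_bound by (intro divide_right_mono) auto
  finally show "expectation (\<lambda>\<omega>. (sv k \<omega>)\<^sup>2) \<le> C / r\<^sup>2" .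
qed

text \<open>\<open>p2\<close> is \<open>pre k\<close> times the second-order Taylor polynomial of
  \<open>iexp (sx k)\<close>, and \<open>p3\<close> is \<open>pre k\<close> times the first-order
  one of the exponential of \<open>- (sv k / 2)\<close>. Conditional mean 0 and the matching
  conditional variance give them the same expectation, so only the two remainders are left.\<close>

lemma phase_step: "norm (expectation (phase (Suc k)) - expectation (phase k)) \<le> err"
proof -
  have sv_int: "integrable M (sv k)"
    using square_integrable_mult[of "sv k" M "\<lambda>_. 1"] sv_sq(2)[of k] by simp
  have bm: "integrable M (\<lambda>\<omega>. pre k \<omega> * complex_of_real (f \<omega>))" if f: "integrable M f" for f
  proof (rule Bochner_Integration.integrable_bound[where f = "\<lambda>\<omega>. bnd * f \<omega>"])
    have [measurable]: "f \<in> borel_measurable M" using f by auto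
    show "(\<lambda>\<omega>. pre k \<omega> * complex_of_real (f \<omega>)) \<in> borel_measurable M" by measurable
    show "AE \<omega> in M. norm (pre k \<omega> * complex_of_real (f \<omega>)) \<le> norm (bnd * f \<omega>)"
      using pre_norm by (intro AE_I2) (auto simp: norm_mult abs_mult bnd_def intro!: mult_right_mono)
  qed (use f in simp)
  have ph: "integrable M (phase j)" for j
    by (rule integrable_const_bound[of _ bnd]) (use phase_norm in auto)
  have prei: "integrable M (pre k)"
    by (rule integrable_const_bound[of _ bnd]) (use pre_norm in auto)
  define p2 where "p2 \<omega> = pre k \<omega> + \<i> * (pre k \<omega> * complex_of_real (sx k \<omega>)) - (pre k \<omega> * complex_of_real ((sx k \<omega>)\<^sup>2)) / 2" for \<omega>
  define p3 where "p3 \<omega> = pre k \<omega> - (pre k \<omega> * complex_of_real (sv k \<omega>)) / 2" for \<omega>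
  have i1: "integrable M (\<lambda>\<omega>. pre k \<omega> * complex_of_real (sx k \<omega>))" by (rule bm[OF L4_integrable[OF sx_L4]])
  have i2: "integrable M (\<lambda>\<omega>. pre k \<omega> * complex_of_real ((sx k \<omega>)\<^sup>2))" by (rule bm[OF L4_square_integrable[OF sx_L4]])
  have i3: "integrable M (\<lambda>\<omega>. pre k \<omega> * complex_of_real (sv k \<omega>))" by (rule bm[OF sv_int])
  have ip2: "integrable M p2" and ip3: "integrable M p3" unfolding p2_def p3_def using prei i1 i2 i3 by auto
  have "expectation p2 = expectation (pre k) + \<i> * expectation (\<lambda>\<omega>. pre k \<omega> * complex_of_real (sx k \<omega>)) -
      expectation (\<lambda>\<omega>. pre k \<omega> * complex_of_real ((sx k \<omega>)\<^sup>2)) / 2"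
    unfolding p2_def using prei i1 i2 by simp
  also have "\<dots> = expectation p3"
    unfolding p3_def sx_cond sx_sq_cond using prei i3 by simp
  finally have p23: "expectation p2 = expectation p3" .
  have one: "norm (phase (Suc k) \<omega> - p2 \<omega>) \<le> bnd * \<bar>sx k \<omega>\<bar> ^ 3" for \<omega>
  proof -
    have pS: "phase (Suc k) \<omega> = pre k \<omega> * iexp (sx k \<omega>)"
      unfolding phase_def pre_def sum.lessThan_Suc[of "\<lambda>j. sx j \<omega>"] of_real_add distrib_left exp_add by (simp only: mult_ac)
    have "phase (Suc k) \<omega> - p2 \<omega> = pre k \<omega> * (iexp (sx k \<omega>) - (\<Sum>j\<le>2. (\<i> * sx k \<omega>) ^ j / fact j))"
      unfolding pS p2_def by (simp add: numeral_2_eq_2 power2_eq_square algebra_simps)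
    then have "norm (phase (Suc k) \<omega> - p2 \<omega>) = norm (pre k \<omega>) * norm (iexp (sx k \<omega>) - (\<Sum>j\<le>2. (\<i> * sx k \<omega>) ^ j / fact j))"
      by (simp only: norm_mult)
    also have "\<dots> \<le> bnd * (\<bar>sx k \<omega>\<bar> ^ Suc 2 / fact (Suc 2))"
      by (intro mult_mono pre_norm iexp_approx1) (auto simp: bnd_def)
    also have "\<dots> \<le> bnd * \<bar>sx k \<omega>\<bar> ^ 3"
    proof (rule mult_left_mono)
      have f6: "fact 3 = (6::real)" by (simp add: fact_numeral)
      have "0 \<le> \<bar>sx k \<omega>\<bar> ^ 3" by (rule zero_le_power) simp
      then have "\<bar>sx k \<omega>\<bar> ^ 3 / 6 \<le> \<bar>sx k \<omega>\<bar> ^ 3" by linarith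
      then show "\<bar>sx k \<omega>\<bar> ^ Suc 2 / fact (Suc 2) \<le> \<bar>sx k \<omega>\<bar> ^ 3" by (simp add: f6)
    qed (simp add: bnd_def)
    finally show ?thesis .
  qed
  have two: "norm (p3 \<omega> - phase k \<omega>) \<le> bnd * (sv k \<omega>)\<^sup>2" for \<omega>
  proof -
    have pp: "phase k \<omega> = pre k \<omega> * complex_of_real (exp (- (sv k \<omega> / 2)))"
    proof -
      have "exp ((\<Sum>j<k. sv j \<omega>) / 2) = exp ((\<Sum>j<Suc k. sv j \<omega>) / 2) * exp (- (sv k \<omega> / 2))"
        unfolding exp_add[symmetric] by (simp add: add_divide_distrib)
      then show ?thesis unfolding phase_def pre_def by (simp only: of_real_mult mult.assoc)
    qed
    have "p3 \<omega> - phase k \<omega> = pre k \<omega> * complex_of_real ((1 - sv k \<omega> / 2) - exp (- (sv k \<omega> / 2)))"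
      unfolding pp p3_def by (simp add: algebra_simps)
    then have "norm (p3 \<omega> - phase k \<omega>) = norm (pre k \<omega>) * \<bar>(1 - sv k \<omega> / 2) - exp (- (sv k \<omega> / 2))\<bar>"
      by (simp only: norm_mult norm_of_real)
    also have "\<dots> \<le> bnd * (sv k \<omega> / 2)\<^sup>2"
      using sv_nonneg by (intro mult_mono pre_norm exp_minus_approx) (auto simp: bnd_def)
    also have "\<dots> \<le> bnd * (sv k \<omega>)\<^sup>2"
      by (intro mult_left_mono) (auto simp: bnd_def power_divide)
    finally show ?thesis .
  qed
  have "norm (expectation (phase (Suc k)) - expectation p2) \<le> expectation (\<lambda>\<omega>. bnd * \<bar>sx k \<omega>\<bar> ^ 3)"
    unfolding Bochner_Integration.integral_diff[OF ph ip2, symmetric]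
    by (rule order_trans[OF integral_norm_bound integral_mono]) (use ph ip2 sx_cube one in auto)
  also have "\<dots> = bnd * expectation (\<lambda>\<omega>. \<bar>sx k \<omega>\<bar> ^ 3)" by simp
  also have "\<dots> \<le> bnd * ((1 + C) / (r * sqrt r))"
    by (intro mult_left_mono sx_cube) (simp add: bnd_def)
  finally have A: "norm (expectation (phase (Suc k)) - expectation p2) \<le> bnd * ((1 + C) / (r * sqrt r))" .
  have "norm (expectation p3 - expectation (phase k)) \<le> expectation (\<lambda>\<omega>. bnd * (sv k \<omega>)\<^sup>2)"
    unfolding Bochner_Integration.integral_diff[OF ip3 ph, symmetric]
    by (rule order_trans[OF integral_norm_bound integral_mono]) (use ph ip3 sv_sq two in auto)
  also have "\<dots> = bnd * expectation (\<lambda>\<omega>. (sv k \<omega>)\<^sup>2)" by simp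
  also have "\<dots> \<le> bnd * (C / r\<^sup>2)"
    by (intro mult_left_mono sv_sq) (simp add: bnd_def)
  finally have B: "norm (expectation p3 - expectation (phase k)) \<le> bnd * (C / r\<^sup>2)" .
  have "norm (expectation (phase (Suc k)) - expectation (phase k)) \<le>
      norm (expectation (phase (Suc k)) - expectation p2) + norm (expectation p3 - expectation (phase k))"
    using norm_triangle_ineq[of "expectation (phase (Suc k)) - expectation p2" "expectation p3 - expectation (phase k)"] p23 by simp
  then show ?thesis using A B by (simp add: err_def distrib_left)
qed

lemma phase_total: "norm (expectation (phase k) - 1) \<le> real k * err"
proof (induction k)
  case 0 then show ?case by (simp add: phase_def prob_space)
next
  case (Suc k)
  have "norm (expectation (phase (Suc k)) - 1) \<le> norm (expectation (phase (Suc k)) - expectation (phase k)) + norm (expectation (phase k) - 1)"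
    using norm_triangle_ineq[of "expectation (phase (Suc k)) - expectation (phase k)" "expectation (phase k) - 1"] by simp
  then show ?case using Suc phase_step[of k] by (simp add: distrib_right)
qed

lemma phase_eq:
  assumes "(\<Sum>j<m. v j \<omega>) / r \<le> V + 1"
  shows "phase m \<omega> = iexp ((\<Sum>j<m. \<xi> j \<omega>) / sqrt r) * complex_of_real (exp ((\<Sum>j<m. v j \<omega>) / r / 2))"
proof -
  have "keep j \<omega> = 1" if "j < m" for j
  proof -
    have "(\<Sum>i\<le>j. v i \<omega>) \<le> (\<Sum>i<m. v i \<omega>)" using that v_nonneg by (intro sum_mono2) auto
    then have "(\<Sum>i\<le>j. v i \<omega>) / r \<le> (\<Sum>i<m. v i \<omega>) / r" using r_pos by (intro divide_right_mono) auto
    then show ?thesis using assms by (simp add: keep_def)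
  qed
  then have "(\<Sum>j<m. sx j \<omega>) = (\<Sum>j<m. \<xi> j \<omega>) / sqrt r" "(\<Sum>j<m. sv j \<omega>) = (\<Sum>j<m. v j \<omega>) / r"
    by (auto simp: sx_def sv_def sum_divide_distrib)
  then show ?thesis by (simp add: phase_def)
qed

end

text \<open>Almost surely the stopping is eventually inactive at the final time. From then on the
  characteristic exponential and exp (- V / 2) times the phase differ by a quantity that tends to 0.
  The difference is bounded, so dominated convergence transfers the limit 1 of the expected
  phase.\<close>

theorem (in filtered_prob_space) martingale_central_limit:
  fixes \<xi> v :: "nat \<Rightarrow> 'a \<Rightarrow> real" and m :: "nat \<Rightarrow> nat" and r :: "nat \<Rightarrow> real"
  assumes \<xi>_meas: "\<And>k. \<xi> k \<in> borel_measurable (G (Suc k))"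
    and v_meas: "\<And>k. v k \<in> borel_measurable (G k)" and v_nonneg: "\<And>k \<omega>. 0 \<le> v k \<omega>"
    and \<xi>_L4: "\<And>k. L4 M (\<xi> k)"
    and \<xi>_mean: "\<And>k. AE \<omega> in M. real_cond_exp M (G k) (\<xi> k) \<omega> = 0"
    and \<xi>_var: "\<And>k. AE \<omega> in M. real_cond_exp M (G k) (\<lambda>\<omega>. (\<xi> k \<omega>)\<^sup>2) \<omega> = v k \<omega>"
    and \<xi>_bound: "\<And>k. expectation (\<lambda>\<omega>. (\<xi> k \<omega>) ^ 4) \<le> C"
    and v_sq: "\<And>k. integrable M (\<lambda>\<omega>. (v k \<omega>)\<^sup>2)" and v_bound: "\<And>k. expectation (\<lambda>\<omega>. (v k \<omega>)\<^sup>2) \<le> C"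
    and V: "0 \<le> V" and r_pos: "\<And>n. 0 < r n" and r_lim: "filterlim r at_top sequentially"
    and m_le: "\<And>n. real (m n) \<le> K * r n"
    and avg: "AE \<omega> in M. (\<lambda>n. (\<Sum>k<m n. v k \<omega>) / r n) \<longlonglongrightarrow> V"
  shows "(\<lambda>n. expectation (\<lambda>\<omega>. iexp ((\<Sum>k<m n. \<xi> k \<omega>) / sqrt (r n)))) \<longlonglongrightarrow> complex_of_real (exp (- V / 2))"
proof -
  interpret R: martingale_clt M G \<xi> v C V "m n" "r n" for n
    by unfold_locales (fact assms)+
  have [measurable]: "\<xi> k \<in> borel_measurable M" for k by (rule measurable_G_M[OF \<xi>_meas])
  define E where "E n = complex_of_real (exp (- V / 2))" for n :: nat
  have "(\<lambda>n. real (m n) * R.err n) \<longlonglongrightarrow> 0"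
  proof (rule Lim_null_comparison[of _ "\<lambda>n. K * (R.bnd * ((1 + C) / sqrt (r n) + C / r n))"])
    have Cn: "0 \<le> C" using v_bound[of 0] by (rule order_trans[rotated]) (simp add: Bochner_Integration.integral_nonneg)
    show "\<forall>\<^sub>F n in sequentially. norm (real (m n) * R.err n) \<le> K * (R.bnd * ((1 + C) / sqrt (r n) + C / r n))"
    proof (intro always_eventually allI)
      fix n
      have e0: "0 \<le> R.err n" using r_pos[of n] Cn by (simp add: R.err_def R.bnd_def)
      have "real (m n) * R.err n \<le> K * r n * R.err n" by (intro mult_right_mono m_le e0)
      also have "\<dots> = K * (R.bnd * ((1 + C) / sqrt (r n) + C / r n))"
        using r_pos[of n] by (simp add: R.err_def field_simps power2_eq_square)
      finally show "norm (real (m n) * R.err n) \<le> K * (R.bnd * ((1 + C) / sqrt (r n) + C / r n))"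
        using e0 by simp
    qed
    have "filterlim (\<lambda>n. sqrt (r n)) at_top sequentially" by (rule filterlim_compose[OF sqrt_at_top r_lim])
    then have "(\<lambda>n. (1 + C) / sqrt (r n)) \<longlonglongrightarrow> 0" "(\<lambda>n. C / r n) \<longlonglongrightarrow> 0"
      using r_lim by (auto intro!: tendsto_divide_0[OF tendsto_const] filterlim_at_top_imp_at_infinity)
    then have "(\<lambda>n. K * (R.bnd * ((1 + C) / sqrt (r n) + C / r n))) \<longlonglongrightarrow> K * (R.bnd * (0 + 0))"
      by (intro tendsto_intros)
    then show "(\<lambda>n. K * (R.bnd * ((1 + C) / sqrt (r n) + C / r n))) \<longlonglongrightarrow> 0" by simp
  qed
  then have "(\<lambda>n. expectation (R.phase n (m n)) - 1) \<longlonglongrightarrow> 0"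
    by (rule Lim_null_comparison[rotated]) (simp add: R.phase_total)
  then have ph: "(\<lambda>n. expectation (R.phase n (m n))) \<longlonglongrightarrow> 1" by (rule LIM_zero_cancel)
  define d where "d n \<omega> = iexp ((\<Sum>k<m n. \<xi> k \<omega>) / sqrt (r n)) - complex_of_real (exp (- V / 2)) * R.phase n (m n) \<omega>" for n \<omega>
  have db: "norm (d n \<omega>) \<le> 1 + exp (- V / 2) * R.bnd" for n \<omega>
    unfolding d_def
    by (rule order_trans[OF norm_triangle_ineq4]) (auto simp: norm_mult intro!: add_mono mult_left_mono R.phase_norm)
  have [measurable]: "d n \<in> borel_measurable M" for n unfolding d_def by measurable
  have "(\<lambda>n. expectation (d n)) \<longlonglongrightarrow> expectation (\<lambda>\<omega>. 0)"
  proof (rule integral_dominated_convergence[where w = "\<lambda>_. 1 + exp (- V / 2) * R.bnd"])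
    show "AE \<omega> in M. (\<lambda>n. d n \<omega>) \<longlonglongrightarrow> 0"
      using avg
    proof eventually_elim
      case (elim \<omega>)
      have "\<forall>\<^sub>F n in sequentially. (\<Sum>k<m n. v k \<omega>) / r n < V + 1" using order_tendstoD(2)[OF elim, of "V + 1"] by simp
      then have "\<forall>\<^sub>F n in sequentially. norm (d n \<omega>) \<le> \<bar>1 - exp (- V / 2) * exp ((\<Sum>k<m n. v k \<omega>) / r n / 2)\<bar>"
      proof eventually_elim
        case (elim n)
        have "d n \<omega> = iexp ((\<Sum>k<m n. \<xi> k \<omega>) / sqrt (r n)) * complex_of_real (1 - exp (- V / 2) * exp ((\<Sum>k<m n. v k \<omega>) / r n / 2))"
          unfolding d_def R.phase_eq[OF less_imp_le[OF elim]] by (simp add: right_diff_distrib mult_ac)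
        then show ?case by (simp add: norm_mult del: of_real_diff of_real_mult)
      qed
      moreover have "(\<lambda>n. \<bar>1 - exp (- V / 2) * exp ((\<Sum>k<m n. v k \<omega>) / r n / 2)\<bar>) \<longlonglongrightarrow> \<bar>1 - exp (- V / 2) * exp (V / 2)\<bar>"
        by (intro tendsto_intros elim) auto
      moreover have "\<bar>1 - exp (- V / 2) * exp (V / 2)\<bar> = 0" by (simp add: exp_add[symmetric])
      ultimately show ?case by (intro Lim_null_comparison[where f = "\<lambda>n. d n \<omega>"]) (simp_all only:)
    qed
  qed (use db in auto)
  then have "(\<lambda>n. expectation (d n) + complex_of_real (exp (- V / 2)) * expectation (R.phase n (m n))) \<longlonglongrightarrow> 0 + complex_of_real (exp (- V / 2)) * 1"
    by (intro tendsto_intros ph) simp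
  moreover have "expectation (d n) + complex_of_real (exp (- V / 2)) * expectation (R.phase n (m n)) =
      expectation (\<lambda>\<omega>. iexp ((\<Sum>k<m n. \<xi> k \<omega>) / sqrt (r n)))" for n
  proof -
    have "integrable M (R.phase n (m n))"
      by (rule integrable_const_bound[of _ R.bnd]) (use R.phase_norm in auto)
    moreover have "integrable M (\<lambda>\<omega>. iexp ((\<Sum>k<m n. \<xi> k \<omega>) / sqrt (r n)))" by (rule integrable_iexp) auto
    ultimately show ?thesis unfolding d_def by simp
  qed
  ultimately show ?thesis by simp
qed

section \<open>From conditional independence to a single filtration\<close>

lemma (in prob_space) sigma_finite_subalgebra_of_subalgebra:
  assumes "subalgebra M F" shows "sigma_finite_subalgebra M F"
proof -
  interpret finite_measure_subalgebra M F by standard (rule assms)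
  show ?thesis by standard
qed

text \<open>Conditional independence factorizes the conditional expectation both over
  \<open>insert k J\<close> and over \<open>J\<close>. The factor of \<open>k\<close> is measurable
  for \<open>F\<close> and is split off; the product over \<open>J\<close> is then put back under
  the expectation. So on such cylinders the indicator of \<open>Z k\<close> may be replaced by its
  conditional expectation given \<open>F\<close>.\<close>

lemma (in prob_space) cond_indep_vars_cylinder:
  fixes F :: "'a measure" and Z :: "'i \<Rightarrow> 'a \<Rightarrow> 'c"
  assumes F: "subalgebra M F" and Z[measurable]: "\<And>i. i \<in> I \<Longrightarrow> Z i \<in> measurable M N"
    and ind: "cond_indep_vars M F N Z I"
    and k: "k \<in> I" "k \<notin> J" and J: "J \<subseteq> I" "finite J"
    and A: "A \<in> sets F" and B: "\<And>j. j \<in> J \<Longrightarrow> B j \<in> sets N" and Bk: "Bk \<in> sets N"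
  shows "(\<integral>\<omega>. (indicator A \<omega> * (\<Prod>j\<in>J. indicator (B j) (Z j \<omega>))) * indicator Bk (Z k \<omega>) \<partial>M) =
    (\<integral>\<omega>. (indicator A \<omega> * (\<Prod>j\<in>J. indicator (B j) (Z j \<omega>))) * real_cond_exp M F (\<lambda>\<omega>. indicator Bk (Z k \<omega>)) \<omega> \<partial>M)"
proof -
  interpret S: sigma_finite_subalgebra M F by (rule sigma_finite_subalgebra_of_subalgebra[OF F])
  define C where "C = B(k := Bk)"
  have C: "C j = B j" if "j \<in> J" for j using that k by (auto simp: C_def)
  have Ck: "C k = Bk" by (simp add: C_def)
  have CB: "(\<Prod>j\<in>J. indicator (C j) (Z j \<omega>) :: real) = (\<Prod>j\<in>J. indicator (B j) (Z j \<omega>))" for \<omega>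
    using C by (intro prod.cong) auto
  have Cs [measurable]: "C j \<in> sets N" if "j \<in> insert k J" for j using that B Bk by (auto simp: C_def)
  have AM [measurable]: "A \<in> sets M" using A F by (auto simp: subalgebra_def)
  have AF: "indicator A \<in> borel_measurable F" using A by (rule borel_measurable_indicator)
  have Zm: "(\<lambda>\<omega>. indicator (C j) (Z j \<omega>) :: real) \<in> borel_measurable M" if "j \<in> insert k J" for j
    using Cs[OF that] Z[of j] that k J by (auto intro!: borel_measurable_indicator')
  have Pm: "(\<lambda>\<omega>. \<Prod>j\<in>K. indicator (C j) (Z j \<omega>) :: real) \<in> borel_measurable M" if "K \<subseteq> insert k J" for K
    by (intro borel_measurable_prod Zm) (use that in auto)
  have P01: "0 \<le> (\<Prod>j\<in>K. indicator (C j) (Z j \<omega>) :: real)" "(\<Prod>j\<in>K. indicator (C j) (Z j \<omega>) :: real) \<le> 1" for K \<omega>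
    by (auto intro!: prod_nonneg prod_le_1)
  define p where "p j = real_cond_exp M F (\<lambda>\<omega>. indicator (C j) (Z j \<omega>))" for j
  have pF: "p j \<in> borel_measurable F" for j by (simp add: p_def)
  have pM [measurable]: "p j \<in> borel_measurable M" for j by (simp add: p_def)
  have i1: "integrable M (\<lambda>\<omega>. indicator (C j) (Z j \<omega>) :: real)" if "j \<in> insert k J" for j
    by (rule integrable_const_bound[of _ 1]) (use Zm[OF that] in \<open>auto simp: indicator_def\<close>)
  have pint: "integrable M (p j)" if "j \<in> insert k J" for j
    unfolding p_def by (rule S.real_cond_exp_int(1)[OF i1[OF that]])
  have fact: "AE \<omega> in M. real_cond_exp M F (\<lambda>\<omega>. \<Prod>j\<in>K. indicator (C j) (Z j \<omega>)) \<omega> = (\<Prod>j\<in>K. p j \<omega>)"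
    if "K \<subseteq> insert k J" "finite K" for K
    using ind[unfolded cond_indep_vars_def, rule_format, of K C] that Cs k J unfolding p_def by blast
  have split: "(\<Prod>j\<in>insert k J. f j) = f k * (\<Prod>j\<in>J. f j)" for f :: "'i \<Rightarrow> real"
    using k J by simp
  have [measurable]: "(\<lambda>\<omega>. \<Prod>j\<in>J. indicator (C j) (Z j \<omega>) :: real) \<in> borel_measurable M"
    "(\<lambda>\<omega>. \<Prod>j\<in>insert k J. indicator (C j) (Z j \<omega>) :: real) \<in> borel_measurable M"
    by (rule Pm; auto)+
  have int1: "integrable M (\<lambda>\<omega>. indicator A \<omega> * (\<Prod>j\<in>insert k J. indicator (C j) (Z j \<omega>)) :: real)"
  proof -
    have "integrable M (\<lambda>\<omega>. \<Prod>j\<in>insert k J. indicator (C j) (Z j \<omega>) :: real)"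
      by (rule integrable_const_bound[of _ 1]) (use P01 in \<open>auto simp del: prod.insert\<close>)
    from integrable_mult_indicator[OF AM this] show ?thesis by (simp only: real_scaleR_def)
  qed
  have int2: "integrable M (\<lambda>\<omega>. (indicator A \<omega> * p k \<omega>) * (\<Prod>j\<in>J. indicator (C j) (Z j \<omega>)) :: real)"
  proof (rule Bochner_Integration.integrable_bound[OF pint[of k]])
    show "AE \<omega> in M. norm ((indicator A \<omega> * p k \<omega>) * (\<Prod>j\<in>J. indicator (C j) (Z j \<omega>))) \<le> norm (p k \<omega>)"
      using P01[of _ J] by (intro AE_I2) (auto simp: abs_mult indicator_def abs_of_nonneg intro!: mult_right_le_one_le)
  qed auto
  have "(\<integral>\<omega>. indicator A \<omega> * (\<Prod>j\<in>insert k J. indicator (C j) (Z j \<omega>)) \<partial>M) =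
      (\<integral>\<omega>. indicator A \<omega> * real_cond_exp M F (\<lambda>\<omega>. \<Prod>j\<in>insert k J. indicator (C j) (Z j \<omega>)) \<omega> \<partial>M)"
    by (rule S.real_cond_exp_intg(2)[OF int1 AF, symmetric]) simp
  also have "\<dots> = (\<integral>\<omega>. (indicator A \<omega> * p k \<omega>) * real_cond_exp M F (\<lambda>\<omega>. \<Prod>j\<in>J. indicator (C j) (Z j \<omega>)) \<omega> \<partial>M)"
  proof (rule integral_cong_AE)
    show "AE \<omega> in M. indicator A \<omega> * real_cond_exp M F (\<lambda>\<omega>. \<Prod>j\<in>insert k J. indicator (C j) (Z j \<omega>)) \<omega> =
        (indicator A \<omega> * p k \<omega>) * real_cond_exp M F (\<lambda>\<omega>. \<Prod>j\<in>J. indicator (C j) (Z j \<omega>)) \<omega>"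
      using fact[OF subset_refl finite.insertI[OF J(2)]] fact[OF subset_insertI J(2)]
      by eventually_elim (simp only: split mult.assoc)
  qed auto
  also have "\<dots> = (\<integral>\<omega>. (indicator A \<omega> * p k \<omega>) * (\<Prod>j\<in>J. indicator (C j) (Z j \<omega>)) \<partial>M)"
    by (rule S.real_cond_exp_intg(2)[OF int2]) (use AF pF in \<open>auto intro: borel_measurable_times\<close>)
  finally show ?thesis
    unfolding split p_def CB Ck by (simp only: ac_simps)
qed

text \<open>The intersection-stable generator of the join of \<open>F\<close> with the variables
  \<open>Z j\<close> for \<open>j\<close> in \<open>J\<close>.\<close>

definition cylinders :: "'w measure \<Rightarrow> 'w measure \<Rightarrow> 'c measure \<Rightarrow> ('i \<Rightarrow> 'w \<Rightarrow> 'c) \<Rightarrow> 'i set \<Rightarrow> 'w set set" where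
  "cylinders M F N Z J = {A \<inter> {\<omega> \<in> space M. \<forall>j\<in>J. Z j \<omega> \<in> B j} |A B. A \<in> sets F \<and> (\<forall>j\<in>J. B j \<in> sets N)}"

lemma cylinders_Int_stable: "Int_stable (cylinders M F N Z J)"
proof (rule Int_stableI)
  fix a b assume "a \<in> cylinders M F N Z J" "b \<in> cylinders M F N Z J"
  then obtain A B A' B' where *: "a = A \<inter> {\<omega> \<in> space M. \<forall>j\<in>J. Z j \<omega> \<in> B j}" "A \<in> sets F" "\<forall>j\<in>J. B j \<in> sets N"
    "b = A' \<inter> {\<omega> \<in> space M. \<forall>j\<in>J. Z j \<omega> \<in> B' j}" "A' \<in> sets F" "\<forall>j\<in>J. B' j \<in> sets N"
    by (auto simp: cylinders_def)
  have "a \<inter> b = (A \<inter> A') \<inter> {\<omega> \<in> space M. \<forall>j\<in>J. Z j \<omega> \<in> B j \<inter> B' j}" using * by auto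
  moreover have "A \<inter> A' \<in> sets F" "\<forall>j\<in>J. B j \<inter> B' j \<in> sets N" using * by auto
  ultimately show "a \<inter> b \<in> cylinders M F N Z J" unfolding cylinders_def
    by (intro CollectI exI[of _ "A \<inter> A'"] exI[of _ "\<lambda>j. B j \<inter> B' j"] conjI)
qed

text \<open>Both sides are countably additive in \<open>D\<close> and agree on the whole space,
  because conditioning preserves expectations. Equality on the cylinders therefore extends to the
  generated sigma-algebra by Dynkin's theorem.\<close>

lemma (in prob_space) cond_indep_vars_cond_exp_indicator:
  fixes F :: "'a measure" and Z :: "'i \<Rightarrow> 'a \<Rightarrow> 'c"
  assumes F: "subalgebra M F" and Z[measurable]: "\<And>i. i \<in> I \<Longrightarrow> Z i \<in> measurable M N"
    and ind: "cond_indep_vars M F N Z I"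
    and k: "k \<in> I" "k \<notin> J" and J: "J \<subseteq> I" "finite J"
    and D: "D \<in> sigma_sets (space M) (cylinders M F N Z J)" and Bk: "Bk \<in> sets N"
  shows "(\<integral>\<omega>\<in>D. indicator Bk (Z k \<omega>) \<partial>M) = (\<integral>\<omega>\<in>D. real_cond_exp M F (\<lambda>\<omega>. indicator Bk (Z k \<omega>)) \<omega> \<partial>M)"
proof -
  interpret S: sigma_finite_subalgebra M F by (rule sigma_finite_subalgebra_of_subalgebra[OF F])
  define f :: "'a \<Rightarrow> real" where "f \<omega> = indicator Bk (Z k \<omega>)" for \<omega>
  define g where "g = real_cond_exp M F f"
  have fm [measurable]: "f \<in> borel_measurable M"
    unfolding f_def using Z[OF k(1)] Bk by (auto intro!: borel_measurable_indicator')
  have fi: "integrable M f"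
    by (rule integrable_const_bound[of _ 1]) (auto simp: f_def indicator_def)
  have gi: "integrable M g" unfolding g_def by (rule S.real_cond_exp_int(1)[OF fi])
  have tot: "(\<integral>\<omega>. g \<omega> \<partial>M) = (\<integral>\<omega>. f \<omega> \<partial>M)" unfolding g_def by (rule S.real_cond_exp_int(2)[OF fi])
  have cylM: "cylinders M F N Z J \<subseteq> sets M"
  proof
    fix a assume "a \<in> cylinders M F N Z J"
    then obtain A B where a: "a = A \<inter> {\<omega> \<in> space M. \<forall>j\<in>J. Z j \<omega> \<in> B j}" "A \<in> sets F" "\<forall>j\<in>J. B j \<in> sets N"
      by (auto simp: cylinders_def)
    have "{\<omega> \<in> space M. \<forall>j\<in>J. Z j \<omega> \<in> B j} \<in> sets M"
    proof (rule sets.sets_Collect_finite_All[OF _ J(2)])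
      fix j assume "j \<in> J"
      then show "{\<omega> \<in> space M. Z j \<omega> \<in> B j} \<in> sets M"
        using measurable_sets[OF Z[of j], of "B j"] J(1) a(3) by (auto simp: vimage_def Int_def conj_commute)
    qed
    then show "a \<in> sets M" using a F by (auto simp: subalgebra_def)
  qed
  have DM: "D' \<in> sets M" if "D' \<in> sigma_sets (space M) (cylinders M F N Z J)" for D'
    using sets.sigma_sets_subset[OF cylM] that by auto
  have si: "set_integrable M D' f" "set_integrable M D' g" if "D' \<in> sets M" for D'
    unfolding set_integrable_def by (intro integrable_mult_indicator that fi gi)+
  have sub: "cylinders M F N Z J \<subseteq> Pow (space M)" using cylM sets.sets_into_space by auto
  have "(\<integral>\<omega>\<in>D. f \<omega> \<partial>M) = (\<integral>\<omega>\<in>D. g \<omega> \<partial>M)"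
    using cylinders_Int_stable sub D
  proof (induction rule: sigma_sets_induct_disjoint)
    case (basic a)
    then obtain A B where a: "a = A \<inter> {\<omega> \<in> space M. \<forall>j\<in>J. Z j \<omega> \<in> B j}" "A \<in> sets F" "\<forall>j\<in>J. B j \<in> sets N"
      by (auto simp: cylinders_def)
    have ind_a: "indicator a \<omega> = (indicator A \<omega> * (\<Prod>j\<in>J. indicator (B j) (Z j \<omega>)) :: real)" if "\<omega> \<in> space M" for \<omega>
      using that J(2) by (auto simp: a indicator_def prod_eq_1_iff)
    have "(\<integral>\<omega>\<in>a. h \<omega> \<partial>M) = (\<integral>\<omega>. (indicator A \<omega> * (\<Prod>j\<in>J. indicator (B j) (Z j \<omega>))) * h \<omega> \<partial>M)" for h :: "'a \<Rightarrow> real"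
      unfolding set_lebesgue_integral_def by (intro Bochner_Integration.integral_cong refl) (simp add: ind_a)
    then show ?case
      using cond_indep_vars_cylinder[OF F Z ind k J a(2) _ Bk, of B] a(3) by (simp add: f_def[abs_def] g_def)
  next
    case empty then show ?case by (simp add: set_lebesgue_integral_def)
  next
    case (compl A)
    have A: "A \<in> sets M" by (rule DM[OF compl.hyps])
    have "(\<integral>\<omega>\<in>space M - A. h \<omega> \<partial>M) = (\<integral>\<omega>. h \<omega> \<partial>M) - (\<integral>\<omega>\<in>A. h \<omega> \<partial>M)" if h: "integrable M h" for h :: "'a \<Rightarrow> real"
    proof -
      have "(\<integral>\<omega>\<in>space M - A. h \<omega> \<partial>M) = (\<integral>\<omega>. h \<omega> - indicator A \<omega> *\<^sub>R h \<omega> \<partial>M)"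
        unfolding set_lebesgue_integral_def by (intro Bochner_Integration.integral_cong refl) (auto simp: indicator_def)
      then show ?thesis
        unfolding set_lebesgue_integral_def using h integrable_mult_indicator[OF A h] by simp
    qed
    then show ?case using compl.IH tot fi gi by simp
  next
    case (union A)
    have A: "A i \<in> sets M" for i using union.hyps(2) by (auto intro: DM)
    have "(\<integral>\<omega>\<in>(\<Union>i. A i). h \<omega> \<partial>M) = (\<Sum>i. (\<integral>\<omega>\<in>A i. h \<omega> \<partial>M))" if "integrable M h" for h :: "'a \<Rightarrow> real"
      by (rule lebesgue_integral_countable_add)
         (use A union.hyps(1) integrable_mult_indicator[OF sets.countable_UN[of A UNIV] that] in
           \<open>auto simp: disjoint_family_on_def set_integrable_def\<close>)
    then show ?case using union.IH fi gi by simp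
  qed
  moreover have "f = (\<lambda>\<omega>. indicator Bk (Z k \<omega>))" by (rule ext) (simp add: f_def)
  ultimately show ?thesis by (simp only: g_def)
qed

text \<open>The identity for indicators says that, for D in the larger sigma-algebra, Z k has the same law under
  the densities 1_D and E[1_D | F]; hence it extends to integrable functions of Z k.\<close>

lemma (in prob_space) cond_indep_vars_cond_exp:
  fixes F H :: "'a measure" and Z :: "'i \<Rightarrow> 'a \<Rightarrow> 'c" and g :: "'c \<Rightarrow> real"
  assumes F: "subalgebra M F" and H: "subalgebra M H" and FH: "sets F \<subseteq> sets H"
    and Z[measurable]: "\<And>i. i \<in> I \<Longrightarrow> Z i \<in> measurable M N"
    and ind: "cond_indep_vars M F N Z I"
    and k: "k \<in> I" "k \<notin> J" and J: "J \<subseteq> I" "finite J"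
    and gen: "sets H \<subseteq> sigma_sets (space M) (cylinders M F N Z J)"
    and g[measurable]: "g \<in> borel_measurable N" and gi: "integrable M (\<lambda>\<omega>. g (Z k \<omega>))"
  shows "AE \<omega> in M. real_cond_exp M H (\<lambda>\<omega>. g (Z k \<omega>)) \<omega> = real_cond_exp M F (\<lambda>\<omega>. g (Z k \<omega>)) \<omega>"
proof -
  interpret S: sigma_finite_subalgebra M F by (rule sigma_finite_subalgebra_of_subalgebra[OF F])
  interpret SH: sigma_finite_subalgebra M H by (rule sigma_finite_subalgebra_of_subalgebra[OF H])
  have [measurable]: "Z k \<in> measurable M N" by (rule Z[OF k(1)])
  show ?thesis
  proof (rule SH.real_cond_exp_charact)
    show "integrable M (\<lambda>\<omega>. g (Z k \<omega>))" by fact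
    show "integrable M (real_cond_exp M F (\<lambda>\<omega>. g (Z k \<omega>)))" by (rule S.real_cond_exp_int(1)[OF gi])
    have "space F = space H" using F H by (simp add: subalgebra_def)
    then show "real_cond_exp M F (\<lambda>\<omega>. g (Z k \<omega>)) \<in> borel_measurable H"
      using measurable_mono[of borel borel F H] FH borel_measurable_cond_exp by blast
    fix D assume DH: "D \<in> sets H"
    then have D [measurable]: "D \<in> sets M" using H by (auto simp: subalgebra_def)
    define q where "q = real_cond_exp M F (indicator D)"
    have qF: "q \<in> borel_measurable F" and [measurable]: "q \<in> borel_measurable M" by (simp_all add: q_def)
    have iD: "integrable M (indicator D :: 'a \<Rightarrow> real)" by (simp add: less_top[symmetric])
    have q01: "AE \<omega> in M. 0 \<le> q \<omega> \<and> q \<omega> \<le> 1"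
      using S.real_cond_exp_pos[of "indicator D"] S.real_cond_exp_le_c[OF iD, of 1] unfolding q_def
      by (auto simp: indicator_def)
    have qint: "integrable M (\<lambda>\<omega>. q \<omega> * h \<omega>)" if h: "integrable M h" for h
      by (rule Bochner_Integration.integrable_bound[OF h])
         (use q01 h in \<open>auto simp: abs_mult intro!: mult_left_le_one_le\<close>)
    \<comment> \<open>Conditioning is self-adjoint: the projection onto \<open>F\<close> is moved
      from \<open>h\<close> to the indicator of \<open>D\<close>. The result is an integral against
      the density \<open>q\<close>, which lies in [0, 1], so integrability of \<open>h\<close>
      suffices.\<close>
    have dual: "(\<integral>\<omega>\<in>D. real_cond_exp M F h \<omega> \<partial>M) = (\<integral>\<omega>. q \<omega> * h \<omega> \<partial>M)" if h: "integrable M h" for h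
    proof -
      have hm [measurable]: "h \<in> borel_measurable M" using h by auto
      have i: "integrable M (\<lambda>\<omega>. real_cond_exp M F h \<omega> * indicator D \<omega>)"
        using integrable_mult_indicator[OF D S.real_cond_exp_int(1)[OF h]] by (simp add: mult.commute)
      have "(\<integral>\<omega>\<in>D. real_cond_exp M F h \<omega> \<partial>M) = (\<integral>\<omega>. real_cond_exp M F h \<omega> * indicator D \<omega> \<partial>M)"
        unfolding set_lebesgue_integral_def by (simp add: mult.commute)
      also have "\<dots> = (\<integral>\<omega>. real_cond_exp M F h \<omega> * q \<omega> \<partial>M)"
        unfolding q_def by (rule S.real_cond_exp_intg(2)[OF i, symmetric]) auto
      also have "\<dots> = (\<integral>\<omega>. q \<omega> * real_cond_exp M F h \<omega> \<partial>M)" by (simp add: mult.commute)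
      also have "\<dots> = (\<integral>\<omega>. q \<omega> * h \<omega> \<partial>M)"
        by (rule S.real_cond_exp_intg(2)[OF qint[OF h] qF hm])
      finally show ?thesis .
    qed
    define \<mu>1 where "\<mu>1 = distr (density M (\<lambda>\<omega>. ennreal (indicator D \<omega>))) N (Z k)"
    define \<mu>2 where "\<mu>2 = distr (density M (\<lambda>\<omega>. ennreal (q \<omega>))) N (Z k)"
    have "\<mu>1 = \<mu>2"
    proof (rule measure_eqI)
      show "sets \<mu>1 = sets \<mu>2" by (simp add: \<mu>1_def \<mu>2_def)
      fix B assume "B \<in> sets \<mu>1"
      then have B [measurable]: "B \<in> sets N" by (simp add: \<mu>1_def)
      have ib: "integrable M (\<lambda>\<omega>. indicator B (Z k \<omega>) :: real)"
        by (rule integrable_const_bound[of _ 1]) (auto simp: indicator_def)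
      have em: "emeasure (distr (density M (\<lambda>\<omega>. ennreal (c \<omega>))) N (Z k)) B = ennreal (\<integral>\<omega>. c \<omega> * indicator B (Z k \<omega>) \<partial>M)"
        if [measurable]: "c \<in> borel_measurable M" and c: "AE \<omega> in M. 0 \<le> c \<omega>" "integrable M (\<lambda>\<omega>. c \<omega> * indicator B (Z k \<omega>))" for c
      proof -
        have "emeasure (distr (density M (\<lambda>\<omega>. ennreal (c \<omega>))) N (Z k)) B =
            (\<integral>\<^sup>+\<omega>. ennreal (c \<omega>) * indicator (Z k -` B \<inter> space M) \<omega> \<partial>M)"
          by (simp add: emeasure_distr emeasure_density)
        also have "\<dots> = (\<integral>\<^sup>+\<omega>. ennreal (c \<omega> * indicator B (Z k \<omega>)) \<partial>M)"
          by (intro nn_integral_cong) (auto simp: indicator_def)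
        also have "\<dots> = ennreal (\<integral>\<omega>. c \<omega> * indicator B (Z k \<omega>) \<partial>M)"
          by (rule nn_integral_eq_integral[OF c(2)]) (use c(1) in \<open>auto simp: indicator_def\<close>)
        finally show ?thesis .
      qed
      have "(\<integral>\<omega>. indicator D \<omega> * indicator B (Z k \<omega>) \<partial>M) = (\<integral>\<omega>\<in>D. (indicator B (Z k \<omega>) :: real) \<partial>M)"
        by (simp add: set_lebesgue_integral_def)
      also have "\<dots> = (\<integral>\<omega>\<in>D. real_cond_exp M F (\<lambda>\<omega>. indicator B (Z k \<omega>)) \<omega> \<partial>M)"
        using DH gen by (intro cond_indep_vars_cond_exp_indicator[OF F Z ind k J _ B]) auto
      also have "\<dots> = (\<integral>\<omega>. q \<omega> * indicator B (Z k \<omega>) \<partial>M)" by (rule dual[OF ib])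
      finally show "emeasure \<mu>1 B = emeasure \<mu>2 B"
        unfolding \<mu>1_def \<mu>2_def using q01 qint[OF ib] integrable_mult_indicator[OF D ib] by (simp add: em)
    qed
    have "(\<integral>\<omega>\<in>D. g (Z k \<omega>) \<partial>M) = integral\<^sup>L \<mu>1 g"
      unfolding \<mu>1_def set_lebesgue_integral_def
      by (subst integral_distr) (auto simp: integral_density)
    also have "\<dots> = integral\<^sup>L \<mu>2 g" by (simp add: \<open>\<mu>1 = \<mu>2\<close>)
    also have "\<dots> = (\<integral>\<omega>. q \<omega> * g (Z k \<omega>) \<partial>M)"
      unfolding \<mu>2_def using q01 by (subst integral_distr) (auto simp: integral_density)
    also have "\<dots> = (\<integral>\<omega>\<in>D. real_cond_exp M F (\<lambda>\<omega>. g (Z k \<omega>)) \<omega> \<partial>M)" by (rule dual[OF gi, symmetric])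
    finally show "(\<integral>\<omega>\<in>D. g (Z k \<omega>) \<partial>M) = (\<integral>\<omega>\<in>D. real_cond_exp M F (\<lambda>\<omega>. g (Z k \<omega>)) \<omega> \<partial>M)" .
  qed
qed

section \<open>Weak convergence from characteristic functions\<close>

text \<open>Multiplication is not a constructor: induction then reduces expectations to real and
  imaginary parts of characteristic functions. Closure under products, which the Stone-Weierstrass
  theorem asks for, follows from the addition formulas.\<close>

inductive trig_poly :: "('v::euclidean_space \<Rightarrow> real) \<Rightarrow> bool" where
  cos: "trig_poly (\<lambda>x. a * cos (u \<bullet> x))"
| sin: "trig_poly (\<lambda>x. a * sin (u \<bullet> x))"
| add: "trig_poly f \<Longrightarrow> trig_poly g \<Longrightarrow> trig_poly (\<lambda>x. f x + g x)"

lemma trig_poly_const: "trig_poly (\<lambda>x. c)"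
  using trig_poly.cos[of c 0] by simp

lemma trig_poly_cmult:
  assumes "trig_poly f" shows "trig_poly (\<lambda>x. c * f x)"
  using assms
proof induction
  case (cos a u) show ?case using trig_poly.cos[of "c * a" u] by (simp add: mult.assoc)
next
  case (sin a u) show ?case using trig_poly.sin[of "c * a" u] by (simp add: mult.assoc)
next
  case (add f g) show ?case using trig_poly.add[OF add.IH] by (simp add: distrib_left)
qed

lemma trig_poly_mult_cos:
  assumes "trig_poly f" shows "trig_poly (\<lambda>x. f x * (b * cos (v \<bullet> x)))"
  using assms
proof induction
  case (cos a u)
  have "trig_poly (\<lambda>x. a * b / 2 * cos ((u - v) \<bullet> x) + a * b / 2 * cos ((u + v) \<bullet> x))"
    by (intro trig_poly.intros)
  also have "(\<lambda>x. a * b / 2 * cos ((u - v) \<bullet> x) + a * b / 2 * cos ((u + v) \<bullet> x)) =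
    (\<lambda>x. a * cos (u \<bullet> x) * (b * cos (v \<bullet> x)))"
    by (rule ext) (simp add: inner_diff_left inner_add_left cos_add cos_diff algebra_simps)
  finally show ?case .
next
  case (sin a u)
  have "trig_poly (\<lambda>x. a * b / 2 * sin ((u + v) \<bullet> x) + a * b / 2 * sin ((u - v) \<bullet> x))"
    by (intro trig_poly.intros)
  also have "(\<lambda>x. a * b / 2 * sin ((u + v) \<bullet> x) + a * b / 2 * sin ((u - v) \<bullet> x)) =
    (\<lambda>x. a * sin (u \<bullet> x) * (b * cos (v \<bullet> x)))"
    by (rule ext) (simp add: inner_diff_left inner_add_left sin_add sin_diff algebra_simps)
  finally show ?case .
next
  case (add f g) show ?case using trig_poly.add[OF add.IH] by (simp add: distrib_right)
qed

lemma trig_poly_mult_sin: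
  assumes "trig_poly f" shows "trig_poly (\<lambda>x. f x * (b * sin (v \<bullet> x)))"
  using assms
proof induction
  case (cos a u)
  have "trig_poly (\<lambda>x. a * b / 2 * sin ((u + v) \<bullet> x) + - (a * b / 2) * sin ((u - v) \<bullet> x))"
    by (intro trig_poly.intros)
  also have "(\<lambda>x. a * b / 2 * sin ((u + v) \<bullet> x) + - (a * b / 2) * sin ((u - v) \<bullet> x)) =
    (\<lambda>x. a * cos (u \<bullet> x) * (b * sin (v \<bullet> x)))"
    by (rule ext) (simp add: inner_diff_left inner_add_left sin_add sin_diff algebra_simps)
  finally show ?case .
next
  case (sin a u)
  have "trig_poly (\<lambda>x. a * b / 2 * cos ((u - v) \<bullet> x) + - (a * b / 2) * cos ((u + v) \<bullet> x))"
    by (intro trig_poly.intros)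
  also have "(\<lambda>x. a * b / 2 * cos ((u - v) \<bullet> x) + - (a * b / 2) * cos ((u + v) \<bullet> x)) =
    (\<lambda>x. a * sin (u \<bullet> x) * (b * sin (v \<bullet> x)))"
    by (rule ext) (simp add: inner_diff_left inner_add_left cos_add cos_diff algebra_simps)
  finally show ?case .
next
  case (add f g) show ?case using trig_poly.add[OF add.IH] by (simp add: distrib_right)
qed

lemma trig_poly_mult:
  assumes g: "trig_poly g" and f: "trig_poly f" shows "trig_poly (\<lambda>x. f x * g x)"
  using g
proof induction
  case (cos a u) show ?case by (rule trig_poly_mult_cos[OF f])
next
  case (sin a u) show ?case by (rule trig_poly_mult_sin[OF f])
next
  case (add g h) show ?case using trig_poly.add[OF add.IH] by (simp add: distrib_left)
qed

lemma trig_poly_compose_polynomial: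
  assumes q: "real_polynomial_function (q :: real \<Rightarrow> real)" and f: "trig_poly f"
  shows "trig_poly (\<lambda>x. q (f x))"
  using q
proof induction
  case (linear h)
  then interpret h: bounded_linear h .
  have "(\<lambda>x. h (f x)) = (\<lambda>x. h 1 * f x)"
  proof
    show "h (f x) = h 1 * f x" for x using h.scaleR[of "f x" 1] by (subst mult.commute) simp
  qed
  then show ?case using trig_poly_cmult[OF f, of "h 1"] by (simp only:)
next
  case (const c) show ?case by (rule trig_poly_const)
next
  case (add q r) show ?case by (rule trig_poly.add[OF add.IH])
next
  case (mult q r) show ?case by (rule trig_poly_mult[OF mult.IH(2,1)])
qed

lemma trig_poly_continuous: "trig_poly f \<Longrightarrow> continuous_on S f"
  by (induction rule: trig_poly.induct) (auto intro!: continuous_intros)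

lemma trig_poly_bounded: "trig_poly f \<Longrightarrow> \<exists>B. \<forall>x. \<bar>f x\<bar> \<le> B"
proof (induction rule: trig_poly.induct)
  case (cos a u)
  have "\<bar>a * cos (u \<bullet> x)\<bar> \<le> \<bar>a\<bar> * 1" for x unfolding abs_mult by (intro mult_left_mono) auto
  then show ?case by blast
next
  case (sin a u)
  have "\<bar>a * sin (u \<bullet> x)\<bar> \<le> \<bar>a\<bar> * 1" for x unfolding abs_mult by (intro mult_left_mono) auto
  then show ?case by blast
next
  case (add f g)
  then obtain B C where "\<And>x. \<bar>f x\<bar> \<le> B" "\<And>x. \<bar>g x\<bar> \<le> C" by blast
  then show ?case by (intro exI[of _ "B + C"]) (meson abs_triangle_ineq add_mono order_trans)
qed

text \<open>A trigonometric polynomial close to f on the ball need not be bounded by a constant independent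
  of the ball; composing it with a polynomial close to the truncation at level F restores this.\<close>

lemma trig_poly_approx:
  fixes f :: "'v::euclidean_space \<Rightarrow> real"
  assumes f: "continuous_on UNIV f" and F: "\<And>x. \<bar>f x\<bar> \<le> F" and e: "0 < e"
  obtains g where "trig_poly g" "\<And>x. \<bar>g x\<bar> \<le> F + e" "\<And>x. x \<in> cball 0 R \<Longrightarrow> \<bar>f x - g x\<bar> \<le> e"
proof -
  have sep: "\<exists>h. trig_poly h \<and> h x \<noteq> h y" if "x \<noteq> y" for x y :: 'v
  proof -
    \<comment> \<open>Normalized so that the phases of the two points differ by exactly 1, which is
      no multiple of 2 pi; hence cosine or sine distinguishes them.\<close>
    define t where "t = 1 / (norm (x - y))\<^sup>2"
    have d: "(t *\<^sub>R (x - y)) \<bullet> x - (t *\<^sub>R (x - y)) \<bullet> y = 1"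
      using that by (simp add: t_def inner_diff_right[symmetric] diff_divide_distrib[symmetric] power2_norm_eq_inner)
    show ?thesis
    proof (rule ccontr)
      assume n: "\<not> ?thesis"
      let ?a = "(t *\<^sub>R (x - y)) \<bullet> x" and ?b = "(t *\<^sub>R (x - y)) \<bullet> y"
      have "cos ?a = cos ?b" "sin ?a = sin ?b"
        using n trig_poly.cos[of 1 "t *\<^sub>R (x - y)"] trig_poly.sin[of 1 "t *\<^sub>R (x - y)"] by auto
      then have "cos (?a - ?b) = 1" unfolding cos_diff using sin_cos_squared_add3[of ?b] by simp
      then have "cos 1 = (1::real)" using d by simp
      then show False using cos_monotone_0_pi[of 0 1] pi_gt3 by simp
    qed
  qed
  have "\<exists>T. trig_poly T \<and> (\<forall>x\<in>cball 0 R. \<bar>f x - T x\<bar> < e / 2)"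
    by (rule Stone_Weierstrass_HOL)
       (use e sep continuous_on_subset[OF f subset_UNIV] in
         \<open>auto intro: trig_poly_const trig_poly_continuous trig_poly.add trig_poly_mult\<close>)
  then obtain T where T: "trig_poly T" "\<And>x. x \<in> cball 0 R \<Longrightarrow> \<bar>f x - T x\<bar> < e / 2"
    by blast
  obtain B where B: "\<And>x. \<bar>T x\<bar> \<le> B" using trig_poly_bounded[OF T(1)] by blast
  define \<psi> where "\<psi> t = max (- F) (min F t)" for t :: real
  have "continuous_on {-B..B} \<psi>" unfolding \<psi>_def by (intro continuous_intros)
  then obtain q where q: "real_polynomial_function q" "\<And>t. t \<in> {-B..B} \<Longrightarrow> \<bar>\<psi> t - q t\<bar> < e / 2"
    using Stone_Weierstrass_real_polynomial_function[of "{-B..B}" \<psi> "e/2"] e by auto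
  have qT: "\<bar>\<psi> (T x) - q (T x)\<bar> < e / 2" for x using q(2)[of "T x"] B[of x] by (simp add: abs_le_iff)
  have F0: "0 \<le> F" using F[of 0] by linarith
  show ?thesis
  proof
    show "trig_poly (\<lambda>x. q (T x))" by (rule trig_poly_compose_polynomial[OF q(1) T(1)])
    show "\<bar>q (T x)\<bar> \<le> F + e" for x
    proof -
      have "\<bar>\<psi> (T x)\<bar> \<le> F" using F0 by (auto simp: \<psi>_def)
      then show ?thesis using qT[of x] e by linarith
    qed
    show "\<bar>f x - q (T x)\<bar> \<le> e" if "x \<in> cball 0 R" for x
    proof -
      \<comment> \<open>\<open>\<psi>\<close> is the nearest-point map onto an interval that
        contains \<open>f x\<close>, so it does not increase the distance to
        \<open>f x\<close>.\<close>
      have "\<bar>f x - \<psi> (T x)\<bar> \<le> \<bar>f x - T x\<bar>" using F[of x] by (auto simp: \<psi>_def)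
      then show ?thesis using T(2)[OF that] qT[of x] by linarith
    qed
  qed
qed

lemma trig_poly_expectation_tendsto:
  fixes Z :: "nat \<Rightarrow> 'w \<Rightarrow> 'v::euclidean_space"
  assumes P: "prob_space P" and Z[measurable]: "\<And>n. Z n \<in> borel_measurable P"
    and \<mu>: "prob_space \<mu>" and s[measurable_cong]: "sets \<mu> = sets borel"
    and ch: "\<And>u. (\<lambda>n. LINT \<omega>|P. exp (\<i> * complex_of_real (u \<bullet> Z n \<omega>))) \<longlonglongrightarrow>
      (LINT x|\<mu>. exp (\<i> * complex_of_real (u \<bullet> x)))"
    and g: "trig_poly g"
  shows "(\<lambda>n. LINT \<omega>|P. g (Z n \<omega>)) \<longlonglongrightarrow> (LINT x|\<mu>. g x)"
proof -
  interpret P: prob_space P by fact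
  interpret \<mu>: prob_space \<mu> by fact
  have iP: "integrable P (\<lambda>\<omega>. exp (\<i> * complex_of_real (u \<bullet> Z n \<omega>)))" for u n
    by (rule P.integrable_iexp) auto
  have i\<mu>: "integrable \<mu> (\<lambda>x. exp (\<i> * complex_of_real (u \<bullet> x)))" for u
    by (rule \<mu>.integrable_iexp) auto
  have bint: "integrable P (\<lambda>\<omega>. h (Z n \<omega>))" "integrable \<mu> h" if h: "trig_poly h" for h n
  proof -
    obtain B where B: "\<And>x. \<bar>h x\<bar> \<le> B" using trig_poly_bounded[OF h] by blast
    have [measurable]: "h \<in> borel_measurable borel"
      using trig_poly_continuous[OF h] by (rule borel_measurable_continuous_onI)
    show "integrable P (\<lambda>\<omega>. h (Z n \<omega>))" by (rule P.integrable_const_bound[of _ B]) (use B in auto)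
    show "integrable \<mu> h" by (rule \<mu>.integrable_const_bound[of _ B]) (use B in auto)
  qed
  show ?thesis using g
  proof induction
    case (cos a u)
    have "(\<lambda>n. Re (LINT \<omega>|P. exp (\<i> * complex_of_real (u \<bullet> Z n \<omega>)))) \<longlonglongrightarrow>
      Re (LINT x|\<mu>. exp (\<i> * complex_of_real (u \<bullet> x)))" by (intro tendsto_Re ch)
    then have "(\<lambda>n. LINT \<omega>|P. cos (u \<bullet> Z n \<omega>)) \<longlonglongrightarrow> (LINT x|\<mu>. cos (u \<bullet> x))"
      unfolding integral_Re[OF iP, symmetric] integral_Re[OF i\<mu>, symmetric] by (simp add: Re_exp)
    from tendsto_mult_left[OF this] show ?case by simp
  next
    case (sin a u)
    have "(\<lambda>n. Im (LINT \<omega>|P. exp (\<i> * complex_of_real (u \<bullet> Z n \<omega>)))) \<longlonglongrightarrow>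
      Im (LINT x|\<mu>. exp (\<i> * complex_of_real (u \<bullet> x)))" by (intro tendsto_Im ch)
    then have "(\<lambda>n. LINT \<omega>|P. sin (u \<bullet> Z n \<omega>)) \<longlonglongrightarrow> (LINT x|\<mu>. sin (u \<bullet> x))"
      unfolding integral_Im[OF iP, symmetric] integral_Im[OF i\<mu>, symmetric] by (simp add: Im_exp)
    from tendsto_mult_left[OF this] show ?case by simp
  next
    case (add f g)
    then show ?case using tendsto_add[OF add.IH] by (simp add: bint)
  qed
qed

text \<open>The second moments bound the mass of the \<open>Z n\<close> outside a ball uniformly in
  n, and the single law \<open>\<mu>\<close> is tight by itself. Inside the ball \<open>f\<close> is
  close to a trigonometric polynomial, whose expectations converge; outside, the difference is at
  most 2 F + 1.\<close>

theorem char_tendsto_imp_converges_in_distribution: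
  fixes Z :: "nat \<Rightarrow> 'w \<Rightarrow> 'v::euclidean_space"
  assumes P: "prob_space P" and Z[measurable]: "\<And>n. Z n \<in> borel_measurable P"
    and \<mu>: "prob_space \<mu>" and s[measurable_cong]: "sets \<mu> = sets borel"
    and ch: "\<And>u. (\<lambda>n. LINT \<omega>|P. exp (\<i> * complex_of_real (u \<bullet> Z n \<omega>))) \<longlonglongrightarrow>
      (LINT x|\<mu>. exp (\<i> * complex_of_real (u \<bullet> x)))"
    and sq: "\<And>n. integrable P (\<lambda>\<omega>. (norm (Z n \<omega>))\<^sup>2)" "\<And>n. (LINT \<omega>|P. (norm (Z n \<omega>))\<^sup>2) \<le> C"
  shows "converges_in_distribution P Z \<mu>"
  unfolding converges_in_distribution_def
proof (intro allI impI)
  fix f :: "'v \<Rightarrow> real" assume "continuous_on UNIV f \<and> bounded (range f)"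
  then have f: "continuous_on UNIV f" and bf: "bounded (range f)" by auto
  interpret P: prob_space P by fact
  interpret \<mu>: prob_space \<mu> by fact
  have [measurable]: "f \<in> borel_measurable borel" using f by (rule borel_measurable_continuous_onI)
  from bf obtain F where F: "\<And>x. \<bar>f x\<bar> \<le> F" unfolding bounded_iff by auto
  have F0: "0 \<le> F" using F[of 0] by linarith
  have C0: "0 \<le> C" using sq(2)[of 0] by (rule order_trans[rotated]) simp
  have fP: "integrable P (\<lambda>\<omega>. f (Z n \<omega>))" for n by (rule P.integrable_const_bound[of _ F]) (use F in auto)
  have f\<mu>: "integrable \<mu> f" by (rule \<mu>.integrable_const_bound[of _ F]) (use F in auto)
  show "(\<lambda>n. LINT \<omega>|P. f (Z n \<omega>)) \<longlonglongrightarrow> (LINT x|\<mu>. f x)"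
  proof (rule LIMSEQ_I)
    fix r :: real assume r: "0 < r"
    \<comment> \<open>The total error is 2 e for \<open>Z n\<close>, 2 e for \<open>\<mu>\<close>
      and less than e for the trigonometric polynomial. The cap at 1 makes F + (F + e) at most the
      constant \<open>D\<close> below, whatever the ball.\<close>
    define e where "e = min 1 (r / 5)"
    have e: "0 < e" "e \<le> 1" "5 * e \<le> r" using r by (auto simp: e_def)
    define D where "D = 2 * F + 1"
    have D: "0 < D" using F0 by (simp add: D_def)
    have "(\<lambda>n. measure \<mu> {x \<in> space \<mu>. real n < norm x}) \<longlonglongrightarrow> measure \<mu> (\<Inter>n. {x \<in> space \<mu>. real n < norm x})"
      by (rule \<mu>.finite_Lim_measure_decseq) (auto simp: decseq_def)
    also have "(\<Inter>n. {x \<in> space \<mu>. real n < norm x}) = {}"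
    proof -
      have "\<exists>n. \<not> real n < norm x" for x :: 'v using real_arch_simple[of "norm x"] by (auto simp: not_less)
      then show ?thesis by auto
    qed
    finally have "(\<lambda>n. D * measure \<mu> {x \<in> space \<mu>. real n < norm x}) \<longlonglongrightarrow> D * 0"
      by (intro tendsto_intros) simp
    moreover have "(\<lambda>n. D * C / (real n)\<^sup>2) \<longlonglongrightarrow> 0"
      by (intro tendsto_divide_0[OF tendsto_const] filterlim_at_top_imp_at_infinity
            filterlim_pow_at_top filterlim_real_sequentially) auto
    ultimately have "\<forall>\<^sub>F n in sequentially. D * measure \<mu> {x \<in> space \<mu>. real n < norm x} < e \<and> D * C / (real n)\<^sup>2 < e \<and> n > 0"
      using e by (intro eventually_conj eventually_gt_at_top order_tendstoD(2)) auto
    from eventually_happens'[OF sequentially_bot this] obtain N where N: "D * measure \<mu> {x \<in> space \<mu>. real N < norm x} < e" "D * C / (real N)\<^sup>2 < e" "N > 0"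
      by auto
    obtain g where g: "trig_poly g" "\<And>x. \<bar>g x\<bar> \<le> F + e" "\<And>x. x \<in> cball 0 (real N) \<Longrightarrow> \<bar>f x - g x\<bar> \<le> e"
      using trig_poly_approx[OF f F e(1)] by blast
    have [measurable]: "g \<in> borel_measurable borel"
      using trig_poly_continuous[OF g(1)] by (rule borel_measurable_continuous_onI)
    have gP: "integrable P (\<lambda>\<omega>. g (Z n \<omega>))" for n by (rule P.integrable_const_bound[of _ "F + e"]) (use g in auto)
    have g\<mu>: "integrable \<mu> g" by (rule \<mu>.integrable_const_bound[of _ "F + e"]) (use g in auto)
    have fg: "\<bar>f x - g x\<bar> \<le> e + D * indicator {x. real N < norm x} x" for x
    proof (cases "real N < norm x")
      case True
      have "\<bar>f x - g x\<bar> \<le> F + (F + e)" using F[of x] g(2)[of x] by linarith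
      then show ?thesis using True e by (simp add: D_def)
    qed (use g(3)[of x] in simp)
    have fg2: "\<bar>f x - g x\<bar> \<le> e + D * (norm x)\<^sup>2 / (real N)\<^sup>2" for x
    proof -
      have "indicator {x. real N < norm x} x \<le> (norm x)\<^sup>2 / (real N)\<^sup>2"
      proof (cases "real N < norm x")
        case True
        then have "(real N)\<^sup>2 \<le> (norm x)\<^sup>2" by (intro power_mono) auto
        then show ?thesis using True N(3) by simp
      qed simp
      from mult_left_mono[OF this, of D] fg[of x] D show ?thesis by simp
    qed
    have dP: "\<bar>(LINT \<omega>|P. f (Z n \<omega>)) - (LINT \<omega>|P. g (Z n \<omega>))\<bar> \<le> 2 * e" for n
    proof -
      have "\<bar>(LINT \<omega>|P. f (Z n \<omega>)) - (LINT \<omega>|P. g (Z n \<omega>))\<bar> = \<bar>LINT \<omega>|P. f (Z n \<omega>) - g (Z n \<omega>)\<bar>"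
        using fP gP by simp
      also have "\<dots> \<le> (LINT \<omega>|P. \<bar>f (Z n \<omega>) - g (Z n \<omega>)\<bar>)" by (rule integral_abs_bound)
      also have "\<dots> \<le> (LINT \<omega>|P. e + D * (norm (Z n \<omega>))\<^sup>2 / (real N)\<^sup>2)"
        using fP gP sq(1) fg2 by (intro integral_mono) auto
      also have "\<dots> = e + D * (LINT \<omega>|P. (norm (Z n \<omega>))\<^sup>2) / (real N)\<^sup>2"
        using sq(1) by (simp add: P.prob_space)
      also have "\<dots> \<le> e + D * C / (real N)\<^sup>2"
        using sq(2)[of n] D by (intro add_left_mono divide_right_mono mult_left_mono) auto
      finally show ?thesis using N(2) by linarith
    qed
    have d\<mu>: "\<bar>(LINT x|\<mu>. f x) - (LINT x|\<mu>. g x)\<bar> \<le> 2 * e"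
    proof -
      have sp: "space \<mu> = UNIV" using sets_eq_imp_space_eq[OF s] by simp
      have "{x::'v. real N < norm x} \<in> sets borel" by measurable
      then have iI: "integrable \<mu> (indicator {x. real N < norm x} :: 'v \<Rightarrow> real)"
        by (simp add: s integrable_indicator_iff less_top[symmetric])
      have "\<bar>(LINT x|\<mu>. f x) - (LINT x|\<mu>. g x)\<bar> = \<bar>LINT x|\<mu>. f x - g x\<bar>"
        using f\<mu> g\<mu> by simp
      also have "\<dots> \<le> (LINT x|\<mu>. \<bar>f x - g x\<bar>)" by (rule integral_abs_bound)
      also have "\<dots> \<le> (LINT x|\<mu>. e + D * indicator {x. real N < norm x} x)"
        using f\<mu> g\<mu> fg iI by (intro integral_mono) auto
      also have "\<dots> = e + D * measure \<mu> {x. real N < norm x}"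
        using iI \<mu>.prob_space sp by simp
      finally show ?thesis using N(1) sp by simp
    qed
    have "(\<lambda>n. LINT \<omega>|P. g (Z n \<omega>)) \<longlonglongrightarrow> (LINT x|\<mu>. g x)"
      by (rule trig_poly_expectation_tendsto[OF P Z \<mu> s ch g(1)])
    from LIMSEQ_D[OF this e(1)] obtain n0 where
      "\<And>n. n \<ge> n0 \<Longrightarrow> \<bar>(LINT \<omega>|P. g (Z n \<omega>)) - (LINT x|\<mu>. g x)\<bar> < e" by auto
    then have "\<bar>(LINT \<omega>|P. f (Z n \<omega>)) - (LINT x|\<mu>. f x)\<bar> < r" if "n \<ge> n0" for n
    proof -
      have "\<bar>(LINT \<omega>|P. g (Z n \<omega>)) - (LINT x|\<mu>. g x)\<bar> < e" using \<open>n \<ge> n0\<close> by fact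
      then show ?thesis using dP[of n] d\<mu> e(3) by linarith
    qed
    then show "\<exists>n0. \<forall>n\<ge>n0. norm ((LINT \<omega>|P. f (Z n \<omega>)) - (LINT x|\<mu>. f x)) < r" by auto
  qed
qed

section \<open>Existence of multivariate normal laws\<close>

text \<open>Completing the square at a pivot \<open>i\<close> removes its row and column; the
  induction runs over a set outside which all rows vanish. A zero pivot forces its whole row to
  vanish, by positivity.\<close>

lemma psd_matrix_sum_of_squares:
  fixes Q :: "real ^ 'd ^ 'd"
  assumes "finite I"
    and "\<And>i j. Q $ i $ j = Q $ j $ i" and "\<And>u. 0 \<le> u \<bullet> (Q *v u)"
    and "\<And>i j. i \<notin> I \<Longrightarrow> Q $ i $ j = 0"
  shows "\<exists>(m::nat) w. \<forall>u. u \<bullet> (Q *v u) = (\<Sum>j<m. (w j \<bullet> u)\<^sup>2)"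
  using assms
proof (induction I arbitrary: Q rule: finite_induct)
  case empty
  then have "u \<bullet> (Q *v u) = 0" for u
    by (simp add: inner_vec_def matrix_vector_mult_def)
  then show ?case by (intro exI[of _ 0] exI[of _ "\<lambda>_. 0"]) simp
next
  case (insert i I)
  note sym = insert.prems(1) and psd = insert.prems(2) and supp = insert.prems(3)
  have qadd: "(u + t *\<^sub>R axis i 1) \<bullet> (Q *v (u + t *\<^sub>R axis i 1)) =
      u \<bullet> (Q *v u) + 2 * t * (Q $ i \<bullet> u) + t\<^sup>2 * Q $ i $ i" for u t
  proof -
    have a: "axis i 1 \<bullet> (Q *v u) = Q $ i \<bullet> u" for u
      unfolding inner_axis' by (simp add: matrix_vector_mult_def inner_vec_def)
    have b: "u \<bullet> (Q *v axis i 1) = Q $ i \<bullet> u" for u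
      using sym by (simp add: matrix_vector_mult_basis inner_vec_def column_def mult.commute)
    have c: "Q $ i \<bullet> axis i 1 = Q $ i $ i" by (simp add: inner_axis)
    show ?thesis
      by (simp add: matrix_vector_right_distrib matrix_vector_mult_scaleR inner_add_left inner_add_right a b c
          power2_eq_square algebra_simps)
  qed
  show ?case
  proof (cases "Q $ i $ i = 0")
    case True
    have "Q $ i \<bullet> u = 0" for u
    proof (rule ccontr)
      assume n: "Q $ i \<bullet> u \<noteq> 0"
      \<comment> \<open>With a zero pivot the form at \<open>u + t *\<^sub>R axis i 1\<close> is
        affine in t; this t gives it the value -1.\<close>
      define t where "t = - (u \<bullet> (Q *v u) + 1) / (2 * (Q $ i \<bullet> u))"
      have "(u + t *\<^sub>R axis i 1) \<bullet> (Q *v (u + t *\<^sub>R axis i 1)) = -1"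
        unfolding qadd True using n by (simp add: t_def field_simps)
      then show False using psd[of "u + t *\<^sub>R axis i 1"] by simp
    qed
    then have "Q $ i $ j = 0" for j using inner_axis[of "Q $ i" j "1::real"] by simp
    then have "Q $ k $ l = 0" if "k \<notin> I" for k l using supp[of k l] that by (cases "k = i") auto
    then show ?thesis using insert.IH[OF sym psd] by blast
  next
    case False
    then have pos: "0 < Q $ i $ i"
      using psd[of "axis i 1"] qadd[of 0 1] by simp
    define Q' where "Q' = (\<chi> k l. Q $ k $ l - Q $ i $ k * Q $ i $ l / Q $ i $ i)"
    have q': "u \<bullet> (Q' *v u) = u \<bullet> (Q *v u) - (Q $ i \<bullet> u)\<^sup>2 / Q $ i $ i" for u
    proof -
      have "(Q' *v u) $ k = (Q *v u - ((Q $ i \<bullet> u) / Q $ i $ i) *\<^sub>R Q $ i) $ k" for k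
      proof -
        have "(\<Sum>l\<in>UNIV. Q $ i $ k * Q $ i $ l / Q $ i $ i * u $ l) = (Q $ i \<bullet> u) / Q $ i $ i * Q $ i $ k"
          unfolding inner_vec_def sum_divide_distrib sum_distrib_right by (intro sum.cong refl) simp
        then show ?thesis by (simp add: Q'_def matrix_vector_mult_def left_diff_distrib sum_subtractf)
      qed
      then have "Q' *v u = Q *v u - ((Q $ i \<bullet> u) / Q $ i $ i) *\<^sub>R Q $ i" by (simp add: vec_eq_iff)
      then show ?thesis by (simp add: inner_diff_right power2_eq_square inner_commute[of u "Q $ i"])
    qed
    have "\<exists>(m::nat) w. \<forall>u. u \<bullet> (Q' *v u) = (\<Sum>j<m. (w j \<bullet> u)\<^sup>2)"
    proof (rule insert.IH)
      show "Q' $ k $ l = Q' $ l $ k" for k l using sym[of k l] by (simp add: Q'_def mult.commute)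
      show "0 \<le> u \<bullet> (Q' *v u)" for u
      proof -
        \<comment> \<open>The minimizer in t of the form at \<open>u + t *\<^sub>R axis i 1\<close>.
          The minimum is the form of \<open>Q'\<close> at \<open>u\<close>, so \<open>Q'\<close>
          inherits positivity.\<close>
        define t where "t = - (Q $ i \<bullet> u) / Q $ i $ i"
        have "u \<bullet> (Q' *v u) = (u + t *\<^sub>R axis i 1) \<bullet> (Q *v (u + t *\<^sub>R axis i 1))"
          unfolding qadd q' using pos by (simp add: t_def field_simps power2_eq_square)
        then show ?thesis using psd by simp
      qed
      show "Q' $ k $ l = 0" if "k \<notin> I" for k l
      proof (cases "k = i")
        case True then show ?thesis using pos by (simp add: Q'_def)
      next
        case False
        then have "Q $ k $ l = 0" "Q $ i $ k = 0" using that supp[of k] sym[of i k] by auto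
        then show ?thesis by (simp add: Q'_def)
      qed
    qed
    then obtain m w where w: "\<And>u. u \<bullet> (Q' *v u) = (\<Sum>j<(m::nat). (w j \<bullet> u)\<^sup>2)" by blast
    define v where "v = w(m := (1 / sqrt (Q $ i $ i)) *\<^sub>R Q $ i)"
    have "u \<bullet> (Q *v u) = (\<Sum>j<Suc m. (v j \<bullet> u)\<^sup>2)" for u
      using w[of u] q'[of u] pos by (simp add: v_def power_divide)
    then show ?thesis by blast
  qed
qed

text \<open>The law of the sum of the vectors \<open>x j *\<^sub>R w j\<close> with independent
  standard normal \<open>x j\<close>, where the squares of \<open>w j \<bullet> u\<close> add up to
  the form of \<open>Q\<close>. Its characteristic function is a product of one-dimensional
  ones.\<close>

lemma multivariate_normal_exists:
  fixes Q :: "real ^ 'd ^ 'd"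
  assumes "\<And>i j. Q $ i $ j = Q $ j $ i" and "\<And>u. 0 \<le> u \<bullet> (Q *v u)"
  shows "\<exists>\<mu>. multivariate_normal 0 Q \<mu>"
proof -
  obtain m :: nat and w where w: "\<And>u. u \<bullet> (Q *v u) = (\<Sum>j<m. (w j \<bullet> u)\<^sup>2)"
    using psd_matrix_sum_of_squares[of UNIV Q] assms by auto
  interpret std: prob_space std_normal_distribution by (rule prob_space_normal_density) simp
  interpret N: product_sigma_finite "\<lambda>j::nat. std_normal_distribution"
    by (rule product_sigma_finite.intro) (rule std.sigma_finite_measure_axioms)
  define M where "M = PiM {..<m} (\<lambda>j::nat. std_normal_distribution)"
  interpret M: prob_space M unfolding M_def by (intro prob_space_PiM std.prob_space_axioms)
  define h where "h x = (\<Sum>j<m. x j *\<^sub>R w j)" for x :: "nat \<Rightarrow> real"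
  have [measurable]: "h \<in> borel_measurable M" unfolding h_def M_def by measurable
  show ?thesis
  proof (intro exI[of _ "distr M borel h"], unfold multivariate_normal_def, intro conjI allI)
    show "prob_space (distr M borel h)" by (rule M.prob_space_distr) simp
    show "sets (distr M borel h) = sets borel" by simp
    fix u
    have "(LINT x|distr M borel h. exp (\<i> * complex_of_real (u \<bullet> x))) =
        (LINT x|M. exp (\<i> * complex_of_real (u \<bullet> h x)))"
      by (subst integral_distr) auto
    also have "\<dots> = (LINT x|M. (\<Prod>j<m. iexp ((w j \<bullet> u) * x j)))"
    proof -
      have "u \<bullet> h x = (\<Sum>j<m. (w j \<bullet> u) * x j)" for x
        unfolding h_def inner_sum_right by (intro sum.cong refl) (simp add: inner_commute mult.commute)
      then show ?thesis by (simp only: of_real_sum sum_distrib_left exp_sum finite_lessThan)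
    qed
    also have "\<dots> = (\<Prod>j<m. char std_normal_distribution (w j \<bullet> u))"
      unfolding M_def char_def
      by (subst N.product_integral_prod)
         (auto intro!: std.integrable_iexp)
    also have "\<dots> = complex_of_real (exp (- (u \<bullet> (Q *v u)) / 2))"
      unfolding w char_std_normal_distribution by (simp add: exp_sum sum_negf[symmetric] sum_divide_distrib)
    also have "\<dots> = exp (\<i> * complex_of_real (u \<bullet> 0) - complex_of_real (u \<bullet> (Q *v u)) / 2)"
      by (simp flip: exp_of_real)
    finally show "(LINT x|distr M borel h. exp (\<i> * complex_of_real (u \<bullet> x))) =
      exp (\<i> * complex_of_real (u \<bullet> 0) - complex_of_real (u \<bullet> (Q *v u)) / 2)" .
  qed
qed

section \<open>The noise as a martingale difference sequence\<close>

lemma Tree_eq: "Tree n = {1..<2 ^ (n + 1)}"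
proof (induction n)
  case 0 then show ?case by (auto simp: Tree_def Gen_def)
next
  case (Suc n)
  have "Tree (Suc n) = Tree n \<union> Gen (Suc n)" by (auto simp: Tree_def le_Suc_eq)
  also have "\<dots> = {1..<2 ^ (Suc n + 1)}" unfolding Suc Gen_def
    using ivl_disj_un_two(3)[of 1 "2 ^ (n + 1)" "2 ^ (Suc n + 1) :: nat"] by simp
  finally show ?case .
qed

lemma borel_measurable_fst_pair: "fst \<in> borel_measurable (borel :: (real \<times> real) measure)"
  by (intro borel_measurable_continuous_onI continuous_intros)

lemma borel_measurable_snd_pair: "snd \<in> borel_measurable (borel :: (real \<times> real) measure)"
  by (intro borel_measurable_continuous_onI continuous_intros)

lemma child_in_Gen: "k \<in> Gen n \<Longrightarrow> c \<le> 1 \<Longrightarrow> 2 * k + c \<in> Gen (n + 1)"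
  by (auto simp: Gen_def)

lemma L4_mono:
  assumes g: "L4 M g" and f[measurable]: "f \<in> borel_measurable M" and le: "\<And>x. \<bar>f x\<bar> \<le> \<bar>g x\<bar>"
  shows "L4 M f"
proof -
  note g[THEN L4_measurable, measurable]
  have "integrable M (\<lambda>x. f x ^ 4)"
  proof (rule Bochner_Integration.integrable_bound[where f = "\<lambda>x. g x ^ 4"])
    have "\<bar>f x\<bar> ^ 4 \<le> \<bar>g x\<bar> ^ 4" for x by (intro power_mono le) auto
    then show "AE x in M. norm (f x ^ 4) \<le> norm (g x ^ 4)" by (intro AE_I2) simp
  qed (use g in \<open>auto simp: L4_def\<close>)
  then show ?thesis by (simp add: L4_def)
qed

text \<open>Defined through the square, so that sums and products are handled by the closure
  properties of \<open>L4\<close>. It is the space of measurable functions with finite eighth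
  moment.\<close>

definition L8 :: "'a measure \<Rightarrow> ('a \<Rightarrow> real) \<Rightarrow> bool" where
  "L8 M f \<longleftrightarrow> f \<in> borel_measurable M \<and> L4 M (\<lambda>x. (f x)\<^sup>2)"

lemma L8_iff: "L8 M f \<longleftrightarrow> f \<in> borel_measurable M \<and> integrable M (\<lambda>x. f x ^ 8)"
  by (auto simp: L8_def L4_def power_mult[symmetric])

lemma L8_add: assumes "L8 M f" "L8 M g" shows "L8 M (\<lambda>x. f x + g x)"
proof -
  have [measurable]: "f \<in> borel_measurable M" "g \<in> borel_measurable M" using assms by (auto simp: L8_def)
  have "L4 M (\<lambda>x. 2 * ((f x)\<^sup>2 + (g x)\<^sup>2))" using assms by (intro L4_cmult L4_add) (auto simp: L8_def)
  then have "L4 M (\<lambda>x. (f x + g x)\<^sup>2)"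
  proof (rule L4_mono)
    fix x
    have "(f x + g x)\<^sup>2 \<le> 2 * ((f x)\<^sup>2 + (g x)\<^sup>2)"
      using zero_le_power2[of "f x - g x"] by (simp add: power2_eq_square algebra_simps)
    then show "\<bar>(f x + g x)\<^sup>2\<bar> \<le> \<bar>2 * ((f x)\<^sup>2 + (g x)\<^sup>2)\<bar>" by (smt (verit) zero_le_power2)
  qed measurable
  then show ?thesis by (simp add: L8_def)
qed

lemma L8_cmult: assumes "L8 M f" shows "L8 M (\<lambda>x. c * f x)"
  using assms L4_cmult[of M "\<lambda>x. (f x)\<^sup>2" "c\<^sup>2"] by (auto simp: L8_def power_mult_distrib)

lemma L8_zero [simp]: "L8 M (\<lambda>x. 0)" by (simp add: L8_def)

lemma L8_sum: "(\<And>i. i \<in> I \<Longrightarrow> L8 M (f i)) \<Longrightarrow> L8 M (\<lambda>x. \<Sum>i\<in>I. f i x)"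
  by (induction I rule: infinite_finite_induct) (simp_all add: L8_add)

context prob_space
begin

lemma L8_const [simp]: "L8 M (\<lambda>x. c)" by (simp add: L8_def)

lemma L8_imp_L4: assumes "L8 M f" shows "L4 M f"
proof (rule L4_mono[where g = "\<lambda>x. 1 + (f x)\<^sup>2"])
  show "L4 M (\<lambda>x. 1 + (f x)\<^sup>2)" using assms by (intro L4_add) (auto simp: L8_def)
  fix x
  have "2 * \<bar>f x\<bar> \<le> 1 + (f x)\<^sup>2" using zero_le_power2[of "\<bar>f x\<bar> - 1"] by (simp add: power2_eq_square algebra_simps)
  then show "\<bar>f x\<bar> \<le> \<bar>1 + (f x)\<^sup>2\<bar>" by linarith
qed (use assms in \<open>simp add: L8_def\<close>)

end

text \<open>What is known before the children of k are born; for k = 2 ^ n this is the sigma-algebra F n.\<close>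

definition past :: "'w measure \<Rightarrow> (nat \<Rightarrow> 'w \<Rightarrow> real) \<Rightarrow> nat \<Rightarrow> 'w measure" where
  "past P X k = sigma (space P) (\<Union>j\<in>{1..<2 * k}. {X j -` B \<inter> space P |B. B \<in> sets borel})"

lemma tree_filtration_eq_past: "tree_filtration P X n = past P X (2 ^ n)"
  by (simp add: tree_filtration_def past_def Tree_eq)

lemma space_past: "space (past P X k) = space P"
  unfolding past_def by (rule space_measure_of) auto

lemma sets_past: "sets (past P X k) = sigma_sets (space P) (\<Union>j\<in>{1..<2 * k}. {X j -` B \<inter> space P |B. B \<in> sets borel})"
  unfolding past_def by (rule sets_measure_of) auto

locale bar_process = prob_space P for P :: "'w measure" +
  fixes X \<epsilon> :: "nat \<Rightarrow> 'w \<Rightarrow> real" and a b :: "nat \<Rightarrow> real" and p :: nat and \<sigma>2 \<rho> :: real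
  assumes p_pos: "1 \<le> p"
    and X_rv: "\<And>k. 1 \<le> k \<Longrightarrow> X k \<in> borel_measurable P"
    and eps_rv: "\<And>k. 2 ^ p \<le> k \<Longrightarrow> \<epsilon> k \<in> borel_measurable P"
    and BAR_even: "\<And>n \<omega>. 2 ^ (p - 1) \<le> n \<Longrightarrow> \<omega> \<in> space P \<Longrightarrow>
      X (2 * n) \<omega> = a 0 + (\<Sum>k=1..p. a k * X (n div 2 ^ (k - 1)) \<omega>) + \<epsilon> (2 * n) \<omega>"
    and BAR_odd: "\<And>n \<omega>. 2 ^ (p - 1) \<le> n \<Longrightarrow> \<omega> \<in> space P \<Longrightarrow>
      X (2 * n + 1) \<omega> = b 0 + (\<Sum>k=1..p. b k * X (n div 2 ^ (k - 1)) \<omega>) + \<epsilon> (2 * n + 1) \<omega>"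
    and initial: "\<And>k. 1 \<le> k \<Longrightarrow> k < 2 ^ p \<Longrightarrow> integrable P (\<lambda>\<omega>. X k \<omega> ^ 8)"
    and \<sigma>2_pos: "0 < \<sigma>2" and \<rho>_less: "\<bar>\<rho>\<bar> < \<sigma>2"
    and mean_var: "noise_mean_var p P X \<epsilon> \<sigma>2"
    and covar: "noise_covariance p P X \<epsilon> \<rho>"
    and fourth: "noise_moment_bounded p P X \<epsilon> 4"
begin

abbreviation N0 :: nat where "N0 \<equiv> 2 ^ (p - 1)"
abbreviation G :: "nat \<Rightarrow> 'w measure" where "G \<equiv> past P X"

lemma two_N0: "2 * N0 = 2 ^ p"
  using p_pos by (cases p) auto

lemma past_subalgebra: "subalgebra P (G k)"
  unfolding subalgebra_def
proof
  show "space (G k) = space P" by (rule space_past)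
  show "sets (G k) \<subseteq> sets P" unfolding sets_past
    by (rule sets.sigma_sets_subset) (auto intro: measurable_sets[OF X_rv])
qed

lemma past_mono: "j \<le> k \<Longrightarrow> sets (G j) \<subseteq> sets (G k)"
  unfolding sets_past by (intro sigma_sets_mono' UN_mono) auto

sublocale filtered_prob_space P G
  by unfold_locales (auto intro: past_subalgebra past_mono[THEN subsetD])

lemma X_past: assumes "1 \<le> j" "j < 2 * k" shows "X j \<in> borel_measurable (G k)"
proof (rule measurableI)
  fix B :: "real set" assume "B \<in> sets borel"
  then have "X j -` B \<inter> space P \<in> (\<Union>j\<in>{1..<2 * k}. {X j -` B \<inter> space P |B. B \<in> sets borel})"
    using assms by (intro UN_I[of j]) auto
  then show "X j -` B \<inter> space (G k) \<in> sets (G k)"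
    unfolding space_past sets_past by (rule sigma_sets.Basic)
qed simp

lemma anc_pos: "N0 \<le> k \<Longrightarrow> i < p \<Longrightarrow> 1 \<le> k div 2 ^ i"
proof -
  assume k: "N0 \<le> k" and i: "i < p"
  have "2 ^ i \<le> N0" using i by (intro power_increasing) auto
  then have "2 ^ i \<le> k" using k by linarith
  then show ?thesis by (simp add: Suc_le_eq div_greater_zero_iff)
qed

lemma drift_cases:
  assumes "2 ^ p \<le> i"
  shows "\<exists>c. \<forall>\<omega>\<in>space P. X i \<omega> = c 0 + (\<Sum>k=1..p. c k * X (i div 2 div 2 ^ (k - 1)) \<omega>) + \<epsilon> i \<omega>"
proof -
  have "N0 \<le> i div 2" using assms two_N0 by linarith
  moreover have "i = 2 * (i div 2) \<or> i = 2 * (i div 2) + 1" by presburger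
  ultimately show ?thesis
  proof (elim disjE)
    assume i: "i = 2 * (i div 2)" and N: "N0 \<le> i div 2"
    show ?thesis using BAR_even[OF N] i[symmetric] by (intro exI[of _ a] ballI) simp
  next
    assume i: "i = 2 * (i div 2) + 1" and N: "N0 \<le> i div 2"
    show ?thesis using BAR_odd[OF N] i[symmetric] by (intro exI[of _ b] ballI) simp
  qed
qed

definition pair :: "nat \<Rightarrow> 'w \<Rightarrow> real \<times> real" where "pair j \<omega> = (\<epsilon> (2 * j) \<omega>, \<epsilon> (2 * j + 1) \<omega>)"

lemma pair_meas: "N0 \<le> j \<Longrightarrow> pair j \<in> borel_measurable P"
  unfolding pair_def using eps_rv[of "2 * j"] eps_rv[of "2 * j + 1"] two_N0
  by (intro borel_measurable_Pair) auto

text \<open>By the autoregression, a child of a vertex in \<open>{2 ^ n..<k}\<close> is a function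
  of its own noise and of states with index below \<open>2 * 2 ^ n\<close>, which are known in
  \<open>G (2 ^ n)\<close>. So the past of \<open>k\<close> contains nothing beyond
  \<open>G (2 ^ n)\<close> and the earlier sister pairs of the generation.\<close>

lemma sets_past_cylinders:
  assumes n: "p - 1 \<le> n" and k: "k \<in> Gen n"
  shows "sets (G k) \<subseteq> sigma_sets (space P) (cylinders P (G (2 ^ n)) borel pair {2 ^ n..<k})"
proof -
  let ?C = "cylinders P (G (2 ^ n)) borel pair {2 ^ n..<k}"
  define S where "S = sigma (space P) ?C"
  have sub: "?C \<subseteq> Pow (space P)" by (auto simp: cylinders_def)
  have spS: "space S = space P" unfolding S_def by (rule space_measure_of[OF sub])
  have seS: "sets S = sigma_sets (space P) ?C" unfolding S_def by (rule sets_measure_of[OF sub])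
  have N0n: "N0 \<le> 2 ^ n" using n by (intro power_increasing) auto
  have base: "sets (G (2 ^ n)) \<subseteq> sets S"
  proof
    fix A assume A: "A \<in> sets (G (2 ^ n))"
    then have "A \<subseteq> space P" using sets.sets_into_space[of A "G (2 ^ n)"] unfolding space_past by simp
    then have eq: "A = A \<inter> {\<omega> \<in> space P. \<forall>j\<in>{2 ^ n..<k}. pair j \<omega> \<in> (\<lambda>_. UNIV) j}" by auto
    have "A \<in> ?C" unfolding cylinders_def
      by (intro CollectI exI[of _ A] exI[of _ "\<lambda>_. UNIV"] conjI A ballI eq) simp
    then show "A \<in> sets S" unfolding seS by (rule sigma_sets.Basic)
  qed
  have pS: "pair j \<in> borel_measurable S" if j: "j \<in> {2 ^ n..<k}" for j
  proof (rule measurableI)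
    fix B :: "(real \<times> real) set" assume B: "B \<in> sets borel"
    have eq: "pair j -` B \<inter> space S = space P \<inter> {\<omega> \<in> space P. \<forall>i\<in>{2 ^ n..<k}. pair i \<omega> \<in> (if i = j then B else UNIV)}"
      using j by (auto simp: spS split: if_splits)
    have sp: "space P \<in> sets (G (2 ^ n))" using sets.top[of "G (2 ^ n)"] unfolding space_past .
    have "pair j -` B \<inter> space S \<in> ?C" unfolding cylinders_def eq
      by (intro CollectI exI[of _ "space P"] exI[of _ "\<lambda>i. if i = j then B else UNIV"] conjI refl sp ballI) (use B in simp)
    then show "pair j -` B \<inter> space S \<in> sets S" unfolding seS by (rule sigma_sets.Basic)
  qed simp
  have old: "X i \<in> borel_measurable S" if i: "1 \<le> i" "i < 2 * 2 ^ n" for i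
  proof (rule measurableI)
    fix B :: "real set" assume "B \<in> sets borel"
    then have "X i -` B \<inter> space (G (2 ^ n)) \<in> sets (G (2 ^ n))" using X_past[OF i] by (rule measurable_sets[rotated])
    then show "X i -` B \<inter> space S \<in> sets S" using base unfolding space_past spS by blast
  qed simp
  have eS: "\<epsilon> i \<in> borel_measurable S" if i: "2 * 2 ^ n \<le> i" "i < 2 * k" for i
  proof -
    have j: "i div 2 \<in> {2 ^ n..<k}" using i by auto
    have "(\<lambda>\<omega>. fst (pair (i div 2) \<omega>)) \<in> borel_measurable S" "(\<lambda>\<omega>. snd (pair (i div 2) \<omega>)) \<in> borel_measurable S"
      using measurable_compose[OF pS[OF j] borel_measurable_fst_pair] measurable_compose[OF pS[OF j] borel_measurable_snd_pair] by auto
    then have "\<epsilon> (2 * (i div 2)) \<in> borel_measurable S" "\<epsilon> (2 * (i div 2) + 1) \<in> borel_measurable S"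
      by (simp_all add: pair_def)
    moreover have "i = 2 * (i div 2) \<or> i = 2 * (i div 2) + 1" by presburger
    ultimately show ?thesis by (elim disjE) (erule ssubst, assumption)+
  qed
  have new: "X i \<in> borel_measurable S" if i: "2 * 2 ^ n \<le> i" "i < 2 * k" for i
  proof -
    have "2 ^ p \<le> i" using i N0n two_N0 by linarith
    then obtain c where c: "\<And>\<omega>. \<omega> \<in> space P \<Longrightarrow> X i \<omega> = c 0 + (\<Sum>k=1..p. c k * X (i div 2 div 2 ^ (k - 1)) \<omega>) + \<epsilon> i \<omega>"
      using drift_cases by blast
    have "X (i div 2 div 2 ^ (l - 1)) \<in> borel_measurable S" if l: "l \<in> {1..p}" for l
    proof (rule old)
      have "N0 \<le> i div 2" using i N0n by linarith
      then show "1 \<le> i div 2 div 2 ^ (l - 1)" using l by (intro anc_pos) auto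
      have "i div 2 div 2 ^ (l - 1) \<le> i div 2" by (rule div_le_dividend)
      also have "i div 2 < k" using i by auto
      also have "k < 2 * 2 ^ n" using k by (simp add: Gen_def)
      finally show "i div 2 div 2 ^ (l - 1) < 2 * 2 ^ n" .
    qed
    then have "(\<lambda>\<omega>. c 0 + (\<Sum>k=1..p. c k * X (i div 2 div 2 ^ (k - 1)) \<omega>) + \<epsilon> i \<omega>) \<in> borel_measurable S"
      using eS[OF i] by (intro borel_measurable_add borel_measurable_sum borel_measurable_times) auto
    then show ?thesis using c by (subst measurable_cong) (auto simp: spS)
  qed
  have "X i \<in> borel_measurable S" if "1 \<le> i" "i < 2 * k" for i
    using old[of i] new[of i] that by (cases "i < 2 * 2 ^ n") auto
  then have "X j -` B \<inter> space P \<in> sets S" if "1 \<le> j" "j < 2 * k" "B \<in> sets borel" for j B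
    using measurable_sets[of "X j" S borel B] that by (simp add: spS)
  then have "(\<Union>j\<in>{1..<2 * k}. {X j -` B \<inter> space P |B. B \<in> sets borel}) \<subseteq> sets S"
    by (intro UN_least) auto
  then have "sigma_sets (space S) (\<Union>j\<in>{1..<2 * k}. {X j -` B \<inter> space P |B. B \<in> sets borel}) \<subseteq> sets S"
    by (rule sets.sigma_sets_subset)
  then show ?thesis by (simp only: sets_past[of P X k] spS seS)
qed

lemma noise_cond_exp:
  fixes g :: "real \<times> real \<Rightarrow> real"
  assumes n: "p - 1 \<le> n" and k: "k \<in> Gen n" and g: "g \<in> borel_measurable borel" and gi: "integrable P (\<lambda>\<omega>. g (pair k \<omega>))"
  shows "AE \<omega> in P. real_cond_exp P (G k) (\<lambda>\<omega>. g (pair k \<omega>)) \<omega> =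
    real_cond_exp P (tree_filtration P X n) (\<lambda>\<omega>. g (pair k \<omega>)) \<omega>"
  unfolding tree_filtration_eq_past
proof (rule cond_indep_vars_cond_exp[where I = "Gen n" and J = "{2 ^ n..<k}" and N = borel and Z = pair])
  have N0n: "N0 \<le> 2 ^ n" using n by (intro power_increasing) auto
  show "pair i \<in> borel_measurable P" if "i \<in> Gen n" for i using that by (intro pair_meas order_trans[OF N0n]) (simp add: Gen_def)
  show "cond_indep_vars P (G (2 ^ n)) borel pair (Gen n)"
    using covar n unfolding noise_covariance_def tree_filtration_eq_past pair_def[abs_def] by auto
  show "sets (G (2 ^ n)) \<subseteq> sets (G k)" using k by (intro past_mono) (simp add: Gen_def)
qed (use k n g gi sets_past_cylinders past_subalgebra in \<open>auto simp: Gen_def\<close>)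

lemma Gen_floor_log: "N0 \<le> k \<Longrightarrow> k \<in> Gen (floor_log k) \<and> p - 1 \<le> floor_log k"
proof -
  assume k: "N0 \<le> k"
  have "0 < N0" by simp
  then have "0 < k" using k by linarith
  moreover have "p - 1 \<le> floor_log k" using floor_log_mono[THEN monoD, OF k] by simp
  ultimately show ?thesis by (simp add: Gen_iff_floor_log)
qed

text \<open>The vertices k < N0 carry no noise in M n; with the value 0 for them, sums over the subtree
  starting at generation p - 1 become sums over all k < 2 ^ n.\<close>

definition noise :: "nat \<Rightarrow> nat \<Rightarrow> 'w \<Rightarrow> real" where
  "noise c k \<omega> = (if k < N0 then 0 else \<epsilon> (2 * k + c) \<omega>)"

definition var :: "nat \<Rightarrow> real" where "var k = (if k < N0 then 0 else \<sigma>2)"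
definition cov :: "nat \<Rightarrow> real" where "cov k = (if k < N0 then 0 else \<rho>)"

text \<open>Conditioned at the beginning of the generation instead of on \<open>G k\<close>. The two
  agree almost surely, and this version is measurable as early as the cut-off of the weights
  requires.\<close>

definition kurt :: "nat \<Rightarrow> nat \<Rightarrow> 'w \<Rightarrow> real" where
  "kurt c k \<omega> = (if k < N0 then 0 else real_cond_exp P (G (2 ^ floor_log k)) (\<lambda>\<omega>. \<epsilon> (2 * k + c) \<omega> ^ 4) \<omega>)"

lemma eps_L4: assumes "2 ^ p \<le> k" shows "L4 P (\<epsilon> k)"
proof -
  have "N0 \<le> k div 2" using assms two_N0 by linarith
  note * = Gen_floor_log[OF this]
  have "k = 2 * (k div 2) + k mod 2" by simp
  then have "k \<in> Gen (floor_log (k div 2) + 1)" using child_in_Gen[of "k div 2" _ "k mod 2"] * by simp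
  then show ?thesis using fourth * eps_rv[OF assms] by (auto simp: noise_moment_bounded_def L4_def)
qed

lemma noise_L4: "L4 P (noise c k)"
proof (cases "k < N0")
  case False
  then have "2 ^ p \<le> 2 * k + c" using two_N0 by linarith
  then show ?thesis using eps_L4 False by (simp add: noise_def[abs_def])
qed (simp add: noise_def[abs_def])

lemma noise_adapted: assumes "c \<le> 1" shows "noise c k \<in> borel_measurable (G (Suc k))"
proof (cases "k < N0")
  case False
  then have k: "N0 \<le> k" by simp
  define i where "i = 2 * k + c"
  have i: "2 ^ p \<le> i" "1 \<le> i" "i < 2 * Suc k" "i div 2 = k"
  proof -
    show i: "2 ^ p \<le> i" using k two_N0 by (simp add: i_def)
    have "1 \<le> (2::nat) ^ p" by simp
    then show "1 \<le> i" using i by linarith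
  qed (use assms in \<open>auto simp: i_def\<close>)
  obtain d where d: "\<And>\<omega>. \<omega> \<in> space P \<Longrightarrow> X i \<omega> = d 0 + (\<Sum>l=1..p. d l * X (k div 2 ^ (l - 1)) \<omega>) + \<epsilon> i \<omega>"
    using drift_cases[OF i(1)] i(4) by auto
  have "X (k div 2 ^ (l - 1)) \<in> borel_measurable (G (Suc k))" if "l \<in> {1..p}" for l
  proof (rule X_past)
    show "1 \<le> k div 2 ^ (l - 1)" using that k by (intro anc_pos) auto
    show "k div 2 ^ (l - 1) < 2 * Suc k" by (rule le_less_trans[OF div_le_dividend]) simp
  qed
  then have "(\<lambda>\<omega>. X i \<omega> - (d 0 + (\<Sum>l=1..p. d l * X (k div 2 ^ (l - 1)) \<omega>))) \<in> borel_measurable (G (Suc k))"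
    using X_past[OF i(2,3)]
    by (intro borel_measurable_diff borel_measurable_add borel_measurable_sum borel_measurable_times) auto
  moreover have "X i \<omega> - (d 0 + (\<Sum>l=1..p. d l * X (k div 2 ^ (l - 1)) \<omega>)) = noise c k \<omega>" if "\<omega> \<in> space P" for \<omega>
    using d[OF that] k by (simp add: noise_def i_def)
  ultimately show ?thesis by (subst measurable_cong[symmetric]) (auto simp: space_past)
qed (simp add: noise_def[abs_def])

lemma noise_transfer:
  fixes g :: "real \<times> real \<Rightarrow> real"
  assumes k: "N0 \<le> k" and g: "g \<in> borel_measurable borel" and gi: "integrable P (\<lambda>\<omega>. g (pair k \<omega>))"
    and h: "AE \<omega> in P. real_cond_exp P (tree_filtration P X (floor_log k)) (\<lambda>\<omega>. g (pair k \<omega>)) \<omega> = h \<omega>"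
  shows "AE \<omega> in P. real_cond_exp P (G k) (\<lambda>\<omega>. g (pair k \<omega>)) \<omega> = h \<omega>"
  using noise_cond_exp[of "floor_log k" k g] Gen_floor_log[OF k] g gi h by auto

lemma real_cond_exp_zero: "AE \<omega> in P. real_cond_exp P (G k) (\<lambda>\<omega>. 0) \<omega> = 0"
proof -
  interpret S: sigma_finite_subalgebra P "G k" by (rule sigma_finite_subalgebra_G)
  show ?thesis by (rule S.real_cond_exp_F_meas) auto
qed

lemma pick:
  assumes "c \<le> (1::nat)"
  obtains g :: "real \<times> real \<Rightarrow> real" where "g \<in> borel_measurable borel" "\<And>k \<omega>. \<epsilon> (2 * k + c) \<omega> = g (pair k \<omega>)"
proof (cases "c = 0")
  case True then show ?thesis using that[of fst] by (simp add: pair_def borel_measurable_fst_pair)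
next
  case False
  then have "c = 1" using assms by simp
  then show ?thesis using that[of snd] by (simp add: pair_def borel_measurable_snd_pair)
qed

lemma noise_mean: assumes c: "c \<le> 1" shows "AE \<omega> in P. real_cond_exp P (G k) (noise c k) \<omega> = 0"
proof (cases "k < N0")
  case False
  then have k: "N0 \<le> k" by simp
  note n = Gen_floor_log[OF k]
  obtain g where g: "g \<in> borel_measurable borel" "\<And>k \<omega>. \<epsilon> (2 * k + c) \<omega> = g (pair k \<omega>)" using pick[OF c] by blast
  have nk: "noise c k = (\<lambda>\<omega>. g (pair k \<omega>))" using k g(2) by (simp add: noise_def fun_eq_iff)
  have "AE \<omega> in P. real_cond_exp P (tree_filtration P X (floor_log k)) (\<epsilon> (2 * k + c)) \<omega> = 0"
    using mean_var n child_in_Gen[of k "floor_log k" c] c unfolding noise_mean_var_def by blast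
  then show ?thesis unfolding nk
    using noise_transfer[OF k g(1), of "\<lambda>_. 0"] L4_integrable[OF noise_L4[of c k]] unfolding nk by (simp add: g(2)[abs_def])
qed (use real_cond_exp_zero in \<open>simp add: noise_def[abs_def]\<close>)

lemma noise_var: assumes c: "c \<le> 1" shows "AE \<omega> in P. real_cond_exp P (G k) (\<lambda>\<omega>. (noise c k \<omega>)\<^sup>2) \<omega> = var k"
proof (cases "k < N0")
  case False
  then have k: "N0 \<le> k" by simp
  note n = Gen_floor_log[OF k]
  obtain g where g: "g \<in> borel_measurable borel" "\<And>k \<omega>. \<epsilon> (2 * k + c) \<omega> = g (pair k \<omega>)" using pick[OF c] by blast
  have nk: "noise c k = (\<lambda>\<omega>. g (pair k \<omega>))" using k g(2) by (simp add: noise_def fun_eq_iff)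
  have "AE \<omega> in P. real_cond_exp P (tree_filtration P X (floor_log k)) (\<lambda>\<omega>. \<epsilon> (2 * k + c) \<omega> ^ 2) \<omega> = \<sigma>2"
    using mean_var n child_in_Gen[of k "floor_log k" c] c unfolding noise_mean_var_def by blast
  then show ?thesis unfolding nk
    using noise_transfer[OF k, of "\<lambda>x. (g x)\<^sup>2" "\<lambda>_. \<sigma>2"] g(1) L4_square_integrable[OF noise_L4[of c k]] k unfolding nk
    by (simp add: g(2) var_def)
qed (use real_cond_exp_zero in \<open>simp add: noise_def[abs_def] var_def\<close>)

lemma noise_cov: "AE \<omega> in P. real_cond_exp P (G k) (\<lambda>\<omega>. noise 0 k \<omega> * noise 1 k \<omega>) \<omega> = cov k"
proof (cases "k < N0")
  case False
  then have k: "N0 \<le> k" by simp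
  note n = Gen_floor_log[OF k]
  have prod_meas: "(\<lambda>x. fst x * snd x) \<in> borel_measurable (borel :: (real \<times> real) measure)"
    by (intro borel_measurable_continuous_onI continuous_intros)
  have nk: "(\<lambda>\<omega>. noise 0 k \<omega> * noise 1 k \<omega>) = (\<lambda>\<omega>. fst (pair k \<omega>) * snd (pair k \<omega>))"
    using k by (simp add: noise_def fun_eq_iff pair_def)
  have "AE \<omega> in P. real_cond_exp P (tree_filtration P X (floor_log k)) (\<lambda>\<omega>. \<epsilon> (2 * k) \<omega> * \<epsilon> (2 * k + 1) \<omega>) \<omega> = \<rho>"
    using covar n child_in_Gen[of k "floor_log k" 0] child_in_Gen[of k "floor_log k" 1] unfolding noise_covariance_def
    by fastforce
  then show ?thesis unfolding nk
    using noise_transfer[OF k prod_meas, of "\<lambda>_. \<rho>"] L4_mult_integrable[OF noise_L4[of 0 k] noise_L4[of 1 k]] k unfolding nk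
    by (simp add: pair_def cov_def)
qed (use real_cond_exp_zero in \<open>simp add: noise_def[abs_def] cov_def\<close>)

lemma noise_fourth: assumes c: "c \<le> 1" shows "AE \<omega> in P. real_cond_exp P (G k) (\<lambda>\<omega>. (noise c k \<omega>) ^ 4) \<omega> = kurt c k \<omega>"
proof (cases "k < N0")
  case False
  then have k: "N0 \<le> k" by simp
  obtain g where g: "g \<in> borel_measurable borel" "\<And>k \<omega>. \<epsilon> (2 * k + c) \<omega> = g (pair k \<omega>)" using pick[OF c] by blast
  have nk: "noise c k = (\<lambda>\<omega>. g (pair k \<omega>))" using k g(2) by (simp add: noise_def fun_eq_iff)
  have "AE \<omega> in P. real_cond_exp P (tree_filtration P X (floor_log k)) (\<lambda>\<omega>. (g (pair k \<omega>)) ^ 4) \<omega> = kurt c k \<omega>"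
    using k by (simp add: kurt_def tree_filtration_eq_past g(2))
  then show ?thesis unfolding nk
    using noise_transfer[OF k, of "\<lambda>x. (g x) ^ 4" "kurt c k"] g(1) noise_L4[of c k] unfolding nk L4_def by simp
qed (use real_cond_exp_zero in \<open>simp add: noise_def[abs_def] kurt_def\<close>)

lemma kurt_meas: "kurt c k \<in> borel_measurable (G (2 ^ floor_log k))"
  by (cases "k < N0") (simp_all add: kurt_def[abs_def])

lemma kurt_bounded: assumes c: "c \<le> 1" shows "AE \<omega> in P. \<exists>C. \<forall>k. kurt c k \<omega> \<le> C"
proof -
  have "AE \<omega> in P. (SUP n\<in>{p - 1..}. SUP k\<in>Gen (n + 1).
        ereal (real_cond_exp P (tree_filtration P X n) (\<lambda>\<omega>. \<epsilon> k \<omega> ^ 4) \<omega>)) < \<infinity>"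
    using fourth by (simp add: noise_moment_bounded_def)
  then show ?thesis
  proof eventually_elim
    case (elim \<omega>)
    let ?S = "SUP n\<in>{p - 1..}. SUP k\<in>Gen (n + 1). ereal (real_cond_exp P (tree_filtration P X n) (\<lambda>\<omega>. \<epsilon> k \<omega> ^ 4) \<omega>)"
    have "\<exists>D. x \<le> ereal D" if "x < \<infinity>" for x :: ereal using that by (cases x) auto
    from this[OF elim] obtain D where D: "?S \<le> ereal D" ..
    \<comment> \<open>\<open>D\<close> bounds the vertices that carry noise, and 0 the
      others.\<close>
    have "kurt c k \<omega> \<le> max 0 D" for k
    proof (cases "k < N0")
      case False
      then have k: "N0 \<le> k" by simp
      note n = Gen_floor_log[OF k]
      have "ereal (kurt c k \<omega>) \<le> ?S"
      proof (rule SUP_upper2[where i = "floor_log k"])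
        have "kurt c k \<omega> = real_cond_exp P (tree_filtration P X (floor_log k)) (\<lambda>\<omega>. \<epsilon> (2 * k + c) \<omega> ^ 4) \<omega>"
          using k by (simp add: kurt_def tree_filtration_eq_past)
        then show "ereal (kurt c k \<omega>) \<le> (SUP l\<in>Gen (floor_log k + 1). ereal (real_cond_exp P (tree_filtration P X (floor_log k)) (\<lambda>\<omega>. \<epsilon> l \<omega> ^ 4) \<omega>))"
          using n child_in_Gen[of k "floor_log k" c] c by (intro SUP_upper2[where i = "2 * k + c"]) auto
      qed (use n in simp)
      also note D
      finally have "kurt c k \<omega> \<le> D" by (simp only: ereal_less_eq)
      then show ?thesis by simp
    qed (simp add: kurt_def)
    then show ?case by blast
  qed
qed

text \<open>\<open>Q\<close> stands for \<open>L4\<close> or \<open>L8\<close>. Strong induction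
  works because a later state is a constant plus a linear combination of strictly older states plus
  noise; \<open>cong\<close> speaks of \<open>space P\<close>, where the recursion holds.\<close>

lemma X_power_integrable_induct:
  assumes base: "\<And>k. 1 \<le> k \<Longrightarrow> k < 2 ^ p \<Longrightarrow> Q (X k)"
    and eps: "\<And>k. 2 ^ p \<le> k \<Longrightarrow> Q (\<epsilon> k)" and const: "\<And>c. Q (\<lambda>\<omega>. c)"
    and add: "\<And>f g. Q f \<Longrightarrow> Q g \<Longrightarrow> Q (\<lambda>\<omega>. f \<omega> + g \<omega>)" and cmult: "\<And>f c. Q f \<Longrightarrow> Q (\<lambda>\<omega>. c * f \<omega>)"
    and cong: "\<And>f g. (\<And>\<omega>. \<omega> \<in> space P \<Longrightarrow> f \<omega> = g \<omega>) \<Longrightarrow> Q g \<Longrightarrow> Q f"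
    and i: "1 \<le> i"
  shows "Q (X i)"
  using i
proof (induction i rule: less_induct)
  case (less i)
  show ?case
  proof (cases "i < 2 ^ p")
    case False
    then have i: "2 ^ p \<le> i" by simp
    obtain d where d: "\<And>\<omega>. \<omega> \<in> space P \<Longrightarrow> X i \<omega> = d 0 + (\<Sum>l=1..p. d l * X (i div 2 div 2 ^ (l - 1)) \<omega>) + \<epsilon> i \<omega>"
      using drift_cases[OF i] by blast
    have N: "N0 \<le> i div 2" using i two_N0 by linarith
    have IH: "Q (X (i div 2 div 2 ^ (l - 1)))" if "l \<in> {1..p}" for l
    proof (rule less.IH)
      show "i div 2 div 2 ^ (l - 1) < i"
        by (rule le_less_trans[OF div_le_dividend]) (use less.prems in auto)
      show "1 \<le> i div 2 div 2 ^ (l - 1)" using that N by (intro anc_pos) auto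
    qed
    have "Q (\<lambda>\<omega>. \<Sum>l\<in>J. d l * X (i div 2 div 2 ^ (l - 1)) \<omega>)" if "finite J" "J \<subseteq> {1..p}" for J
      using that
    proof (induction J rule: finite_induct)
      case empty then show ?case using const[of 0] by simp
    next
      case (insert l J)
      have "Q (\<lambda>\<omega>. d l * X (i div 2 div 2 ^ (l - 1)) \<omega> + (\<Sum>l\<in>J. d l * X (i div 2 div 2 ^ (l - 1)) \<omega>))"
        using insert IH by (intro add cmult) auto
      then show ?case using insert.hyps by simp
    qed
    from this[of "{1..p}"] have "Q (\<lambda>\<omega>. d 0 + (\<Sum>l=1..p. d l * X (i div 2 div 2 ^ (l - 1)) \<omega>) + \<epsilon> i \<omega>)"
      by (intro add const eps i) auto
    then show ?thesis by (rule cong[rotated]) (rule d)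
  qed (use base less.prems in auto)
qed

lemma X_L4: assumes "1 \<le> i" shows "L4 P (X i)"
proof (rule X_power_integrable_induct[where Q = "L4 P", OF _ _ _ _ _ _ assms])
  show "L4 P (X k)" if "1 \<le> k" "k < 2 ^ p" for k
    using initial[OF that] X_rv[OF that(1)] by (intro L8_imp_L4) (simp add: L8_iff)
  show "L4 P f" if "\<And>\<omega>. \<omega> \<in> space P \<Longrightarrow> f \<omega> = g \<omega>" "L4 P g" for f g
  proof -
    have "f \<in> borel_measurable P \<longleftrightarrow> g \<in> borel_measurable P" by (rule measurable_cong) (rule that(1))
    moreover have "integrable P (\<lambda>\<omega>. f \<omega> ^ 4) \<longleftrightarrow> integrable P (\<lambda>\<omega>. g \<omega> ^ 4)"
      by (rule Bochner_Integration.integrable_cong[OF refl]) (simp only: that(1))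
    ultimately show ?thesis using that(2) unfolding L4_def by (simp only:)
  qed
qed (auto intro: eps_L4 L4_add L4_cmult)

lemma X_L8: assumes eps8: "\<And>k. 2 ^ p \<le> k \<Longrightarrow> L8 P (\<epsilon> k)" and i: "1 \<le> i" shows "L8 P (X i)"
proof (rule X_power_integrable_induct[where Q = "L8 P", OF _ _ _ _ _ _ i])
  show "L8 P (X k)" if "1 \<le> k" "k < 2 ^ p" for k
    using initial[OF that] X_rv[OF that(1)] by (simp add: L8_iff)
  show "L8 P f" if "\<And>\<omega>. \<omega> \<in> space P \<Longrightarrow> f \<omega> = g \<omega>" "L8 P g" for f g
  proof -
    have "f \<in> borel_measurable P \<longleftrightarrow> g \<in> borel_measurable P" by (rule measurable_cong) (rule that(1))
    moreover have "integrable P (\<lambda>\<omega>. f \<omega> ^ 8) \<longleftrightarrow> integrable P (\<lambda>\<omega>. g \<omega> ^ 8)"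
      by (rule Bochner_Integration.integrable_cong[OF refl]) (simp only: that(1))
    ultimately show ?thesis using that(2) unfolding L8_iff by (simp only:)
  qed
qed (auto intro: eps8 L8_add L8_cmult)

end

section \<open>Norms, contractions and companion matrices\<close>

lemma is_norm_nonneg: "is_norm N \<Longrightarrow> 0 \<le> N u"
  and is_norm_eq_0: "is_norm N \<Longrightarrow> N u = 0 \<longleftrightarrow> u = 0"
  and is_norm_scaleR: "is_norm N \<Longrightarrow> N (c *\<^sub>R u) = \<bar>c\<bar> * N u"
  and is_norm_triangle: "is_norm N \<Longrightarrow> N (u + v) \<le> N u + N v"
  by (auto simp: is_norm_def)

lemma is_norm_0: "is_norm N \<Longrightarrow> N 0 = 0"
  by (simp add: is_norm_eq_0)

lemma is_norm_sum: "is_norm N \<Longrightarrow> N (\<Sum>i\<in>I. f i) \<le> (\<Sum>i\<in>I. N (f i))"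
proof (induction I rule: infinite_finite_induct)
  case (insert i I)
  then show ?case using is_norm_triangle[of N "f i" "sum f I"] by simp
qed (simp_all add: is_norm_0)

lemma is_norm_upper:
  fixes N :: "'v::euclidean_space \<Rightarrow> real"
  assumes N: "is_norm N"
  obtains C where "0 < C" "\<And>x. N x \<le> C * norm x"
proof
  show "0 < 1 + (\<Sum>b\<in>Basis. N b)" using is_norm_nonneg[OF N] by (intro add_pos_nonneg sum_nonneg) auto
  fix x
  have "N x = N (\<Sum>b\<in>Basis. (x \<bullet> b) *\<^sub>R b)" by (simp add: euclidean_representation)
  also have "\<dots> \<le> (\<Sum>b\<in>Basis. N ((x \<bullet> b) *\<^sub>R b))" by (rule is_norm_sum[OF N])
  also have "\<dots> \<le> (\<Sum>b\<in>Basis. norm x * N b)"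
    unfolding is_norm_scaleR[OF N] using is_norm_nonneg[OF N] Basis_le_norm by (intro sum_mono mult_right_mono) auto
  also have "\<dots> = norm x * (\<Sum>b\<in>Basis. N b)" by (simp add: sum_distrib_left)
  also have "\<dots> \<le> (1 + (\<Sum>b\<in>Basis. N b)) * norm x" by (simp add: algebra_simps)
  finally show "N x \<le> (1 + (\<Sum>b\<in>Basis. N b)) * norm x" .
qed

lemma is_norm_continuous:
  fixes N :: "'v::euclidean_space \<Rightarrow> real"
  assumes N: "is_norm N" shows "continuous_on S N"
proof -
  obtain C where C: "0 < C" "\<And>x. N x \<le> C * norm x" using is_norm_upper[OF N] by blast
  have tri: "N x - N y \<le> C * norm (x - y)" for x y
    using is_norm_triangle[OF N, of "x - y" y] C(2)[of "x - y"] by simp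
  show ?thesis
  proof (rule continuous_on_iff[THEN iffD2], intro ballI allI impI)
    fix x :: 'v and e :: real assume e: "0 < e"
    show "\<exists>d>0. \<forall>y\<in>S. dist y x < d \<longrightarrow> dist (N y) (N x) < e"
    proof (intro exI[of _ "e / C"] conjI ballI impI)
      fix y assume "dist y x < e / C"
      then have "C * norm (y - x) < e" using C(1) by (simp add: dist_norm field_simps)
      then show "dist (N y) (N x) < e" using tri[of x y] tri[of y x] by (simp add: dist_real_def norm_minus_commute)
    qed (use e C in auto)
  qed
qed

lemma is_norm_lower:
  fixes N :: "'v::euclidean_space \<Rightarrow> real"
  assumes N: "is_norm N"
  obtains c where "0 < c" "\<And>x. c * norm x \<le> N x"
proof -
  have "sphere 0 1 \<noteq> ({} :: 'v set)" using vector_choose_size[of 1, where 'a = 'v] by auto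
  then obtain x0 :: 'v where x0: "norm x0 = 1" "\<And>y. norm y = 1 \<Longrightarrow> N x0 \<le> N y"
    using continuous_attains_inf[OF compact_sphere _ is_norm_continuous[OF N], of 0 1] by auto
  show ?thesis
  proof
    have "x0 \<noteq> 0" using x0(1) by auto
    then show "0 < N x0" using is_norm_nonneg[OF N, of x0] is_norm_eq_0[OF N, of x0] by linarith
    fix x
    show "N x0 * norm x \<le> N x"
    proof (cases "x = 0")
      case False
      have "N x0 \<le> N ((1 / norm x) *\<^sub>R x)" using False by (intro x0(2)) simp
      then show ?thesis using False by (simp add: is_norm_scaleR[OF N] field_simps)
    qed (simp add: is_norm_0[OF N])
  qed
qed

lemma is_norm_tendsto_0_iff:
  fixes N :: "'v::euclidean_space \<Rightarrow> real"
  assumes N: "is_norm N"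
  shows "((\<lambda>n. N (z n)) \<longlongrightarrow> 0) F \<longleftrightarrow> (z \<longlongrightarrow> 0) F"
proof
  obtain c where c: "0 < c" "\<And>x. c * norm x \<le> N x" using is_norm_lower[OF N] by blast
  assume "((\<lambda>n. N (z n)) \<longlongrightarrow> 0) F"
  from tendsto_divide[OF this tendsto_const[of c]] c(1) have lim: "((\<lambda>n. N (z n) / c) \<longlongrightarrow> 0) F" by simp
  have "norm (z n) \<le> N (z n) / c" for n using c by (simp add: pos_le_divide_eq mult.commute)
  then show "(z \<longlongrightarrow> 0) F" by (intro Lim_null_comparison[OF _ lim] always_eventually) auto
next
  obtain C where C: "0 < C" "\<And>x. N x \<le> C * norm x" using is_norm_upper[OF N] by blast
  assume "(z \<longlongrightarrow> 0) F"
  from tendsto_mult[OF tendsto_const[of C] tendsto_norm[OF this]] have lim: "((\<lambda>n. C * norm (z n)) \<longlongrightarrow> 0) F" by simp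
  show "((\<lambda>n. N (z n)) \<longlongrightarrow> 0) F"
    by (rule Lim_null_comparison[OF _ lim]) (use C is_norm_nonneg[OF N] in auto)
qed

lemma is_norm_contraction_tendsto_0:
  fixes N :: "'v::euclidean_space \<Rightarrow> real"
  assumes N: "is_norm N" and \<Phi>: "\<And>x. N (\<Phi> x) \<le> \<gamma> * N x" and \<gamma>: "0 \<le> \<gamma>" "\<gamma> < 1"
    and rec: "eventually (\<lambda>n. z (Suc n) = \<Phi> (z n) + r n) sequentially" and r: "r \<longlonglongrightarrow> 0"
  shows "z \<longlonglongrightarrow> 0"
proof -
  have "(\<lambda>n. N (z n)) \<longlonglongrightarrow> 0"
  proof (rule contraction_recursion_LIMSEQ_0[OF \<gamma>])
    show "\<forall>\<^sub>F n in sequentially. N (z (Suc n)) \<le> \<gamma> * N (z n) + N (r n)"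
      using rec
    proof eventually_elim
      case (elim n)
      show ?case unfolding elim using is_norm_triangle[OF N, of "\<Phi> (z n)" "r n"] \<Phi>[of "z n"] by linarith
    qed
    show "(\<lambda>n. N (r n)) \<longlonglongrightarrow> 0" using r by (simp add: is_norm_tendsto_0_iff[OF N])
  qed (rule is_norm_nonneg[OF N])
  then show ?thesis by (simp add: is_norm_tendsto_0_iff[OF N])
qed

text \<open>A contraction has no nonzero fixed point, so x - \<Phi> x is injective and, in finite
  dimension, surjective. It serves both for the matrix behind \<lambda> and for the equation of
  \<ell>.\<close>

lemma is_norm_contraction_surj:
  fixes N :: "'v::euclidean_space \<Rightarrow> real"
  assumes N: "is_norm N" and lin: "linear \<Phi>" and \<Phi>: "\<And>x. N (\<Phi> x) \<le> \<gamma> * N x" and \<gamma>: "\<gamma> < 1"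
  shows "\<exists>!x. x = t + \<Phi> x"
proof -
  have lin': "linear (\<lambda>x. x - \<Phi> x)" by (intro linear_compose_sub linear_id[unfolded id_def] lin)
  have z: "x = 0" if "x - \<Phi> x = 0" for x
  proof -
    have "N x \<le> \<gamma> * N x" using \<Phi>[of x] that by simp
    then have "(1 - \<gamma>) * N x \<le> 0" by (simp add: algebra_simps)
    then have "N x \<le> 0" using \<gamma> by (simp add: mult_le_0_iff)
    then show ?thesis using is_norm_nonneg[OF N, of x] is_norm_eq_0[OF N, of x] by linarith
  qed
  then have inj: "inj (\<lambda>x. x - \<Phi> x)" using linear_injective_0[OF lin'] by blast
  then have "surj (\<lambda>x. x - \<Phi> x)" by (rule linear_inj_imp_surj[OF lin'])
  then obtain x where x: "t = x - \<Phi> x" by (rule surjE)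
  show ?thesis
  proof (rule ex1I[of _ x])
    show "x = t + \<Phi> x" using x by simp
    fix y assume "y = t + \<Phi> y"
    then have "y - \<Phi> y = t" by (rule diff_eq_eq[THEN iffD2])
    then have "y - \<Phi> y = x - \<Phi> x" using x by (simp only:)
    then show "y = x" by (rule injD[OF inj])
  qed
qed

lemma op_norm_bound:
  fixes N :: "real ^ 'n \<Rightarrow> real"
  assumes N: "is_norm N"
  shows "N (A *v u) \<le> op_norm N A * N u" and "0 \<le> op_norm N A"
proof -
  obtain c where c: "0 < c" "\<And>x. c * norm x \<le> N x" using is_norm_lower[OF N] by blast
  obtain C where C: "0 < C" "\<And>x. N x \<le> C * norm x" using is_norm_upper[OF N] by blast
  obtain K where K: "\<And>x. norm (A *v x) \<le> norm x * K"
    using bounded_linear.bounded[OF matrix_vector_mul_bounded_linear[of A]] by blast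
  \<comment> \<open>A supremum of reals is meaningful only for a set bounded above. Here the unit
    sphere of \<open>N\<close> is bounded because \<open>N\<close> dominates a multiple of the
    Euclidean norm.\<close>
  have bdd: "bdd_above ((\<lambda>u. N (A *v u)) ` {u. N u = 1})"
  proof (rule bdd_aboveI2)
    fix u assume "u \<in> {u. N u = 1}"
    then have nu: "norm u \<le> 1 / c" using c(2)[of u] c(1) by (simp add: field_simps)
    have "N (A *v u) \<le> C * (norm u * K)" using C(2)[of "A *v u"] mult_left_mono[OF K[of u], of C] C(1) by linarith
    also have "\<dots> \<le> C * (norm u * \<bar>K\<bar>)" using C(1) by (intro mult_left_mono) auto
    also have "\<dots> \<le> C * (1 / c * \<bar>K\<bar>)"
      using C(1) nu by (intro mult_left_mono mult_right_mono) auto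
    finally show "N (A *v u) \<le> C * (1 / c * \<bar>K\<bar>)" .
  qed
  have one: "N (A *v u) \<le> op_norm N A" if "N u = 1" for u
    unfolding op_norm_def by (rule cSUP_upper[OF _ bdd]) (simp add: that)
  obtain v :: "real ^ 'n" where v: "v \<noteq> 0" using vector_choose_size[of 1, where 'a = "real ^ 'n"] by (metis norm_zero zero_le_one zero_neq_one)
  have sc: "N ((1 / N w) *\<^sub>R w) = 1" if "w \<noteq> 0" for w
    using that is_norm_eq_0[OF N, of w] is_norm_nonneg[OF N, of w] by (simp add: is_norm_scaleR[OF N])
  show "0 \<le> op_norm N A" using one[OF sc[OF v]] is_norm_nonneg[OF N] by (rule order_trans[rotated])
  show "N (A *v u) \<le> op_norm N A * N u"
  proof (cases "u = 0")
    case False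
    then have "0 < N u" using is_norm_eq_0[OF N, of u] is_norm_nonneg[OF N, of u] by linarith
    then show ?thesis using one[OF sc[OF False]] by (simp add: matrix_vector_mult_scaleR is_norm_scaleR[OF N] field_simps)
  qed (simp add: is_norm_0[OF N])
qed

text \<open>A norm on matrices for which congruence K \<mapsto> A K A^T contracts by the square of the factor of A:
  the operator norm of K from the dual norm of N to N.\<close>

definition polar :: "(real ^ 'n \<Rightarrow> real) \<Rightarrow> (real ^ 'n) set" where
  "polar N = {v. \<forall>x. \<bar>v \<bullet> x\<bar> \<le> N x}"

definition tensor_norm :: "(real ^ 'n \<Rightarrow> real) \<Rightarrow> real ^ 'n ^ 'n \<Rightarrow> real" where
  "tensor_norm N K = (SUP v\<in>polar N. N (K *v v))"

context
  fixes N :: "real ^ 'n \<Rightarrow> real"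
  assumes N: "is_norm N"
begin

lemma polar_0: "0 \<in> polar N"
  by (simp add: polar_def is_norm_nonneg[OF N])

lemma tensor_norm_bdd: "bdd_above ((\<lambda>v. N (K *v v)) ` polar N)"
proof -
  obtain C where C: "0 < C" "\<And>x. N x \<le> C * norm x" using is_norm_upper[OF N] by blast
  obtain D where D: "\<And>x. norm (K *v x) \<le> norm x * D"
    using bounded_linear.bounded[OF matrix_vector_mul_bounded_linear[of K]] by blast
  show ?thesis
  proof (rule bdd_aboveI2)
    fix v assume "v \<in> polar N"
    \<comment> \<open>Testing the polar condition with x = v bounds the polar: norm v^2 \<le> C *
      norm v.\<close>
    then have "\<bar>v \<bullet> v\<bar> \<le> N v" unfolding polar_def by blast
    then have "\<bar>v \<bullet> v\<bar> \<le> C * norm v" using C(2)[of v] by linarith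
    then have "norm v * norm v \<le> C * norm v" by (simp add: dot_square_norm power2_eq_square)
    then have nv: "norm v \<le> C" using C(1) by (cases "v = 0") auto
    have "N (K *v v) \<le> C * (norm v * D)" using C(2)[of "K *v v"] mult_left_mono[OF D[of v], of C] C(1) by linarith
    also have "\<dots> \<le> C * (norm v * \<bar>D\<bar>)" using C(1) by (intro mult_left_mono) auto
    also have "\<dots> \<le> C * (C * \<bar>D\<bar>)" using C(1) nv by (intro mult_left_mono mult_right_mono) auto
    finally show "N (K *v v) \<le> C * (C * \<bar>D\<bar>)" .
  qed
qed

lemma tensor_norm_upper: "v \<in> polar N \<Longrightarrow> N (K *v v) \<le> tensor_norm N K"
  unfolding tensor_norm_def by (rule cSUP_upper[OF _ tensor_norm_bdd])

lemma tensor_norm_least: "(\<And>v. v \<in> polar N \<Longrightarrow> N (K *v v) \<le> c) \<Longrightarrow> tensor_norm N K \<le> c"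
  unfolding tensor_norm_def using polar_0 by (intro cSUP_least) auto

lemma tensor_norm_nonneg: "0 \<le> tensor_norm N K"
  using tensor_norm_upper[OF polar_0, of K] by (simp add: is_norm_0[OF N])

lemma tensor_norm_scaleR_le: "tensor_norm N (c *\<^sub>R K) \<le> \<bar>c\<bar> * tensor_norm N K"
  by (rule tensor_norm_least)
     (auto simp: scaleR_matrix_vector_assoc[symmetric] is_norm_scaleR[OF N] intro!: mult_left_mono tensor_norm_upper)

lemma is_norm_tensor_norm: "is_norm (tensor_norm N)"
  unfolding is_norm_def
proof (intro conjI allI)
  show "0 \<le> tensor_norm N K" for K by (rule tensor_norm_nonneg)
  show "tensor_norm N K = 0 \<longleftrightarrow> K = 0" for K
  proof
    assume K: "tensor_norm N K = 0"
    obtain c where c: "0 < c" "\<And>x. c * norm x \<le> N x" using is_norm_lower[OF N] by blast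
    have "K *v w = 0" for w
    proof (cases "w = 0")
      case False
      \<comment> \<open>The polar contains a positive multiple of every direction, so
        \<open>K\<close> vanishes on all vectors when its norm is 0.\<close>
      have "(c / norm w) *\<^sub>R w \<in> polar N"
        unfolding polar_def
      proof (intro CollectI allI)
        fix x
        have "\<bar>((c / norm w) *\<^sub>R w) \<bullet> x\<bar> \<le> norm ((c / norm w) *\<^sub>R w) * norm x" by (rule Cauchy_Schwarz_ineq2)
        also have "\<dots> = c * norm x" using False c(1) by simp
        finally show "\<bar>((c / norm w) *\<^sub>R w) \<bullet> x\<bar> \<le> N x" using c(2)[of x] by linarith
      qed
      from tensor_norm_upper[OF this, of K] K have "N (K *v ((c / norm w) *\<^sub>R w)) = 0"
        using is_norm_nonneg[OF N, of "K *v ((c / norm w) *\<^sub>R w)"] by linarith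
      then show ?thesis using False c(1) by (simp add: is_norm_eq_0[OF N] matrix_vector_mult_scaleR)
    qed simp
    then show "K = 0" by (simp add: matrix_eq)
  next
    assume "K = 0"
    moreover have "polar N \<noteq> {}" using polar_0 by auto
    ultimately show "tensor_norm N K = 0" by (simp add: tensor_norm_def is_norm_0[OF N])
  qed
  show "tensor_norm N (c *\<^sub>R K) = \<bar>c\<bar> * tensor_norm N K" for c K
  proof (cases "c = 0")
    case False
    have "tensor_norm N K = tensor_norm N ((1 / c) *\<^sub>R (c *\<^sub>R K))" using False by simp
    also have "\<dots> \<le> \<bar>1 / c\<bar> * tensor_norm N (c *\<^sub>R K)" by (rule tensor_norm_scaleR_le)
    finally have "\<bar>c\<bar> * tensor_norm N K \<le> tensor_norm N (c *\<^sub>R K)" using False by (simp add: field_simps)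
    then show ?thesis using tensor_norm_scaleR_le[of c K] by linarith
  qed (use tensor_norm_scaleR_le[of 0 K] tensor_norm_nonneg[of "0 *\<^sub>R K"] in simp)
  show "tensor_norm N (K + L) \<le> tensor_norm N K + tensor_norm N L" for K L
  proof (rule tensor_norm_least)
    fix v assume v: "v \<in> polar N"
    have "N ((K + L) *v v) \<le> N (K *v v) + N (L *v v)"
      using is_norm_triangle[OF N, of "K *v v" "L *v v"] by (simp add: matrix_vector_mult_add_rdistrib)
    then show "N ((K + L) *v v) \<le> tensor_norm N K + tensor_norm N L"
      using tensor_norm_upper[OF v, of K] tensor_norm_upper[OF v, of L] by linarith
  qed
qed

text \<open>\<open>A\<close> on the left gives the factor \<open>\<beta>\<close>; on the right, the
  transpose of \<open>A\<close> maps the polar into itself.\<close>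

lemma tensor_norm_congruence:
  assumes A: "\<And>u. N (A *v u) \<le> \<beta> * N u" and \<beta>: "0 \<le> \<beta>" "\<beta> < 1"
  shows "tensor_norm N (A ** K ** transpose A) \<le> \<beta> * tensor_norm N K"
proof (rule tensor_norm_least)
  fix v assume v: "v \<in> polar N"
  have "transpose A *v v \<in> polar N"
    unfolding polar_def
  proof (intro CollectI allI)
    fix x
    have "\<bar>(transpose A *v v) \<bullet> x\<bar> = \<bar>v \<bullet> (A *v x)\<bar>" using dot_lmul_matrix[of v A x] by (simp add: transpose_matrix_vector)
    also have "\<dots> \<le> N (A *v x)" using v by (simp add: polar_def)
    also have "\<dots> \<le> \<beta> * N x" by (rule A)
    also have "\<dots> \<le> N x" using \<beta> is_norm_nonneg[OF N, of x] by (intro mult_left_le_one_le) auto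
    finally show "\<bar>(transpose A *v v) \<bullet> x\<bar> \<le> N x" .
  qed
  from tensor_norm_upper[OF this, of K] have "N (A *v (K *v (transpose A *v v))) \<le> \<beta> * tensor_norm N K"
    by (intro order_trans[OF A] mult_left_mono \<beta>(1))
  then show "N ((A ** K ** transpose A) *v v) \<le> \<beta> * tensor_norm N K"
    by (simp only: matrix_vector_mul_assoc matrix_mul_assoc)
qed

end

section \<open>Inverse matrices and their continuity\<close>

lemma matrix_inv_inverse:
  fixes A :: "real ^ 'd ^ 'd"
  assumes "invertible A" shows "A ** matrix_inv A = mat 1" and "matrix_inv A ** A = mat 1"
  using someI_ex[OF assms[unfolded invertible_def]] by (auto simp: matrix_inv_def)

text \<open>Cramer's rule writes the entries of the inverse as quotients of determinants, which are
  polynomials in the entries of the matrix.\<close>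

lemma tendsto_matrix_inv:
  fixes S :: "nat \<Rightarrow> real ^ 'd ^ 'd"
  assumes S: "S \<longlonglongrightarrow> L" and L: "invertible L"
  shows "eventually (\<lambda>n. invertible (S n)) sequentially" and "(\<lambda>n. matrix_inv (S n)) \<longlonglongrightarrow> matrix_inv L"
proof -
  have ent: "(\<lambda>n. S n $ i $ j) \<longlonglongrightarrow> L $ i $ j" for i j by (intro tendsto_vec_nth S)
  have det: "(\<lambda>n. det (S n)) \<longlonglongrightarrow> det L" unfolding det_def by (intro tendsto_intros ent)
  have L0: "det L \<noteq> 0" using L by (simp add: invertible_det_nz)
  from tendsto_imp_eventually_ne[OF det L0] show ev: "eventually (\<lambda>n. invertible (S n)) sequentially"
    by (simp add: invertible_det_nz)
  have inv: "matrix_inv A $ i $ j = det (\<chi> k l. if l = i then axis j 1 $ k else A $ k $ l) / det A" if A: "invertible A" for A :: "real ^ 'd ^ 'd" and i j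
  proof -
    have "A *v (matrix_inv A *v axis j 1) = axis j 1"
      using A by (simp add: matrix_vector_mul_assoc matrix_inv_inverse)
    then have "matrix_inv A *v axis j 1 = (\<chi> k. det (\<chi> i l. if l = k then axis j 1 $ i else A $ i $ l) / det A)"
      using cramer[of A] A by (simp add: invertible_det_nz)
    then have "(matrix_inv A *v axis j 1) $ i = det (\<chi> k l. if l = i then axis j 1 $ k else A $ k $ l) / det A" by simp
    then show ?thesis by (simp add: matrix_vector_mult_basis column_def)
  qed
  have "(\<lambda>n. matrix_inv (S n) $ i $ j) \<longlonglongrightarrow> matrix_inv L $ i $ j" for i j
  proof (rule Lim_transform_eventually)
    show "\<forall>\<^sub>F n in sequentially. det (\<chi> k l. if l = i then axis j 1 $ k else S n $ k $ l) / det (S n) = matrix_inv (S n) $ i $ j"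
      using ev by eventually_elim (simp add: inv)
    have "(\<lambda>n. det (\<chi> k l. if l = i then axis j 1 $ k else S n $ k $ l)) \<longlonglongrightarrow> det (\<chi> k l. if l = i then axis j 1 $ k else L $ k $ l)"
      unfolding det_def using ent by (intro tendsto_intros) auto
    from tendsto_divide[OF this det L0]
    show "(\<lambda>n. det (\<chi> k l. if l = i then axis j 1 $ k else S n $ k $ l) / det (S n)) \<longlonglongrightarrow> matrix_inv L $ i $ j"
      by (simp add: inv[OF L])
  qed
  then show "(\<lambda>n. matrix_inv (S n)) \<longlonglongrightarrow> matrix_inv L"
    by (intro vec_tendstoI) auto
qed

section \<open>Numbered coordinates and companion matrices\<close>

lemma pos_bij: "bij_betw (pos :: 'n::{finite,linorder} \<Rightarrow> nat) UNIV {1..CARD('n)}"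
proof -
  have mono: "pos i < pos j" if "i < j" for i j :: 'n
    unfolding pos_def by (rule psubset_card_mono) (use that in auto)
  have inj: "inj (pos :: 'n \<Rightarrow> nat)"
  proof (rule injI)
    fix i j :: 'n assume "pos i = pos j" then show "i = j" using mono[of i j] mono[of j i] by (cases i j rule: linorder_cases) auto
  qed
  have sub: "range (pos :: 'n \<Rightarrow> nat) \<subseteq> {1..CARD('n)}"
  proof safe
    fix i :: 'n
    have "0 < pos i" unfolding pos_def by (subst card_gt_0_iff) auto
    moreover have "pos i \<le> CARD('n)" unfolding pos_def by (rule card_mono) auto
    ultimately show "pos i \<in> {1..CARD('n)}" by simp
  qed
  have "range (pos :: 'n \<Rightarrow> nat) = {1..CARD('n)}"
    by (rule card_subset_eq[OF _ sub]) (simp_all add: card_image[OF inj])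
  then show ?thesis using inj by (simp add: bij_betw_def)
qed

lemma pos_inj: "pos i = pos j \<longleftrightarrow> i = (j :: 'n::{finite,linorder})"
  using bij_betw_imp_inj_on[OF pos_bij] by (auto simp: inj_def)

lemma pos_range: "1 \<le> pos (i :: 'n::{finite,linorder}) \<and> pos i \<le> CARD('n)"
  using bij_betw_imp_surj_on[OF pos_bij[where 'n = 'n]] by auto

lemma pos_obtain:
  assumes "1 \<le> l" "l \<le> CARD('n)"
  obtains i :: "'n::{finite,linorder}" where "pos i = l"
proof -
  have "l \<in> range (pos :: 'n \<Rightarrow> nat)" using bij_betw_imp_surj_on[OF pos_bij[where 'n = 'n]] assms by auto
  then show ?thesis using that by auto
qed

lemma sum_pos: "(\<Sum>i\<in>UNIV. f (pos (i :: 'n::{finite,linorder}))) = (\<Sum>l=1..CARD('n). f l)"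
  by (rule sum.reindex_bij_betw[OF pos_bij])

lemma companion_mult_first:
  assumes "pos i = 1"
  shows "(companion c *v v) $ i = (\<Sum>j\<in>UNIV. c (pos j) * v $ j)"
  using assms by (simp add: companion_def matrix_vector_mult_def)

lemma companion_mult_next:
  assumes "pos i = pos j + 1"
  shows "(companion c *v v) $ i = v $ (j :: 'n::{finite,linorder})"
proof -
  have "(companion c *v v) $ i = (\<Sum>l\<in>UNIV. if l = j then v $ l else 0)"
    unfolding matrix_vector_mult_def companion_def vec_lambda_beta
    using assms pos_range[of j] by (intro sum.cong refl) (auto simp: pos_inj)
  then show ?thesis by simp
qed

text \<open>When the first coordinate of \<open>u\<close> vanishes, the first row of the companion
  matrix contributes nothing and only the ones on the subdiagonal act. This lets null vectors of the
  limiting form be emptied one coordinate at a time.\<close>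

lemma transpose_companion_shift:
  assumes "pos j' = pos j + 1" and "\<And>i. pos i = 1 \<Longrightarrow> u $ i = 0"
  shows "(transpose (companion c) *v u) $ j = u $ (j' :: 'n::{finite,linorder})"
proof -
  have "(transpose (companion c) *v u) $ j = (\<Sum>l\<in>UNIV. if l = j' then u $ l else 0)"
    unfolding matrix_vector_mult_def transpose_def companion_def vec_lambda_beta
    using assms pos_range[of j] by (intro sum.cong refl) (auto simp: pos_inj[symmetric])
  then show ?thesis by simp
qed

section \<open>Laws of large numbers on the tree\<close>

context filtered_prob_space
begin

lemma mds_orthogonal:
  assumes "f \<in> borel_measurable (G k)" and sqf: "integrable M (\<lambda>\<omega>. (f \<omega>)\<^sup>2)"
    and [measurable]: "g \<in> borel_measurable M" and sqg: "integrable M (\<lambda>\<omega>. (g \<omega>)\<^sup>2)"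
    and "AE \<omega> in M. real_cond_exp M (G k) g \<omega> = 0"
  shows "expectation (\<lambda>\<omega>. f \<omega> * g \<omega>) = 0"
proof -
  have [measurable]: "f \<in> borel_measurable M" using assms(1) by (rule measurable_G_M)
  have "expectation (\<lambda>\<omega>. f \<omega> * g \<omega>) = expectation (\<lambda>\<omega>. f \<omega> * 0)"
    by (rule expectation_mult_cond_exp(1)[OF assms(1) _ square_integrable_mult[OF _ _ sqf sqg] assms(5)]) auto
  then show ?thesis by simp
qed

lemma mds_strong_law:
  assumes meas: "\<And>k. \<xi> k \<in> borel_measurable (G (Suc k))"
    and sq: "\<And>k. integrable M (\<lambda>\<omega>. (\<xi> k \<omega>)\<^sup>2)"
    and mean: "\<And>k. AE \<omega> in M. real_cond_exp M (G k) (\<xi> k) \<omega> = 0"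
    and bound: "\<And>k. expectation (\<lambda>\<omega>. (\<xi> k \<omega>)\<^sup>2) \<le> C"
  shows "AE \<omega> in M. (\<lambda>n. (\<Sum>k<2 ^ n. \<xi> k \<omega>) / 2 ^ n) \<longlonglongrightarrow> 0"
proof -
  have measM: "\<xi> k \<in> borel_measurable M" for k by (rule measurable_G_M[OF meas])
  have "AE \<omega> in M. (\<lambda>n. (\<Sum>k<n. \<xi> k \<omega>) / real n) \<longlonglongrightarrow> 0"
  proof (rule orthogonal_strong_law[OF measM sq _ bound])
    show "expectation (\<lambda>\<omega>. \<xi> j \<omega> * \<xi> k \<omega>) = 0" if "j < k" for j k
      by (rule mds_orthogonal[OF measurable_G_mono[OF meas] sq measM sq mean]) (use that in simp)
  qed
  then show ?thesis
  proof eventually_elim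
    case (elim \<omega>)
    have "filterlim (\<lambda>n. (2::nat) ^ n) at_top sequentially"
      by (rule filterlim_subseq) (simp add: strict_mono_def)
    from filterlim_compose[OF elim this] show ?case by simp
  qed
qed

lemma mult_mean_zero:
  assumes f: "f \<in> borel_measurable (G k)" and [measurable]: "g \<in> borel_measurable M"
    and "integrable M (\<lambda>\<omega>. f \<omega> * g \<omega>)" and z: "AE \<omega> in M. real_cond_exp M (G k) g \<omega> = 0"
  shows "AE \<omega> in M. real_cond_exp M (G k) (\<lambda>\<omega>. f \<omega> * g \<omega>) \<omega> = 0"
proof -
  interpret S: sigma_finite_subalgebra M "G k" by (rule sigma_finite_subalgebra_G)
  from S.real_cond_exp_mult[OF f assms(2,3)] z show ?thesis by eventually_elim simp
qed

end

text \<open>Every index from \<open>2 * N0\<close> on is \<open>2 * k + c\<close> for a unique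
  mother k \<ge> \<open>N0\<close> and side c < 2. The recursions for averages over the tree start
  from this regrouping; the first summand is a fixed boundary term that disappears after division by
  2 ^ n.\<close>

lemma sum_children:
  fixes f :: "nat \<Rightarrow> 'b::real_vector"
  assumes z: "\<And>k. k < N0 \<Longrightarrow> f k = 0" and m: "N0 \<le> m"
  shows "(\<Sum>k<2 * m. f k) = (\<Sum>k<2 * N0. f k) + (\<Sum>k<m. if k < N0 then 0 else (\<Sum>c<2. f (2 * k + c)))"
  using m
proof (induction rule: dec_induct)
  case base
  have "(\<Sum>k<N0. if k < N0 then 0 else (\<Sum>c<2. f (2 * k + c))) = 0" by (intro sum.neutral) auto
  then show ?case by (simp only: add_0_right)
next
  case (step m)
  have "(\<Sum>k<2 * Suc m. f k) = (\<Sum>k<2 * m. f k) + (\<Sum>c<2. f (2 * m + c))"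
    by (simp add: numeral_2_eq_2)
  then show ?case using step by (simp add: add.assoc)
qed

locale bar_vector = bar_process P X \<epsilon> a b p \<sigma>2 \<rho>
  for P :: "'w measure" and X \<epsilon> :: "nat \<Rightarrow> 'w \<Rightarrow> real" and a b :: "nat \<Rightarrow> real" and p :: nat and \<sigma>2 \<rho> :: real +
  fixes N :: "real ^ 'n::{finite,linorder} \<Rightarrow> real" and \<beta> :: real
  assumes p_card: "p = CARD('n)" and N: "is_norm N" and \<beta>: "0 \<le> \<beta>" "\<beta> < 1"
    and a_contr: "\<And>u. N (companion a *v u) \<le> \<beta> * N u" and b_contr: "\<And>u. N (companion b *v u) \<le> \<beta> * N u"
begin

definition co :: "nat \<Rightarrow> nat \<Rightarrow> real" where "co c = (if c = 0 then a else b)"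

abbreviation comp :: "nat \<Rightarrow> ((real, 'n) vec, 'n) vec" where "comp c \<equiv> companion (co c)"

lemma comp_contr: "N (comp c *v u) \<le> \<beta> * N u"
  using a_contr b_contr by (simp add: co_def)

definition st :: "nat \<Rightarrow> 'w \<Rightarrow> (real, 'n) vec" where
  "st k \<omega> = (if k < N0 then 0 else state_vec X k \<omega>)"

lemma st_0 [simp]: "k < N0 \<Longrightarrow> st k \<omega> = 0" by (simp add: st_def)

lemma st_component: "N0 \<le> k \<Longrightarrow> st k \<omega> $ i = X (k div 2 ^ (pos i - 1)) \<omega>"
  by (simp add: st_def state_vec_def)

lemma BAR_child:
  assumes "N0 \<le> k" "c < 2" "\<omega> \<in> space P"
  shows "X (2 * k + c) \<omega> = co c 0 + (\<Sum>l=1..p. co c l * X (k div 2 ^ (l - 1)) \<omega>) + noise c k \<omega>"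
proof -
  have "c = 0 \<or> c = 1" using assms(2) by auto
  then show ?thesis
  proof
    assume "c = 0"
    then show ?thesis using BAR_even[OF assms(1,3)] assms(1) by (simp add: co_def noise_def)
  next
    assume "c = 1"
    then show ?thesis using BAR_odd[OF assms(1,3)] assms(1) by (simp add: co_def noise_def)
  qed
qed

lemma child_ge: "N0 \<le> k \<Longrightarrow> N0 \<le> 2 * k + c" by simp

lemma st_child:
  assumes k: "N0 \<le> k" and c: "c < 2" and \<omega>: "\<omega> \<in> space P"
  shows "st (2 * k + c) \<omega> = comp c *v st k \<omega> + (co c 0 + noise c k \<omega>) *\<^sub>R e1"
proof (subst vec_eq_iff, rule allI)
  fix i :: 'n
  show "st (2 * k + c) \<omega> $ i = (comp c *v st k \<omega> + (co c 0 + noise c k \<omega>) *\<^sub>R e1) $ i"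
  proof (cases "pos i = 1")
    case True
    have "(comp c *v st k \<omega>) $ i = (\<Sum>j\<in>UNIV. co c (pos j) * X (k div 2 ^ (pos (j::'n) - 1)) \<omega>)"
      unfolding companion_mult_first[OF True] by (simp add: st_component[OF k])
    also have "\<dots> = (\<Sum>l=1..p. co c l * X (k div 2 ^ (l - 1)) \<omega>)"
      unfolding p_card by (rule sum_pos)
    finally show ?thesis
      using True BAR_child[OF k c \<omega>] by (simp add: st_component[OF child_ge[OF k]] e1_def)
  next
    case False
    then have "1 \<le> pos i - 1" "pos i - 1 \<le> CARD('n)" using pos_range[of i] by auto
    then obtain j :: 'n where j: "pos j = pos i - 1" by (rule pos_obtain)
    then have ij: "pos i = pos j + 1" using False pos_range[of i] by auto
    have "(2 * k + c) div 2 ^ (pos i - 1) = ((2 * k + c) div 2) div 2 ^ (pos j - 1)"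
    proof -
      have "(2::nat) ^ (pos i - 1) = 2 * 2 ^ (pos j - 1)" using ij pos_range[of j] by (cases "pos j") auto
      then show ?thesis by (simp only: div_mult2_eq)
    qed
    also have "(2 * k + c) div 2 = k" using c by simp
    finally show ?thesis
      using False by (simp add: st_component[OF child_ge[OF k]] e1_def companion_mult_next[OF ij] st_component[OF k])
  qed
qed

lemma st_component_L4: "L4 P (\<lambda>\<omega>. st k \<omega> $ i)"
proof (cases "k < N0")
  case False
  then have k: "N0 \<le> k" by simp
  have "pos i - 1 < p" using pos_range[of i] p_card by auto
  then show ?thesis unfolding st_component[OF k] using anc_pos[OF k] by (intro X_L4) auto
qed simp

text \<open>The entries of the state are ancestors of \<open>k\<close>, with index at most
  \<open>k\<close> and hence below \<open>2 * 2 ^ floor_log k\<close>. This is the early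
  measurability that the quadratic law demands of its weights.\<close>

lemma st_component_meas: "0 < k \<Longrightarrow> (\<lambda>\<omega>. st k \<omega> $ i) \<in> borel_measurable (G (2 ^ floor_log k))"
proof (cases "k < N0")
  case False
  then have k: "N0 \<le> k" by simp
  have "pos i - 1 < p" using pos_range[of i] p_card by auto
  then have 1: "1 \<le> k div 2 ^ (pos i - 1)" by (rule anc_pos[OF k])
  have "k < 2 * 2 ^ floor_log k" using Gen_floor_log[OF k] by (simp add: Gen_def)
  then have "k div 2 ^ (pos i - 1) < 2 * 2 ^ floor_log k" by (rule le_less_trans[OF div_le_dividend])
  then show ?thesis unfolding st_component[OF k] by (rule X_past[OF 1])
qed simp

lemma st_component_meas': "(\<lambda>\<omega>. st k \<omega> $ i) \<in> borel_measurable (G k)"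
proof (cases "k = 0")
  case False
  then show ?thesis using measurable_G_mono[OF st_component_meas floor_log_exp2_le, of k i] by simp
qed simp

lemma noise_meas_M [measurable]: "noise c k \<in> borel_measurable P"
  using noise_L4 by (rule L4_measurable)

lemma st_meas_M [measurable]: "(\<lambda>\<omega>. st k \<omega> $ i) \<in> borel_measurable P"
  using st_component_L4 by (rule L4_measurable)

lemma st_meas_vec [measurable]: "st k \<in> borel_measurable P"
  by (subst borel_measurable_euclidean_space) (auto simp: Basis_vec_def inner_axis)

subsection \<open>Moments\<close>

lemma N_st_L4: "L4 P (\<lambda>\<omega>. N (st k \<omega>))"
proof -
  obtain C where C: "0 < C" "\<And>x. N x \<le> C * norm x" using is_norm_upper[OF N] by blast
  have "L4 P (\<lambda>\<omega>. \<bar>st k \<omega> $ i\<bar>)" for i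
    by (rule L4_mono[OF st_component_L4[of k i]]) auto
  then have "L4 P (\<lambda>\<omega>. C * (\<Sum>i\<in>UNIV. \<bar>st k \<omega> $ i\<bar>))" by (intro L4_cmult L4_sum)
  then show ?thesis
  proof (rule L4_mono)
    have "N \<in> borel_measurable borel" by (rule borel_measurable_continuous_onI[OF is_norm_continuous[OF N]])
    then show "(\<lambda>\<omega>. N (st k \<omega>)) \<in> borel_measurable P" using measurable_compose[OF st_meas_vec] by blast
    fix \<omega>
    have "N (st k \<omega>) \<le> C * (\<Sum>i\<in>UNIV. \<bar>st k \<omega> $ i\<bar>)"
      using C(2)[of "st k \<omega>"] mult_left_mono[OF norm_le_l1_cart[of "st k \<omega>"], of C] C(1) by linarith
    then show "\<bar>N (st k \<omega>)\<bar> \<le> \<bar>C * (\<Sum>i\<in>UNIV. \<bar>st k \<omega> $ i\<bar>)\<bar>" using is_norm_nonneg[OF N, of "st k \<omega>"] by linarith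
  qed
qed

text \<open>Convexity gives E (2 k + c) \<le> \<beta> * E k + (1 - \<beta>) * (s^r * D), a convex
  combination. Hence the maximum of s^r * D and of the finitely many initial values is a bound that
  mothers pass on to their children.\<close>

lemma moment_bound:
  assumes r: "even r" "0 < r" and int: "\<And>f. L4 P f \<Longrightarrow> integrable P (\<lambda>\<omega>. f \<omega> ^ r)"
    and D: "\<And>c k. c < 2 \<Longrightarrow> expectation (\<lambda>\<omega>. (\<bar>co c 0\<bar> + \<bar>noise c k \<omega>\<bar>) ^ r) \<le> D"
  shows "\<exists>K. \<forall>k. expectation (\<lambda>\<omega>. N (st k \<omega>) ^ r) \<le> K"
proof -
  define E where "E k = expectation (\<lambda>\<omega>. N (st k \<omega>) ^ r)" for k
  define s where "s = N e1 / (1 - \<beta>)"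
  have s0: "0 \<le> s" unfolding s_def using \<beta> is_norm_nonneg[OF N] by (intro divide_nonneg_nonneg) auto
  have q_L4: "L4 P (\<lambda>\<omega>. \<bar>co c 0\<bar> + \<bar>noise c k \<omega>\<bar>)" for c k
  proof (rule L4_add)
    show "L4 P (\<lambda>\<omega>. \<bar>noise c k \<omega>\<bar>)" by (rule L4_mono[OF noise_L4[of c k]]) auto
  qed simp
  have step: "E (2 * k + c) \<le> \<beta> * E k + (1 - \<beta>) * (s ^ r * D)" if k: "N0 \<le> k" and c: "c < 2" for k c
  proof -
    have "E (2 * k + c) \<le> expectation (\<lambda>\<omega>. \<beta> * N (st k \<omega>) ^ r + (1 - \<beta>) * (s ^ r * (\<bar>co c 0\<bar> + \<bar>noise c k \<omega>\<bar>) ^ r))"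
      unfolding E_def
    proof (rule integral_mono)
      fix \<omega> assume \<omega>: "\<omega> \<in> space P"
      let ?q = "\<bar>co c 0\<bar> + \<bar>noise c k \<omega>\<bar>"
      have "N (st (2 * k + c) \<omega>) \<le> N (comp c *v st k \<omega>) + \<bar>co c 0 + noise c k \<omega>\<bar> * N e1"
        unfolding st_child[OF k c \<omega>] is_norm_scaleR[OF N, symmetric] by (rule is_norm_triangle[OF N])
      also have "\<dots> \<le> \<beta> * N (st k \<omega>) + ?q * N e1"
        by (intro add_mono comp_contr mult_right_mono abs_triangle_ineq is_norm_nonneg[OF N])
      finally have "N (st (2 * k + c) \<omega>) ^ r \<le> (\<beta> * N (st k \<omega>) + ?q * N e1) ^ r"
        by (intro power_mono is_norm_nonneg[OF N])
      also have "\<dots> \<le> \<beta> * N (st k \<omega>) ^ r + (1 - \<beta>) * (?q * N e1 / (1 - \<beta>)) ^ r"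
        by (rule convex_power_bound[OF \<beta> r])
      also have "?q * N e1 / (1 - \<beta>) = s * ?q" by (simp add: s_def)
      finally show "N (st (2 * k + c) \<omega>) ^ r \<le> \<beta> * N (st k \<omega>) ^ r + (1 - \<beta>) * (s ^ r * ?q ^ r)"
        by (simp add: power_mult_distrib)
    qed (use int[OF N_st_L4] int[OF q_L4] in auto)
    also have "\<dots> = \<beta> * E k + (1 - \<beta>) * (s ^ r * expectation (\<lambda>\<omega>. (\<bar>co c 0\<bar> + \<bar>noise c k \<omega>\<bar>) ^ r))"
      unfolding E_def using int[OF N_st_L4] int[OF q_L4] by simp
    also have "\<dots> \<le> \<beta> * E k + (1 - \<beta>) * (s ^ r * D)"
      using \<beta> s0 D[OF c] by (intro add_left_mono mult_left_mono) auto
    finally show ?thesis .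
  qed
  define K where "K = max (s ^ r * D) (Max (E ` {..<2 * N0}))"
  have "E k \<le> K" for k
  proof (induction k rule: less_induct)
    case (less k)
    show ?case
    proof (cases "k < 2 * N0")
      case True
      then have "E k \<le> Max (E ` {..<2 * N0})" by (intro Max_ge) auto
      then show ?thesis by (simp add: K_def)
    next
      case False
      then have h: "N0 \<le> k div 2" by linarith
      have N0p: "0 < N0" by simp
      have "k div 2 < k" using False N0p by linarith
      then have IH: "E (k div 2) \<le> K" by (rule less.IH)
      have "E k = E (2 * (k div 2) + k mod 2)" by simp
      also have "\<dots> \<le> \<beta> * E (k div 2) + (1 - \<beta>) * (s ^ r * D)" by (rule step[OF h]) simp
      also have "\<dots> \<le> \<beta> * K + (1 - \<beta>) * K"
        using \<beta> IH by (intro add_mono mult_left_mono) (auto simp: K_def)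
      also have "\<dots> = K" by (simp add: algebra_simps)
      finally show ?thesis .
    qed
  qed
  then show ?thesis unfolding E_def by blast
qed

lemma noise_second_moment: assumes c: "c < 2" shows "expectation (\<lambda>\<omega>. (noise c k \<omega>)\<^sup>2) = var k"
proof -
  have "expectation (\<lambda>\<omega>. 1 * (noise c k \<omega>)\<^sup>2) = expectation (\<lambda>\<omega>. 1 * var k)"
    by (rule expectation_mult_cond_exp(1)[OF _ _ _ noise_var]) (use c L4_square_integrable[OF noise_L4] in auto)
  then show ?thesis by (simp add: prob_space)
qed

lemma var_bounds: "0 \<le> var k" "var k \<le> \<sigma>2" using \<sigma>2_pos by (auto simp: var_def)

lemma second_moment_bound: "\<exists>K. \<forall>k. expectation (\<lambda>\<omega>. (N (st k \<omega>))\<^sup>2) \<le> K"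
proof (rule moment_bound)
  show "expectation (\<lambda>\<omega>. (\<bar>co c 0\<bar> + \<bar>noise c k \<omega>\<bar>)\<^sup>2) \<le> 2 * ((max \<bar>a 0\<bar> \<bar>b 0\<bar>)\<^sup>2 + \<sigma>2)" if c: "c < 2" for c k
  proof -
    have sq: "(x + y)\<^sup>2 \<le> 2 * (x\<^sup>2 + y\<^sup>2)" for x y :: real
      using zero_le_power2[of "x - y"] by (simp add: power2_eq_square algebra_simps)
    have i: "integrable P (\<lambda>\<omega>. 2 * (\<bar>co c 0\<bar>\<^sup>2 + (noise c k \<omega>)\<^sup>2))"
      using L4_square_integrable[OF noise_L4] by simp
    have "expectation (\<lambda>\<omega>. (\<bar>co c 0\<bar> + \<bar>noise c k \<omega>\<bar>)\<^sup>2) \<le> expectation (\<lambda>\<omega>. 2 * (\<bar>co c 0\<bar>\<^sup>2 + (noise c k \<omega>)\<^sup>2))"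
    proof (rule integral_mono[OF _ i])
      show "(\<bar>co c 0\<bar> + \<bar>noise c k \<omega>\<bar>)\<^sup>2 \<le> 2 * (\<bar>co c 0\<bar>\<^sup>2 + (noise c k \<omega>)\<^sup>2)" for \<omega>
        using sq[of "\<bar>co c 0\<bar>" "\<bar>noise c k \<omega>\<bar>"] by simp
      show "integrable P (\<lambda>\<omega>. (\<bar>co c 0\<bar> + \<bar>noise c k \<omega>\<bar>)\<^sup>2)"
      proof (rule L4_square_integrable[OF L4_add[OF L4_const]])
        show "L4 P (\<lambda>\<omega>. \<bar>noise c k \<omega>\<bar>)" by (rule L4_mono[OF noise_L4[of c k]]) auto
      qed
    qed
    also have "\<dots> = 2 * (\<bar>co c 0\<bar>\<^sup>2 + var k)"
      using L4_square_integrable[OF noise_L4] noise_second_moment[OF c] by (simp add: prob_space)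
    also have "\<dots> \<le> 2 * ((max \<bar>a 0\<bar> \<bar>b 0\<bar>)\<^sup>2 + \<sigma>2)"
      using var_bounds by (intro mult_left_mono add_mono power_mono) (auto simp: co_def)
    finally show ?thesis .
  qed
qed (auto intro: L4_square_integrable)

lemma component_le_N: "\<exists>d>0. \<forall>x i. \<bar>x $ i\<bar> \<le> d * N x"
proof -
  obtain c where c: "0 < c" "\<And>x. c * norm x \<le> N x" using is_norm_lower[OF N] by blast
  have "\<bar>x $ i\<bar> \<le> (1 / c) * N x" for x i
    using c(2)[of x] component_le_norm_cart[of x i] c(1) by (simp add: field_simps) (smt (verit) mult_left_mono)
  then show ?thesis using c(1) by (intro exI[of _ "1 / c"]) auto
qed

lemma component_second_moment: "\<exists>K. \<forall>k i. expectation (\<lambda>\<omega>. (st k \<omega> $ i)\<^sup>2) \<le> K"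
proof -
  obtain d where d: "0 < d" "\<And>x i. \<bar>x $ i\<bar> \<le> d * N x" using component_le_N by blast
  obtain K where K: "\<And>k. expectation (\<lambda>\<omega>. (N (st k \<omega>))\<^sup>2) \<le> K" using second_moment_bound by blast
  have "expectation (\<lambda>\<omega>. (st k \<omega> $ i)\<^sup>2) \<le> d\<^sup>2 * K" for k i
  proof -
    have "expectation (\<lambda>\<omega>. (st k \<omega> $ i)\<^sup>2) \<le> expectation (\<lambda>\<omega>. d\<^sup>2 * (N (st k \<omega>))\<^sup>2)"
    proof (rule integral_mono)
      fix \<omega>
      have "\<bar>st k \<omega> $ i\<bar>\<^sup>2 \<le> (d * N (st k \<omega>))\<^sup>2" by (intro power_mono d) auto
      then show "(st k \<omega> $ i)\<^sup>2 \<le> d\<^sup>2 * (N (st k \<omega>))\<^sup>2" by (simp add: power_mult_distrib)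
    qed (use L4_square_integrable[OF st_component_L4] L4_square_integrable[OF N_st_L4] in auto)
    also have "\<dots> = d\<^sup>2 * expectation (\<lambda>\<omega>. (N (st k \<omega>))\<^sup>2)" by simp
    also have "\<dots> \<le> d\<^sup>2 * K" by (intro mult_left_mono K) auto
    finally show ?thesis .
  qed
  then show ?thesis by blast
qed

subsection \<open>Averages of the noise\<close>

lemma noise_sq_mult:
  assumes c: "c < 2" and f: "f \<in> borel_measurable (G k)" "L4 P f"
  shows "expectation (\<lambda>\<omega>. (f \<omega> * noise c k \<omega>)\<^sup>2) = var k * expectation (\<lambda>\<omega>. (f \<omega>)\<^sup>2)"
proof -
  have f2: "(\<lambda>\<omega>. (f \<omega>)\<^sup>2) \<in> borel_measurable (G k)" using f(1) by measurable
  have "expectation (\<lambda>\<omega>. (f \<omega>)\<^sup>2 * (noise c k \<omega>)\<^sup>2) = expectation (\<lambda>\<omega>. (f \<omega>)\<^sup>2 * var k)"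
    by (rule expectation_mult_cond_exp(1)[OF f2 _ _ noise_var])
       (use c L4_mult_square_integrable[OF f(2) noise_L4] in \<open>auto simp: power_mult_distrib\<close>)
  then show ?thesis by (simp add: power_mult_distrib mult.commute)
qed

lemma noise_weighted_average:
  assumes c: "c < 2" and f: "\<And>k. f k \<in> borel_measurable (G k)" "\<And>k. L4 P (f k)"
    and K: "\<And>k. expectation (\<lambda>\<omega>. (f k \<omega>)\<^sup>2) \<le> K"
  shows "AE \<omega> in P. (\<lambda>n. (\<Sum>k<2 ^ n. f k \<omega> * noise c k \<omega>) / 2 ^ n) \<longlonglongrightarrow> 0"
proof (rule mds_strong_law)
  have c1: "c \<le> 1" using c by simp
  show "(\<lambda>\<omega>. f k \<omega> * noise c k \<omega>) \<in> borel_measurable (G (Suc k))" for k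
    using measurable_G_mono[OF f(1), of k "Suc k"] noise_adapted[OF c1] by (intro borel_measurable_times) auto
  show "integrable P (\<lambda>\<omega>. (f k \<omega> * noise c k \<omega>)\<^sup>2)" for k by (rule L4_mult_square_integrable[OF f(2) noise_L4])
  show "AE \<omega> in P. real_cond_exp P (G k) (\<lambda>\<omega>. f k \<omega> * noise c k \<omega>) \<omega> = 0" for k
    by (rule mult_mean_zero[OF f(1) noise_meas_M L4_mult_integrable[OF f(2) noise_L4] noise_mean[OF c1]])
  show "expectation (\<lambda>\<omega>. (f k \<omega> * noise c k \<omega>)\<^sup>2) \<le> \<sigma>2 * K" for k
    unfolding noise_sq_mult[OF c f] using var_bounds[of k] K[of k] \<sigma>2_pos
    by (intro mult_mono) (auto intro: Bochner_Integration.integral_nonneg)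
qed

lemma noise_average: "c < 2 \<Longrightarrow> AE \<omega> in P. (\<lambda>n. (\<Sum>k<2 ^ n. noise c k \<omega>) / 2 ^ n) \<longlonglongrightarrow> 0"
  using noise_weighted_average[of c "\<lambda>k \<omega>. 1" 1] by (simp add: prob_space)

lemma noise_state_average: "c < 2 \<Longrightarrow> AE \<omega> in P. (\<lambda>n. (\<Sum>k<2 ^ n. st k \<omega> $ i * noise c k \<omega>) / 2 ^ n) \<longlonglongrightarrow> 0"
proof -
  assume c: "c < 2"
  obtain K where "\<And>k i. expectation (\<lambda>\<omega>. (st k \<omega> $ i)\<^sup>2) \<le> K" using component_second_moment by blast
  then show ?thesis by (intro noise_weighted_average[OF c st_component_meas' st_component_L4])
qed

lemma indicator_average: "(\<lambda>n. (\<Sum>k<2 ^ n. if k < N0 then 0 else d) / 2 ^ n) \<longlonglongrightarrow> (d::real)"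
proof -
  have "(\<lambda>n. d - d * real N0 * (1 / 2) ^ n) \<longlonglongrightarrow> d - d * real N0 * 0"
    by (intro tendsto_intros LIMSEQ_power_zero) auto
  moreover have "\<forall>\<^sub>F n in sequentially. d - d * real N0 * (1 / 2) ^ n = (\<Sum>k<2 ^ n. if k < N0 then 0 else d) / 2 ^ n"
    using eventually_ge_at_top[of "p - 1"]
  proof eventually_elim
    case (elim n)
    have le: "N0 \<le> 2 ^ n" using elim by (intro power_increasing) auto
    have "(\<Sum>k<2 ^ n. if k < N0 then 0 else d) = (\<Sum>k\<in>{N0..<2 ^ n}. d)"
      by (rule sum.mono_neutral_cong_right) auto
    also have "\<dots> = (2 ^ n - real N0) * d" using le by (simp add: of_nat_diff)
    finally show ?case by (simp add: field_simps power_one_over)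
  qed
  ultimately show ?thesis by (simp add: Lim_transform_eventually)
qed

text \<open>The cut-off \<open>tr D\<close> is known before the noise, so it preserves the
  martingale property and bounds the second moments of the centred squares by \<open>D\<close>. For
  almost every \<omega> some integer level cuts nothing.\<close>

lemma noise_square_average:
  assumes c: "c < 2" shows "AE \<omega> in P. (\<lambda>n. (\<Sum>k<2 ^ n. (noise c k \<omega>)\<^sup>2) / 2 ^ n) \<longlonglongrightarrow> \<sigma>2"
proof -
  have c1: "c \<le> 1" using c by simp
  have kurt_G: "kurt c k \<in> borel_measurable (G k)" for k
  proof (cases "k = 0")
    case False
    then show ?thesis using measurable_G_mono[OF kurt_meas floor_log_exp2_le, of k c] by simp
  qed (simp add: kurt_def[abs_def])
  define tr where "tr D k \<omega> = (if kurt c k \<omega> \<le> D then 1 else 0 :: real)" for D k \<omega>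
  have trG: "tr D k \<in> borel_measurable (G k)" for D k unfolding tr_def using kurt_G[of k] by measurable
  have trM [measurable]: "tr D k \<in> borel_measurable P" for D k by (rule measurable_G_M[OF trG])
  have tr01: "0 \<le> tr D k \<omega>" "tr D k \<omega> \<le> 1" "(tr D k \<omega>)\<^sup>2 = tr D k \<omega>" for D k \<omega> by (auto simp: tr_def)
  have i4: "integrable P (\<lambda>\<omega>. (noise c k \<omega>) ^ 4)" for k using noise_L4[of c k] by (simp add: L4_def)
  have i2: "integrable P (\<lambda>\<omega>. (noise c k \<omega>)\<^sup>2)" for k by (rule L4_square_integrable[OF noise_L4])
  have it: "integrable P (\<lambda>\<omega>. tr D k \<omega> * f \<omega>)" if "integrable P f" for D k f
    by (rule Bochner_Integration.integrable_bound[OF that])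
       (use tr01 that in \<open>auto simp: abs_mult intro!: mult_left_le_one_le\<close>)
  have law: "AE \<omega> in P. (\<lambda>n. (\<Sum>k<2 ^ n. tr D k \<omega> * ((noise c k \<omega>)\<^sup>2 - var k)) / 2 ^ n) \<longlonglongrightarrow> 0" if D: "0 \<le> D" for D
  proof (rule mds_strong_law)
    fix k
    show "(\<lambda>\<omega>. tr D k \<omega> * ((noise c k \<omega>)\<^sup>2 - var k)) \<in> borel_measurable (G (Suc k))"
      using measurable_G_mono[OF trG, of k "Suc k" D] noise_adapted[OF c1, of k] by measurable
    have e: "(tr D k \<omega> * ((noise c k \<omega>)\<^sup>2 - var k))\<^sup>2 = tr D k \<omega> * (noise c k \<omega>) ^ 4 - 2 * var k * (tr D k \<omega> * (noise c k \<omega>)\<^sup>2) + (var k)\<^sup>2 * tr D k \<omega>" for \<omega>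
      unfolding power_mult_distrib tr01(3) power2_diff by (simp add: algebra_simps)
    have i0: "integrable P (tr D k)" using it[of "\<lambda>_. 1" D k] by simp
    show "integrable P (\<lambda>\<omega>. (tr D k \<omega> * ((noise c k \<omega>)\<^sup>2 - var k))\<^sup>2)"
      unfolding e using it[OF i4] it[OF i2] i0 by simp
    interpret S: sigma_finite_subalgebra P "G k" by (rule sigma_finite_subalgebra_G)
    have "AE \<omega> in P. real_cond_exp P (G k) (\<lambda>\<omega>. (noise c k \<omega>)\<^sup>2 - var k) \<omega> = 0"
      using S.real_cond_exp_diff[OF i2 integrable_const[of "var k"], of k] noise_var[OF c1, of k]
        S.real_cond_exp_F_meas[OF integrable_const[of "var k"] borel_measurable_const]
      by eventually_elim simp
    then show "AE \<omega> in P. real_cond_exp P (G k) (\<lambda>\<omega>. tr D k \<omega> * ((noise c k \<omega>)\<^sup>2 - var k)) \<omega> = 0"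
      using i2[of k] by (intro mult_mean_zero[OF trG] it) auto
    have t4: "expectation (\<lambda>\<omega>. tr D k \<omega> * (noise c k \<omega>) ^ 4) \<le> D"
    proof -
      have km: "kurt c k \<in> borel_measurable P" by (rule measurable_G_M[OF kurt_G])
      note E = expectation_mult_cond_exp[OF trG _ it[OF i4] noise_fourth[OF c1] km]
      have "expectation (\<lambda>\<omega>. tr D k \<omega> * kurt c k \<omega>) \<le> expectation (\<lambda>\<omega>. D)"
        by (rule integral_mono) (use E(2) D in \<open>auto simp: tr_def\<close>)
      then show ?thesis using E(1) by (simp add: prob_space)
    qed
    have t2: "expectation (\<lambda>\<omega>. tr D k \<omega> * (noise c k \<omega>)\<^sup>2) = var k * expectation (tr D k)"
    proof -
      have "expectation (\<lambda>\<omega>. tr D k \<omega> * (noise c k \<omega>)\<^sup>2) = expectation (\<lambda>\<omega>. tr D k \<omega> * var k)"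
        by (rule expectation_mult_cond_exp(1)[OF trG _ it[OF i2] noise_var[OF c1]]) auto
      then show ?thesis by (simp add: mult.commute)
    qed
    have "expectation (\<lambda>\<omega>. (tr D k \<omega> * ((noise c k \<omega>)\<^sup>2 - var k))\<^sup>2) =
        expectation (\<lambda>\<omega>. tr D k \<omega> * (noise c k \<omega>) ^ 4) - 2 * var k * (var k * expectation (tr D k)) + (var k)\<^sup>2 * expectation (tr D k)"
      unfolding e t2[symmetric] using it[OF i4] it[OF i2] i0 by simp
    also have "\<dots> = expectation (\<lambda>\<omega>. tr D k \<omega> * (noise c k \<omega>) ^ 4) - (var k)\<^sup>2 * expectation (tr D k)"
      by (simp add: power2_eq_square)
    also have "\<dots> \<le> D"
    proof -
      have "0 \<le> (var k)\<^sup>2 * expectation (tr D k)" using tr01 by (intro mult_nonneg_nonneg Bochner_Integration.integral_nonneg) auto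
      then show ?thesis using t4 by linarith
    qed
    finally show "expectation (\<lambda>\<omega>. (tr D k \<omega> * ((noise c k \<omega>)\<^sup>2 - var k))\<^sup>2) \<le> D" .
  qed
  have "AE \<omega> in P. \<forall>m::nat. (\<lambda>n. (\<Sum>k<2 ^ n. tr (real m) k \<omega> * ((noise c k \<omega>)\<^sup>2 - var k)) / 2 ^ n) \<longlonglongrightarrow> 0"
    unfolding AE_all_countable using law by auto
  with kurt_bounded[OF c1] show ?thesis
  proof eventually_elim
    case (elim \<omega>)
    then obtain C where C: "\<And>k. kurt c k \<omega> \<le> C" by blast
    obtain m :: nat where m: "C \<le> real m" using real_arch_simple by blast
    have "tr (real m) k \<omega> = 1" for k using order_trans[OF C m, of k] by (simp add: tr_def)
    then have "(\<lambda>n. (\<Sum>k<2 ^ n. (noise c k \<omega>)\<^sup>2 - var k) / 2 ^ n) \<longlonglongrightarrow> 0"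
      using elim(2)[rule_format, of m] by simp
    from tendsto_add[OF this indicator_average[of \<sigma>2]] show ?case
      by (simp add: var_def sum_subtractf diff_divide_distrib)
  qed
qed

end

section \<open>Convergence of the empirical covariance\<close>

lemma bounded_bilinear_outer: "bounded_bilinear (outer :: real ^ 'm \<Rightarrow> real ^ 'k \<Rightarrow> real ^ 'k ^ 'm)"
  unfolding bilinear_conv_bounded_bilinear[symmetric] bilinear_def
  by (auto intro!: linearI simp: outer_def vec_eq_iff algebra_simps)

interpretation outer: bounded_bilinear "outer :: real ^ 'm \<Rightarrow> real ^ 'k \<Rightarrow> real ^ 'k ^ 'm"
  by (rule bounded_bilinear_outer)

lemma outer_matrix_mult: "outer (A *v x) (A *v x) = A ** outer x x ** transpose (A :: real ^ 'm ^ 'm)"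
proof -
  have "(\<Sum>l\<in>UNIV. (\<Sum>k\<in>UNIV. A $ i $ k * (x $ k * x $ l)) * A $ j $ l) =
      (\<Sum>k\<in>UNIV. A $ i $ k * x $ k) * (\<Sum>l\<in>UNIV. A $ j $ l * x $ l)" for i j
  proof -
    have "(\<Sum>l\<in>UNIV. (\<Sum>k\<in>UNIV. A $ i $ k * (x $ k * x $ l)) * A $ j $ l) =
        (\<Sum>l\<in>UNIV. \<Sum>k\<in>UNIV. A $ i $ k * (x $ k * x $ l) * A $ j $ l)"
      unfolding sum_distrib_right ..
    also have "\<dots> = (\<Sum>k\<in>UNIV. \<Sum>l\<in>UNIV. A $ i $ k * (x $ k * x $ l) * A $ j $ l)" by (rule sum.swap)
    also have "\<dots> = (\<Sum>k\<in>UNIV. A $ i $ k * x $ k) * (\<Sum>l\<in>UNIV. A $ j $ l * x $ l)"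
      unfolding sum_product by (intro sum.cong refl) (simp add: ac_simps)
    finally show ?thesis .
  qed
  then show ?thesis
    by (simp add: vec_eq_iff outer_def matrix_matrix_mult_def matrix_vector_mult_def transpose_def)
qed

lemma linear_congruence: "linear (\<lambda>K. A ** K ** transpose (A :: real ^ 'm ^ 'm))"
proof (rule linearI)
  show "A ** (K + L) ** transpose A = A ** K ** transpose A + A ** L ** transpose A" for K L
    by (simp add: vec_eq_iff matrix_matrix_mult_def distrib_left distrib_right sum.distrib)
  show "A ** (c *\<^sub>R K) ** transpose A = c *\<^sub>R (A ** K ** transpose A)" for c K
    by (simp add: vec_eq_iff matrix_matrix_mult_def sum_distrib_left sum_distrib_right ac_simps)
qed

context bar_vector
begin

abbreviation lam :: "(real, 'n) vec" where "lam \<equiv> lambda_vec a b"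
abbreviation unit1 :: "(real, 'n) vec" where "unit1 \<equiv> e1"
abbreviation ell :: "((real, 'n) vec, 'n) vec" where "ell \<equiv> ell_mat a b \<sigma>2"

definition mean_map :: "(real, 'n) vec \<Rightarrow> (real, 'n) vec" where
  "mean_map v = (1 / 2) *\<^sub>R (\<Sum>c<2. comp c *v v)"

definition cov_map :: "((real, 'n) vec, 'n) vec \<Rightarrow> ((real, 'n) vec, 'n) vec" where
  "cov_map K = (1 / 2) *\<^sub>R (\<Sum>c<2. comp c ** K ** transpose (comp c))"

lemma sum_less_2: "(\<Sum>c<2::nat. f c) = f 0 + (f 1 :: 'z::comm_monoid_add)"
  by (simp add: numeral_2_eq_2)

lemma mean_map_contr: "N (mean_map v) \<le> \<beta> * N v"
proof -
  have "N (mean_map v) = 1 / 2 * N (comp 0 *v v + comp 1 *v v)"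
    by (simp add: mean_map_def sum_less_2 is_norm_scaleR[OF N])
  then show ?thesis
    using is_norm_triangle[OF N, of "comp 0 *v v" "comp 1 *v v"] comp_contr[of 0 v] comp_contr[of 1 v] by linarith
qed

lemma linear_mean_map: "linear mean_map"
  unfolding mean_map_def[abs_def] by (intro linear_compose_scale_right linear_compose_sum) auto

lemma linear_cov_map: "linear cov_map"
  unfolding cov_map_def[abs_def] by (intro linear_compose_scale_right linear_compose_sum ballI linear_congruence)

lemma cov_map_contr: "tensor_norm N (cov_map K) \<le> \<beta> * tensor_norm N K"
proof -
  note T = is_norm_tensor_norm[OF N]
  have "tensor_norm N (cov_map K) = 1 / 2 * tensor_norm N (comp 0 ** K ** transpose (comp 0) + comp 1 ** K ** transpose (comp 1))"
    by (simp add: cov_map_def sum_less_2 is_norm_scaleR[OF T])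
  then show ?thesis
    using is_norm_triangle[OF T, of "comp 0 ** K ** transpose (comp 0)" "comp 1 ** K ** transpose (comp 1)"]
      tensor_norm_congruence[OF N comp_contr \<beta>, of 0 K] tensor_norm_congruence[OF N comp_contr \<beta>, of 1 K] by linarith
qed

text \<open>The inverse in \<open>lambda_vec\<close> is a true inverse: a kernel vector of I - (A +
  B) / 2 is a fixed point of the contraction \<open>mean_map\<close>, hence 0.\<close>

lemma lam_fix: "lam = ((a 0 + b 0) / 2) *\<^sub>R unit1 + mean_map lam"
proof -
  define Q :: "((real, 'n) vec, 'n) vec" where "Q = mat 1 - (1 / 2) *\<^sub>R (companion a + companion b)"
  have Qv: "Q *v v = v - mean_map v" for v
    by (simp add: Q_def mean_map_def sum_less_2 co_def matrix_vector_mult_diff_rdistrib matrix_vector_mult_add_rdistrib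
        scaleR_matrix_vector_assoc[symmetric])
  have "v = 0" if "Q *v v = 0" for v
  proof -
    have "\<exists>!x. x = 0 + mean_map x" by (rule is_norm_contraction_surj[OF N linear_mean_map mean_map_contr \<beta>(2)])
    moreover have "v = 0 + mean_map v" using that unfolding Qv by simp
    moreover have "0 = 0 + mean_map 0" using linear_0[OF linear_mean_map] by simp
    ultimately show ?thesis by blast
  qed
  then have "\<exists>B. B ** Q = mat 1" unfolding matrix_left_invertible_ker by blast
  then have "invertible Q" by (simp add: invertible_left_inverse)
  then have "Q *v lam = ((a 0 + b 0) / 2) *\<^sub>R unit1"
    unfolding lambda_vec_def Q_def[symmetric]
    by (simp add: matrix_vector_mult_scaleR matrix_vector_mul_assoc matrix_inv_inverse)
  then show ?thesis unfolding Qv by (simp add: diff_eq_eq)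
qed

text \<open>The contraction in \<open>tensor_norm\<close> gives the unique existence behind the
  definite description in \<open>ell_mat\<close>.\<close>

lemma ell_fix: "ell = T_mat a b \<sigma>2 + cov_map ell"
proof -
  have "\<exists>!l. l = T_mat a b \<sigma>2 + cov_map l"
    by (rule is_norm_contraction_surj[OF is_norm_tensor_norm[OF N] linear_cov_map cov_map_contr \<beta>(2)])
  moreover have "cov_map l = (1/2) *\<^sub>R (companion a ** l ** transpose (companion a) + companion b ** l ** transpose (companion b))" for l
    by (simp add: cov_map_def sum_less_2 co_def)
  ultimately have ex: "\<exists>!l. l = T_mat a b \<sigma>2 + (1/2) *\<^sub>R (companion a ** l ** transpose (companion a) + companion b ** l ** transpose (companion b :: ((real, 'n) vec, 'n) vec))"
    and eq: "\<And>l. cov_map l = (1/2) *\<^sub>R (companion a ** l ** transpose (companion a) + companion b ** l ** transpose (companion b))"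
    by simp_all
  show ?thesis unfolding eq ell_mat_def by (rule theI'[OF ex])
qed

text \<open>An almost sure event on which the limits of the empirical means and covariances follow
  without further probability. Algebraic facts about the limit matrix are also obtained from it, by
  evaluating empirical limits at one such point.\<close>

definition good :: "'w \<Rightarrow> bool" where
  "good \<omega> \<longleftrightarrow> \<omega> \<in> space P \<and> (\<forall>c<2. (\<lambda>n. (\<Sum>k<2 ^ n. noise c k \<omega>) / 2 ^ n) \<longlonglongrightarrow> 0 \<and>
     (\<lambda>n. (\<Sum>k<2 ^ n. (noise c k \<omega>)\<^sup>2) / 2 ^ n) \<longlonglongrightarrow> \<sigma>2 \<and>
     (\<forall>i. (\<lambda>n. (\<Sum>k<2 ^ n. st k \<omega> $ i * noise c k \<omega>) / 2 ^ n) \<longlonglongrightarrow> 0))"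

lemma AE_good: "AE \<omega> in P. good \<omega>"
proof -
  have *: "AE \<omega> in P. (\<lambda>n. (\<Sum>k<2 ^ n. noise c k \<omega>) / 2 ^ n) \<longlonglongrightarrow> 0 \<and>
     (\<lambda>n. (\<Sum>k<2 ^ n. (noise c k \<omega>)\<^sup>2) / 2 ^ n) \<longlonglongrightarrow> \<sigma>2 \<and>
     (\<forall>i. (\<lambda>n. (\<Sum>k<2 ^ n. st k \<omega> $ i * noise c k \<omega>) / 2 ^ n) \<longlonglongrightarrow> 0)" if c: "c < 2" for c
  proof -
    have "AE \<omega> in P. \<forall>i\<in>UNIV. (\<lambda>n. (\<Sum>k<2 ^ n. st k \<omega> $ i * noise c k \<omega>) / 2 ^ n) \<longlonglongrightarrow> 0"
      by (rule AE_finite_allI) (use noise_state_average[OF c] in auto)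
    with noise_average[OF c] noise_square_average[OF c] show ?thesis by eventually_elim simp
  qed
  from *[of 0] *[of 1] AE_space show ?thesis
    by (auto simp: good_def numeral_2_eq_2 less_Suc_eq)
qed

lemma shrinking: "(\<lambda>n. (1 / 2 ^ Suc n) *\<^sub>R (B :: 'z::real_normed_vector)) \<longlonglongrightarrow> 0"
proof -
  have "(\<lambda>n. ((1 / 2) ^ n * (1 / 2)) *\<^sub>R B) \<longlonglongrightarrow> (0 * (1 / 2)) *\<^sub>R B"
    by (intro tendsto_intros LIMSEQ_power_zero) auto
  then show ?thesis by (simp add: power_one_over mult.commute)
qed

lemma eventually_N0: "\<forall>\<^sub>F n in sequentially. N0 \<le> 2 ^ n"
  using eventually_ge_at_top[of "p - 1"] by eventually_elim (intro power_increasing, auto)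

definition avg_st :: "nat \<Rightarrow> 'w \<Rightarrow> (real, 'n) vec" where
  "avg_st n \<omega> = (1 / 2 ^ n) *\<^sub>R (\<Sum>k<2 ^ n. st k \<omega>)"

definition avg_outer :: "nat \<Rightarrow> 'w \<Rightarrow> ((real, 'n) vec, 'n) vec" where
  "avg_outer n \<omega> = (1 / 2 ^ n) *\<^sub>R (\<Sum>k<2 ^ n. outer (st k \<omega>) (st k \<omega>))"

text \<open>Regrouping by mothers gives a recursion with linear part \<open>mean_map\<close>, whose
  remainder \<open>r n\<close> collects the boundary term, the intercepts and the noise averages and
  tends to the inhomogeneous term in the equation of \<lambda>. Subtracting that equation leaves a
  contraction with null remainder.\<close>

lemma avg_st_tendsto:
  assumes g: "good \<omega>" shows "(\<lambda>n. avg_st n \<omega>) \<longlonglongrightarrow> lam"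
proof -
  have \<omega>: "\<omega> \<in> space P" using g by (simp add: good_def)
  define base where "base = (\<Sum>k<2 * N0. st k \<omega>)"
  define t where "t n c = (\<Sum>k<2 ^ n. noise c k \<omega>) / 2 ^ n + (\<Sum>k<2 ^ n. if k < N0 then 0 else co c 0) / 2 ^ n" for n c
  define r where "r n = (1 / 2 ^ Suc n) *\<^sub>R base + ((1 / 2) * (\<Sum>c<2. t n c)) *\<^sub>R unit1" for n
  have t: "(\<lambda>n. t n c) \<longlonglongrightarrow> 0 + co c 0" if "c < 2" for c
    unfolding t_def using g that by (intro tendsto_add indicator_average) (auto simp: good_def)
  have rec: "avg_st (Suc n) \<omega> = mean_map (avg_st n \<omega>) + r n" if n: "N0 \<le> 2 ^ n" for n
  proof -
    have trm: "(if k < N0 then 0 else (\<Sum>c<2. st (2 * k + c) \<omega>)) =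
        (\<Sum>c<2. comp c *v st k \<omega> + (noise c k \<omega> + (if k < N0 then 0 else co c 0)) *\<^sub>R unit1)" for k
      using st_child[OF _ _ \<omega>, of k] by (auto simp: noise_def add.commute intro!: sum.cong)
    have "(\<Sum>k<2 ^ Suc n. st k \<omega>) = base + (\<Sum>k<2 ^ n. if k < N0 then 0 else (\<Sum>c<2. st (2 * k + c) \<omega>))"
      unfolding base_def power_Suc by (rule sum_children[OF _ n]) simp
    also have "\<dots> = base + (\<Sum>c<2. \<Sum>k<2 ^ n. comp c *v st k \<omega> + (noise c k \<omega> + (if k < N0 then 0 else co c 0)) *\<^sub>R unit1)"
      unfolding trm by (subst sum.swap) simp
    also have "\<dots> = base + (\<Sum>c<2. comp c *v (\<Sum>k<2 ^ n. st k \<omega>) + (2 ^ n * t n c) *\<^sub>R unit1)"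
      by (simp add: sum.distrib linear_sum[OF matrix_vector_mul_linear] scaleR_sum_left[symmetric] t_def distrib_left)
    finally have S: "(\<Sum>k<2 ^ Suc n. st k \<omega>) = base + (\<Sum>c<2. comp c *v (\<Sum>k<2 ^ n. st k \<omega>) + (2 ^ n * t n c) *\<^sub>R unit1)" .
    show ?thesis
      unfolding avg_st_def S r_def mean_map_def sum_less_2
      by (simp add: algebra_simps matrix_vector_mult_scaleR)
  qed
  have "r \<longlonglongrightarrow> 0 + ((1 / 2) * (\<Sum>c<2. 0 + co c 0)) *\<^sub>R unit1"
    unfolding r_def by (intro tendsto_intros shrinking t) auto
  then have r: "(\<lambda>n. r n - ((a 0 + b 0) / 2) *\<^sub>R unit1) \<longlonglongrightarrow> 0"
    using LIM_zero by (simp add: sum_less_2 co_def)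
  have "(\<lambda>n. avg_st n \<omega> - lam) \<longlonglongrightarrow> 0"
  proof (rule is_norm_contraction_tendsto_0[OF N mean_map_contr \<beta> _ r])
    show "\<forall>\<^sub>F n in sequentially. avg_st (Suc n) \<omega> - lam = mean_map (avg_st n \<omega> - lam) + (r n - ((a 0 + b 0) / 2) *\<^sub>R unit1)"
      using eventually_N0
    proof eventually_elim
      case (elim n)
      have "avg_st (Suc n) \<omega> - lam = mean_map (avg_st n \<omega>) + r n - (((a 0 + b 0) / 2) *\<^sub>R unit1 + mean_map lam)"
        using rec[OF elim] lam_fix by (simp only:)
      then show ?case by (simp add: linear_diff[OF linear_mean_map] algebra_simps)
    qed
  qed
  then show ?thesis by (rule LIM_zero_cancel)
qed

text \<open>A child is K x + d e1, with x the state of its mother, K the companion matrix of its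
  side and d intercept plus noise. The average of d x tends to the intercept times \<lambda> and
  that of d^2 to the squared intercept plus \<sigma>2, so the terms of the outer square that contain
  e1 tend to \<open>T_mat\<close>; the remaining one is \<open>cov_map\<close> of the previous
  average.\<close>

lemma avg_outer_tendsto:
  assumes g: "good \<omega>" shows "(\<lambda>n. avg_outer n \<omega>) \<longlonglongrightarrow> ell"
proof -
  have \<omega>: "\<omega> \<in> space P" using g by (simp add: good_def)
  define base where "base = (\<Sum>k<2 * N0. outer (st k \<omega>) (st k \<omega>))"
  define d where "d c k = (if k < N0 then 0 else co c 0 + noise c k \<omega>)" for c k
  define w where "w n c = (1 / 2 ^ n) *\<^sub>R (\<Sum>k<2 ^ n. d c k *\<^sub>R st k \<omega>)" for n c
  define t where "t n c = (\<Sum>k<2 ^ n. (d c k)\<^sup>2) / 2 ^ n" for n c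
  define r where "r n = (1 / 2 ^ Suc n) *\<^sub>R base +
      (1 / 2) *\<^sub>R (\<Sum>c<2. outer (comp c *v w n c) unit1 + outer unit1 (comp c *v w n c) + t n c *\<^sub>R outer unit1 unit1)" for n
  have w: "(\<lambda>n. w n c) \<longlonglongrightarrow> co c 0 *\<^sub>R lam" if c: "c < 2" for c
  proof -
    have "w n c = co c 0 *\<^sub>R avg_st n \<omega> + (\<chi> i. (\<Sum>k<2 ^ n. st k \<omega> $ i * noise c k \<omega>) / 2 ^ n)" for n
    proof -
      have "d c k *\<^sub>R st k \<omega> = co c 0 *\<^sub>R st k \<omega> + noise c k \<omega> *\<^sub>R st k \<omega>" for k
        by (simp add: d_def scaleR_add_left)
      then show ?thesis
        by (simp add: w_def avg_st_def sum.distrib vec_eq_iff sum_distrib_left sum_divide_distrib distrib_left ac_simps)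
    qed
    moreover have "(\<lambda>n. (\<chi> i. (\<Sum>k<2 ^ n. st k \<omega> $ i * noise c k \<omega>) / 2 ^ n)) \<longlonglongrightarrow> (0 :: (real, 'n) vec)"
      by (rule vec_tendstoI) (use g c in \<open>auto simp: good_def\<close>)
    ultimately show ?thesis
      using tendsto_add[OF tendsto_scaleR[OF tendsto_const avg_st_tendsto[OF g]], of _ 0] by simp
  qed
  have t: "(\<lambda>n. t n c) \<longlonglongrightarrow> (co c 0)\<^sup>2 + \<sigma>2" if c: "c < 2" for c
  proof -
    have "t n c = (\<Sum>k<2 ^ n. if k < N0 then 0 else (co c 0)\<^sup>2) / 2 ^ n + 2 * co c 0 * ((\<Sum>k<2 ^ n. noise c k \<omega>) / 2 ^ n) +
        (\<Sum>k<2 ^ n. (noise c k \<omega>)\<^sup>2) / 2 ^ n" for n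
    proof -
      have "(d c k)\<^sup>2 = (if k < N0 then 0 else (co c 0)\<^sup>2) + 2 * co c 0 * noise c k \<omega> + (noise c k \<omega>)\<^sup>2" for k
        by (simp add: d_def noise_def power2_sum)
      then show ?thesis by (simp add: t_def sum.distrib add_divide_distrib sum_distrib_left)
    qed
    moreover have "(\<lambda>n. (\<Sum>k<2 ^ n. if k < N0 then 0 else (co c 0)\<^sup>2) / 2 ^ n + 2 * co c 0 * ((\<Sum>k<2 ^ n. noise c k \<omega>) / 2 ^ n) +
        (\<Sum>k<2 ^ n. (noise c k \<omega>)\<^sup>2) / 2 ^ n) \<longlonglongrightarrow> (co c 0)\<^sup>2 + 2 * co c 0 * 0 + \<sigma>2"
      using g c by (intro tendsto_add tendsto_mult tendsto_const indicator_average) (auto simp: good_def)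
    ultimately show ?thesis by simp
  qed
  have rec: "avg_outer (Suc n) \<omega> = cov_map (avg_outer n \<omega>) + r n" if n: "N0 \<le> 2 ^ n" for n
  proof -
    have one: "outer (st (2 * k + c) \<omega>) (st (2 * k + c) \<omega>) = comp c ** outer (st k \<omega>) (st k \<omega>) ** transpose (comp c) +
          (outer (comp c *v (d c k *\<^sub>R st k \<omega>)) unit1 + outer unit1 (comp c *v (d c k *\<^sub>R st k \<omega>)) + (d c k)\<^sup>2 *\<^sub>R outer unit1 unit1)"
      if "N0 \<le> k" "c < 2" for k c
      unfolding st_child[OF that \<omega>] outer_matrix_mult[symmetric] using that(1)
      by (simp add: d_def outer.add_left outer.add_right outer.scaleR_left outer.scaleR_right matrix_vector_mult_scaleR
          power2_eq_square scaleR_add_right)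
    have trm: "(if k < N0 then 0 else (\<Sum>c<2. outer (st (2 * k + c) \<omega>) (st (2 * k + c) \<omega>))) =
        (\<Sum>c<2. comp c ** outer (st k \<omega>) (st k \<omega>) ** transpose (comp c) +
          (outer (comp c *v (d c k *\<^sub>R st k \<omega>)) unit1 + outer unit1 (comp c *v (d c k *\<^sub>R st k \<omega>)) + (d c k)\<^sup>2 *\<^sub>R outer unit1 unit1))" for k
    proof (cases "k < N0")
      case True
      then show ?thesis by (simp add: d_def outer.zero_left outer.zero_right linear_0[OF linear_congruence])
    next
      case False
      then show ?thesis using one[of k] by (auto intro!: sum.cong)
    qed
    have "(\<Sum>k<2 ^ Suc n. outer (st k \<omega>) (st k \<omega>)) = base + (\<Sum>k<2 ^ n. if k < N0 then 0 else (\<Sum>c<2. outer (st (2 * k + c) \<omega>) (st (2 * k + c) \<omega>)))"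
      unfolding base_def power_Suc by (rule sum_children[OF _ n]) (simp add: outer.zero_left)
    also have "\<dots> = base + (\<Sum>c<2. \<Sum>k<2 ^ n. comp c ** outer (st k \<omega>) (st k \<omega>) ** transpose (comp c) +
          (outer (comp c *v (d c k *\<^sub>R st k \<omega>)) unit1 + outer unit1 (comp c *v (d c k *\<^sub>R st k \<omega>)) + (d c k)\<^sup>2 *\<^sub>R outer unit1 unit1))"
      unfolding trm by (subst sum.swap) simp
    also have "\<dots> = base + (\<Sum>c<2. comp c ** (2 ^ n *\<^sub>R avg_outer n \<omega>) ** transpose (comp c) +
         (outer (comp c *v (2 ^ n *\<^sub>R w n c)) unit1 + outer unit1 (comp c *v (2 ^ n *\<^sub>R w n c)) + (2 ^ n * t n c) *\<^sub>R outer unit1 unit1))"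
    proof (intro arg_cong2[where f = "(+)"] sum.cong refl)
      fix c
      have W: "2 ^ n *\<^sub>R w n c = (\<Sum>k<2 ^ n. d c k *\<^sub>R st k \<omega>)" and O: "2 ^ n *\<^sub>R avg_outer n \<omega> = (\<Sum>k<2 ^ n. outer (st k \<omega>) (st k \<omega>))"
        and T: "2 ^ n * t n c = (\<Sum>k<2 ^ n. (d c k)\<^sup>2)" by (simp_all add: w_def avg_outer_def t_def)
      show "(\<Sum>k<2 ^ n. comp c ** outer (st k \<omega>) (st k \<omega>) ** transpose (comp c) +
          (outer (comp c *v (d c k *\<^sub>R st k \<omega>)) unit1 + outer unit1 (comp c *v (d c k *\<^sub>R st k \<omega>)) + (d c k)\<^sup>2 *\<^sub>R outer unit1 unit1)) =
        comp c ** (2 ^ n *\<^sub>R avg_outer n \<omega>) ** transpose (comp c) +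
         (outer (comp c *v (2 ^ n *\<^sub>R w n c)) unit1 + outer unit1 (comp c *v (2 ^ n *\<^sub>R w n c)) + (2 ^ n * t n c) *\<^sub>R outer unit1 unit1)"
        unfolding W O T linear_sum[OF linear_congruence] linear_sum[OF matrix_vector_mul_linear] outer.sum_left outer.sum_right scaleR_sum_left
        by (simp only: sum.distrib)
    qed
    also have "\<dots> = base + 2 ^ n *\<^sub>R (\<Sum>c<2. comp c ** avg_outer n \<omega> ** transpose (comp c) +
         (outer (comp c *v w n c) unit1 + outer unit1 (comp c *v w n c) + t n c *\<^sub>R outer unit1 unit1))"
      by (simp add: linear_scale[OF linear_congruence] matrix_vector_mult_scaleR outer.scaleR_left outer.scaleR_right
          scaleR_sum_right scaleR_add_right)
    finally have "avg_outer (Suc n) \<omega> = (1 / 2 ^ Suc n) *\<^sub>R (base + 2 ^ n *\<^sub>R (\<Sum>c<2. comp c ** avg_outer n \<omega> ** transpose (comp c) +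
         (outer (comp c *v w n c) unit1 + outer unit1 (comp c *v w n c) + t n c *\<^sub>R outer unit1 unit1)))"
      by (simp only: avg_outer_def)
    also have "\<dots> = (1 / 2 ^ Suc n) *\<^sub>R base + (1 / 2) *\<^sub>R (\<Sum>c<2. comp c ** avg_outer n \<omega> ** transpose (comp c) +
         (outer (comp c *v w n c) unit1 + outer unit1 (comp c *v w n c) + t n c *\<^sub>R outer unit1 unit1))"
      by (simp add: scaleR_add_right)
    also have "\<dots> = cov_map (avg_outer n \<omega>) + r n"
      unfolding cov_map_def r_def sum.distrib[where A = "{..<2}" and g = "\<lambda>c. comp c ** avg_outer n \<omega> ** transpose (comp c)"]
      by (simp only: scaleR_add_right ac_simps)
    finally show ?thesis .
  qed
  have "r \<longlonglongrightarrow> 0 + (1 / 2) *\<^sub>R (\<Sum>c<2. outer (comp c *v (co c 0 *\<^sub>R lam)) unit1 + outer unit1 (comp c *v (co c 0 *\<^sub>R lam)) + ((co c 0)\<^sup>2 + \<sigma>2) *\<^sub>R outer unit1 unit1)"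
    unfolding r_def
    by (intro tendsto_add tendsto_scaleR tendsto_const shrinking tendsto_sum outer.tendsto t w
        bounded_linear.tendsto[OF matrix_vector_mul_bounded_linear]) auto
  moreover have "(1 / 2) *\<^sub>R (\<Sum>c<2. outer (comp c *v (co c 0 *\<^sub>R lam)) unit1 + outer unit1 (comp c *v (co c 0 *\<^sub>R lam)) + ((co c 0)\<^sup>2 + \<sigma>2) *\<^sub>R outer unit1 unit1) = T_mat a b \<sigma>2"
    unfolding sum_less_2 T_mat_def Let_def
    by (simp add: co_def vec_eq_iff outer_def matrix_vector_mult_scaleR field_simps)
  ultimately have r: "(\<lambda>n. r n - T_mat a b \<sigma>2) \<longlonglongrightarrow> 0"
    using LIM_zero by simp
  have "(\<lambda>n. avg_outer n \<omega> - ell) \<longlonglongrightarrow> 0"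
  proof (rule is_norm_contraction_tendsto_0[OF is_norm_tensor_norm[OF N] cov_map_contr \<beta> _ r])
    show "\<forall>\<^sub>F n in sequentially. avg_outer (Suc n) \<omega> - ell = cov_map (avg_outer n \<omega> - ell) + (r n - T_mat a b \<sigma>2)"
      using eventually_N0
    proof eventually_elim
      case (elim n)
      have "avg_outer (Suc n) \<omega> - ell = cov_map (avg_outer n \<omega>) + r n - (T_mat a b \<sigma>2 + cov_map ell)"
        using rec[OF elim] ell_fix by (simp only:)
      then show ?case by (simp add: linear_diff[OF linear_cov_map] algebra_simps)
    qed
  qed
  then show ?thesis by (rule LIM_zero_cancel)
qed

definition yv :: "nat \<Rightarrow> 'w \<Rightarrow> (real, 'n option) vec" where
  "yv k \<omega> = (if k < N0 then 0 else Y_vec X k \<omega>)"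

abbreviation LL :: "((real, 'n option) vec, 'n option) vec" where "LL \<equiv> L_mat a b \<sigma>2"

lemma yv_None: "yv k \<omega> $ None = (if k < N0 then 0 else 1)" by (simp add: yv_def Y_vec_def)
lemma yv_Some: "yv k \<omega> $ Some j = st k \<omega> $ j" by (simp add: yv_def Y_vec_def st_def)

lemma yv_average:
  assumes g: "good \<omega>" shows "(\<lambda>n. (\<Sum>k<2 ^ n. yv k \<omega> $ i * yv k \<omega> $ j) / 2 ^ n) \<longlonglongrightarrow> LL $ i $ j"
proof -
  have h: "(\<lambda>n. (\<Sum>k<2 ^ n. st k \<omega> $ l) / 2 ^ n) \<longlonglongrightarrow> lam $ l" for l
    using tendsto_vec_nth[OF avg_st_tendsto[OF g], of l] by (simp add: avg_st_def)
  have K: "(\<lambda>n. (\<Sum>k<2 ^ n. st k \<omega> $ l * st k \<omega> $ l') / 2 ^ n) \<longlonglongrightarrow> ell $ l $ l'" for l l'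
    using tendsto_vec_nth[OF tendsto_vec_nth[OF avg_outer_tendsto[OF g], of l], of l'] by (simp add: avg_outer_def outer_def)
  have i: "(if k < N0 then 0 else 1) * st k \<omega> $ l = st k \<omega> $ l" "st k \<omega> $ l * (if k < N0 then 0 else 1) = st k \<omega> $ l" for k l
    by auto
  have ii: "(if k < N0 then 0 else 1) * (if k < N0 then 0 else 1) = (if k < N0 then 0 else 1 :: real)" for k by simp
  show ?thesis
    by (cases i; cases j; simp only: yv_None yv_Some i ii L_mat_def vec_lambda_beta prod.case option.case)
       (intro indicator_average h K)+
qed

definition qf :: "(real, 'n option) vec \<Rightarrow> real" where "qf u = u \<bullet> (LL *v u)"

lemma qf_expand: "qf u = (\<Sum>i\<in>UNIV. \<Sum>j\<in>UNIV. u $ i * u $ j * LL $ i $ j)"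
  by (simp add: qf_def inner_vec_def matrix_vector_mult_def sum_distrib_left ac_simps)

lemma inner_yv_square: "(u \<bullet> yv k \<omega>)\<^sup>2 = (\<Sum>i\<in>UNIV. \<Sum>j\<in>UNIV. u $ i * u $ j * (yv k \<omega> $ i * yv k \<omega> $ j))"
  by (simp add: power2_eq_square inner_vec_def sum_product ac_simps)

lemma qf_average:
  assumes g: "good \<omega>" shows "(\<lambda>n. (\<Sum>k<2 ^ n. (u \<bullet> yv k \<omega>)\<^sup>2) / 2 ^ n) \<longlonglongrightarrow> qf u"
proof -
  have "(\<Sum>k<2 ^ n. (u \<bullet> yv k \<omega>)\<^sup>2) / 2 ^ n = (\<Sum>i\<in>UNIV. \<Sum>j\<in>UNIV. u $ i * u $ j * ((\<Sum>k<2 ^ n. yv k \<omega> $ i * yv k \<omega> $ j) / 2 ^ n))" for n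
  proof -
    have "(\<Sum>k<2 ^ n. (u \<bullet> yv k \<omega>)\<^sup>2) = (\<Sum>i\<in>UNIV. \<Sum>j\<in>UNIV. \<Sum>k<2 ^ n. u $ i * u $ j * (yv k \<omega> $ i * yv k \<omega> $ j))"
      unfolding inner_yv_square by (subst sum.swap, rule sum.cong[OF refl], subst sum.swap) simp
    then show ?thesis by (simp add: sum_divide_distrib sum_distrib_left)
  qed
  moreover have "(\<lambda>n. \<Sum>i\<in>UNIV. \<Sum>j\<in>UNIV. u $ i * u $ j * ((\<Sum>k<2 ^ n. yv k \<omega> $ i * yv k \<omega> $ j) / 2 ^ n)) \<longlonglongrightarrow> qf u"
    unfolding qf_expand by (intro tendsto_sum tendsto_mult tendsto_const yv_average g)
  ultimately show ?thesis by simp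
qed

text \<open>In the direction u, the child c of k is observed as \<^term>\<open>pull c u\<close> observes k, up to noise.\<close>

definition head :: "(real, 'n option) vec \<Rightarrow> real" where "head u = (\<chi> j. u $ Some j) \<bullet> unit1"

definition pull :: "nat \<Rightarrow> (real, 'n option) vec \<Rightarrow> (real, 'n option) vec" where
  "pull c u = (\<chi> i. case i of None \<Rightarrow> u $ None + co c 0 * head u
     | Some j \<Rightarrow> (transpose (comp c) *v (\<chi> j. u $ Some j)) $ j)"

lemma sum_option: "(\<Sum>i\<in>UNIV. f (i :: 'n option)) = f None + (\<Sum>j\<in>UNIV. f (Some j))"
  by (simp add: UNIV_option_conv sum.reindex)

lemma inner_option: "u \<bullet> v = u $ None * v $ None + (\<chi> j. u $ Some j) \<bullet> (\<chi> j. (v :: (real, 'n option) vec) $ Some j)"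
  by (simp add: inner_vec_def sum_option)

lemma inner_yv_child:
  assumes k: "N0 \<le> k" and c: "c < 2" and \<omega>: "\<omega> \<in> space P"
  shows "u \<bullet> yv (2 * k + c) \<omega> = pull c u \<bullet> yv k \<omega> + head u * noise c k \<omega>"
proof -
  define u' where "u' = (\<chi> j. u $ Some j)"
  have st: "(\<chi> j. yv l \<omega> $ Some j) = st l \<omega>" for l by (simp add: yv_Some vec_eq_iff)
  have "u \<bullet> yv (2 * k + c) \<omega> = u $ None + u' \<bullet> (comp c *v st k \<omega> + (co c 0 + noise c k \<omega>) *\<^sub>R unit1)"
    unfolding inner_option[of u] st u'_def[symmetric] st_child[OF assms] using child_ge[OF k, of c] by (simp add: yv_None)
  also have "\<dots> = u $ None + (transpose (comp c) *v u') \<bullet> st k \<omega> + (co c 0 + noise c k \<omega>) * head u"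
    by (simp add: inner_add_right head_def u'_def[symmetric] dot_lmul_matrix transpose_matrix_vector)
  also have "\<dots> = pull c u \<bullet> yv k \<omega> + head u * noise c k \<omega>"
    unfolding inner_option[of "pull c u"] st using k
    by (simp add: pull_def yv_None u'_def[symmetric] algebra_simps vec_lambda_eta)
  finally show ?thesis .
qed

text \<open>The average of \<open>(u \<bullet> yv k \<omega>)\<^sup>2\<close> up to generation n is
  computed in two ways: its limit is \<open>qf u\<close>, and expanding every child over its mother
  gives the right-hand side, the products with the noise averaging to 0.\<close>

lemma qf_recursion: assumes g: "good \<omega>" shows "qf u = \<sigma>2 * (head u)\<^sup>2 + (\<Sum>c<2. qf (pull c u)) / 2"
proof -
  have \<omega>: "\<omega> \<in> space P" using g by (simp add: good_def)
  define base where "base = (\<Sum>k<2 * N0. (u \<bullet> yv k \<omega>)\<^sup>2)"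
  define cr where "cr n c = (\<Sum>k<2 ^ n. (pull c u \<bullet> yv k \<omega>) * noise c k \<omega>) / 2 ^ n" for n c
  have cr: "(\<lambda>n. cr n c) \<longlonglongrightarrow> 0" if c: "c < 2" for c
  proof -
    let ?v = "pull c u"
    have "(?v \<bullet> yv k \<omega>) * noise c k \<omega> = ?v $ None * noise c k \<omega> + (\<Sum>j\<in>UNIV. ?v $ Some j * (st k \<omega> $ j * noise c k \<omega>))" for k
      by (simp add: inner_vec_def sum_option yv_None yv_Some distrib_right sum_distrib_right noise_def mult.assoc)
    then have "cr n c = ?v $ None * ((\<Sum>k<2 ^ n. noise c k \<omega>) / 2 ^ n) + (\<Sum>j\<in>UNIV. ?v $ Some j * ((\<Sum>k<2 ^ n. st k \<omega> $ j * noise c k \<omega>) / 2 ^ n))" for n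
      unfolding cr_def by (simp add: sum.distrib add_divide_distrib sum_distrib_left sum_divide_distrib) (subst sum.swap, simp)
    moreover have "(\<lambda>n. ?v $ None * ((\<Sum>k<2 ^ n. noise c k \<omega>) / 2 ^ n) + (\<Sum>j\<in>UNIV. ?v $ Some j * ((\<Sum>k<2 ^ n. st k \<omega> $ j * noise c k \<omega>) / 2 ^ n)))
        \<longlonglongrightarrow> ?v $ None * 0 + (\<Sum>j\<in>UNIV. ?v $ Some j * 0)"
      using g c by (intro tendsto_add tendsto_mult tendsto_const tendsto_sum) (auto simp: good_def)
    ultimately show ?thesis by simp
  qed
  define rhs where "rhs n = base / 2 ^ Suc n + (\<Sum>c<2. (\<Sum>k<2 ^ n. (pull c u \<bullet> yv k \<omega>)\<^sup>2) / 2 ^ n + 2 * head u * cr n c + (head u)\<^sup>2 * ((\<Sum>k<2 ^ n. (noise c k \<omega>)\<^sup>2) / 2 ^ n)) / 2" for n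
  have ev: "\<forall>\<^sub>F n in sequentially. rhs n = (\<Sum>k<2 ^ Suc n. (u \<bullet> yv k \<omega>)\<^sup>2) / 2 ^ Suc n"
    using eventually_N0
  proof eventually_elim
    case (elim n)
    have trm: "(if k < N0 then 0 else (\<Sum>c<2. (u \<bullet> yv (2 * k + c) \<omega>)\<^sup>2)) =
       (\<Sum>c<2. (pull c u \<bullet> yv k \<omega>)\<^sup>2 + 2 * head u * ((pull c u \<bullet> yv k \<omega>) * noise c k \<omega>) + (head u)\<^sup>2 * (noise c k \<omega>)\<^sup>2)" for k
    proof (cases "k < N0")
      case True then show ?thesis by (simp add: yv_def noise_def)
    next
      case False
      then have "(u \<bullet> yv (2 * k + c) \<omega>)\<^sup>2 = (pull c u \<bullet> yv k \<omega>)\<^sup>2 + 2 * head u * ((pull c u \<bullet> yv k \<omega>) * noise c k \<omega>) + (head u)\<^sup>2 * (noise c k \<omega>)\<^sup>2" if "c < 2" for c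
        using inner_yv_child[OF _ that \<omega>, of k u] by (simp add: power2_sum power_mult_distrib)
      then show ?thesis using False by (auto intro!: sum.cong)
    qed
    have "(\<Sum>k<2 ^ Suc n. (u \<bullet> yv k \<omega>)\<^sup>2) = base + (\<Sum>k<2 ^ n. if k < N0 then 0 else (\<Sum>c<2. (u \<bullet> yv (2 * k + c) \<omega>)\<^sup>2))"
      unfolding base_def power_Suc by (rule sum_children[OF _ elim]) (simp add: yv_def)
    also have "\<dots> = base + (\<Sum>c<2. \<Sum>k<2 ^ n. (pull c u \<bullet> yv k \<omega>)\<^sup>2 + 2 * head u * ((pull c u \<bullet> yv k \<omega>) * noise c k \<omega>) + (head u)\<^sup>2 * (noise c k \<omega>)\<^sup>2)"
      unfolding trm by (subst sum.swap) simp
    also have "\<dots> = base + 2 ^ n * (\<Sum>c<2. (\<Sum>k<2 ^ n. (pull c u \<bullet> yv k \<omega>)\<^sup>2) / 2 ^ n + 2 * head u * cr n c + (head u)\<^sup>2 * ((\<Sum>k<2 ^ n. (noise c k \<omega>)\<^sup>2) / 2 ^ n))"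
      unfolding sum.distrib sum_distrib_left[symmetric] sum_less_2 cr_def by (simp add: field_simps)
    finally show ?case by (simp add: rhs_def field_simps)
  qed
  have "rhs \<longlonglongrightarrow> 0 + (\<Sum>c<2. qf (pull c u) + 2 * head u * 0 + (head u)\<^sup>2 * \<sigma>2) / 2"
    unfolding rhs_def using g shrinking[of base]
    by (intro tendsto_add tendsto_divide tendsto_mult tendsto_sum tendsto_const qf_average cr) (auto simp: good_def)
  then have "rhs \<longlonglongrightarrow> \<sigma>2 * (head u)\<^sup>2 + (\<Sum>c<2. qf (pull c u)) / 2" by (simp add: sum_less_2 field_simps)
  from Lim_transform_eventually[OF this ev] LIMSEQ_Suc[OF qf_average[OF g, of u]]
  show ?thesis using LIMSEQ_unique by blast
qed

lemma qf_nonneg: assumes g: "good \<omega>" shows "0 \<le> qf u"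
  by (rule LIMSEQ_le_const[OF qf_average[OF g]]) (auto intro!: divide_nonneg_nonneg sum_nonneg)

text \<open>A null vector has zero \<open>head\<close>, and its pull-back to the mother is null
  again. With zero \<open>head\<close> the pull-back shifts the coordinates, so one more of them
  vanishes at each level. The coordinate \<open>None\<close> is left, and the form there is its
  square because the corner entry of L is 1.\<close>

lemma qf_eq_0: assumes g: "good \<omega>" and q: "qf u = 0" shows "u = 0"
proof -
  have split: "head u = 0 \<and> qf (pull 0 u) = 0" if "qf u = 0" for u
  proof -
    have "0 \<le> \<sigma>2 * (head u)\<^sup>2" using \<sigma>2_pos by simp
    moreover have "qf u = \<sigma>2 * (head u)\<^sup>2 + (qf (pull 0 u) + qf (pull 1 u)) / 2"
      using qf_recursion[OF g, of u] by (simp only: sum_less_2)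
    moreover have "0 \<le> qf (pull 0 u)" "0 \<le> qf (pull 1 u)" by (rule qf_nonneg[OF g])+
    ultimately have "\<sigma>2 * (head u)\<^sup>2 = 0 \<and> qf (pull 0 u) = 0" using that by argo
    then show ?thesis using \<sigma>2_pos by simp
  qed
  have head_eq: "head u = u $ Some i" if "pos i = 1" for u and i :: 'n
  proof -
    have "head u = (\<Sum>j\<in>UNIV. if j = i then u $ Some j else 0)"
      unfolding head_def inner_vec_def e1_def using that by (intro sum.cong refl) (auto simp: pos_inj[symmetric])
    then show ?thesis by simp
  qed
  \<comment> \<open>Quantified over all null vectors, because the induction hypothesis is applied to
    \<open>pull 0 u\<close>.\<close>
  have "\<forall>u. qf u = 0 \<longrightarrow> (\<forall>i::'n. pos i \<le> m \<longrightarrow> u $ Some i = 0)" for m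
  proof (induction m)
    case 0 show ?case using pos_range by (metis le_zero_eq not_one_le_zero)
  next
    case (Suc m)
    show ?case
    proof (intro allI impI)
      fix u and i :: 'n assume q: "qf u = 0" and i: "pos i \<le> Suc m"
      note s = split[OF q]
      show "u $ Some i = 0"
      proof (cases "pos i = 1")
        case True then show ?thesis using s head_eq[OF True, of u] by simp
      next
        case False
        then have "1 \<le> pos i - 1" "pos i - 1 \<le> CARD('n)" using pos_range[of i] by auto
        then obtain j :: 'n where j: "pos j = pos i - 1" by (rule pos_obtain)
        then have ij: "pos i = pos j + 1" using False pos_range[of i] by auto
        have "pull 0 u $ Some j = (\<chi> j. u $ Some j) $ i"
        proof -
          have "(transpose (comp 0) *v (\<chi> j. u $ Some j)) $ j = (\<chi> j. u $ Some j) $ i"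
            by (rule transpose_companion_shift[OF ij]) (use s head_eq[of _ u] in simp)
          then show ?thesis unfolding pull_def by (simp only: vec_lambda_beta option.case)
        qed
        moreover have "pull 0 u $ Some j = 0" using Suc s ij i by simp
        ultimately show ?thesis by simp
      qed
    qed
  qed
  from this[of "CARD('n)"] have z: "u $ Some i = 0" for i using q pos_range by blast
  have "qf u = u $ None * u $ None"
    unfolding qf_expand sum_option by (simp add: z L_mat_def)
  then have "u $ None = 0" using q by simp
  with z have "u $ i = 0" for i by (cases i) auto
  then show ?thesis by (simp add: vec_eq_iff)
qed

lemma good_exists: "\<exists>\<omega>. good \<omega>"
proof (rule ccontr)
  assume "\<not> ?thesis"
  then have "AE \<omega> in P. False" using AE_good by simp
  then show False by simp
qed

lemma LL_invertible: "invertible LL"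
proof -
  obtain \<omega> where g: "good \<omega>" using good_exists by blast
  have "u = 0" if "LL *v u = 0" for u using that by (intro qf_eq_0[OF g]) (simp add: qf_def)
  then have "\<exists>B. B ** LL = mat 1" unfolding matrix_left_invertible_ker by blast
  then show ?thesis by (simp add: invertible_left_inverse)
qed

text \<open>Inherited from the symmetric empirical matrices, whose limit it is.\<close>

lemma LL_sym: "LL $ i $ j = LL $ j $ i"
proof -
  obtain \<omega> where g: "good \<omega>" using good_exists by blast
  show ?thesis
    by (rule LIMSEQ_unique[OF yv_average[OF g]]) (use yv_average[OF g, of j i] in \<open>simp add: mult.commute\<close>)
qed

end

section \<open>The quadratic functional\<close>

lemma matrix_inv_unique:
  fixes A B :: "real ^ 'd ^ 'd"
  assumes "A ** B = mat 1" "B ** A = mat 1" shows "matrix_inv A = B"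
proof -
  have "invertible A" using assms by (auto simp: invertible_def)
  then have "matrix_inv A ** (A ** B) = B" by (simp add: matrix_mul_assoc matrix_inv_inverse)
  then show ?thesis by (simp add: assms)
qed

lemma sum_prod_UNIV: "(\<Sum>x\<in>UNIV. f (x :: 'c::finite \<times> 'd::finite)) = (\<Sum>a\<in>UNIV. \<Sum>b\<in>UNIV. f (a, b))"
  by (simp add: UNIV_Times_UNIV[symmetric] sum.cartesian_product del: UNIV_Times_UNIV)

lemma kron_mult: "kron A B ** kron C D = kron (A ** C) (B ** (D :: real ^ 'd ^ 'd) :: real ^ 'd ^ 'd)"
  for A C :: "real ^ 'c ^ 'c"
  by (simp add: vec_eq_iff kron_def matrix_matrix_mult_def sum_prod_UNIV sum_product ac_simps)

lemma kron_one: "kron (mat 1 :: real ^ 'c ^ 'c) (mat 1 :: real ^ 'd ^ 'd) = mat 1"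
  by (auto simp: vec_eq_iff kron_def mat_def)

lemma matrix_inv_kron_one:
  fixes S :: "real ^ 'd ^ 'd" assumes "invertible S"
  shows "matrix_inv (kron (mat 1 :: real ^ 'c ^ 'c) S) = kron (mat 1) (matrix_inv S)"
  by (rule matrix_inv_unique) (simp_all add: kron_mult matrix_inv_inverse[OF assms] kron_one)

lemma inner_kron_mult:
  fixes A :: "real ^ 'c ^ 'c" and B :: "real ^ 'd ^ 'd"
  shows "u \<bullet> (kron A B *v u) = (\<Sum>a\<in>UNIV. \<Sum>a'\<in>UNIV. A $ a $ a' * ((\<chi> i. u $ (a, i)) \<bullet> (B *v (\<chi> i. u $ (a', i)))))"
proof -
  have "u \<bullet> (kron A B *v u) = (\<Sum>a\<in>UNIV. \<Sum>i\<in>UNIV. \<Sum>a'\<in>UNIV. \<Sum>j\<in>UNIV. u $ (a, i) * (A $ a $ a' * B $ i $ j * u $ (a', j)))"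
    by (simp add: inner_vec_def matrix_vector_mult_def kron_def sum_prod_UNIV sum_distrib_left)
  also have "\<dots> = (\<Sum>a\<in>UNIV. \<Sum>a'\<in>UNIV. \<Sum>i\<in>UNIV. \<Sum>j\<in>UNIV. u $ (a, i) * (A $ a $ a' * B $ i $ j * u $ (a', j)))"
    by (intro sum.cong refl) (rule sum.swap)
  also have "\<dots> = (\<Sum>a\<in>UNIV. \<Sum>a'\<in>UNIV. A $ a $ a' * ((\<chi> i. u $ (a, i)) \<bullet> (B *v (\<chi> i. u $ (a', i)))))"
    by (simp add: inner_vec_def matrix_vector_mult_def sum_distrib_left ac_simps)
  finally show ?thesis .
qed

lemma UNIV_2: "(UNIV :: 2 set) = {1, 2}"
  using exhaust_2 by auto

lemma bounded_average:
  fixes x :: "nat \<Rightarrow> real"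
  assumes lim: "(\<lambda>n. (\<Sum>k<n. x k) / real n) \<longlonglongrightarrow> l" and pos: "\<And>k. 0 \<le> x k"
  shows "\<exists>C. \<forall>n. (\<Sum>k<n. x k) \<le> C * real n"
proof -
  obtain C where C: "\<And>n. \<bar>(\<Sum>k<n. x k) / real n\<bar> \<le> C"
    using Bseq_conv_Bfun convergentI[OF lim, THEN convergent_imp_Bseq] by (auto simp: Bseq_def)
  have "(\<Sum>k<n. x k) \<le> C * real n" for n
  proof (cases "n = 0")
    case False
    have "(\<Sum>k<n. x k) / real n \<le> C" using C[of n] by linarith
    then show ?thesis using False by (simp add: divide_le_eq)
  qed simp
  then show ?thesis by blast
qed

text \<open>\<open>D\<close> collects the finitely many terms in which \<open>V\<close> and
  \<open>V'\<close> or the starting points of the sums differ. For the bound,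
  \<open>V' n / real n\<close> is the difference of two sequences with the same limit, the sums up
  to n + 1 and up to n, both divided by n.\<close>

lemma average_eventually_eq:
  fixes V V' :: "nat \<Rightarrow> real"
  assumes ev: "eventually (\<lambda>n. V n = V' n) sequentially" and lim: "(\<lambda>n. (\<Sum>k<n. V' k) / real n) \<longlonglongrightarrow> v"
  shows "(\<lambda>n. (1 / real n) * (\<Sum>k=p..n. V k)) \<longlonglongrightarrow> v" and "V \<in> O(\<lambda>n. real n)"
proof -
  obtain K where K: "\<And>n. n \<ge> K \<Longrightarrow> V n = V' n" using ev by (auto simp: eventually_sequentially)
  define L where "L = max K p"
  define D where "D = (\<Sum>k=p..<L. V k) - (\<Sum>k<L. V' k)"
  have ratio: "(\<lambda>n. real (Suc n) / real n) \<longlonglongrightarrow> 1"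
    using LIMSEQ_Suc_n_over_n by simp
  have shift: "(\<lambda>n. (\<Sum>k<Suc n. V' k) / real n) \<longlonglongrightarrow> v"
  proof (rule Lim_transform_eventually)
    show "(\<lambda>n. ((\<Sum>k<Suc n. V' k) / real (Suc n)) * (real (Suc n) / real n)) \<longlonglongrightarrow> v"
      using tendsto_mult[OF LIMSEQ_Suc[OF lim] ratio] by simp
    show "\<forall>\<^sub>F n in sequentially. ((\<Sum>k<Suc n. V' k) / real (Suc n)) * (real (Suc n) / real n) = (\<Sum>k<Suc n. V' k) / real n"
      by (rule always_eventually) (simp del: of_nat_Suc sum.lessThan_Suc)
  qed
  have "(\<lambda>n. (\<Sum>k<Suc n. V' k) / real n + D / real n) \<longlonglongrightarrow> v + 0"
    by (intro tendsto_add shift lim_const_over_n)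
  moreover have "\<forall>\<^sub>F n in sequentially. (\<Sum>k<Suc n. V' k) / real n + D / real n = (1 / real n) * (\<Sum>k=p..n. V k)"
    using eventually_ge_at_top[of L]
  proof eventually_elim
    case (elim n)
    have "(\<Sum>k=p..n. V k) = (\<Sum>k=p..<L. V k) + (\<Sum>k=L..<Suc n. V k)"
      using elim by (subst sum.atLeastLessThan_concat) (auto simp: L_def atLeastLessThanSuc_atLeastAtMost)
    also have "(\<Sum>k=L..<Suc n. V k) = (\<Sum>k=L..<Suc n. V' k)" using K by (intro sum.cong) (auto simp: L_def)
    also have "\<dots> = (\<Sum>k<Suc n. V' k) - (\<Sum>k<L. V' k)"
      using elim sum.atLeastLessThan_concat[of 0 L "Suc n" V'] by (simp add: atLeast0LessThan del: sum.lessThan_Suc sum.op_ivl_Suc)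
    finally have "(\<Sum>k=p..n. V k) = (\<Sum>k<Suc n. V' k) + D" by (simp add: D_def del: sum.lessThan_Suc)
    then show ?case by (simp add: add_divide_distrib del: sum.lessThan_Suc)
  qed
  ultimately show "(\<lambda>n. (1 / real n) * (\<Sum>k=p..n. V k)) \<longlonglongrightarrow> v"
    by (simp add: Lim_transform_eventually del: sum.lessThan_Suc)
  have "(\<lambda>n. (\<Sum>k<Suc n. V' k) / real n - (\<Sum>k<n. V' k) / real n) \<longlonglongrightarrow> v - v" by (intro tendsto_diff shift lim)
  then have "(\<lambda>n. V' n / real n) \<longlonglongrightarrow> 0" by (simp add: add_divide_distrib)
  then have "(\<lambda>n. V n / real n) \<longlonglongrightarrow> 0"
    by (rule Lim_transform_eventually) (use ev in eventually_elim, simp)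
  then show "V \<in> O(\<lambda>n. real n)"
    by (rule bigoI_tendsto) (use eventually_gt_at_top[of 0] in eventually_elim, simp)
qed

context bar_vector
begin

section \<open>Quadratic averages of the two blocks of M n\<close>

definition mv :: "nat \<Rightarrow> nat \<Rightarrow> 'w \<Rightarrow> (real, 'n option) vec" where
  "mv c n \<omega> = (\<Sum>k<2 ^ n. noise c k \<omega> *\<^sub>R yv k \<omega>)"

lemma yv_component_meas: "0 < k \<Longrightarrow> (\<lambda>\<omega>. yv k \<omega> $ i) \<in> borel_measurable (G (2 ^ floor_log k))"
  by (cases i) (simp_all add: yv_None yv_Some st_component_meas)

lemma yv_component_meas': "(\<lambda>\<omega>. yv k \<omega> $ i) \<in> borel_measurable (G k)"
  by (cases i) (simp_all add: yv_None yv_Some st_component_meas')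

lemma yv_component_L4: "L4 P (\<lambda>\<omega>. yv k \<omega> $ i)"
  by (cases i) (simp_all add: yv_None yv_Some st_component_L4)

lemma inner_mv: "u \<bullet> mv c n \<omega> = (\<Sum>k<2 ^ n. noise c k \<omega> * (u \<bullet> yv k \<omega>))"
  by (simp add: mv_def inner_sum_right)

text \<open>By the quadratic law, the square of \<open>u \<bullet> mv c n \<omega>\<close> and its
  compensator have the same averages after division by 2 ^ n. At good points the normalized
  compensator converges to \<open>\<sigma>2 * qf u\<close>; the convergence behind this also
  supplies the random bound on the weights.\<close>

lemma mv_square_average:
  assumes c: "c < 2"
  shows "AE \<omega> in P. (\<lambda>m. (\<Sum>n<m. (u \<bullet> mv c n \<omega>)\<^sup>2 / 2 ^ n) / real m) \<longlonglongrightarrow> \<sigma>2 * qf u"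
proof -
  have c1: "c \<le> 1" using c by simp
  interpret Q: quadratic_law P G "noise c" var "kurt c" "\<lambda>k \<omega>. u \<bullet> yv k \<omega>" \<sigma>2
  proof unfold_locales
    show "(\<lambda>\<omega>. u \<bullet> yv k \<omega>) \<in> borel_measurable (G (2 ^ floor_log k))" if "0 < k" for k
      unfolding inner_vec_def inner_real_def
      by (intro borel_measurable_sum borel_measurable_times yv_component_meas that) auto
    show "(\<lambda>\<omega>. u \<bullet> yv 0 \<omega>) = (\<lambda>\<omega>. 0)" by (simp add: yv_def)
  qed (use noise_L4 noise_adapted[OF c1] noise_mean[OF c1] noise_var[OF c1] var_bounds noise_fourth[OF c1] kurt_meas in auto)
  have "AE \<omega> in P. \<exists>C. \<forall>n. (\<Sum>k\<in>Gen n. (u \<bullet> yv k \<omega>)\<^sup>2) \<le> C * 2 ^ n"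
    using AE_good
  proof eventually_elim
    case (elim \<omega>)
    obtain C where C: "\<And>n. \<bar>(\<Sum>k<2 ^ n. (u \<bullet> yv k \<omega>)\<^sup>2) / 2 ^ n\<bar> \<le> C"
      using convergentI[OF qf_average[OF elim, of u], THEN convergent_imp_Bseq] by (auto simp: Bseq_def)
    \<comment> \<open>Generation n lies among the first 2 ^ (n + 1) indices, hence the factor
      2.\<close>
    have "(\<Sum>k\<in>Gen n. (u \<bullet> yv k \<omega>)\<^sup>2) \<le> (2 * C) * 2 ^ n" for n
    proof -
      have "(\<Sum>k\<in>Gen n. (u \<bullet> yv k \<omega>)\<^sup>2) \<le> (\<Sum>k<2 ^ Suc n. (u \<bullet> yv k \<omega>)\<^sup>2)"
        by (intro sum_mono2) (auto simp: Gen_def)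
      also have "\<dots> \<le> C * 2 ^ Suc n"
      proof -
        have "(\<Sum>k<2 ^ Suc n. (u \<bullet> yv k \<omega>)\<^sup>2) / 2 ^ Suc n \<le> C" using C[of "Suc n"] by linarith
        then show ?thesis by (simp only: pos_divide_le_eq zero_less_power zero_less_numeral)
      qed
      finally show ?thesis by simp
    qed
    then show ?case by blast
  qed
  from Q.quadratic_strong_law[OF this kurt_bounded[OF c1]] AE_good show ?thesis
  proof eventually_elim
    case (elim \<omega>)
    define A where "A n = \<sigma>2 * ((\<Sum>k<2 ^ n. (u \<bullet> yv k \<omega>)\<^sup>2) / 2 ^ n)" for n
    have "A \<longlonglongrightarrow> \<sigma>2 * qf u" unfolding A_def by (intro tendsto_mult tendsto_const qf_average elim)
    note lim0 = cesaro_null[OF LIM_zero[OF this]]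
    \<comment> \<open>The quotient \<open>real m / real m\<close> is kept because it is 0 at m =
      0.\<close>
    have "(\<Sum>n<m. A n - \<sigma>2 * qf u) / real m = (\<Sum>n<m. A n) / real m - \<sigma>2 * qf u * (real m / real m)" for m
      by (simp add: sum_subtractf diff_divide_distrib)
    then have "(\<lambda>m. (\<Sum>n<m. A n) / real m - \<sigma>2 * qf u * (real m / real m)) \<longlonglongrightarrow> 0"
      using lim0 by (simp only:)
    moreover have one: "(\<lambda>m. real m / real m) \<longlonglongrightarrow> 1"
      by (rule Lim_transform_eventually[OF tendsto_const]) (use eventually_gt_at_top[of 0] in eventually_elim, simp)
    ultimately have "(\<lambda>m. ((\<Sum>n<m. A n) / real m - \<sigma>2 * qf u * (real m / real m)) + \<sigma>2 * qf u * (real m / real m)) \<longlonglongrightarrow> 0 + \<sigma>2 * qf u * 1"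
      by (intro tendsto_add tendsto_mult tendsto_const)
    then have Aavg: "(\<lambda>m. (\<Sum>n<m. A n) / real m) \<longlonglongrightarrow> \<sigma>2 * qf u" by simp
    have "(\<Sum>k<2 ^ n. var k * (u \<bullet> yv k \<omega>)\<^sup>2) / 2 ^ n = A n" for n
    proof -
      have "var k * (u \<bullet> yv k \<omega>)\<^sup>2 = \<sigma>2 * (u \<bullet> yv k \<omega>)\<^sup>2" for k by (simp add: var_def yv_def)
      then have "(\<Sum>k<2 ^ n. var k * (u \<bullet> yv k \<omega>)\<^sup>2) = \<sigma>2 * (\<Sum>k<2 ^ n. (u \<bullet> yv k \<omega>)\<^sup>2)"
        unfolding sum_distrib_left by (intro sum.cong refl)
      then show ?thesis by (simp add: A_def)
    qed
    then have "((\<Sum>k<2 ^ n. noise c k \<omega> * (u \<bullet> yv k \<omega>))\<^sup>2 - (\<Sum>k<2 ^ n. var k * (u \<bullet> yv k \<omega>)\<^sup>2)) / 2 ^ n = (u \<bullet> mv c n \<omega>)\<^sup>2 / 2 ^ n - A n" for n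
      by (simp add: inner_mv diff_divide_distrib)
    then have "(\<lambda>m. (\<Sum>n<m. (u \<bullet> mv c n \<omega>)\<^sup>2 / 2 ^ n - A n) / real m) \<longlonglongrightarrow> 0"
      using elim(1) by (simp only:)
    from tendsto_add[OF this Aavg] show ?case
      by (simp add: sum_subtractf diff_divide_distrib)
  qed
qed

lemma qf_polar: "qf (axis i 1 + axis j 1) = qf (axis i 1) + qf (axis j 1) + 2 * LL $ i $ j"
proof -
  have e: "axis i 1 \<bullet> (LL *v axis j 1) = LL $ i $ j" for i j
    by (simp add: inner_axis' matrix_vector_mult_basis column_def)
  show ?thesis
    by (simp add: qf_def matrix_vector_right_distrib inner_add_left inner_add_right e LL_sym[of j i])
qed

text \<open>Products of two components come from squares by polarization. The second conjunct bounds
  the averages of absolute values through \<bar>x y\<bar> \<le> x^2 + y^2, as the averaging with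
  convergent weights demands.\<close>

lemma mv_product_average:
  assumes c: "c < 2"
  shows "AE \<omega> in P. \<forall>i j. (\<lambda>m. (\<Sum>n<m. mv c n \<omega> $ i * mv c n \<omega> $ j / 2 ^ n) / real m) \<longlonglongrightarrow> \<sigma>2 * LL $ i $ j \<and>
    (\<exists>C. \<forall>m. (\<Sum>n<m. \<bar>mv c n \<omega> $ i * mv c n \<omega> $ j / 2 ^ n\<bar>) \<le> C * real m)"
proof -
  have "AE \<omega> in P. \<forall>q\<in>UNIV. (\<lambda>m. (\<Sum>n<m. ((axis (fst q) 1 + axis (snd q) 1) \<bullet> mv c n \<omega>)\<^sup>2 / 2 ^ n) / real m) \<longlonglongrightarrow> \<sigma>2 * qf (axis (fst q) 1 + axis (snd q) 1)"
    by (rule AE_finite_allI) (auto intro: mv_square_average[OF c])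
  moreover have "AE \<omega> in P. \<forall>i\<in>UNIV. (\<lambda>m. (\<Sum>n<m. (axis i 1 \<bullet> mv c n \<omega>)\<^sup>2 / 2 ^ n) / real m) \<longlonglongrightarrow> \<sigma>2 * qf (axis i 1)"
    by (rule AE_finite_allI) (auto intro: mv_square_average[OF c])
  ultimately show ?thesis
  proof eventually_elim
    case (elim \<omega>)
    show ?case
    proof (intro allI conjI)
      fix i j
      let ?s = "\<lambda>u m. (\<Sum>n<m. (u \<bullet> mv c n \<omega>)\<^sup>2 / 2 ^ n)"
      have L: "(\<lambda>m. ?s (axis i 1 + axis j 1) m / real m) \<longlonglongrightarrow> \<sigma>2 * qf (axis i 1 + axis j 1)"
        using elim(1)[rule_format, of "(i, j)"] by simp
      have Li: "(\<lambda>m. ?s (axis i 1) m / real m) \<longlonglongrightarrow> \<sigma>2 * qf (axis i 1)" for i using elim(2) by blast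
      have "(\<lambda>m. (?s (axis i 1 + axis j 1) m / real m - ?s (axis i 1) m / real m - ?s (axis j 1) m / real m) / 2)
          \<longlonglongrightarrow> (\<sigma>2 * qf (axis i 1 + axis j 1) - \<sigma>2 * qf (axis i 1) - \<sigma>2 * qf (axis j 1)) / 2"
        by (intro tendsto_intros L Li) simp
      moreover have "(?s (axis i 1 + axis j 1) m / real m - ?s (axis i 1) m / real m - ?s (axis j 1) m / real m) / 2 =
          (\<Sum>n<m. mv c n \<omega> $ i * mv c n \<omega> $ j / 2 ^ n) / real m" for m
      proof -
        have "((axis i 1 + axis j 1) \<bullet> mv c n \<omega>)\<^sup>2 / 2 ^ n = (axis i 1 \<bullet> mv c n \<omega>)\<^sup>2 / 2 ^ n + (axis j 1 \<bullet> mv c n \<omega>)\<^sup>2 / 2 ^ n +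
            2 * (mv c n \<omega> $ i * mv c n \<omega> $ j / 2 ^ n)" for n
          by (simp add: inner_add_left inner_axis' power2_sum add_divide_distrib)
        then have "?s (axis i 1 + axis j 1) m = ?s (axis i 1) m + ?s (axis j 1) m + 2 * (\<Sum>n<m. mv c n \<omega> $ i * mv c n \<omega> $ j / 2 ^ n)"
          by (simp add: sum.distrib sum_distrib_left)
        then show ?thesis by (simp add: add_divide_distrib)
      qed
      moreover have "(\<sigma>2 * qf (axis i 1 + axis j 1) - \<sigma>2 * qf (axis i 1) - \<sigma>2 * qf (axis j 1)) / 2 = \<sigma>2 * LL $ i $ j"
        unfolding qf_polar by (simp add: algebra_simps)
      ultimately show "(\<lambda>m. (\<Sum>n<m. mv c n \<omega> $ i * mv c n \<omega> $ j / 2 ^ n) / real m) \<longlonglongrightarrow> \<sigma>2 * LL $ i $ j"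
        by simp
      obtain C where C: "\<And>m. ?s (axis i 1) m \<le> C * real m" using bounded_average[OF Li[of i]] by auto
      obtain D where D: "\<And>m. ?s (axis j 1) m \<le> D * real m" using bounded_average[OF Li[of j]] by auto
      have "(\<Sum>n<m. \<bar>mv c n \<omega> $ i * mv c n \<omega> $ j / 2 ^ n\<bar>) \<le> (C + D) * real m" for m
      proof -
        have "\<bar>x * y / z\<bar> \<le> x\<^sup>2 / z + y\<^sup>2 / z" if "0 < z" for x y z :: real
        proof -
          have "2 * (\<bar>x\<bar> * \<bar>y\<bar>) \<le> x\<^sup>2 + y\<^sup>2" using sum_squares_bound[of "\<bar>x\<bar>" "\<bar>y\<bar>"] by simp
          moreover have "0 \<le> \<bar>x\<bar> * \<bar>y\<bar>" by (rule mult_nonneg_nonneg) auto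
          ultimately have "\<bar>x * y\<bar> \<le> x\<^sup>2 + y\<^sup>2" unfolding abs_mult by linarith
          then show ?thesis using that by (simp add: abs_divide add_divide_distrib[symmetric] divide_right_mono)
        qed
        then have "(\<Sum>n<m. \<bar>mv c n \<omega> $ i * mv c n \<omega> $ j / 2 ^ n\<bar>) \<le> (\<Sum>n<m. (mv c n \<omega> $ i)\<^sup>2 / 2 ^ n + (mv c n \<omega> $ j)\<^sup>2 / 2 ^ n)"
          by (intro sum_mono) auto
        also have "\<dots> = ?s (axis i 1) m + ?s (axis j 1) m" by (simp add: sum.distrib inner_axis')
        also have "\<dots> \<le> (C + D) * real m" using C[of m] D[of m] by (simp add: distrib_right)
        finally show ?thesis .
      qed
      then show "\<exists>C. \<forall>m. (\<Sum>n<m. \<bar>mv c n \<omega> $ i * mv c n \<omega> $ j / 2 ^ n\<bar>) \<le> C * real m" by blast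
    qed
  qed
qed

section \<open>The quadratic form in terms of the blocks\<close>

lemma Tree_from_eq: "1 \<le> n \<Longrightarrow> Tree_from (n - 1) (CARD('n) - 1) = {N0..<2 ^ n}"
proof -
  assume n: "1 \<le> n"
  have "1 \<le> k" if "N0 \<le> k" for k by (rule order_trans[OF _ that]) simp
  then show ?thesis using n unfolding Tree_from_def Tree_eq p_card[symmetric] by auto
qed

definition side :: "2 \<Rightarrow> nat" where "side t = (if t = 1 then 0 else 1)"

lemma side_less: "side t < 2" by (simp add: side_def)

lemma M_vec_component:
  assumes n: "1 \<le> n"
  shows "(M_vec X \<epsilon> n \<omega> :: (real, 2 \<times> 'n option) vec) $ (t, i) = mv (side t) n \<omega> $ i"
proof -
  have "(M_vec X \<epsilon> n \<omega> :: (real, 2 \<times> 'n option) vec) $ (t, i) =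
      (\<Sum>k\<in>{N0..<2 ^ n}. vector [\<epsilon> (2 * k) \<omega>, \<epsilon> (2 * k + 1) \<omega>] $ t * Y_vec X k \<omega> $ i)"
    unfolding M_vec_def Tree_from_eq[OF n] by simp
  also have "\<dots> = (\<Sum>k\<in>{N0..<2 ^ n}. noise (side t) k \<omega> * yv k \<omega> $ i)"
  proof (intro sum.cong refl)
    fix k assume k: "k \<in> {N0..<2 ^ n}"
    have "t = 1 \<or> t = 2" by (rule exhaust_2)
    then show "vector [\<epsilon> (2 * k) \<omega>, \<epsilon> (2 * k + 1) \<omega>] $ t * Y_vec X k \<omega> $ i = noise (side t) k \<omega> * yv k \<omega> $ i"
      using k by (auto simp: vector_2 noise_def yv_def side_def)
  qed
  also have "\<dots> = (\<Sum>k<2 ^ n. noise (side t) k \<omega> * yv k \<omega> $ i)"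
    by (rule sum.mono_neutral_left) (auto simp: noise_def)
  finally show ?thesis by (simp add: mv_def)
qed

definition avg_yy :: "nat \<Rightarrow> 'w \<Rightarrow> ((real, 'n option) vec, 'n option) vec" where
  "avg_yy n \<omega> = (1 / 2 ^ n) *\<^sub>R (\<Sum>k<2 ^ n. outer (yv k \<omega>) (yv k \<omega>))"

lemma avg_yy_tendsto: "good \<omega> \<Longrightarrow> (\<lambda>n. avg_yy n \<omega>) \<longlonglongrightarrow> LL"
  by (intro vec_tendstoI) (simp add: avg_yy_def outer_def yv_average)

text \<open>The generations up to n - 1 are the positive indices below 2 ^ n, so the sum in
  \<open>S_mat X (n - 1)\<close> is \<open>2 ^ n *\<^sub>R avg_yy n \<omega>\<close>. When the
  average is invertible, the replacement of S by S + I does not take place.\<close>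

lemma S_mat_eq:
  assumes n: "1 \<le> n" and inv: "invertible (avg_yy n \<omega>)"
  shows "invertible (S_mat X (n - 1) \<omega> :: ((real, 'n option) vec, 'n option) vec)"
    and "matrix_inv (S_mat X (n - 1) \<omega>) = (1 / 2 ^ n) *\<^sub>R matrix_inv (avg_yy n \<omega>)"
proof -
  let ?S = "\<Sum>k\<in>Tree_from (n - 1) (CARD('n) - 1). outer (Y_vec X k \<omega> :: (real, 'n option) vec) (Y_vec X k \<omega> :: (real, 'n option) vec)"
  have S: "?S = 2 ^ n *\<^sub>R avg_yy n \<omega>"
  proof -
    have "?S = (\<Sum>k\<in>{N0..<2 ^ n}. outer (yv k \<omega>) (yv k \<omega>))"
      unfolding Tree_from_eq[OF n] by (intro sum.cong refl) (simp add: yv_def)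
    also have "\<dots> = (\<Sum>k<2 ^ n. outer (yv k \<omega>) (yv k \<omega>))"
      by (rule sum.mono_neutral_left) (auto simp: yv_def outer.zero_left)
    finally show ?thesis by (simp add: avg_yy_def)
  qed
  have sc: "(c *\<^sub>R A) ** B = c *\<^sub>R (A ** B)" "A ** (c *\<^sub>R B) = c *\<^sub>R (A ** B)" for c and A B :: "((real, 'n option) vec, 'n option) vec"
    by (simp_all add: vec_eq_iff matrix_matrix_mult_def sum_distrib_left ac_simps)
  have r: "?S ** ((1 / 2 ^ n) *\<^sub>R matrix_inv (avg_yy n \<omega>)) = mat 1" "((1 / 2 ^ n) *\<^sub>R matrix_inv (avg_yy n \<omega>)) ** ?S = mat 1"
    unfolding S sc by (simp_all add: matrix_inv_inverse[OF inv])
  then have i: "invertible ?S" unfolding invertible_def by blast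
  then have SS: "(S_mat X (n - 1) \<omega> :: ((real, 'n option) vec, 'n option) vec) = ?S"
    unfolding S_mat_def Let_def by (simp only: if_True)
  show "invertible (S_mat X (n - 1) \<omega> :: ((real, 'n option) vec, 'n option) vec)" using i SS by simp
  show "matrix_inv (S_mat X (n - 1) \<omega>) = (1 / 2 ^ n) *\<^sub>R matrix_inv (avg_yy n \<omega>)"
    unfolding SS by (rule matrix_inv_unique[OF r])
qed

text \<open>The inverse of the Kronecker product of the identity with S is again block diagonal, so
  the form is the sum of the forms of the two blocks.\<close>

lemma quadratic_form_eq:
  assumes n: "1 \<le> n" and inv: "invertible (avg_yy n \<omega>)"
  shows "(M_vec X \<epsilon> n \<omega> :: (real, 2 \<times> 'n option) vec) \<bullet> (matrix_inv (Sigma_mat X (n - 1) \<omega>) *v M_vec X \<epsilon> n \<omega>) =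
    (\<Sum>t\<in>UNIV. \<Sum>i\<in>UNIV. \<Sum>j\<in>UNIV. matrix_inv (avg_yy n \<omega>) $ i $ j * (mv (side t) n \<omega> $ i * mv (side t) n \<omega> $ j / 2 ^ n))"
proof -
  have m: "(\<chi> i. (M_vec X \<epsilon> n \<omega> :: (real, 2 \<times> 'n option) vec) $ (t, i)) = mv (side t) n \<omega>" for t
    by (simp add: vec_eq_iff M_vec_component[OF n])
  have "(M_vec X \<epsilon> n \<omega> :: (real, 2 \<times> 'n option) vec) \<bullet> (matrix_inv (Sigma_mat X (n - 1) \<omega>) *v M_vec X \<epsilon> n \<omega>) =
      (\<Sum>t\<in>UNIV. \<Sum>t'\<in>UNIV. (mat 1 :: real ^ 2 ^ 2) $ t $ t' * (mv (side t) n \<omega> \<bullet> (((1 / 2 ^ n) *\<^sub>R matrix_inv (avg_yy n \<omega>)) *v mv (side t') n \<omega>)))"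
    unfolding Sigma_mat_def matrix_inv_kron_one[OF S_mat_eq(1)[OF assms]] S_mat_eq(2)[OF assms] inner_kron_mult m ..
  also have "\<dots> = (\<Sum>t\<in>UNIV. mv (side t) n \<omega> \<bullet> (((1 / 2 ^ n) *\<^sub>R matrix_inv (avg_yy n \<omega>)) *v mv (side t) n \<omega>))"
  proof (intro sum.cong refl)
    fix t :: 2
    let ?f = "\<lambda>t'. mv (side t) n \<omega> \<bullet> (((1 / 2 ^ n) *\<^sub>R matrix_inv (avg_yy n \<omega>)) *v mv (side t') n \<omega>)"
    have "(\<Sum>t'\<in>UNIV. (mat 1 :: real ^ 2 ^ 2) $ t $ t' * ?f t') = (\<Sum>t'\<in>UNIV. if t' = t then ?f t' else 0)"
      by (intro sum.cong refl) (simp add: mat_def)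
    then show "(\<Sum>t'\<in>UNIV. (mat 1 :: real ^ 2 ^ 2) $ t $ t' * ?f t') = ?f t" by simp
  qed
  also have "\<dots> = (\<Sum>t\<in>UNIV. \<Sum>i\<in>UNIV. \<Sum>j\<in>UNIV. matrix_inv (avg_yy n \<omega>) $ i $ j * (mv (side t) n \<omega> $ i * mv (side t) n \<omega> $ j / 2 ^ n))"
    by (simp add: inner_vec_def matrix_vector_mult_def sum_distrib_left ac_simps)
  finally show ?thesis .
qed

text \<open>Since L is symmetric, the products of corresponding entries add up to the trace of the
  inverse of L times L, which is the dimension p + 1.\<close>

lemma trace_inverse: "(\<Sum>i\<in>UNIV. \<Sum>j\<in>UNIV. matrix_inv LL $ i $ j * (\<sigma>2 * LL $ i $ j)) = \<sigma>2 * (real p + 1)"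
proof -
  have "(\<Sum>i\<in>UNIV. \<Sum>j\<in>UNIV. matrix_inv LL $ i $ j * (\<sigma>2 * LL $ i $ j)) = \<sigma>2 * (\<Sum>i\<in>UNIV. (matrix_inv LL ** LL) $ i $ i)"
    by (simp add: matrix_matrix_mult_def sum_distrib_left LL_sym[of _ _] ac_simps)
  also have "(\<Sum>i\<in>UNIV. (matrix_inv LL ** LL) $ i $ i) = real CARD('n option)"
    unfolding matrix_inv_inverse[OF LL_invertible] by (simp add: mat_def)
  also have "real CARD('n option) = real p + 1" by (simp add: p_card)
  finally show ?thesis .
qed

theorem quadratic_functional:
  "AE \<omega> in P.
     (\<lambda>n. (M_vec X \<epsilon> n \<omega> :: (real, 2 \<times> 'n option) vec) \<bullet> (matrix_inv (Sigma_mat X (n - 1) \<omega>) *v M_vec X \<epsilon> n \<omega>)) \<in> O(\<lambda>n. real n) \<and>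
     (\<lambda>n. (1 / real n) * (\<Sum>k=p..n. (M_vec X \<epsilon> k \<omega> :: (real, 2 \<times> 'n option) vec) \<bullet>
        (matrix_inv (Sigma_mat X (k - 1) \<omega>) *v M_vec X \<epsilon> k \<omega>))) \<longlonglongrightarrow> 2 * (real p + 1) * \<sigma>2"
  using AE_good mv_product_average[of 0, simplified] mv_product_average[of 1, simplified]
proof eventually_elim
  case (elim \<omega>)
  let ?V = "\<lambda>n. (M_vec X \<epsilon> n \<omega> :: (real, 2 \<times> 'n option) vec) \<bullet> (matrix_inv (Sigma_mat X (n - 1) \<omega>) *v M_vec X \<epsilon> n \<omega>)"
  define W where "W t i j n = matrix_inv (avg_yy n \<omega>) $ i $ j * (mv (side t) n \<omega> $ i * mv (side t) n \<omega> $ j / 2 ^ n)" for t i j n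
  have R: "(\<lambda>n. matrix_inv (avg_yy n \<omega>) $ i $ j) \<longlonglongrightarrow> matrix_inv LL $ i $ j" for i j
    by (intro tendsto_vec_nth tendsto_matrix_inv(2)[OF avg_yy_tendsto[OF elim(1)] LL_invertible])
  have W: "(\<lambda>m. (\<Sum>n<m. W t i j n) / real m) \<longlonglongrightarrow> matrix_inv LL $ i $ j * (\<sigma>2 * LL $ i $ j)" for t i j
  proof -
    have "(\<lambda>m. (\<Sum>n<m. mv (side t) n \<omega> $ i * mv (side t) n \<omega> $ j / 2 ^ n) / real m) \<longlonglongrightarrow> \<sigma>2 * LL $ i $ j \<and>
      (\<exists>C. \<forall>m. (\<Sum>n<m. \<bar>mv (side t) n \<omega> $ i * mv (side t) n \<omega> $ j / 2 ^ n\<bar>) \<le> C * real m)"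
      using elim(2,3) by (cases "t = 1") (simp_all add: side_def)
    then show ?thesis unfolding W_def using cesaro_weighted[OF R] by blast
  qed
  have "(\<lambda>m. \<Sum>t\<in>UNIV. \<Sum>i\<in>UNIV. \<Sum>j\<in>UNIV. (\<Sum>n<m. W t i j n) / real m) \<longlonglongrightarrow>
      (\<Sum>t\<in>(UNIV :: 2 set). \<Sum>i\<in>UNIV. \<Sum>j\<in>UNIV. matrix_inv LL $ i $ j * (\<sigma>2 * LL $ i $ j))"
    by (intro tendsto_sum W)
  moreover have "(\<Sum>t\<in>(UNIV :: 2 set). \<Sum>i\<in>UNIV. \<Sum>j\<in>UNIV. matrix_inv LL $ i $ j * (\<sigma>2 * LL $ i $ j)) = 2 * (real p + 1) * \<sigma>2"
    unfolding trace_inverse by simp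
  moreover have "(\<Sum>t\<in>UNIV. \<Sum>i\<in>UNIV. \<Sum>j\<in>UNIV. (\<Sum>n<m. W t i j n) / real m) = (\<Sum>n<m. \<Sum>t\<in>UNIV. \<Sum>i\<in>UNIV. \<Sum>j\<in>UNIV. W t i j n) / real m" for m
    unfolding sum_divide_distrib[symmetric]
    by (intro arg_cong2[where f = "(/)"] refl) (simp only: sum.swap[of _ "{..<m}"])
  ultimately have avg: "(\<lambda>m. (\<Sum>n<m. \<Sum>t\<in>UNIV. \<Sum>i\<in>UNIV. \<Sum>j\<in>UNIV. W t i j n) / real m) \<longlonglongrightarrow> 2 * (real p + 1) * \<sigma>2" by simp
  have ev: "\<forall>\<^sub>F n in sequentially. ?V n = (\<Sum>t\<in>UNIV. \<Sum>i\<in>UNIV. \<Sum>j\<in>UNIV. W t i j n)"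
    using tendsto_matrix_inv(1)[OF avg_yy_tendsto[OF elim(1)] LL_invertible] eventually_ge_at_top[of 1]
    unfolding W_def by eventually_elim (rule quadratic_form_eq)
  show ?case using average_eventually_eq[OF ev avg] by blast
qed

end

section \<open>The central limit theorem\<close>

lemma L8_mult: assumes "L8 M f" "L8 M g" shows "L4 M (\<lambda>x. f x * g x)"
proof (rule L4_mono[where g = "\<lambda>x. (f x)\<^sup>2 + (g x)\<^sup>2"])
  have [measurable]: "f \<in> borel_measurable M" "g \<in> borel_measurable M" using assms by (auto simp: L8_def)
  show "L4 M (\<lambda>x. (f x)\<^sup>2 + (g x)\<^sup>2)" using assms by (intro L4_add) (auto simp: L8_def)
  show "(\<lambda>x. f x * g x) \<in> borel_measurable M" by measurable
  fix x
  have "2 * (\<bar>f x\<bar> * \<bar>g x\<bar>) \<le> (f x)\<^sup>2 + (g x)\<^sup>2" using sum_squares_bound[of "\<bar>f x\<bar>" "\<bar>g x\<bar>"] by simp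
  moreover have "0 \<le> \<bar>f x\<bar> * \<bar>g x\<bar>" by (rule mult_nonneg_nonneg) auto
  ultimately show "\<bar>f x * g x\<bar> \<le> \<bar>(f x)\<^sup>2 + (g x)\<^sup>2\<bar>" unfolding abs_mult by linarith
qed

locale bar_clt = bar_vector P X \<epsilon> a b p \<sigma>2 \<rho> N \<beta>
  for P :: "'w measure" and X \<epsilon> :: "nat \<Rightarrow> 'w \<Rightarrow> real" and a b :: "nat \<Rightarrow> real" and p :: nat and \<sigma>2 \<rho> :: real
    and N :: "real ^ 'n::{finite,linorder} \<Rightarrow> real" and \<beta> :: real +
  fixes \<tau>4 \<nu>2 :: real
  assumes \<tau>4: "0 < \<tau>4" and fourth_moments: "noise_fourth_moments p P X \<epsilon> \<tau>4 \<nu>2"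
    and eighth: "noise_moment_bounded p P X \<epsilon> 8"
begin

section \<open>Higher moments under the additional hypotheses\<close>

lemma eps_L8: assumes "2 ^ p \<le> k" shows "L8 P (\<epsilon> k)"
proof -
  have "N0 \<le> k div 2" using assms two_N0 by linarith
  note * = Gen_floor_log[OF this]
  have "k = 2 * (k div 2) + k mod 2" by simp
  then have "k \<in> Gen (floor_log (k div 2) + 1)" using child_in_Gen[of "k div 2" _ "k mod 2"] * by simp
  then show ?thesis using eighth * eps_rv[OF assms] by (auto simp: noise_moment_bounded_def L8_iff)
qed

lemma noise_L8: "L8 P (noise c k)"
proof (cases "k < N0")
  case False
  then have "2 ^ p \<le> 2 * k + c" using two_N0 by linarith
  then show ?thesis using eps_L8 False by (simp add: noise_def[abs_def])
qed (simp add: noise_def[abs_def])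

lemma yv_component_L8: "L8 P (\<lambda>\<omega>. yv k \<omega> $ i)"
proof (cases i)
  case (Some j)
  show ?thesis
  proof (cases "k < N0")
    case False
    then have k: "N0 \<le> k" by simp
    have "pos j - 1 < p" using pos_range[of j] p_card by auto
    then have "1 \<le> k div 2 ^ (pos j - 1)" by (rule anc_pos[OF k])
    from X_L8[OF eps_L8 this] show ?thesis unfolding Some yv_Some st_component[OF k] .
  qed (simp add: yv_def)
qed (simp add: yv_None)

lemma noise_fourth_const: assumes c: "c < 2" shows "AE \<omega> in P. kurt c k \<omega> = (if k < N0 then 0 else \<tau>4)"
proof (cases "k < N0")
  case False
  then have k: "N0 \<le> k" by simp
  note n = Gen_floor_log[OF k]
  have "AE \<omega> in P. real_cond_exp P (tree_filtration P X (floor_log k)) (\<lambda>\<omega>. \<epsilon> (2 * k + c) \<omega> ^ 4) \<omega> = \<tau>4"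
    using fourth_moments n child_in_Gen[of k "floor_log k" c] c unfolding noise_fourth_moments_def by auto
  then show ?thesis using k by (simp add: kurt_def tree_filtration_eq_past)
qed (simp add: kurt_def)

lemma noise_fourth_mult:
  assumes c: "c < 2" and f: "f \<in> borel_measurable (G k)" "L8 P f"
  shows "expectation (\<lambda>\<omega>. (f \<omega> * noise c k \<omega>) ^ 4) \<le> \<tau>4 * expectation (\<lambda>\<omega>. (f \<omega>) ^ 4)"
proof -
  have c1: "c \<le> 1" using c by simp
  have f4: "(\<lambda>\<omega>. (f \<omega>) ^ 4) \<in> borel_measurable (G k)" using f(1) by measurable
  have "AE \<omega> in P. real_cond_exp P (G k) (\<lambda>\<omega>. (noise c k \<omega>) ^ 4) \<omega> = (if k < N0 then 0 else \<tau>4)"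
    using noise_fourth[OF c1, of k] noise_fourth_const[OF c, of k] by eventually_elim simp
  then have "expectation (\<lambda>\<omega>. (f \<omega>) ^ 4 * (noise c k \<omega>) ^ 4) = expectation (\<lambda>\<omega>. (f \<omega>) ^ 4 * (if k < N0 then 0 else \<tau>4))"
    using L8_mult[OF f(2) noise_L8[of c k]]
    by (intro expectation_mult_cond_exp(1)[OF f4]) (auto simp: L4_def power_mult_distrib)
  also have "\<dots> = (if k < N0 then 0 else \<tau>4) * expectation (\<lambda>\<omega>. (f \<omega>) ^ 4)" by (simp add: mult.commute)
  also have "\<dots> \<le> \<tau>4 * expectation (\<lambda>\<omega>. (f \<omega>) ^ 4)"
    using \<tau>4 by (intro mult_right_mono Bochner_Integration.integral_nonneg) auto
  finally show ?thesis by (simp add: power_mult_distrib)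
qed

lemma fourth_moment_bound: "\<exists>K. \<forall>k. expectation (\<lambda>\<omega>. (N (st k \<omega>)) ^ 4) \<le> K"
proof (rule moment_bound)
  show "expectation (\<lambda>\<omega>. (\<bar>co c 0\<bar> + \<bar>noise c k \<omega>\<bar>) ^ 4) \<le> 8 * ((max \<bar>a 0\<bar> \<bar>b 0\<bar>) ^ 4 + \<tau>4)" if c: "c < 2" for c k
  proof -
    have n4: "integrable P (\<lambda>\<omega>. (noise c k \<omega>) ^ 4)" using noise_L4[of c k] by (simp add: L4_def)
    have "expectation (\<lambda>\<omega>. (\<bar>co c 0\<bar> + \<bar>noise c k \<omega>\<bar>) ^ 4) \<le> expectation (\<lambda>\<omega>. 8 * (\<bar>co c 0\<bar> ^ 4 + (noise c k \<omega>) ^ 4))"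
    proof (rule integral_mono)
      show "(\<bar>co c 0\<bar> + \<bar>noise c k \<omega>\<bar>) ^ 4 \<le> 8 * (\<bar>co c 0\<bar> ^ 4 + (noise c k \<omega>) ^ 4)" for \<omega>
        using power4_add_le[of "\<bar>co c 0\<bar>" "\<bar>noise c k \<omega>\<bar>"] by simp
      have "L4 P (\<lambda>\<omega>. \<bar>noise c k \<omega>\<bar>)" by (rule L4_mono[OF noise_L4[of c k]]) auto
      then show "integrable P (\<lambda>\<omega>. (\<bar>co c 0\<bar> + \<bar>noise c k \<omega>\<bar>) ^ 4)" using L4_add[OF L4_const] by (simp add: L4_def)
    qed (use n4 in simp)
    also have "\<dots> = 8 * (\<bar>co c 0\<bar> ^ 4 + expectation (\<lambda>\<omega>. (noise c k \<omega>) ^ 4))"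
      using n4 by (simp add: prob_space)
    also have "\<dots> \<le> 8 * ((max \<bar>a 0\<bar> \<bar>b 0\<bar>) ^ 4 + \<tau>4)"
    proof (intro mult_left_mono add_mono power_mono)
      show "expectation (\<lambda>\<omega>. (noise c k \<omega>) ^ 4) \<le> \<tau>4"
        using noise_fourth_mult[OF c, of "\<lambda>_. 1" k] by (simp add: prob_space)
    qed (auto simp: co_def)
    finally show ?thesis .
  qed
qed (auto simp: L4_def)

lemma yv_fourth_moment: "\<exists>K. \<forall>k i. expectation (\<lambda>\<omega>. (yv k \<omega> $ i) ^ 4) \<le> K"
proof -
  obtain d where d: "0 < d" "\<And>x i. \<bar>x $ i\<bar> \<le> d * N x" using component_le_N by blast
  obtain K where K: "\<And>k. expectation (\<lambda>\<omega>. (N (st k \<omega>)) ^ 4) \<le> K" using fourth_moment_bound by blast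
  have "expectation (\<lambda>\<omega>. (yv k \<omega> $ i) ^ 4) \<le> max 1 (d ^ 4 * K)" for k i
  proof (cases i)
    case None
    then show ?thesis by (cases "k < N0") (simp_all add: yv_None prob_space le_max_iff_disj)
  next
    case (Some j)
    have "expectation (\<lambda>\<omega>. (st k \<omega> $ j) ^ 4) \<le> expectation (\<lambda>\<omega>. d ^ 4 * (N (st k \<omega>)) ^ 4)"
    proof (rule integral_mono)
      fix \<omega>
      have "\<bar>st k \<omega> $ j\<bar> ^ 4 \<le> (d * N (st k \<omega>)) ^ 4" by (intro power_mono d) auto
      then show "(st k \<omega> $ j) ^ 4 \<le> d ^ 4 * (N (st k \<omega>)) ^ 4" by (simp add: power_mult_distrib)
    qed (use st_component_L4[of k j] N_st_L4[of k] in \<open>auto simp: L4_def\<close>)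
    also have "\<dots> = d ^ 4 * expectation (\<lambda>\<omega>. (N (st k \<omega>)) ^ 4)" by simp
    also have "\<dots> \<le> d ^ 4 * K" using d(1) by (intro mult_left_mono K) auto
    finally show ?thesis by (simp add: Some yv_Some)
  qed
  then show ?thesis by blast
qed

lemma inner_yv_L8: "L8 P (\<lambda>\<omega>. u \<bullet> yv k \<omega>)"
  unfolding inner_vec_def inner_real_def by (intro L8_sum L8_cmult yv_component_L8)

lemma inner_yv_meas: "(\<lambda>\<omega>. u \<bullet> yv k \<omega>) \<in> borel_measurable (G k)"
  unfolding inner_vec_def inner_real_def
  by (intro borel_measurable_sum borel_measurable_times yv_component_meas') auto

lemma inner_yv_fourth_moment: "\<exists>K. \<forall>k. expectation (\<lambda>\<omega>. (u \<bullet> yv k \<omega>) ^ 4) \<le> K"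
proof -
  obtain K where K: "\<And>k i. expectation (\<lambda>\<omega>. (yv k \<omega> $ i) ^ 4) \<le> K" using yv_fourth_moment by blast
  have y4: "integrable P (\<lambda>\<omega>. (yv k \<omega> $ i) ^ 4)" for k i using yv_component_L4[of k i] by (simp add: L4_def)
  have "expectation (\<lambda>\<omega>. (u \<bullet> yv k \<omega>) ^ 4) \<le> (norm u) ^ 4 * (CARD('n option) * (CARD('n option) * K))" for k
  proof -
    have "expectation (\<lambda>\<omega>. (u \<bullet> yv k \<omega>) ^ 4) \<le> expectation (\<lambda>\<omega>. (norm u) ^ 4 * (CARD('n option) * (\<Sum>i\<in>UNIV. (yv k \<omega> $ i) ^ 4)))"
    proof (rule integral_mono)
      show "integrable P (\<lambda>\<omega>. (u \<bullet> yv k \<omega>) ^ 4)" using L8_imp_L4[OF inner_yv_L8] by (simp add: L4_def)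
      show "integrable P (\<lambda>\<omega>. (norm u) ^ 4 * (CARD('n option) * (\<Sum>i\<in>UNIV. (yv k \<omega> $ i) ^ 4)))"
        by (intro integrable_mult_right Bochner_Integration.integrable_sum y4)
      fix \<omega>
      have "\<bar>u \<bullet> yv k \<omega>\<bar> ^ 4 \<le> (norm u * norm (yv k \<omega>)) ^ 4" by (intro power_mono Cauchy_Schwarz_ineq2) auto
      also have "\<dots> = (norm u) ^ 4 * (\<Sum>i\<in>UNIV. (yv k \<omega> $ i)\<^sup>2)\<^sup>2"
        unfolding power_mult_distrib power4_eq[of "norm (yv k \<omega>)"] power2_norm_eq_inner[of "yv k \<omega>"]
        by (simp add: inner_vec_def power2_eq_square)
      also have "\<dots> \<le> (norm u) ^ 4 * (CARD('n option) * (\<Sum>i\<in>UNIV. ((yv k \<omega> $ i)\<^sup>2)\<^sup>2))"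
        using sum_squared_le_sum_of_squares[of "\<lambda>i. (yv k \<omega> $ i)\<^sup>2" UNIV] by (intro mult_left_mono) (auto simp: mult.commute)
      finally show "(u \<bullet> yv k \<omega>) ^ 4 \<le> (norm u) ^ 4 * (CARD('n option) * (\<Sum>i\<in>UNIV. (yv k \<omega> $ i) ^ 4))" by simp
    qed
    also have "\<dots> = (norm u) ^ 4 * (CARD('n option) * (\<Sum>i\<in>UNIV. expectation (\<lambda>\<omega>. (yv k \<omega> $ i) ^ 4)))"
      using y4 by simp
    also have "\<dots> \<le> (norm u) ^ 4 * (CARD('n option) * (CARD('n option) * K))"
      using sum_bounded_above[of "UNIV :: 'n option set", OF K] by (intro mult_left_mono) auto
    finally show ?thesis .
  qed
  then show ?thesis by blast
qed

section \<open>Projections of M n as scalar martingales\<close>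

definition blk :: "(real, 2 \<times> 'n option) vec \<Rightarrow> nat \<Rightarrow> (real, 'n option) vec" where
  "blk u c = (\<chi> i. u $ (if c = 0 then 1 else 2, i))"

definition wgt :: "(real, 2 \<times> 'n option) vec \<Rightarrow> nat \<Rightarrow> nat \<Rightarrow> 'w \<Rightarrow> real" where
  "wgt u c k \<omega> = blk u c \<bullet> yv k \<omega>"

definition inc :: "(real, 2 \<times> 'n option) vec \<Rightarrow> nat \<Rightarrow> 'w \<Rightarrow> real" where
  "inc u k \<omega> = wgt u 0 k \<omega> * noise 0 k \<omega> + wgt u 1 k \<omega> * noise 1 k \<omega>"

text \<open>The form of \<Gamma> at the two weights of \<open>k\<close>, with \<open>var\<close> and
  \<open>cov\<close> in place of its entries so that it vanishes below \<open>N0\<close>. It is the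
  conditional variance of \<open>inc u k\<close>.\<close>

definition cvar :: "(real, 2 \<times> 'n option) vec \<Rightarrow> nat \<Rightarrow> 'w \<Rightarrow> real" where
  "cvar u k \<omega> = (wgt u 0 k \<omega>)\<^sup>2 * var k + (wgt u 1 k \<omega>)\<^sup>2 * var k + 2 * (wgt u 0 k \<omega> * wgt u 1 k \<omega> * cov k)"

abbreviation Qm :: "((real, 2 \<times> 'n option) vec, 2 \<times> 'n option) vec" where "Qm \<equiv> kron (Gamma_mat \<sigma>2 \<rho>) LL"

lemma Gamma_mat_nth: "Gamma_mat \<sigma>2 \<rho> $ 1 $ 1 = \<sigma>2" "Gamma_mat \<sigma>2 \<rho> $ 1 $ 2 = \<rho>"
    "Gamma_mat \<sigma>2 \<rho> $ 2 $ 1 = \<rho>" "Gamma_mat \<sigma>2 \<rho> $ 2 $ 2 = \<sigma>2"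
  by (simp_all add: Gamma_mat_def vector_2)

lemma Qm_form: "u \<bullet> (Qm *v u) = \<sigma>2 * qf (blk u 0) + \<sigma>2 * qf (blk u 1) + 2 * (\<rho> * (blk u 0 \<bullet> (LL *v blk u 1)))"
proof -
  have s: "blk u 1 \<bullet> (LL *v blk u 0) = blk u 0 \<bullet> (LL *v blk u 1)"
  proof -
    have "transpose LL = LL" by (simp add: vec_eq_iff transpose_def LL_sym)
    then have "blk u 1 \<bullet> (LL *v blk u 0) = (LL *v blk u 1) \<bullet> blk u 0"
      using dot_lmul_matrix[of "blk u 1" LL "blk u 0"] transpose_matrix_vector[of LL "blk u 1"] by simp
    then show ?thesis by (simp only: inner_commute)
  qed
  have b: "(\<chi> i. u $ (1, i)) = blk u 0" "(\<chi> i. u $ (2, i)) = blk u 1" by (simp_all add: blk_def)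
  show ?thesis unfolding inner_kron_mult UNIV_2 using s by (simp add: b Gamma_mat_nth qf_def algebra_simps)
qed

lemma wgt_meas: "wgt u c k \<in> borel_measurable (G k)" unfolding wgt_def[abs_def] by (rule inner_yv_meas)
lemma wgt_L8: "L8 P (wgt u c k)" unfolding wgt_def[abs_def] by (rule inner_yv_L8)
lemma wgt_L4: "L4 P (wgt u c k)" by (rule L8_imp_L4[OF wgt_L8])
lemma wgt_meas_M [measurable]: "wgt u c k \<in> borel_measurable P" by (rule measurable_G_M[OF wgt_meas])

lemma inc_adapted: "inc u k \<in> borel_measurable (G (Suc k))"
  unfolding inc_def[abs_def]
  by (intro borel_measurable_add borel_measurable_times measurable_G_mono[OF wgt_meas] noise_adapted) auto

lemma inc_L4: "L4 P (inc u k)"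
  unfolding inc_def[abs_def] by (intro L4_add L8_mult wgt_L8 noise_L8)

lemma cvar_meas: "cvar u k \<in> borel_measurable (G k)"
  unfolding cvar_def[abs_def] using wgt_meas[of u 0 k] wgt_meas[of u 1 k] by measurable

lemma cvar_meas_M [measurable]: "cvar u k \<in> borel_measurable P" by (rule measurable_G_M[OF cvar_meas])

lemma cov_le_var: "\<bar>cov k\<bar> \<le> var k" using \<rho>_less by (simp add: cov_def var_def)

lemma two_mult_le: "2 * \<bar>x * y\<bar> \<le> x\<^sup>2 + (y::real)\<^sup>2"
  using sum_squares_bound[of "\<bar>x\<bar>" "\<bar>y\<bar>"] by (simp add: abs_mult)

text \<open>The mixed term is dominated by the diagonal part from both sides, because
  \<open>cov\<close> is at most \<open>var\<close> in absolute value.\<close>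

lemma cvar_bounds: "0 \<le> cvar u k \<omega>" "cvar u k \<omega> \<le> 2 * \<sigma>2 * ((wgt u 0 k \<omega>)\<^sup>2 + (wgt u 1 k \<omega>)\<^sup>2)"
proof -
  let ?s = "(wgt u 0 k \<omega>)\<^sup>2 + (wgt u 1 k \<omega>)\<^sup>2"
  have "\<bar>2 * (wgt u 0 k \<omega> * wgt u 1 k \<omega> * cov k)\<bar> = (2 * \<bar>wgt u 0 k \<omega> * wgt u 1 k \<omega>\<bar>) * \<bar>cov k\<bar>"
    by (simp add: abs_mult)
  also have "\<dots> \<le> ?s * var k" by (intro mult_mono two_mult_le cov_le_var) auto
  finally have b: "\<bar>2 * (wgt u 0 k \<omega> * wgt u 1 k \<omega> * cov k)\<bar> \<le> ?s * var k" .
  have e: "cvar u k \<omega> = ?s * var k + 2 * (wgt u 0 k \<omega> * wgt u 1 k \<omega> * cov k)" by (simp add: cvar_def distrib_right)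
  show "0 \<le> cvar u k \<omega>" unfolding e using b by linarith
  have "?s * var k \<le> ?s * \<sigma>2" by (intro mult_left_mono var_bounds) auto
  then show "cvar u k \<omega> \<le> 2 * \<sigma>2 * ?s" unfolding e using b by (simp add: algebra_simps)
qed

lemma inc_mean: "AE \<omega> in P. real_cond_exp P (G k) (inc u k) \<omega> = 0"
proof -
  interpret S: sigma_finite_subalgebra P "G k" by (rule sigma_finite_subalgebra_G)
  have i: "integrable P (\<lambda>\<omega>. wgt u c k \<omega> * noise c k \<omega>)" for c by (rule L4_mult_integrable[OF wgt_L4 noise_L4])
  have z: "AE \<omega> in P. real_cond_exp P (G k) (\<lambda>\<omega>. wgt u c k \<omega> * noise c k \<omega>) \<omega> = 0" if "c \<le> 1" for c
    by (rule mult_mean_zero[OF wgt_meas noise_meas_M i noise_mean[OF that]])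
  from S.real_cond_exp_add[OF i[of 0] i[of 1]] z[of 0, simplified] z[of 1, simplified]
  show ?thesis unfolding inc_def[abs_def] by eventually_elim simp
qed

lemma inc_var: "AE \<omega> in P. real_cond_exp P (G k) (\<lambda>\<omega>. (inc u k \<omega>)\<^sup>2) \<omega> = cvar u k \<omega>"
proof -
  interpret S: sigma_finite_subalgebra P "G k" by (rule sigma_finite_subalgebra_G)
  let ?w = "\<lambda>c. wgt u c k" and ?n = "\<lambda>c. noise c k"
  have isq: "integrable P (\<lambda>\<omega>. (?w c \<omega>)\<^sup>2 * (?n c \<omega>)\<^sup>2)" for c
    using L4_mult_square_integrable[OF wgt_L4 noise_L4] by (simp add: power_mult_distrib)
  have ix: "integrable P (\<lambda>\<omega>. (2 * (?w 0 \<omega> * ?w 1 \<omega>)) * (?n 0 \<omega> * ?n 1 \<omega>))"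
    using L4_mult4_integrable[OF L4_cmult[OF wgt_L4[of u 0 k], of 2] wgt_L4[of u 1 k] noise_L4[of 0 k] noise_L4[of 1 k]]
    by (simp add: mult.assoc)
  have sq: "AE \<omega> in P. real_cond_exp P (G k) (\<lambda>\<omega>. (?w c \<omega>)\<^sup>2 * (?n c \<omega>)\<^sup>2) \<omega> = (?w c \<omega>)\<^sup>2 * var k" if c: "c \<le> 1" for c
  proof -
    have "(\<lambda>\<omega>. (?w c \<omega>)\<^sup>2) \<in> borel_measurable (G k)" using wgt_meas[of u c k] by measurable
    note w = this
    have m: "(\<lambda>\<omega>. (?n c \<omega>)\<^sup>2) \<in> borel_measurable P" using noise_meas_M[of c k] by measurable
    from S.real_cond_exp_mult[OF w m isq] noise_var[OF c, of k] show ?thesis by eventually_elim simp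
  qed
  have cr: "AE \<omega> in P. real_cond_exp P (G k) (\<lambda>\<omega>. (2 * (?w 0 \<omega> * ?w 1 \<omega>)) * (?n 0 \<omega> * ?n 1 \<omega>)) \<omega> = (2 * (?w 0 \<omega> * ?w 1 \<omega>)) * cov k"
  proof -
    have "(\<lambda>\<omega>. 2 * (?w 0 \<omega> * ?w 1 \<omega>)) \<in> borel_measurable (G k)" using wgt_meas[of u 0 k] wgt_meas[of u 1 k] by measurable
    note w = this
    have m: "(\<lambda>\<omega>. ?n 0 \<omega> * ?n 1 \<omega>) \<in> borel_measurable P" using noise_meas_M[of 0 k] noise_meas_M[of 1 k] by measurable
    from S.real_cond_exp_mult[OF w m ix] noise_cov[of k] show ?thesis by eventually_elim simp
  qed
  have e: "(\<lambda>\<omega>. (inc u k \<omega>)\<^sup>2) = (\<lambda>\<omega>. ((?w 0 \<omega>)\<^sup>2 * (?n 0 \<omega>)\<^sup>2 + (?w 1 \<omega>)\<^sup>2 * (?n 1 \<omega>)\<^sup>2) + (2 * (?w 0 \<omega> * ?w 1 \<omega>)) * (?n 0 \<omega> * ?n 1 \<omega>))"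
    by (rule ext) (simp add: inc_def power2_sum power_mult_distrib ac_simps)
  from S.real_cond_exp_add[OF Bochner_Integration.integrable_add[OF isq[of 0] isq[of 1]] ix] S.real_cond_exp_add[OF isq[of 0] isq[of 1]]
    sq[of 0, simplified] sq[of 1, simplified] cr
  show ?thesis unfolding e cvar_def by eventually_elim simp
qed

text \<open>The bounds are uniform in the vertex, as the scalar limit theorem asks. The fourth power
  of the sum is at most 8 times the sum of the fourth powers, which separates the sisters; each then
  costs \<open>\<tau>4\<close> times the fourth moment of its weight.\<close>

lemma inc_moments:
  "\<exists>C. \<forall>k. expectation (\<lambda>\<omega>. (inc u k \<omega>) ^ 4) \<le> C \<and> integrable P (\<lambda>\<omega>. (cvar u k \<omega>)\<^sup>2) \<and> expectation (\<lambda>\<omega>. (cvar u k \<omega>)\<^sup>2) \<le> C"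
proof -
  obtain K0 where K0: "\<And>k. expectation (\<lambda>\<omega>. (wgt u 0 k \<omega>) ^ 4) \<le> K0" unfolding wgt_def using inner_yv_fourth_moment by blast
  obtain K1 where K1: "\<And>k. expectation (\<lambda>\<omega>. (wgt u 1 k \<omega>) ^ 4) \<le> K1" unfolding wgt_def using inner_yv_fourth_moment by blast
  have w4: "integrable P (\<lambda>\<omega>. (wgt u c k \<omega>) ^ 4)" for c k using wgt_L4[of u c k] by (simp add: L4_def)
  have wn: "integrable P (\<lambda>\<omega>. (wgt u c k \<omega> * noise c k \<omega>) ^ 4)" for c k using L8_mult[OF wgt_L8 noise_L8, of u c k c k] by (simp add: L4_def)
  have A: "expectation (\<lambda>\<omega>. (inc u k \<omega>) ^ 4) \<le> 8 * (\<tau>4 * K0 + \<tau>4 * K1)" for k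
  proof -
    have "expectation (\<lambda>\<omega>. (inc u k \<omega>) ^ 4) \<le> expectation (\<lambda>\<omega>. 8 * ((wgt u 0 k \<omega> * noise 0 k \<omega>) ^ 4 + (wgt u 1 k \<omega> * noise 1 k \<omega>) ^ 4))"
      by (rule integral_mono) (use inc_L4[of u k] wn power4_add_le in \<open>auto simp: L4_def inc_def\<close>)
    also have "\<dots> = 8 * (expectation (\<lambda>\<omega>. (wgt u 0 k \<omega> * noise 0 k \<omega>) ^ 4) + expectation (\<lambda>\<omega>. (wgt u 1 k \<omega> * noise 1 k \<omega>) ^ 4))"
      using wn by simp
    also have "\<dots> \<le> 8 * (\<tau>4 * K0 + \<tau>4 * K1)"
      using \<tau>4 by (intro mult_left_mono add_mono order_trans[OF noise_fourth_mult[OF _ wgt_meas wgt_L8]] K0 K1) auto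
    finally show ?thesis .
  qed
  have le: "(cvar u k \<omega>)\<^sup>2 \<le> (2 * \<sigma>2)\<^sup>2 * (2 * ((wgt u 0 k \<omega>) ^ 4 + (wgt u 1 k \<omega>) ^ 4))" for k \<omega>
  proof -
    have "(cvar u k \<omega>)\<^sup>2 \<le> (2 * \<sigma>2 * ((wgt u 0 k \<omega>)\<^sup>2 + (wgt u 1 k \<omega>)\<^sup>2))\<^sup>2" by (intro power_mono cvar_bounds)
    also have "\<dots> = (2 * \<sigma>2)\<^sup>2 * ((wgt u 0 k \<omega>)\<^sup>2 + (wgt u 1 k \<omega>)\<^sup>2)\<^sup>2" by (simp only: power_mult_distrib)
    also have "\<dots> \<le> (2 * \<sigma>2)\<^sup>2 * (2 * (((wgt u 0 k \<omega>)\<^sup>2)\<^sup>2 + ((wgt u 1 k \<omega>)\<^sup>2)\<^sup>2))"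
    proof (intro mult_left_mono)
      show "(x + y)\<^sup>2 \<le> 2 * (x\<^sup>2 + y\<^sup>2)" for x y :: real
        using zero_le_power2[of "x - y"] by (simp add: power2_eq_square algebra_simps)
    qed simp
    finally show ?thesis unfolding power4_eq .
  qed
  have i: "integrable P (\<lambda>\<omega>. (2 * \<sigma>2)\<^sup>2 * (2 * ((wgt u 0 k \<omega>) ^ 4 + (wgt u 1 k \<omega>) ^ 4)))" for k using w4 by simp
  have I: "integrable P (\<lambda>\<omega>. (cvar u k \<omega>)\<^sup>2)" for k
  proof (rule Bochner_Integration.integrable_bound[OF i])
    show "AE \<omega> in P. norm ((cvar u k \<omega>)\<^sup>2) \<le> norm ((2 * \<sigma>2)\<^sup>2 * (2 * ((wgt u 0 k \<omega>) ^ 4 + (wgt u 1 k \<omega>) ^ 4)))"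
      using le[of k] by (intro AE_I2) (simp add: order_trans[OF _ abs_ge_self])
  qed measurable
  have B: "expectation (\<lambda>\<omega>. (cvar u k \<omega>)\<^sup>2) \<le> (2 * \<sigma>2)\<^sup>2 * (2 * (K0 + K1))" for k
  proof -
    have "expectation (\<lambda>\<omega>. (cvar u k \<omega>)\<^sup>2) \<le> expectation (\<lambda>\<omega>. (2 * \<sigma>2)\<^sup>2 * (2 * ((wgt u 0 k \<omega>) ^ 4 + (wgt u 1 k \<omega>) ^ 4)))"
      by (rule integral_mono[OF I i le])
    also have "\<dots> = (2 * \<sigma>2)\<^sup>2 * (2 * (expectation (\<lambda>\<omega>. (wgt u 0 k \<omega>) ^ 4) + expectation (\<lambda>\<omega>. (wgt u 1 k \<omega>) ^ 4)))"
      using w4 by simp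
    also have "\<dots> \<le> (2 * \<sigma>2)\<^sup>2 * (2 * (K0 + K1))" by (intro mult_left_mono add_mono K0 K1) auto
    finally show ?thesis .
  qed
  show ?thesis
    by (rule exI[of _ "max (8 * (\<tau>4 * K0 + \<tau>4 * K1)) ((2 * \<sigma>2)\<^sup>2 * (2 * (K0 + K1)))"])
       (use A B I in \<open>auto simp: le_max_iff_disj\<close>)
qed

lemma cvar_average: assumes g: "good \<omega>" shows "(\<lambda>n. (\<Sum>k<2 ^ n. cvar u k \<omega>) / 2 ^ n) \<longlonglongrightarrow> u \<bullet> (Qm *v u)"
proof -
  let ?u = "blk u 0" and ?v = "blk u 1"
  have cross: "(\<lambda>n. (\<Sum>k<2 ^ n. wgt u 0 k \<omega> * wgt u 1 k \<omega>) / 2 ^ n) \<longlonglongrightarrow> ?u \<bullet> (LL *v ?v)"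
  proof -
    have "wgt u 0 k \<omega> * wgt u 1 k \<omega> = (\<Sum>i\<in>UNIV. \<Sum>j\<in>UNIV. ?u $ i * ?v $ j * (yv k \<omega> $ i * yv k \<omega> $ j))" for k
      by (simp add: wgt_def inner_vec_def sum_product ac_simps)
    then have "(\<Sum>k<2 ^ n. wgt u 0 k \<omega> * wgt u 1 k \<omega>) / 2 ^ n = (\<Sum>i\<in>UNIV. \<Sum>j\<in>UNIV. ?u $ i * ?v $ j * ((\<Sum>k<2 ^ n. yv k \<omega> $ i * yv k \<omega> $ j) / 2 ^ n))" for n
      by (simp only: sum.swap[of _ _ "{..<2 ^ n}"] sum_distrib_left[symmetric] sum_divide_distrib[symmetric] times_divide_eq_right)
    moreover have "(\<lambda>n. \<Sum>i\<in>UNIV. \<Sum>j\<in>UNIV. ?u $ i * ?v $ j * ((\<Sum>k<2 ^ n. yv k \<omega> $ i * yv k \<omega> $ j) / 2 ^ n)) \<longlonglongrightarrow>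
        (\<Sum>i\<in>UNIV. \<Sum>j\<in>UNIV. ?u $ i * ?v $ j * LL $ i $ j)"
      by (intro tendsto_sum tendsto_mult tendsto_const yv_average g)
    moreover have "(\<Sum>i\<in>UNIV. \<Sum>j\<in>UNIV. ?u $ i * ?v $ j * LL $ i $ j) = ?u \<bullet> (LL *v ?v)"
      by (simp add: inner_vec_def matrix_vector_mult_def sum_distrib_left ac_simps)
    ultimately show ?thesis by simp
  qed
  have "cvar u k \<omega> = \<sigma>2 * (?u \<bullet> yv k \<omega>)\<^sup>2 + \<sigma>2 * (?v \<bullet> yv k \<omega>)\<^sup>2 + 2 * (\<rho> * (wgt u 0 k \<omega> * wgt u 1 k \<omega>))" for k
    by (cases "k < N0") (simp_all add: cvar_def wgt_def var_def cov_def yv_def ac_simps)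
  then have "(\<Sum>k<2 ^ n. cvar u k \<omega>) / 2 ^ n = \<sigma>2 * ((\<Sum>k<2 ^ n. (?u \<bullet> yv k \<omega>)\<^sup>2) / 2 ^ n) + \<sigma>2 * ((\<Sum>k<2 ^ n. (?v \<bullet> yv k \<omega>)\<^sup>2) / 2 ^ n) +
     2 * (\<rho> * ((\<Sum>k<2 ^ n. wgt u 0 k \<omega> * wgt u 1 k \<omega>) / 2 ^ n))" for n
    by (simp add: sum.distrib sum_distrib_left add_divide_distrib)
  moreover have "(\<lambda>n. \<sigma>2 * ((\<Sum>k<2 ^ n. (?u \<bullet> yv k \<omega>)\<^sup>2) / 2 ^ n) + \<sigma>2 * ((\<Sum>k<2 ^ n. (?v \<bullet> yv k \<omega>)\<^sup>2) / 2 ^ n) +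
     2 * (\<rho> * ((\<Sum>k<2 ^ n. wgt u 0 k \<omega> * wgt u 1 k \<omega>) / 2 ^ n))) \<longlonglongrightarrow> u \<bullet> (Qm *v u)"
    unfolding Qm_form by (intro tendsto_add tendsto_mult tendsto_const qf_average[OF g] cross)
  ultimately show ?thesis by simp
qed

text \<open>The form is a limit of averages of conditional variances.\<close>

lemma Qm_nonneg: "0 \<le> u \<bullet> (Qm *v u)"
proof -
  obtain \<omega> where g: "good \<omega>" using good_exists by blast
  show ?thesis by (rule LIMSEQ_le_const[OF cvar_average[OF g]]) (auto intro!: divide_nonneg_nonneg sum_nonneg cvar_bounds(1))
qed

lemma Qm_sym: "Qm $ i $ j = Qm $ j $ i"
proof -
  have "Gamma_mat \<sigma>2 \<rho> $ t $ t' = Gamma_mat \<sigma>2 \<rho> $ t' $ t" for t t'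
    using exhaust_2[of t] exhaust_2[of t'] by (auto simp: Gamma_mat_nth)
  then show ?thesis by (simp add: kron_def LL_sym[of "snd i"])
qed

section \<open>Normalization and characteristic functions\<close>

definition size :: "nat \<Rightarrow> real" where "size n = real (card (Tree (n - 1)))"

text \<open>Truncated subtraction gives n = 0 the same one-vertex tree as n = 1.\<close>

lemma size_eq: "size n = (if n = 0 then 1 else 2 ^ n - 1)"
proof (cases n)
  case 0 then show ?thesis by (simp add: size_def Tree_eq)
next
  case (Suc m)
  have "1 \<le> (2::nat) ^ Suc m" by simp
  then show ?thesis using Suc by (simp add: size_def Tree_eq of_nat_diff del: power_Suc)
qed

lemma size_ge_1: "1 \<le> size n"
proof (cases "n = 0")
  case False
  then have "(2::real) ^ 1 \<le> 2 ^ n" by (intro power_increasing) auto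
  then show ?thesis using False by (simp add: size_eq)
qed (simp add: size_eq)

lemma pow_le_size: "2 ^ n \<le> 2 * size n"
proof (cases "n = 0")
  case False
  then have "(2::real) ^ 1 \<le> 2 ^ n" by (intro power_increasing) auto
  then show ?thesis using False by (simp add: size_eq)
qed (simp add: size_eq)

lemma pow_over_size: "(\<lambda>n. 2 ^ n / size n) \<longlonglongrightarrow> 1"
proof -
  have "(\<lambda>n. 1 / (1 - (1 / 2) ^ n)) \<longlonglongrightarrow> 1 / (1 - 0 :: real)"
    by (intro tendsto_intros LIMSEQ_power_zero) auto
  moreover have "\<forall>\<^sub>F n in sequentially. 1 / (1 - (1 / 2) ^ n) = 2 ^ n / size n"
    using eventually_gt_at_top[of 0]
  proof eventually_elim
    case (elim n)
    have "2 ^ n - 1 = 2 ^ n * (1 - (1 / 2) ^ n :: real)" by (simp add: right_diff_distrib power_one_over)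
    then show ?case using elim by (simp add: size_eq)
  qed
  ultimately show ?thesis by (simp add: Lim_transform_eventually)
qed

lemma inner_M_vec:
  assumes n: "1 \<le> n"
  shows "u \<bullet> M_vec X \<epsilon> n \<omega> = (\<Sum>k<2 ^ n. inc u k \<omega>)"
proof -
  have "u \<bullet> M_vec X \<epsilon> n \<omega> = (\<Sum>t\<in>UNIV. \<Sum>i\<in>UNIV. u $ (t, i) * mv (side t) n \<omega> $ i)"
    by (simp add: inner_vec_def sum_prod_UNIV M_vec_component[OF n])
  also have "\<dots> = blk u 0 \<bullet> mv 0 n \<omega> + blk u 1 \<bullet> mv 1 n \<omega>"
    unfolding UNIV_2 by (simp add: side_def blk_def inner_vec_def)
  also have "\<dots> = (\<Sum>k<2 ^ n. inc u k \<omega>)"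
    by (simp add: inner_mv inc_def wgt_def sum.distrib mult.commute)
  finally show ?thesis .
qed

text \<open>For fixed \<open>u\<close> the projection of M n is a scalar martingale at time 2 ^ n,
  so the scalar limit theorem determines the characteristic function. The number 2 ^ n of steps and
  the normalization 2 ^ n - 1 have a ratio that tends to 1.\<close>

lemma M_vec_char_tendsto:
  "(\<lambda>n. expectation (\<lambda>\<omega>. exp (\<i> * complex_of_real (u \<bullet> ((1 / sqrt (size n)) *\<^sub>R M_vec X \<epsilon> n \<omega>))))) \<longlonglongrightarrow>
     complex_of_real (exp (- (u \<bullet> (Qm *v u)) / 2))"
proof -
  obtain C where C: "\<And>k. expectation (\<lambda>\<omega>. (inc u k \<omega>) ^ 4) \<le> C" "\<And>k. integrable P (\<lambda>\<omega>. (cvar u k \<omega>)\<^sup>2)" "\<And>k. expectation (\<lambda>\<omega>. (cvar u k \<omega>)\<^sup>2) \<le> C"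
    using inc_moments by blast
  have "(\<lambda>n. expectation (\<lambda>\<omega>. iexp ((\<Sum>k<2 ^ n. inc u k \<omega>) / sqrt (size n)))) \<longlonglongrightarrow> complex_of_real (exp (- (u \<bullet> (Qm *v u)) / 2))"
  proof (rule martingale_central_limit[OF inc_adapted cvar_meas cvar_bounds(1) inc_L4 inc_mean inc_var C Qm_nonneg])
    show "0 < size n" for n using size_ge_1[of n] by linarith
    show "real (2 ^ n) \<le> 2 * size n" for n using pow_le_size[of n] by simp
    have "filterlim (\<lambda>n. (1 / 2) * real n) at_top sequentially"
      by (intro filterlim_tendsto_pos_mult_at_top[OF tendsto_const] filterlim_real_sequentially) auto
    then show "filterlim size at_top sequentially"
    proof (rule filterlim_at_top_mono)
      have "(1 / 2) * real n \<le> size n" for n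
        using pow_le_size[of n] of_nat_less_two_power[of n, where 'a = real] by linarith
      then show "\<forall>\<^sub>F n in sequentially. (1 / 2) * real n \<le> size n" by simp
    qed
    show "AE \<omega> in P. (\<lambda>n. (\<Sum>k<2 ^ n. cvar u k \<omega>) / size n) \<longlonglongrightarrow> u \<bullet> (Qm *v u)"
      using AE_good
    proof eventually_elim
      case (elim \<omega>)
      from tendsto_mult[OF cvar_average[OF elim, of u] pow_over_size] show ?case by simp
    qed
  qed
  moreover have "\<forall>\<^sub>F n in sequentially. expectation (\<lambda>\<omega>. iexp ((\<Sum>k<2 ^ n. inc u k \<omega>) / sqrt (size n))) =
      expectation (\<lambda>\<omega>. exp (\<i> * complex_of_real (u \<bullet> ((1 / sqrt (size n)) *\<^sub>R M_vec X \<epsilon> n \<omega>))))"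
    using eventually_ge_at_top[of 1] by eventually_elim (simp add: inner_M_vec)
  ultimately show ?thesis by (rule Lim_transform_eventually)
qed

section \<open>Second moments of the normalized vectors\<close>

lemma M_vec_0: "(M_vec X \<epsilon> 0 \<omega> :: (real, 2 \<times> 'n option) vec) = M_vec X \<epsilon> 1 \<omega>"
  by (simp add: M_vec_def)

lemma mv_component_L4: "L4 P (\<lambda>\<omega>. mv c n \<omega> $ i)"
  unfolding mv_def by (simp add: L4_sum L8_mult noise_L8 yv_component_L8)

lemma yv_second_moment: "\<exists>K. \<forall>k i. expectation (\<lambda>\<omega>. (yv k \<omega> $ i)\<^sup>2) \<le> K"
proof -
  obtain K where K: "\<And>k i. expectation (\<lambda>\<omega>. (st k \<omega> $ i)\<^sup>2) \<le> K" using component_second_moment by blast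
  have "expectation (\<lambda>\<omega>. (yv k \<omega> $ i)\<^sup>2) \<le> max 1 K" for k i
    using K[of k] by (cases i) (simp_all add: yv_None yv_Some prob_space le_max_iff_disj)
  then show ?thesis by blast
qed

text \<open>The increments are orthogonal with uniformly bounded second moments, so the growth is at
  most linear in the number 2 ^ n of indices. This matches the normalization of M n.\<close>

lemma mv_second_moment: "\<exists>K. \<forall>c<2. \<forall>n i. expectation (\<lambda>\<omega>. (mv c n \<omega> $ i)\<^sup>2) \<le> K * 2 ^ n"
proof -
  obtain K where K: "\<And>k i. expectation (\<lambda>\<omega>. (yv k \<omega> $ i)\<^sup>2) \<le> K" using yv_second_moment by blast
  have "expectation (\<lambda>\<omega>. (mv c n \<omega> $ i)\<^sup>2) \<le> (\<sigma>2 * K) * 2 ^ n" if c: "c < 2" for c n i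
  proof -
    have c1: "c \<le> 1" using c by simp
    let ?x = "\<lambda>k \<omega>. yv k \<omega> $ i * noise c k \<omega>"
    have xL: "L4 P (?x k)" for k by (rule L8_mult[OF yv_component_L8 noise_L8])
    have xG: "?x k \<in> borel_measurable (G (Suc k))" for k
      using measurable_G_mono[OF yv_component_meas', of k "Suc k" i] noise_adapted[OF c1, of k] by (intro borel_measurable_times) auto
    have xm: "AE \<omega> in P. real_cond_exp P (G k) (?x k) \<omega> = 0" for k
      by (rule mult_mean_zero[OF yv_component_meas' noise_meas_M L4_mult_integrable[OF yv_component_L4 noise_L4] noise_mean[OF c1]])
    have "expectation (\<lambda>\<omega>. (mv c n \<omega> $ i)\<^sup>2) = expectation (\<lambda>\<omega>. (\<Sum>k\<in>{..<2 ^ n}. ?x k \<omega>)\<^sup>2)"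
      by (simp add: mv_def mult.commute)
    also have "\<dots> = (\<Sum>k\<in>{..<2 ^ n}. expectation (\<lambda>\<omega>. (?x k \<omega>)\<^sup>2))"
    proof (rule expectation_orthogonal_sum_square)
      show "integrable P (\<lambda>\<omega>. ?x j \<omega> * ?x k \<omega>)" for j k by (rule L4_mult_integrable[OF xL xL])
      show "expectation (\<lambda>\<omega>. ?x j \<omega> * ?x k \<omega>) = 0" if "j < k" for j k
        by (rule mds_orthogonal[OF measurable_G_mono[OF xG] L4_square_integrable[OF xL] L4_measurable[OF xL] L4_square_integrable[OF xL] xm])
           (use that in simp)
    qed simp
    also have "\<dots> \<le> (\<Sum>k\<in>{..<(2::nat) ^ n}. \<sigma>2 * K)"
    proof (rule sum_mono)
      show "expectation (\<lambda>\<omega>. (?x k \<omega>)\<^sup>2) \<le> \<sigma>2 * K" for k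
        unfolding noise_sq_mult[OF c yv_component_meas' yv_component_L4] using var_bounds[of k] \<sigma>2_pos
        by (intro mult_mono K) (auto intro: Bochner_Integration.integral_nonneg)
    qed
    finally show ?thesis by (simp add: mult.commute)
  qed
  then show ?thesis by blast
qed

lemma M_vec_second_moment:
  "\<exists>K. \<forall>n. integrable P (\<lambda>\<omega>. (norm ((1 / sqrt (size n)) *\<^sub>R (M_vec X \<epsilon> n \<omega> :: (real, 2 \<times> 'n option) vec)))\<^sup>2) \<and>
     expectation (\<lambda>\<omega>. (norm ((1 / sqrt (size n)) *\<^sub>R (M_vec X \<epsilon> n \<omega> :: (real, 2 \<times> 'n option) vec)))\<^sup>2) \<le> K"
proof -
  obtain K where K: "\<And>c n i. c < 2 \<Longrightarrow> expectation (\<lambda>\<omega>. (mv c n \<omega> $ i)\<^sup>2) \<le> K * 2 ^ n" using mv_second_moment by blast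
  have K0: "0 \<le> K" using order_trans[OF _ K[of 0 0]] by (simp add: Bochner_Integration.integral_nonneg)
  let ?D = "(\<Sum>t\<in>(UNIV :: 2 set). \<Sum>i\<in>(UNIV :: 'n option set). K * 2)"
  have main: "integrable P (\<lambda>\<omega>. (norm ((1 / sqrt (size n)) *\<^sub>R (M_vec X \<epsilon> n \<omega> :: (real, 2 \<times> 'n option) vec)))\<^sup>2) \<and>
     expectation (\<lambda>\<omega>. (norm ((1 / sqrt (size n)) *\<^sub>R (M_vec X \<epsilon> n \<omega> :: (real, 2 \<times> 'n option) vec)))\<^sup>2) \<le> ?D" if n: "1 \<le> n" for n
  proof -
    have s: "0 < size n" using size_ge_1[of n] by linarith
    have e: "(norm ((1 / sqrt (size n)) *\<^sub>R (M_vec X \<epsilon> n \<omega> :: (real, 2 \<times> 'n option) vec)))\<^sup>2 =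
        (\<Sum>t\<in>UNIV. \<Sum>i\<in>UNIV. (mv (side t) n \<omega> $ i)\<^sup>2 / size n)" for \<omega>
    proof -
      have "(norm ((1 / sqrt (size n)) *\<^sub>R (M_vec X \<epsilon> n \<omega> :: (real, 2 \<times> 'n option) vec)))\<^sup>2 =
          (norm (M_vec X \<epsilon> n \<omega> :: (real, 2 \<times> 'n option) vec))\<^sup>2 / size n"
        using s by (simp add: power_mult_distrib power_divide)
      then show ?thesis
        unfolding power2_norm_eq_inner[of "M_vec X \<epsilon> n \<omega>"]
        by (simp add: inner_vec_def sum_prod_UNIV M_vec_component[OF n] sum_divide_distrib power2_eq_square)
    qed
    have i: "integrable P (\<lambda>\<omega>. (mv (side t) n \<omega> $ i)\<^sup>2)" for t i by (rule L4_square_integrable[OF mv_component_L4])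
    have "expectation (\<lambda>\<omega>. \<Sum>t\<in>UNIV. \<Sum>i\<in>UNIV. (mv (side t) n \<omega> $ i)\<^sup>2 / size n) =
        (\<Sum>t\<in>UNIV. \<Sum>i\<in>UNIV. expectation (\<lambda>\<omega>. (mv (side t) n \<omega> $ i)\<^sup>2) / size n)" using i by simp
    also have "\<dots> \<le> ?D"
    proof (intro sum_mono)
      fix t :: 2 and i :: "'n option"
      have "expectation (\<lambda>\<omega>. (mv (side t) n \<omega> $ i)\<^sup>2) \<le> K * (2 * size n)"
        by (rule order_trans[OF K[OF side_less] mult_left_mono[OF pow_le_size K0]])
      then show "expectation (\<lambda>\<omega>. (mv (side t) n \<omega> $ i)\<^sup>2) / size n \<le> K * 2" using s by (simp add: divide_le_eq mult.assoc)
    qed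
    finally show ?thesis unfolding e using i by simp
  qed
  have "size 0 = size 1" by (simp add: size_eq)
  then have zero: "(1 / sqrt (size 0)) *\<^sub>R (M_vec X \<epsilon> 0 \<omega> :: (real, 2 \<times> 'n option) vec) = (1 / sqrt (size 1)) *\<^sub>R M_vec X \<epsilon> 1 \<omega>" for \<omega>
    by (simp only: M_vec_0)
  show ?thesis
  proof (intro exI[of _ ?D] allI)
    fix n
    show "integrable P (\<lambda>\<omega>. (norm ((1 / sqrt (size n)) *\<^sub>R (M_vec X \<epsilon> n \<omega> :: (real, 2 \<times> 'n option) vec)))\<^sup>2) \<and>
      expectation (\<lambda>\<omega>. (norm ((1 / sqrt (size n)) *\<^sub>R (M_vec X \<epsilon> n \<omega> :: (real, 2 \<times> 'n option) vec)))\<^sup>2) \<le> ?D"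
    proof (cases "n = 0")
      case True
      show ?thesis unfolding True zero by (rule main) simp
    next
      case False
      then show ?thesis by (intro main) simp
    qed
  qed
qed

lemma M_vec_meas: "(\<lambda>\<omega>. M_vec X \<epsilon> n \<omega> :: (real, 2 \<times> 'n option) vec) \<in> borel_measurable P"
proof -
  have m: "(\<lambda>\<omega>. M_vec X \<epsilon> n \<omega> :: (real, 2 \<times> 'n option) vec) \<in> borel_measurable P" if n: "1 \<le> n" for n
  proof -
    have "(\<lambda>\<omega>. (M_vec X \<epsilon> n \<omega> :: (real, 2 \<times> 'n option) vec) $ q) \<in> borel_measurable P" for q
      using M_vec_component[OF n, of _ "fst q" "snd q"] L4_measurable[OF mv_component_L4] by simp
    then show ?thesis by (subst borel_measurable_euclidean_space) (auto simp: Basis_vec_def inner_axis)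
  qed
  show ?thesis
    using m[of n] m[of 1] by (cases "n = 0") (simp_all add: M_vec_0)
qed

theorem central_limit:
  "\<exists>\<mu> :: (real, 2 \<times> 'n option) vec measure. multivariate_normal 0 Qm \<mu> \<and>
     converges_in_distribution P (\<lambda>n \<omega>. (1 / sqrt (real (card (Tree (n - 1))))) *\<^sub>R M_vec X \<epsilon> n \<omega>) \<mu>"
proof -
  obtain \<mu> where \<mu>: "multivariate_normal 0 Qm \<mu>" using multivariate_normal_exists[of Qm, OF Qm_sym Qm_nonneg] by blast
  obtain K where K: "\<And>n. integrable P (\<lambda>\<omega>. (norm ((1 / sqrt (size n)) *\<^sub>R (M_vec X \<epsilon> n \<omega> :: (real, 2 \<times> 'n option) vec)))\<^sup>2)"
     "\<And>n. expectation (\<lambda>\<omega>. (norm ((1 / sqrt (size n)) *\<^sub>R (M_vec X \<epsilon> n \<omega> :: (real, 2 \<times> 'n option) vec)))\<^sup>2) \<le> K"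
    using M_vec_second_moment by blast
  have "converges_in_distribution P (\<lambda>n \<omega>. (1 / sqrt (size n)) *\<^sub>R M_vec X \<epsilon> n \<omega>) \<mu>"
  proof (rule char_tendsto_imp_converges_in_distribution[OF prob_space_axioms _ _ _ _ K])
    show "(\<lambda>\<omega>. (1 / sqrt (size n)) *\<^sub>R (M_vec X \<epsilon> n \<omega> :: (real, 2 \<times> 'n option) vec)) \<in> borel_measurable P" for n
      using M_vec_meas[of n] by measurable
    show "prob_space \<mu>" "sets \<mu> = sets borel" using \<mu> by (auto simp: multivariate_normal_def)
    fix u
    have "(LINT x|\<mu>. exp (\<i> * complex_of_real (u \<bullet> x))) = exp (\<i> * complex_of_real (u \<bullet> 0) - complex_of_real (u \<bullet> (Qm *v u)) / 2)"
      using \<mu> unfolding multivariate_normal_def by blast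
    also have "\<dots> = complex_of_real (exp (- (u \<bullet> (Qm *v u)) / 2))" by (simp flip: exp_of_real)
    finally show "(\<lambda>n. expectation (\<lambda>\<omega>. exp (\<i> * complex_of_real (u \<bullet> ((1 / sqrt (size n)) *\<^sub>R M_vec X \<epsilon> n \<omega>))))) \<longlonglongrightarrow>
        (LINT x|\<mu>. exp (\<i> * complex_of_real (u \<bullet> x)))"
      using M_vec_char_tendsto[of u] by simp
  qed
  with \<mu> show ?thesis unfolding size_def by blast
qed

end

theorem theorem5p1:
  fixes P :: "'w measure"
    and X \<epsilon> :: "nat \<Rightarrow> 'w \<Rightarrow> real"
    and a b :: "nat \<Rightarrow> real"
    and N :: "real ^ 'n::{finite,linorder} \<Rightarrow> real"
    and p :: nat
    and \<sigma>2 \<rho> :: real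
  assumes p: "p = CARD('n)"
    and "prob_space P"
    and X_rv: "\<forall>k\<ge>1. X k \<in> borel_measurable P"
    and eps_rv: "\<forall>k\<ge>2 ^ p. \<epsilon> k \<in> borel_measurable P"
    and BAR_even: "\<forall>n\<ge>2 ^ (p - 1). \<forall>\<omega>\<in>space P.
      X (2 * n) \<omega> = a 0 + (\<Sum>k=1..p. a k * X (n div 2 ^ (k - 1)) \<omega>) + \<epsilon> (2 * n) \<omega>"
    and BAR_odd: "\<forall>n\<ge>2 ^ (p - 1). \<forall>\<omega>\<in>space P.
      X (2 * n + 1) \<omega> = b 0 + (\<Sum>k=1..p. b k * X (n div 2 ^ (k - 1)) \<omega>) + \<epsilon> (2 * n + 1) \<omega>"
    and initial: "\<forall>k\<in>{1..2 ^ p - 1}. integrable P (\<lambda>\<omega>. X k \<omega> ^ 8)"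
    and "is_norm N"
    and beta: "max (op_norm N (companion a)) (op_norm N (companion b)) < 1"
    and "\<sigma>2 > 0" and "\<bar>\<rho>\<bar> < \<sigma>2"
    and i: "noise_mean_var p P X \<epsilon> \<sigma>2"
    and ii: "noise_covariance p P X \<epsilon> \<rho>"
    and iii: "noise_moment_bounded p P X \<epsilon> 4"
  shows
    "(AE \<omega> in P.
        (\<lambda>n. (M_vec X \<epsilon> n \<omega> :: real ^ (2 \<times> 'n option)) \<bullet>
               (matrix_inv (Sigma_mat X (n - 1) \<omega>) *v M_vec X \<epsilon> n \<omega>)) \<in> O(\<lambda>n. real n)) \<and>
     (AE \<omega> in P.
        (\<lambda>n. (1 / real n) *
             (\<Sum>k=p..n. (M_vec X \<epsilon> k \<omega> :: real ^ (2 \<times> 'n option)) \<bullet>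
               (matrix_inv (Sigma_mat X (k - 1) \<omega>) *v M_vec X \<epsilon> k \<omega>)))
          \<longlonglongrightarrow> 2 * (real p + 1) * \<sigma>2) \<and>
     (\<forall>\<tau>4 \<nu>2. \<tau>4 > 0 \<and> \<nu>2 < \<tau>4 \<and> noise_fourth_moments p P X \<epsilon> \<tau>4 \<nu>2 \<and>
        noise_moment_bounded p P X \<epsilon> 8 \<longrightarrow>
        (\<exists>\<mu> :: (real ^ (2 \<times> 'n option)) measure.
           multivariate_normal 0 (kron (Gamma_mat \<sigma>2 \<rho>) (L_mat a b \<sigma>2)) \<mu> \<and>
           converges_in_distribution P
             (\<lambda>n \<omega>. (1 / sqrt (real (card (Tree (n - 1))))) *\<^sub>R M_vec X \<epsilon> n \<omega>) \<mu>))"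
proof -
  note is_norm = \<open>is_norm N\<close>
  define \<beta> where "\<beta> = max (op_norm N (companion a)) (op_norm N (companion b))"
  have N0: "0 \<le> N u" for u using is_norm by (simp add: is_norm_def)
  interpret bar_vector P X \<epsilon> a b p \<sigma>2 \<rho> N \<beta>
  proof (intro bar_vector.intro bar_process.intro bar_vector_axioms.intro bar_process_axioms.intro)
    show "1 \<le> p" unfolding p by (simp add: Suc_leI)
    show "integrable P (\<lambda>\<omega>. X k \<omega> ^ 8)" if "1 \<le> k" "k < 2 ^ p" for k
    proof -
      have "k \<in> {1..2 ^ p - 1}" using that by simp
      then show ?thesis using initial by blast
    qed
    show "0 \<le> \<beta>" unfolding \<beta>_def using op_norm_bound(2)[OF is_norm] by (simp add: le_max_iff_disj)
    show "N (companion a *v u) \<le> \<beta> * N u" for u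
      unfolding \<beta>_def by (rule order_trans[OF op_norm_bound(1)[OF is_norm] mult_right_mono]) (simp_all add: N0)
    show "N (companion b *v u) \<le> \<beta> * N u" for u
      unfolding \<beta>_def by (rule order_trans[OF op_norm_bound(1)[OF is_norm] mult_right_mono]) (simp_all add: N0)
  qed (use assms in \<open>auto simp: \<beta>_def\<close>)
  have "bar_clt P X \<epsilon> a b p \<sigma>2 \<rho> N \<beta> \<tau>4 \<nu>2"
    if "0 < \<tau>4" "noise_fourth_moments p P X \<epsilon> \<tau>4 \<nu>2" "noise_moment_bounded p P X \<epsilon> 8" for \<tau>4 \<nu>2
    by (intro bar_clt.intro bar_vector_axioms bar_clt_axioms.intro that)
  from bar_clt.central_limit[OF this] quadratic_functional show ?thesis
    unfolding AE_conj_iff by blast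
qed

end
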